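(* Let $X'$ be the core of the inverse limit of a tent map $T_s$, $s\in(\sqrt2,2]$, with kneading sequence $\nu$, embedded in the plane by $\varphi_{\mathcal C}=\varphi_L$ with $L=0^\infty1$. If $\nu=\mathrm{lhe}(q)$ for some $q=\frac mn\in(0,\frac12)$, where $m$ and $n$ are relatively prime, then in $\varphi_{\mathcal C}(X')$ there exist $n$ fully accessible rays, which are symbolically described by a tail which is a shift of $\overleftarrow\nu$, and no other point of $\varphi_{\mathcal C}(X')$ is accessible. Specifically, there exist no infinite canals in $\varphi_{\mathcal C}(X')$.
   Context: Tent inverse limits. For $s\in(\sqrt2,2]$ let $T=T_s\colon[0,1]\to[0,1]$, $T_s(t)=\min\{st,s(1-t)\}$, $c=\frac12$, and $X=\{x=(\pi_i(x))_{i\le0}\in[0,1]^{-\mathbb N_0}: T(\pi_i(x))=\pi_{i+1}(x)\ \forall i<0\}$ with the product topology. The core is $X'=\varprojlim([T^2(c),T(c)],T)\subset X$, an indecomposable continuum; $X=X'\cup\mathcal C$, where $\mathcal C$ is a ray containing the fixed point $(\ldots,0,0)$. Symbolics. $\#_1(w)$ is the number of ones of a word $w$. The kneading sequence is $\nu=c_1c_2\ldots$, $c_i=0$ if $T^i(c)\in[0,c]$, $c_i=1$ if $T^i(c)\in[c,1]$; if $T^n(c)=c$, $\nu$ is the smaller of $(c_1\ldots c_{n-1}0)^\infty,(c_1\ldots c_{n-1}1)^\infty$ in the parity-lexicographical order: for sequences (or words of equal length) first differing at index $k$, $s\prec t$ iff $s_k<t_k$ and $\#_1(s_1\ldots s_{k-1})$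 is even, or $s_k>t_k$ and it is odd. A word $a_1\ldots a_n$ is admissible if $c_2\ldots c_{2+n-i}\preceq a_i\ldots a_n\preceq c_1\ldots c_{1+n-i}$ for all $i$. An infinite sequence is admissible if all its finite subwords are; additionally, sequences $0^\infty s_ks_{k+1}\ldots$ with $s_k=1$ and the part from $s_k$ on admissible (and the constant zero sequence) are called admissible; these correspond to points of $\mathcal C$. $X$ is identified with $\Sigma_{adm}/\!\sim$, where $\Sigma_{adm}$ is the set of admissible two-sided sequences $\ldots s_{-1}.s_0s_1\ldots$ and $s\sim t$ iff $s=t$ or they differ at exactly one index $k$ and $s_{k+1}s_{k+2}\ldots=t_{k+1}t_{k+2}\ldots=\nu$; the point $x$ corresponds to the class of $(x_i)$ with $x_i=0$ (resp. $1$) if $\pi_i(x)$ (for $i\le0$) or $T^i(\pi_0(x))$ (for $i>0$) lies in $[0,c]$ (resp. $[c,1]$). Using only sequences all of whose finite subwords are admissible gives $X'$. Left-infinite sequences are written $\overleftarrow s=\ldots s_2s_1$ ($s_j$ being the entry at index $-j$), and the basic arc $A(\overleftarrow s)$ is the set of points of $X$ having a representative with left part $\overleftarrow s$; it is an arc or a point. $\overleftarrow\nu=\ldots c_3c_2c_1$ is the reverse of $\nu$. An arc-component (union of all arcs through a point) is symbolically described by a tail which is a shift of $\overleftarrow\nu$ if there is $i\in\mathbb Z$ such that it consists of the basic arcs $A(\overleftarrow s)$ with $s_{k+i}=c_k$ for all sufficiently large $k$. Embeddings. For an admissible left-infinite $L=\ldots l_2l_1$ put $\psi_L(\overleftarrow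 s)=\sum_{i\ge1}(-1)^{\#_1(l_i\ldots l_1)-\#_1(s_i\ldots s_1)}3^{-i}+\frac12$. The embedding $\varphi_L\colon X\to\mathbb R^2$ draws each basic arc $A(\overleftarrow s)$ as the horizontal segment $\pi_0(A(\overleftarrow s))\times\{\psi_L(\overleftarrow s)\}$; whenever two $\sim$-identified two-sided sequences differ only at an index $k<0$, the corresponding endpoints of the two basic arcs are joined by a semicircle, on the left if $\#_1$ of the word at indices $k+1,\ldots,-1$ is odd and on the right if it is even. $X'$ is embedded by restricting $\varphi_L$. The sequence lhe. For $q\in(0,\frac12)$ let $\kappa_1(q)=\lfloor\frac1q\rfloor-1$ and $\kappa_i(q)=\lfloor\frac iq\rfloor-\lfloor\frac{i-1}q\rfloor-2$ for $i\ge2$. For $q=\frac mn$ in lowest terms let $w_q=10^{\kappa_1(q)}110^{\kappa_2(q)}11\ldots110^{\kappa_m(q)-1}$ and $\mathrm{lhe}(q)=(w_q1)^\infty$. Accessibility and prime ends. For a non-separating continuum $K\subset\mathbb R^2$, $a\in K$ is accessible if some arc $A\subset\mathbb R^2$ has $A\cap K=\{a\}$; an arc-component is fully accessible if all its points are accessible. A ray is a continuous injective image of $[0,\infty)$. A crosscut is an arc $Q\subset\mathbb R^2$ meeting $K$ exactly in its endpoints; $B_Q$ is the bounded component of $\mathbb R^2\setminus(K\cup Q)$. A chain is a sequence of pairwise disjoint crosscuts $Q_i$ with $\operatorname{diam}Q_i\to0$ and $B_{Q_{i+1}}\subset B_{Q_i}$; two chains are equivalent if each $B$-set of one contains a $B$-set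 of the other and conversely; equivalence classes are prime ends. For a prime end $P$, $\Pi(P)=\{\lim Q_i:\{Q_i\}\in P\text{ convergent}\}$. An infinite canal is a prime end $P$ with $\Pi(P)$ non-degenerate and different from $K$. Here $K=\varphi_{\mathcal C}(X')$. *)

theory Defs
  imports "HOL-Analysis.Analysis"
begin

section \<open>Tent maps and their inverse limits\<close>

definition tent :: "real \<Rightarrow> real \<Rightarrow> real" where
  "tent s t = min (s * t) (s * (1 - t))"

text \<open>A point of the inverse limit is a function \<open>x\<close> with \<open>x i = \<pi>\<^sub>-\<^sub>i(x)\<close>.  The topology on
  \<open>nat \<Rightarrow> real\<close> is the product topology.\<close>

definition inv_lim :: "real \<Rightarrow> (nat \<Rightarrow> real) set" where
  "inv_lim s = {x. (\<forall>i. x i \<in> {0..1}) \<and> (\<forall>i. tent s (x (Suc i)) = x i)}"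

definition core :: "real \<Rightarrow> (nat \<Rightarrow> real) set" where
  "core s = {x \<in> inv_lim s. \<forall>i. x i \<in> {tent s (tent s (1/2)) .. tent s (1/2)}}"


section \<open>Words, kneading sequence, admissibility\<close>

text \<open>The letters 0 and 1 are \<open>False\<close> and \<open>True\<close> (so \<open>False < True\<close>).  One-sided sequences are
  indexed from 0: the sequence \<open>a\<^sub>1 a\<^sub>2 \<dots>\<close> is the function \<open>a\<close> with \<open>a i = a\<^sub>i\<^sub>+\<^sub>1\<close>.\<close>

definition ones :: "bool list \<Rightarrow> nat" where
  "ones w = count_list w True"

definition plex_less_at :: "nat \<Rightarrow> (nat \<Rightarrow> bool) \<Rightarrow> (nat \<Rightarrow> bool) \<Rightarrow> bool" where
  "plex_less_at k a b \<longleftrightarrow> (\<forall>j<k. a j = b j) \<and>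
     (if even (ones (map a [0..<k])) then a k < b k else b k < a k)"

definition plex_less :: "(nat \<Rightarrow> bool) \<Rightarrow> (nat \<Rightarrow> bool) \<Rightarrow> bool" where
  "plex_less a b \<longleftrightarrow> (\<exists>k. plex_less_at k a b)"

definition plex_le_word :: "bool list \<Rightarrow> bool list \<Rightarrow> bool" where
  "plex_le_word u v \<longleftrightarrow> u = v \<or>
     (length u = length v \<and> (\<exists>k<length u. plex_less_at k (nth u) (nth v)))"

definition periodic_seq :: "bool list \<Rightarrow> nat \<Rightarrow> bool" where
  "periodic_seq w i = w ! (i mod length w)"

text \<open>In the non-periodic case no \<open>T\<^sup>i(c)\<close> with \<open>i > 0\<close> equals \<open>c\<close>; in the periodic case \<open>n\<close> is the
  period of \<open>c\<close>, and only the letter at index \<open>n\<close> is ambiguous.\<close>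

definition kneading :: "real \<Rightarrow> nat \<Rightarrow> bool" where
  "kneading s =
     (let letter = (\<lambda>i. 1/2 \<le> (tent s ^^ Suc i) (1/2));
          returns = (\<lambda>n. 0 < n \<and> (tent s ^^ n) (1/2) = 1/2)
      in if \<exists>n. returns n
         then let n = (LEAST n. returns n);
                  w = map letter [0..<n - 1];
                  a = periodic_seq (w @ [False]);
                  b = periodic_seq (w @ [True])
              in if plex_less a b then a else b
         else letter)"

definition admissible_word :: "(nat \<Rightarrow> bool) \<Rightarrow> bool list \<Rightarrow> bool" where
  "admissible_word \<nu> w \<longleftrightarrow> (\<forall>i<length w.
     plex_le_word (map (\<lambda>j. \<nu> (Suc j)) [0..<length w - i]) (drop i w) \<and>
     plex_le_word (drop i w) (map \<nu> [0..<length w - i]))"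

text \<open>Two-sided sequences are functions on \<open>int\<close>; \<open>subword a i n\<close> is \<open>a\<^sub>i \<dots> a\<^sub>i\<^sub>+\<^sub>n\<^sub>-\<^sub>1\<close>.\<close>

definition subword :: "(int \<Rightarrow> bool) \<Rightarrow> int \<Rightarrow> nat \<Rightarrow> bool list" where
  "subword a i n = map (\<lambda>j. a (i + int j)) [0..<n]"

definition admissible :: "(nat \<Rightarrow> bool) \<Rightarrow> (int \<Rightarrow> bool) \<Rightarrow> bool" where
  "admissible \<nu> a \<longleftrightarrow>
     (\<forall>i n. admissible_word \<nu> (subword a i n)) \<or>
     (\<exists>k. (\<forall>i<k. \<not> a i) \<and> a k \<and> (\<forall>i\<ge>k. \<forall>n. admissible_word \<nu> (subword a i n))) \<or>
     (\<forall>i. \<not> a i)"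

text \<open>The nontrivial instances of the identification \<open>\<sim>\<close>, with the index of the differing letter.\<close>

definition identified_at :: "(nat \<Rightarrow> bool) \<Rightarrow> int \<Rightarrow> (int \<Rightarrow> bool) \<Rightarrow> (int \<Rightarrow> bool) \<Rightarrow> bool" where
  "identified_at \<nu> k a b \<longleftrightarrow> a k \<noteq> b k \<and> (\<forall>i. i \<noteq> k \<longrightarrow> a i = b i) \<and>
     (\<forall>j. a (k + 1 + int j) = \<nu> j)"

definition coord :: "real \<Rightarrow> (nat \<Rightarrow> real) \<Rightarrow> int \<Rightarrow> real" where
  "coord s x i = (if i \<le> 0 then x (nat (- i)) else (tent s ^^ nat i) (x 0))"

text \<open>\<open>represents s a x\<close>: the two-sided sequence \<open>a\<close> belongs to the class of the point \<open>x\<close>.\<close>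

definition represents :: "real \<Rightarrow> (int \<Rightarrow> bool) \<Rightarrow> (nat \<Rightarrow> real) \<Rightarrow> bool" where
  "represents s a x \<longleftrightarrow> x \<in> inv_lim s \<and> admissible (kneading s) a \<and>
     (\<forall>i. if a i then 1/2 \<le> coord s x i else coord s x i \<le> 1/2)"

text \<open>A left-infinite sequence \<open>\<dots> l\<^sub>2 l\<^sub>1\<close> is the function \<open>l\<close> with \<open>l j = l\<^sub>j\<^sub>+\<^sub>1\<close>, the letter at
  index \<open>-(j+1)\<close>.\<close>

definition left_part :: "(int \<Rightarrow> bool) \<Rightarrow> nat \<Rightarrow> bool" where
  "left_part a j = a (- int j - 1)"

definition basic_arc :: "real \<Rightarrow> (nat \<Rightarrow> bool) \<Rightarrow> (nat \<Rightarrow> real) set" where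
  "basic_arc s l = {x. \<exists>a. represents s a x \<and> left_part a = l}"

text \<open>\<open>s\<^sub>k\<^sub>+\<^sub>i = c\<^sub>k\<close> for all large \<open>k\<close>; shifting both indices by one leaves \<open>i\<close> unchanged.\<close>

definition described_by_kneading_tail :: "real \<Rightarrow> (nat \<Rightarrow> real) set \<Rightarrow> bool" where
  "described_by_kneading_tail s U \<longleftrightarrow> (\<exists>i::int.
     U = (\<Union>l \<in> {l. \<forall>\<^sub>F k in sequentially. l (nat (int k + i)) = kneading s k}. basic_arc s l))"


section \<open>The planar embeddings\<close>

definition psi :: "(nat \<Rightarrow> bool) \<Rightarrow> (nat \<Rightarrow> bool) \<Rightarrow> real" where
  "psi L l = (\<Sum>i. (-1) powi (int (ones (map L [0..<Suc i])) - int (ones (map l [0..<Suc i])))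
                   / 3 ^ Suc i) + 1/2"

definition drawn_segment :: "real \<Rightarrow> (nat \<Rightarrow> bool) \<Rightarrow> (nat \<Rightarrow> bool) \<Rightarrow> (real \<times> real) set" where
  "drawn_segment s L l = (\<lambda>x. x 0) ` basic_arc s l \<times> {psi L l}"

text \<open>The semicircle with endpoints \<open>(u, y)\<close> and \<open>(u, z)\<close>, to the left or to the right of the line
  through them.\<close>

definition semicircle :: "bool \<Rightarrow> real \<Rightarrow> real \<Rightarrow> real \<Rightarrow> (real \<times> real) set" where
  "semicircle on_left u y z =
     {p. dist p (u, (y + z) / 2) = \<bar>y - z\<bar> / 2 \<and> (if on_left then fst p \<le> u else u \<le> fst p)}"

text \<open>The semicircle at the point \<open>x\<close>; it is empty if all representatives of \<open>x\<close> have the same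
  left part.\<close>

definition drawn_semicircle :: "real \<Rightarrow> (nat \<Rightarrow> bool) \<Rightarrow> (nat \<Rightarrow> real) \<Rightarrow> (real \<times> real) set" where
  "drawn_semicircle s L x =
     \<Union> {semicircle (odd (ones (subword a (k + 1) (nat (- k - 1)))))
           (x 0) (psi L (left_part a)) (psi L (left_part b)) | a b k.
         represents s a x \<and> represents s b x \<and> k < 0 \<and> identified_at (kneading s) k a b}"

text \<open>A point lying on two basic arcs is drawn somewhere on the semicircle joining the
  corresponding segments, so a basic arc is drawn as its segment together with parts of the
  semicircles at its endpoints.  The segments and semicircles determine the images of \<open>inv_lim s\<close>,
  of \<open>core s\<close> and of their arc-components, but the parametrization is only determined up to
  this choice.\<close>

definition draws :: "real \<Rightarrow> (nat \<Rightarrow> bool) \<Rightarrow> ((nat \<Rightarrow> real) \<Rightarrow> real \<times> real) \<Rightarrow> bool" where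
  "draws s L f \<longleftrightarrow>
     embedding_map (top_of_set (inv_lim s)) euclidean f \<and>
     (\<forall>l. drawn_segment s L l \<subseteq> f ` basic_arc s l) \<and>
     (\<forall>l. f ` basic_arc s l \<subseteq> drawn_segment s L l \<union> (\<Union>x \<in> basic_arc s l. drawn_semicircle s L x)) \<and>
     (\<forall>x \<in> inv_lim s. drawn_semicircle s L x \<subseteq> f ` (\<Union>l \<in> {l. x \<in> basic_arc s l}. basic_arc s l))"

definition phi :: "real \<Rightarrow> (nat \<Rightarrow> bool) \<Rightarrow> (nat \<Rightarrow> real) \<Rightarrow> real \<times> real" where
  "phi s L = (SOME f. draws s L f)"

text \<open>\<open>L = 0\<^sup>\<infinity>1\<close>\<close>

definition L_C :: "nat \<Rightarrow> bool" where
  "L_C j \<longleftrightarrow> j = 0"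

abbreviation phi_C :: "real \<Rightarrow> (nat \<Rightarrow> real) \<Rightarrow> real \<times> real" where
  "phi_C s \<equiv> phi s L_C"


section \<open>The sequence lhe\<close>

definition kappa :: "real \<Rightarrow> nat \<Rightarrow> nat" where
  "kappa q i = (if i = 1 then nat (\<lfloor>1 / q\<rfloor> - 1)
                else nat (\<lfloor>real i / q\<rfloor> - \<lfloor>(real i - 1) / q\<rfloor> - 2))"

text \<open>\<open>w\<^sub>q\<close> and \<open>lhe(q)\<close> for \<open>q = m/n\<close> in lowest terms; the last block of zeros is shortened by 1.\<close>

definition lhe_word :: "nat \<Rightarrow> nat \<Rightarrow> bool list" where
  "lhe_word m n =
     (let zeros = (\<lambda>i. replicate (kappa (real m / real n) i - (if i = m then 1 else 0)) False)
      in [True] @ zeros 1 @ concat (map (\<lambda>i. [True, True] @ zeros i) [2..<Suc m]))"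

definition lhe :: "nat \<Rightarrow> nat \<Rightarrow> nat \<Rightarrow> bool" where
  "lhe m n = periodic_seq (lhe_word m n @ [True])"


section \<open>Accessible points and prime ends\<close>

definition arc_component :: "'a::topological_space set \<Rightarrow> 'a \<Rightarrow> 'a set" where
  "arc_component S x = \<Union> {path_image g | g. arc g \<and> path_image g \<subseteq> S \<and> x \<in> path_image g}"

definition is_ray :: "'a::topological_space set \<Rightarrow> bool" where
  "is_ray R \<longleftrightarrow> (\<exists>g :: real \<Rightarrow> 'a. continuous_on {0..} g \<and> inj_on g {0..} \<and> R = g ` {0..})"

definition accessible :: "(real \<times> real) set \<Rightarrow> real \<times> real \<Rightarrow> bool" where
  "accessible K a \<longleftrightarrow> a \<in> K \<and> (\<exists>g. arc g \<and> path_image g \<inter> K = {a})"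

definition fully_accessible :: "(real \<times> real) set \<Rightarrow> (real \<times> real) set \<Rightarrow> bool" where
  "fully_accessible K R \<longleftrightarrow> (\<forall>a \<in> R. accessible K a)"

definition crosscut :: "(real \<times> real) set \<Rightarrow> (real \<times> real) set \<Rightarrow> bool" where
  "crosscut K Q \<longleftrightarrow>
     (\<exists>g. arc g \<and> Q = path_image g \<and> Q \<inter> K = {pathstart g, pathfinish g})"

text \<open>\<open>inside\<close> is the union of the bounded complementary components; for a crosscut of a
  non-separating continuum there is exactly one.\<close>

definition crosscut_domain :: "(real \<times> real) set \<Rightarrow> (real \<times> real) set \<Rightarrow> (real \<times> real) set" where
  "crosscut_domain K Q = inside (K \<union> Q)"

definition crosscut_chain :: "(real \<times> real) set \<Rightarrow> (nat \<Rightarrow> (real \<times> real) set) \<Rightarrow> bool" where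
  "crosscut_chain K Q \<longleftrightarrow>
     (\<forall>i. crosscut K (Q i)) \<and>
     (\<forall>i j. i \<noteq> j \<longrightarrow> Q i \<inter> Q j = {}) \<and>
     (\<lambda>i. diameter (Q i)) \<longlonglongrightarrow> 0 \<and>
     (\<forall>i. crosscut_domain K (Q (Suc i)) \<subseteq> crosscut_domain K (Q i))"

definition chain_equivalence ::
    "(real \<times> real) set \<Rightarrow> ((nat \<Rightarrow> (real \<times> real) set) \<times> (nat \<Rightarrow> (real \<times> real) set)) set" where
  "chain_equivalence K =
     {(Q, R). crosscut_chain K Q \<and> crosscut_chain K R \<and>
        (\<forall>i. \<exists>j. crosscut_domain K (R j) \<subseteq> crosscut_domain K (Q i)) \<and>
        (\<forall>i. \<exists>j. crosscut_domain K (Q j) \<subseteq> crosscut_domain K (R i))}"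

definition prime_ends :: "(real \<times> real) set \<Rightarrow> (nat \<Rightarrow> (real \<times> real) set) set set" where
  "prime_ends K = {Q. crosscut_chain K Q} // chain_equivalence K"

definition principal_set :: "(nat \<Rightarrow> (real \<times> real) set) set \<Rightarrow> (real \<times> real) set" where
  "principal_set P = {p. \<exists>Q \<in> P. \<forall>e>0. \<forall>\<^sub>F i in sequentially. Q i \<subseteq> ball p e}"

definition infinite_canal ::
    "(real \<times> real) set \<Rightarrow> (nat \<Rightarrow> (real \<times> real) set) set \<Rightarrow> bool" where
  "infinite_canal K P \<longleftrightarrow> P \<in> prime_ends K \<and>
     (\<exists>p \<in> principal_set P. \<exists>q \<in> principal_set P. p \<noteq> q) \<and> principal_set P \<noteq> K"

end

theory Submission
  imports Defs "HOL-Analysis.Analysis" "HOL-Number_Theory.Cong"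
begin

text \<open>
  The word lhe(q) codes a rotation, so admissibility of words over the kneading sequence is invariant under
  reversal. Hence left tails of points of the core are forward itineraries, and the heights of the basic arcs are
  ordered like the points of the core interval. A gap in the set of heights corresponds to a preimage of the turning
  point: its two sides are the two itineraries of that preimage, both tails are shifts of \<open>\<nu>\<close> and both arcs
  belong to the same ray. The endpoints of the \<open>n\<close> rays are the points whose coordinates meet the turning
  orbit infinitely often. Away from these endpoints the drawing has flow boxes, on which the height is a continuous
  function, so a short crosscut projects into a gap; thus only points of the rays are accessible and both ends of a
  short crosscut lie on one ray. By Janiszewski's theorem such a crosscut cuts off only a piece of that ray, since the
  other rays are dense and reach the unbounded side, and this makes the limit of a chain of crosscuts unique. Near an
  endpoint, crosscuts not of this kind all meet one small connected set in the complement, with the same consequence.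
\<close>

text \<open>Invariance under reversal comes from counting: over a rotation code a word is admissible
  iff none of its factors made of zero runs separated by \<open>11\<close> is too long for its
  number of runs, and such a count ignores direction. The exact period \<open>n\<close> and a
  reflection symmetry of the code are the other special facts; they are collected in the locale
  \<open>tent_lhe\<close>. Periodicity turns infinitely many constraints into finitely many: the
  ends of basic arcs lie in the finite turning orbit or at 0, and the projection of an arc depends
  on \<open>n\<close> letters only. As \<open>phi\<close> is a choice among all maps satisfying
  \<open>draws\<close>, such a map has to be constructed first; it makes every basic arc the graph
  of a function, and images of families closed under mates do not depend on the choice. The image of
  the core does not separate the plane because nowhere vanishing complex functions on the core have
  continuous logarithms. That there are at least three rays matters: besides the ray carrying a
  crosscut, one more must have an accessible point different from the limit.\<close>

type_synonym bits = "nat \<Rightarrow> bool"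

section \<open>The sequence lhe as a rotation coding\<close>

text \<open>The ceiling of \<open>j * n / m\<close>, written so that all estimates stay in the
  natural numbers.\<close>

definition cl :: "nat \<Rightarrow> nat \<Rightarrow> nat \<Rightarrow> nat" where
 "cl m n j = (j * n + m - 1) div m"

lemma cl_iff:
 assumes "0 < m"
 shows "i = cl m n j \<longleftrightarrow> j * n \<le> i * m \<and> i * m < j * n + m"
proof -
 have "i = cl m n j \<longleftrightarrow> i * m \<le> j * n + m - 1 \<and> j * n + m - 1 < (i + 1) * m"
  unfolding cl_def using assms
  by (metis Suc_eq_plus1 div_mult_mod_eq le_refl less_eq_div_iff_mult_less_eq div_less_iff_less_mult not_less_eq antisym
    less_Suc_eq_le)
 thus ?thesis using assms by (auto simp: algebra_simps)
qed

lemma cl_bounds: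
 fixes m j n :: nat
 assumes "0 < m"
 shows "j * n \<le> cl m n j * m" "cl m n j * m < j * n + m"
 using cl_iff[OF assms] by blast+

lemma cl_0 [simp]: "0 < m \<Longrightarrow> cl m n 0 = 0"
 by (simp add: cl_def)

lemma cl_add_period: "0 < m \<Longrightarrow> cl m n (j + m) = cl m n j + n"
 using cl_iff[of m "cl m n j + n" n "j + m"] cl_bounds[where m = m and n = n and j = j]
 by (auto simp: algebra_simps)

lemma cl_step:
 assumes "0 < m" "2 * m < n"
 shows "cl m n j + 2 \<le> cl m n (Suc j)"
proof -
 have "(cl m n j + 1) * m < cl m n (Suc j) * m"
  using cl_bounds[where m = m and n = n and j = j] cl_bounds[where m = m and n = n and j = "Suc j"] assms by (auto simp: algebra_simps)
 hence "cl m n j + 1 < cl m n (Suc j)" by (rule mult_less_cancel2[THEN iffD1, THEN conjunct2])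
 thus ?thesis by simp
qed

text \<open>A ceiling is additive up to an error of one. The second bound lets a short prefix be cut
  off from an overlong word in \<open>heavy_imp_pattern\<close>.\<close>

lemma cl_superadd:
 assumes "0 < m"
 shows "cl m n (i + j) \<le> cl m n i + cl m n j" "cl m n i + cl m n j \<le> cl m n (i + j) + 1"
proof -
 note b = cl_bounds[OF assms, where n = n and j = i] cl_bounds[OF assms, where n = n and j = j]
  cl_bounds[OF assms, where n = n and j = "i + j"]
 have "cl m n (i + j) * m < (cl m n i + cl m n j + 1) * m"
  using b by (simp add: algebra_simps)
 thus "cl m n (i + j) \<le> cl m n i + cl m n j" by (metis add.commute Suc_eq_plus1 less_Suc_eq_le mult_less_cancel2)
 have "(cl m n i + cl m n j) * m < (cl m n (i + j) + 2) * m"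
  using b by (simp add: algebra_simps)
 hence "cl m n i + cl m n j < cl m n (i + j) + 2" by (rule mult_less_cancel2[THEN iffD1, THEN conjunct2])
 thus "cl m n i + cl m n j \<le> cl m n (i + j) + 1" by simp
qed

text \<open>The coding of a rotation by \<open>m / n\<close>: by \<open>code_mod\<close> the letter
  is 1 iff \<open>i * m\<close> modulo \<open>n\<close> lies in the window from \<open>-m\<close> to
  \<open>m - 1\<close>. The ones come in pairs ending at the ceilings; the pair for
  \<open>j = 0\<close> is cut by the start of the sequence.\<close>

definition code :: "nat \<Rightarrow> nat \<Rightarrow> nat \<Rightarrow> bool" where
 "code m n i \<longleftrightarrow> (\<exists>j. i = cl m n j \<or> i + 1 = cl m n j)"

lemma code_mod:
 assumes "0 < m" "2 * m < n"
 shows "code m n i \<longleftrightarrow> i * m mod n < m \<or> n - m \<le> i * m mod n"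
proof -
 have n: "0 < n" using assms by simp
 have 1: "(\<exists>j. k = cl m n j) \<longleftrightarrow> k * m mod n < m" for k
 proof
  assume "\<exists>j. k = cl m n j"
  then obtain j where j: "j * n \<le> k * m" "k * m < j * n + m" using cl_iff[OF assms(1)] by blast
  obtain d where d: "k * m = j * n + d" using j(1) le_iff_add by blast
  hence "d < m" using j(2) by linarith
  moreover have "d < n" using `d < m` assms by simp
  ultimately show "k * m mod n < m" unfolding d by (metis mod_less mod_mult_self3)
 next
  assume a: "k * m mod n < m"
  show "\<exists>j. k = cl m n j"
  proof (intro exI)
   show "k = cl m n (k * m div n)"
    by (rule cl_iff[OF assms(1), THEN iffD2]) (use a div_mult_mod_eq[of "k * m" n] in linarith)
  qed
 qed
 define r where "r = i * m mod n"
 have r: "r < n" using n by (simp add: r_def)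
 have "(i + 1) * m mod n = (i * m + m) mod n" by (simp add: add.commute)
 also have "\<dots> = (r + m) mod n" unfolding r_def by (simp only: mod_add_left_eq)
 also have "\<dots> = (if r + m < n then r + m else r + m - n)"
  using r assms by (simp add: mod_if)
 finally have e: "(i + 1) * m mod n = (if r + m < n then r + m else r + m - n)" .
 have "(i + 1) * m mod n < m \<longleftrightarrow> n - m \<le> r" unfolding e using r assms by (auto split: if_splits)
 moreover have "code m n i \<longleftrightarrow> i * m mod n < m \<or> (i + 1) * m mod n < m"
  unfolding code_def ex_disj_distrib by (simp only: 1)
 ultimately show ?thesis by (simp only: r_def)
qed

lemma code_periodic:
 assumes "0 < m" "2 * m < n"
 shows "code m n (i mod n) = code m n i"
 unfolding code_mod[OF assms, of i] code_mod[OF assms, of "i mod n"] mod_mult_left_eq by (rule refl)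

lemma code_run:
 assumes "0 < m" "2 * m < n" "cl m n j < i" "i \<le> cl m n (Suc j)"
 shows "code m n i \<longleftrightarrow> cl m n (Suc j) \<le> i + 1"
proof -
 have mono: "a \<le> b \<Longrightarrow> cl m n a \<le> cl m n b" for a b
  unfolding cl_def by (intro div_le_mono diff_le_mono add_right_mono mult_le_mono1)
 show ?thesis
 proof
  assume "code m n i"
  then obtain k where k: "i = cl m n k \<or> i + 1 = cl m n k" unfolding code_def by blast
  show "cl m n (Suc j) \<le> i + 1"
  proof (cases "k \<le> j")
   case True thus ?thesis using mono[OF True] k assms by linarith
  next
   case False thus ?thesis using mono[of "Suc j" k] k by linarith
  qed
 next
  assume "cl m n (Suc j) \<le> i + 1"
  hence "i = cl m n (Suc j) \<or> i + 1 = cl m n (Suc j)" using assms by linarith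
  thus "code m n i" unfolding code_def by blast
 qed
qed

text \<open>The subtracted 2 accounts for the pair of ones that follows each run of zeros.\<close>

definition runlen :: "nat \<Rightarrow> nat \<Rightarrow> nat \<Rightarrow> nat" where
 "runlen m n j = cl m n j - cl m n (j - 1) - 2"

lemma runlen_eq:
 assumes "0 < m" "2 * m < n" "0 < j"
 shows "cl m n j = cl m n (j - 1) + 2 + runlen m n j"
 using cl_step[OF assms(1,2), of "j - 1"] assms(3) by (simp add: runlen_def)

lemma code_block:
 assumes "0 < m" "2 * m < n"
 shows "map (code m n) [cl m n j + 1..<cl m n (Suc j) + 1]
    = replicate (runlen m n (Suc j)) False @ [True, True]"
proof -
 let ?a = "cl m n j + 1" and ?e = "runlen m n (Suc j)"
 have e: "cl m n (Suc j) = ?a + ?e + 1" using runlen_eq[OF assms, of "Suc j"] by simp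
 have "[?a..<cl m n (Suc j) + 1] = [?a..<?a + ?e] @ [?a + ?e, ?a + ?e + 1]"
  unfolding e using upt_add_eq_append[of ?a "?a + ?e" 2] by (simp add: upt_rec)
 moreover have "map (code m n) [?a..<?a + ?e] = replicate ?e False"
 proof (rule nth_equalityI)
  fix i assume "i < length (map (code m n) [?a..<?a + ?e])"
  hence i: "i < ?e" by (simp del: upt_Suc)
  hence "\<not> code m n (?a + i)" using code_run[OF assms, of j "?a + i"] e by simp
  thus "map (code m n) [?a..<?a + ?e] ! i = replicate ?e False ! i" using i by (simp del: upt_Suc)
 qed simp
 moreover have "code m n (?a + ?e)" "code m n (?a + ?e + 1)"
  using code_run[OF assms, of j] e by auto
 ultimately show ?thesis by simp
qed

lemma kappa_floor:
 assumes "0 < m" "2 * m < n"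
 shows "\<lfloor>real i / (real m / real n)\<rfloor> = int (i * n div m)"
proof -
 have "real i / (real m / real n) = real (i * n) / real m" by simp
 thus ?thesis by (metis floor_divide_of_nat_eq)
qed

lemma cl_not_dvd:
 assumes "0 < m" "\<not> m dvd j * n"
 shows "cl m n j = j * n div m + 1"
proof (rule sym, subst cl_iff[OF assms(1)])
 have "j * n mod m > 0" using assms by (simp add: mod_greater_zero_iff_not_dvd)
 moreover have "j * n mod m < m" using assms by simp
 ultimately show "j * n \<le> (j * n div m + 1) * m \<and> (j * n div m + 1) * m < j * n + m"
  using div_mult_mod_eq[of "j * n" m] unfolding distrib_right mult_1 by linarith
qed

text \<open>\<open>kappa\<close> is written with floors, \<open>runlen\<close> with ceilings. As
  \<open>m\<close> divides no \<open>j * n\<close> with \<open>0 < j < m\<close>, the ceiling there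
  is the floor plus one. At \<open>j = 0\<close> and \<open>j = m\<close> the quotient is an
  integer, which is compensated by the special first value of \<open>kappa\<close> and by the
  shortening of the last block.\<close>

lemma kappa_runlen:
 assumes "0 < m" "2 * m < n" "coprime m n" "0 < i" "i \<le> m"
 shows "kappa (real m / real n) i - (if i = m then 1 else 0) = runlen m n i"
proof -
 have nd: "\<not> m dvd j * n" if "0 < j" "j < m" for j
  using that coprime_dvd_mult_left_iff[OF assms(3), of j] nat_dvd_not_less[of j m] by blast
 have clm: "cl m n m = n" using cl_add_period[OF assms(1), of n 0] assms by simp
 have k: "int (kappa (real m / real n) i) = (if i = 1 then int (n div m) - 1 else int (i * n div m) - int ((i - 1) * n div m) - 2)"
 proof (cases "i = 1")
  case True
  have "int (n div m) \<ge> 2" using assms(1,2) by (simp add: less_eq_div_iff_mult_less_eq)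
  thus ?thesis using True kappa_floor[OF assms(1,2), of 1] by (simp add: kappa_def)
 next
  case False
  have r: "real i - 1 = real (i - 1)" using assms(4) by simp
  have f: "\<lfloor>(real i - 1) / (real m / real n)\<rfloor> = int ((i - 1) * n div m)"
   unfolding r by (rule kappa_floor[OF assms(1,2)])
  have "(i - 1) * n div m + 2 = ((i - 1) * n + 2 * m) div m" using assms(1) by simp
  also have "\<dots> \<le> i * n div m" using assms(2,4) by (intro div_le_mono) (cases i; simp)
  finally show ?thesis using False f kappa_floor[OF assms(1,2), of i] by (simp add: kappa_def)
 qed
 have rl: "int (runlen m n i) = int (cl m n i) - int (cl m n (i - 1)) - 2"
  using runlen_eq[OF assms(1,2,4)] by simp
 consider "i = 1" "m = 1" | "i = 1" "1 < m" | "1 < i" "i < m" | "1 < i" "i = m" using assms by linarith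
 thus ?thesis
 proof cases
  case 1
  hence "cl m n i = n" "i = Suc 0" using clm by auto
  moreover have "n div m = n" unfolding 1 by simp
  ultimately have "int (kappa (real m / real n) i) = int n - 1" "int (runlen m n i) = int n - 2"
   using k rl assms(1,2,4) by auto
  thus ?thesis using 1 by simp
 next
  case 2
  have "cl m n 1 = n div m + 1" using cl_not_dvd[OF assms(1) nd, of 1] 2 by simp
  thus ?thesis using k rl 2 assms(1) by auto
 next
  case 3
  have "cl m n i = i * n div m + 1" "cl m n (i - 1) = (i - 1) * n div m + 1"
   using cl_not_dvd[OF assms(1) nd] 3 by auto
  thus ?thesis using k rl 3 by simp
 next
  case 4
  have "cl m n (i - 1) = (i - 1) * n div m + 1"
   using cl_not_dvd[OF assms(1) nd, of "i - 1"] 4 by auto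
  thus ?thesis using k rl 4 clm by simp
 qed
qed

lemma lhe_word_code:
 assumes "0 < m" "2 * m < n" "coprime m n"
 shows "lhe_word m n @ [True] = map (code m n) [0..<n]"
proof -
 define z where "z i = replicate (runlen m n i) False" for i
 have clm: "cl m n m = n" using cl_add_period[OF assms(1), of n 0] assms by simp
 have pre: "[True] @ concat (map (\<lambda>i. z i @ [True, True]) [1..<Suc j]) = map (code m n) [0..<cl m n j + 1]" for j
 proof (induction j)
  case 0
  have "code m n 0" using assms by (simp add: code_mod)
  thus ?case using assms by simp
 next
  case (Suc j)
  have "cl m n j + 1 \<le> cl m n (Suc j) + 1" using cl_step[OF assms(1,2), of j] by simp
  hence "[0..<cl m n (Suc j) + 1] = [0..<cl m n j + 1] @ [cl m n j + 1..<cl m n (Suc j) + 1]"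
   by (metis le_add_diff_inverse upt_add_eq_append zero_le)
  thus ?case using Suc code_block[OF assms(1,2), of j] by (simp add: z_def)
 qed
 \<comment> \<open>Moves the separators from the front of each run to its end, the form in which
   \<open>code_block\<close> delivers the runs.\<close>
 have sw: "concat (map (\<lambda>i. [True, True] @ z i) [2..<Suc k]) @ [True, True]
     = [True, True] @ concat (map (\<lambda>i. z i @ [True, True]) [2..<Suc k])" for k
  by (induction k) auto
 have up: "[1..<Suc m] = 1 # [2..<Suc m]" using assms by (simp add: upt_rec numeral_2_eq_2)
 have zz: "replicate (kappa (real m / real n) i - (if i = m then 1 else 0)) False = z i" if "0 < i" "i \<le> m" for i
  using kappa_runlen[OF assms that] by (simp add: z_def)
 have "lhe_word m n = [True] @ z 1 @ concat (map (\<lambda>i. [True, True] @ z i) [2..<Suc m])"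
  unfolding lhe_word_def Let_def using zz[of 1] assms
  by (auto simp: zz simp del: upt_Suc intro!: arg_cong[where f = concat])
 \<comment> \<open>A second 1 is appended to complete the last pair; it is cancelled again at the
   end.\<close>
 hence "lhe_word m n @ [True, True] = [True] @ z 1 @ [True, True] @ concat (map (\<lambda>i. z i @ [True, True]) [2..<Suc m])"
  using sw[of m] by simp
 also have "\<dots> = [True] @ concat (map (\<lambda>i. z i @ [True, True]) [1..<Suc m])" unfolding up by simp
 also have "\<dots> = map (code m n) [0..<n] @ [code m n n]" using pre[of m] clm by simp
 finally have "lhe_word m n @ [True, True] = map (code m n) [0..<n] @ [code m n n]" .
 hence "(lhe_word m n @ [True]) @ [True] = map (code m n) [0..<n] @ [code m n n]"
  by (simp only: append_assoc append.simps)
 thus ?thesis by (rule append1_eq_conv[THEN iffD1, THEN conjunct1])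
qed

lemma lhe_code:
 assumes a: "0 < m" "2 * m < n" and b: "coprime m n"
 shows "lhe m n i = code m n i"
proof -
 have "0 < n" using a by linarith
 hence 1: "i mod n < n" by (rule mod_less_divisor)
 have 2: "lhe m n i = map (code m n) [0..<n] ! (i mod n)"
  unfolding lhe_def periodic_seq_def lhe_word_code[OF a b] length_map length_upt minus_nat.diff_0 by (rule refl)
 have 3: "map (code m n) [0..<n] ! (i mod n) = code m n (i mod n)"
  using nth_map_upt[of "i mod n" n 0 "code m n"] 1 by (simp only: minus_nat.diff_0 add_0)
 show ?thesis unfolding 2 3 by (rule code_periodic[OF a])
qed

section \<open>Admissible words of lhe and their reversals\<close>

declare upt_Suc [simp del]

text \<open>Recursive form of the parity-lexicographical order: a common leading 1 swaps the two
  words, so that no count of ones has to be carried along.\<close>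

function plexl :: "bool list \<Rightarrow> bool list \<Rightarrow> bool" where
 "plexl (x # xs) (y # ys) = (if x = y then (if x then plexl ys xs else plexl xs ys) else \<not> x)"
| "plexl [] ys = False"
| "plexl (x # xs) [] = False"
 by pat_completeness auto
termination by (relation "Wellfounded.measure (\<lambda>(a, b). length a + length b)") auto

lemma ones_simps [simp]: "ones [] = 0" "ones (x # xs) = (if x then Suc (ones xs) else ones xs)"
 by (auto simp: ones_def)

lemma ones_append [simp]: "ones (xs @ ys) = ones xs + ones ys"
 by (simp add: ones_def)

lemma plex_less_at_Suc:
 "plex_less_at (Suc k) (nth (x # xs)) (nth (y # ys)) \<longleftrightarrow>
   x = y \<and> (if x then plex_less_at k (nth ys) (nth xs) else plex_less_at k (nth xs) (nth ys))"
proof -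
 have m: "map (nth (x # xs)) [0..<Suc k] = x # map (nth xs) [0..<k]" by (simp add: map_upt_Suc del: upt_Suc)
 have a: "(\<forall>j<Suc k. (x # xs) ! j = (y # ys) ! j) \<longleftrightarrow> x = y \<and> (\<forall>j<k. xs ! j = ys ! j)"
  by (auto simp: less_Suc_eq_0_disj)
 have e: "map (nth ys) [0..<k] = map (nth xs) [0..<k]" if "\<forall>j<k. xs ! j = ys ! j" using that by auto
 show ?thesis
 proof (cases "x = y \<and> (\<forall>j<k. xs ! j = ys ! j)")
  case True
  hence "map (nth ys) [0..<k] = map (nth xs) [0..<k]" using e by blast
  hence em: "ones (map (nth ys) [0..<k]) = ones (map (nth xs) [0..<k])" by (rule arg_cong)
  show ?thesis unfolding plex_less_at_def a m em using True by (cases x) simp_all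
 next
  case False
  thus ?thesis unfolding plex_less_at_def a by auto
 qed
qed

lemma plexl_iff:
 "length u = length v \<Longrightarrow> plexl u v \<longleftrightarrow> (\<exists>k<length u. plex_less_at k (nth u) (nth v))"
proof (induction u v rule: plexl.induct)
 case (1 x xs y ys)
 have 0: "plex_less_at 0 (nth (x # xs)) (nth (y # ys)) \<longleftrightarrow> \<not> x \<and> y" by (auto simp: plex_less_at_def)
 have "(\<exists>k<length (x # xs). plex_less_at k (nth (x # xs)) (nth (y # ys))) \<longleftrightarrow>
    (\<not> x \<and> y) \<or> (\<exists>k<length xs. plex_less_at (Suc k) (nth (x # xs)) (nth (y # ys)))"
  using 0 by (auto simp: less_Suc_eq_0_disj)
 thus ?case unfolding plex_less_at_Suc using 1 by auto
qed auto

lemma plexl_cases: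
 "length u = length v \<Longrightarrow> (plexl u v \<or> u = v \<or> plexl v u) \<and> \<not> (plexl u v \<and> plexl v u)"
 by (induction u v rule: plexl.induct) auto

lemma plexl_irrefl [simp]: "\<not> plexl u u"
 using plexl_cases[of u u] by blast

lemma plex_le_word_plexl:
 "length u = length v \<Longrightarrow> plex_le_word u v \<longleftrightarrow> \<not> plexl v u"
 unfolding plex_le_word_def using plexl_iff[of u v] plexl_cases[of u v] by auto

lemma plexl_replicate: "plexl (replicate k False @ u) (replicate k False @ v) = plexl u v"
 by (induction k) auto

lemma admissible_word_plexl:
 "admissible_word \<nu> w \<longleftrightarrow> (\<forall>i<length w. \<not> plexl (drop i w) (map \<nu> [1..<1 + (length w - i)]) \<and>
   \<not> plexl (map \<nu> [0..<length w - i]) (drop i w))"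
proof -
 have "map (\<lambda>j. \<nu> (Suc j)) [0..<k] = map \<nu> [1..<1 + k]" for k
  by (simp add: map_Suc_upt[symmetric] del: upt_Suc map_Suc_upt)
 thus ?thesis unfolding admissible_word_def by (auto simp: plex_le_word_plexl simp del: upt_Suc)
qed

text \<open>As \<open>\<nu>\<close> begins with 1, a suffix above \<open>\<nu>\<close> does so too,
  and dropping this letter reverses the order: the next suffix falls below the shift of
  \<open>\<nu>\<close>. So every violation of the upper bound produces one of the lower
  bound.\<close>

lemma admissible_word_lower:
 assumes "\<nu> 0"
 shows "admissible_word \<nu> w \<longleftrightarrow> (\<forall>i<length w. \<not> plexl (drop i w) (map \<nu> [1..<1 + (length w - i)]))"
proof -
 have "\<not> plexl (map \<nu> [0..<length w - i]) (drop i w)"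
  if a: "\<forall>i<length w. \<not> plexl (drop i w) (map \<nu> [1..<1 + (length w - i)])" and i: "i < length w" for i
 proof
  assume l: "plexl (map \<nu> [0..<length w - i]) (drop i w)"
  have "drop i w = w ! i # drop (Suc i) w" using i by (simp add: Cons_nth_drop_Suc)
  moreover have "map \<nu> [0..<length w - i] = True # map \<nu> [1..<1 + (length w - Suc i)]"
   using i assms by (simp add: upt_rec Suc_diff_Suc)
  ultimately have "plexl (drop (Suc i) w) (map \<nu> [1..<1 + (length w - Suc i)])"
   using l by (auto split: if_splits)
  thus False using a by (cases "Suc i < length w") auto
 qed
 thus ?thesis unfolding admissible_word_plexl by blast
qed

section \<open>Zero runs separated by pairs of ones, and admissibility over the code\<close>

fun blk :: "nat list \<Rightarrow> bool list" where
 "blk [] = []"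
| "blk [b] = replicate b False"
| "blk (b # c # bs) = replicate b False @ [True, True] @ blk (c # bs)"

lemma blk_Cons: "bs \<noteq> [] \<Longrightarrow> blk (b # bs) = replicate b False @ [True, True] @ blk bs"
 by (cases bs) auto

lemma blk_append: "xs \<noteq> [] \<Longrightarrow> ys \<noteq> [] \<Longrightarrow> blk (xs @ ys) = blk xs @ [True, True] @ blk ys"
proof (induction xs)
 case (Cons x xs)
 thus ?case by (cases "xs = []") (auto simp: blk_Cons)
qed simp

lemma rev_blk: "rev (blk bs) = blk (rev bs)"
proof (induction bs)
 case (Cons b bs)
 thus ?case by (cases "bs = []") (auto simp: blk_Cons blk_append)
qed simp

text \<open>Compares \<open>blk bs\<close>, completed by one more pair of ones, with the length that
  equally many runs occupy at the beginning of the code. Only the sum and the number of the runs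
  enter.\<close>

definition heavy :: "nat \<Rightarrow> nat \<Rightarrow> nat list \<Rightarrow> bool" where
 "heavy m n bs \<longleftrightarrow> bs \<noteq> [] \<and> cl m n (length bs) < sum_list bs + 2 * length bs"

text \<open>The shortest ways to fall below the code from index \<open>cl m n j + 1\<close> on:
  follow \<open>i\<close> of its runs, then make the next one longer by a single zero.\<close>

definition light_pat :: "nat \<Rightarrow> nat \<Rightarrow> nat \<Rightarrow> nat \<Rightarrow> nat list" where
 "light_pat m n j i = map (\<lambda>k. runlen m n (j + 1 + k)) [0..<i] @ [runlen m n (j + 1 + i) + 1]"

lemma light_pat_0: "light_pat m n j 0 = [runlen m n (Suc j) + 1]"
 by (simp add: light_pat_def)

lemma light_pat_Suc: "light_pat m n j (Suc i) = runlen m n (Suc j) # light_pat m n (Suc j) i"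
 by (simp add: light_pat_def map_upt_Suc del: upt_Suc)

lemma light_pat_ne: "light_pat m n j i \<noteq> []" by (simp add: light_pat_def)

lemma code_from:
 assumes "0 < m" "2 * m < n"
 shows "map (code m n) [cl m n j + 1..<cl m n j + 1 + N] =
  take N (replicate (runlen m n (Suc j)) False @ [True, True] @
      map (code m n) [cl m n (Suc j) + 1..<cl m n (Suc j) + 1 + N])"
proof -
 define a where "a = cl m n j + 1"
 define b where "b = cl m n (Suc j) + 1"
 have ab: "a \<le> b" using cl_step[OF assms, of j] by (simp add: a_def b_def)
 have "map (code m n) [a..<b + N] = map (code m n) [a..<b] @ map (code m n) [b..<b + N]"
  using ab by (metis le_add1 map_append upt_add_eq_append le_add_diff_inverse)
 moreover have "map (code m n) [a..<a + N] = take N (map (code m n) [a..<b + N])"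
  using ab by (simp add: take_map)
 ultimately show ?thesis using code_block[OF assms, of j] unfolding a_def b_def by (simp only: append_assoc)
qed

text \<open>Before each zero run the number of ones is even, so at the first difference a longer run
  is smaller and a shorter one larger. Breaking off after one 1 of a pair is larger as well, since
  the parity is odd there. Only a run that is too long remains.\<close>

lemma plexl_code_iff:
 assumes "0 < m" "2 * m < n"
 shows "plexl v (map (code m n) [cl m n j + 1..<cl m n j + 1 + length v]) \<longleftrightarrow>
   (\<exists>i r. v = blk (light_pat m n j i) @ r)"
proof (induction v arbitrary: j rule: length_induct)
 case (1 v)
 let ?e = "runlen m n (Suc j)"
 let ?c = "\<lambda>N. map (code m n) [cl m n (Suc j) + 1..<cl m n (Suc j) + 1 + N]"
 obtain k u where v: "v = replicate k False @ u" and u: "u = [] \<or> hd u"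
 proof
  show "v = replicate (length (takeWhile Not v)) False @ dropWhile Not v"
   by (metis (full_types) replicate_length_same set_takeWhileD takeWhile_dropWhile_id)
  show "dropWhile Not v = [] \<or> hd (dropWhile Not v)" using hd_dropWhile by blast
 qed
 have L: "map (code m n) [cl m n j + 1..<cl m n j + 1 + length v] = take (length v) (replicate ?e False @ [True, True] @ ?c (length v))"
  by (rule code_from[OF assms])
 have pat: "(\<exists>i r. v = blk (light_pat m n j i) @ r) \<longleftrightarrow>
   (\<exists>r. v = replicate ?e False @ False # r) \<or> (\<exists>v' i r. v = replicate ?e False @ True # True # v' \<and> v' = blk (light_pat m n (Suc j) i) @ r)"
  (is "?A \<longleftrightarrow> ?B \<or> ?C")
 proof
  assume ?A
  then obtain i r where "v = blk (light_pat m n j i) @ r" by blast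
  thus "?B \<or> ?C"
   by (cases i) (auto simp: light_pat_0 light_pat_Suc blk_Cons light_pat_ne replicate_app_Cons_same)
 next
  assume "?B \<or> ?C"
  thus ?A
  proof
   assume ?B
   then obtain r where "v = replicate ?e False @ False # r" by blast
   hence "v = blk (light_pat m n j 0) @ r" by (simp add: light_pat_0 replicate_app_Cons_same)
   thus ?A by blast
  next
   assume ?C
   then obtain i r where "v = replicate ?e False @ True # True # blk (light_pat m n (Suc j) i) @ r" by blast
   hence "v = blk (light_pat m n j (Suc i)) @ r" by (simp add: light_pat_Suc blk_Cons light_pat_ne)
   thus ?A by blast
  qed
 qed
 consider "k < ?e" | "k > ?e" | "k = ?e" by linarith
 thus ?case
 proof cases
  case 1
  hence e: "replicate ?e False = replicate k False @ replicate (?e - k) False"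
   by (simp add: replicate_add[symmetric])
  have "\<not> ?B \<and> \<not> ?C"
  proof -
   have "v = replicate k False @ False # x \<Longrightarrow> False" for x using u v by auto
   moreover have "replicate ?e False @ y = replicate k False @ False # (replicate (?e - k - 1) False @ y)" for y :: "bool list"
    unfolding e using 1 by (cases "?e - k") auto
   ultimately show ?thesis by metis
  qed
  moreover have "\<not> plexl v (take (length v) (replicate ?e False @ [True, True] @ ?c (length v)))"
   unfolding v e using 1 u by (cases u; cases "?e - k") (auto simp: plexl_replicate)
  ultimately show ?thesis unfolding L pat by blast
 next
  case 2
  then obtain d where d: "k = ?e + Suc d" using less_iff_Suc_add by auto
  hence v': "v = replicate ?e False @ False # (replicate d False @ u)"
   unfolding v by (simp add: replicate_add replicate_app_Cons_same)
  hence ?B by blast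
  moreover have "plexl v (take (length v) (replicate ?e False @ [True, True] @ ?c (length v)))"
   unfolding v' by (simp add: plexl_replicate)
  ultimately show ?thesis unfolding L pat by blast
 next
  case 3
  have v': "v = replicate ?e False @ u" using v 3 by simp
  have B: "\<not> ?B" using u unfolding v' by auto
  have C: "?C \<longleftrightarrow> (\<exists>v' i r. u = True # True # v' \<and> v' = blk (light_pat m n (Suc j) i) @ r)" unfolding v' by auto
  have P: "plexl v (take (length v) (replicate ?e False @ [True, True] @ ?c (length v))) \<longleftrightarrow>
    plexl u (take (length u) ([True, True] @ ?c (length v)))"
   unfolding v' by (simp add: plexl_replicate)
  show ?thesis
  proof (cases "\<exists>v'. u = True # True # v'")
   case True
   then obtain v1 where u1: "u = True # True # v1" by blast
   have tk: "take (length v1) (?c (length v)) = ?c (length v1)" unfolding v' u1 by (simp add: take_map take_upt)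
   have "plexl u (take (length u) ([True, True] @ ?c (length v))) \<longleftrightarrow> plexl v1 (?c (length v1))"
    unfolding u1 using tk by simp
   also have "\<dots> \<longleftrightarrow> (\<exists>i r. v1 = blk (light_pat m n (Suc j) i) @ r)"
    using 1[rule_format, of v1 "Suc j"] unfolding v' u1 by simp
   finally show ?thesis using B C P unfolding L pat u1 by blast
  next
   case False
   hence "\<not> ?C" using C by blast
   moreover have "\<not> plexl u (take (length u) ([True, True] @ ?c (length v)))"
    using u False by (cases u; cases "tl u") auto
   ultimately show ?thesis using B P unfolding L pat by blast
  qed
 qed
qed

lemma sum_runlen:
 assumes "0 < m" "2 * m < n"
 shows "sum_list (map (\<lambda>k. runlen m n (1 + k)) [0..<i]) + 2 * i = cl m n i"
proof (induction i)
 case (Suc i)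
 thus ?case using runlen_eq[OF assms, of "Suc i"] by (simp add: upt_Suc)
qed (use assms in simp)

lemma heavy_light_pat:
 assumes "0 < m" "2 * m < n"
 shows "heavy m n (light_pat m n 0 i)"
 unfolding heavy_def light_pat_def using sum_runlen[OF assms, of i] runlen_eq[OF assms, of "Suc i"] by simp

lemma blk_prefix:
 assumes "b' \<le> b"
 shows "\<exists>r. blk (xs @ b # ys) = blk (xs @ [b']) @ r"
proof -
 have "replicate b False = replicate b' False @ replicate (b - b') False"
  using assms by (simp add: replicate_add[symmetric])
 thus ?thesis by (cases "xs = []"; cases "ys = []") (auto simp: blk_Cons blk_append)
qed

text \<open>Consider the first run that differs from the code. If it is longer, the pattern starts
  at the beginning. If it is shorter, everything up to and including it is cut off: as
  \<open>cl\<close> is additive up to one, the rest is still heavy, and induction applies.\<close>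

lemma heavy_imp_pattern:
 assumes mn: "0 < m" "2 * m < n"
 shows "heavy m n bs \<Longrightarrow> \<exists>a i r. blk bs = a @ blk (light_pat m n 0 i) @ r"
proof (induction bs rule: length_induct)
 case (1 bs)
 let ?e = "\<lambda>k. runlen m n (1 + k)"
 have "\<exists>i<length bs. bs ! i \<noteq> ?e i"
 proof (rule ccontr)
  assume "\<not> ?thesis"
  hence "bs = map ?e [0..<length bs]" by (intro nth_equalityI) auto
  hence "sum_list bs + 2 * length bs = cl m n (length bs)" using sum_runlen[OF mn] by metis
  thus False using 1(2) by (simp add: heavy_def)
 qed
 then obtain i where i: "i < length bs" "bs ! i \<noteq> ?e i" "\<And>k. k < i \<Longrightarrow> bs ! k = ?e k"
  using exists_least_iff[of "\<lambda>i. i < length bs \<and> bs ! i \<noteq> ?e i"] by (metis less_trans)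
 have tk: "take i bs = map ?e [0..<i]" using i by (intro nth_equalityI) auto
 define cs where "cs = drop (Suc i) bs"
 have bs: "bs = map ?e [0..<i] @ bs ! i # cs" unfolding cs_def tk[symmetric] using i(1) by (simp add: id_take_nth_drop)
 show ?case
 proof (cases "bs ! i > ?e i")
  case True
  then obtain r where "blk bs = blk (map ?e [0..<i] @ [?e i + 1]) @ r"
   using blk_prefix[of "?e i + 1" "bs ! i" "map ?e [0..<i]" cs] bs by auto
  hence "blk bs = [] @ blk (light_pat m n 0 i) @ r" by (simp add: light_pat_def)
  thus ?thesis by blast
 next
  case False
  hence lt: "bs ! i < ?e i" using i(2) by simp
  have len: "length bs = Suc i + length cs" using arg_cong[OF bs, of length] by simp
  have "sum_list bs = sum_list (map ?e [0..<i]) + bs ! i + sum_list cs" using arg_cong[OF bs, of sum_list] by simp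
  hence "sum_list bs + 2 * length bs = cl m n i + (bs ! i + 2) + (sum_list cs + 2 * length cs)"
   using len sum_runlen[OF mn, of i] by simp
  moreover have "cl m n i + (bs ! i + 2) + 1 \<le> cl m n (Suc i)" using lt runlen_eq[OF mn, of "Suc i"] by simp
  moreover have "cl m n (Suc i) + cl m n (length cs) \<le> cl m n (length bs) + 1"
   using cl_superadd(2)[OF mn(1), of n "Suc i" "length cs"] len by simp
  ultimately have s: "cl m n (length cs) < sum_list cs + 2 * length cs" using 1(2) by (simp add: heavy_def)
  hence ne: "cs \<noteq> []" by auto
  hence h: "heavy m n cs" using s by (simp add: heavy_def)
  have "length cs < length bs" using len by simp
  then obtain a k r where "blk cs = a @ blk (light_pat m n 0 k) @ r" using 1(1) h by blast
  moreover have "blk bs = blk (map ?e [0..<i] @ [bs ! i]) @ [True, True] @ blk cs"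
   using blk_append[of "map ?e [0..<i] @ [bs ! i]" cs] ne bs by simp
  ultimately have "blk bs = (blk (map ?e [0..<i] @ [bs ! i]) @ [True, True] @ a) @ blk (light_pat m n 0 k) @ r" by simp
  thus ?thesis by blast
 qed
qed

lemma admissible_word_code_iff:
 assumes mn: "0 < m" "2 * m < n"
 shows "admissible_word (code m n) w \<longleftrightarrow> \<not> (\<exists>a bs c. w = a @ blk bs @ c \<and> heavy m n bs)"
proof -
 have c0: "code m n 0" using mn by (auto simp: code_def intro!: exI[of _ 0])
 have cl0: "cl m n 0 = 0" using mn by simp
 have "admissible_word (code m n) w \<longleftrightarrow> (\<forall>i<length w. \<not> (\<exists>k r. drop i w = blk (light_pat m n 0 k) @ r))"
  unfolding admissible_word_lower[of "code m n", OF c0] using plexl_code_iff[OF mn, of "drop i w" 0 for i] cl0 by simp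
 also have "\<dots> \<longleftrightarrow> \<not> (\<exists>a bs c. w = a @ blk bs @ c \<and> heavy m n bs)"
 proof -
  have "\<exists>i<length w. \<exists>k r. drop i w = blk (light_pat m n 0 k) @ r" if w: "w = a @ blk bs @ c" and h: "heavy m n bs" for a bs c
  proof -
   obtain a' k r where b: "blk bs = a' @ blk (light_pat m n 0 k) @ r" using heavy_imp_pattern[OF mn h] by blast
   have "blk (light_pat m n 0 k) \<noteq> []"
    by (cases k) (auto simp: light_pat_0 light_pat_Suc blk_Cons light_pat_ne)
   hence "length (a @ a') < length w" unfolding w b by simp
   moreover have "drop (length (a @ a')) w = blk (light_pat m n 0 k) @ (r @ c)" unfolding w b by simp
   ultimately show ?thesis by blast
  qed
  moreover have "\<exists>a bs c. w = a @ blk bs @ c \<and> heavy m n bs" if "drop i w = blk (light_pat m n 0 k) @ r" for i k r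
   using that heavy_light_pat[OF mn, of k] by (metis append_take_drop_id)
  ultimately show ?thesis by blast
 qed
 finally show ?thesis .
qed

lemma admissible_word_code_rev:
 assumes mn: "0 < m" "2 * m < n" and w: "admissible_word (code m n) w"
 shows "admissible_word (code m n) (rev w)"
proof -
 have "heavy m n (rev bs) \<longleftrightarrow> heavy m n bs" for bs by (simp add: heavy_def)
 moreover have "rev w = a @ blk bs @ c \<Longrightarrow> w = rev c @ blk (rev bs) @ rev a" for a bs c
  by (metis append.assoc rev_append rev_blk rev_rev_ident)
 ultimately show ?thesis using w unfolding admissible_word_code_iff[OF mn] by metis
qed

text \<open>The window \<open>[-m, m)\<close> of the rotation coding is symmetric up to a shift by one.\<close>

lemma code_symmetric:
 assumes mn: "0 < m" "2 * m < n" and cpm: "coprime m n"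
 shows "\<exists>d. \<forall>i j. (i + j + d) mod n = 0 \<longrightarrow> code m n i = code m n j"
proof -
 have n: "1 < n" using mn by simp
 obtain b where b: "[m * b = 1] (mod n)" using cong_solve_coprime_nat[OF cpm] by auto
 have "code m n i = code m n j" if z: "(i + j + b) mod n = 0" for i j
 proof -
  define p where "p = i * m mod n"
  define q where "q = j * m mod n"
  have pq: "p < n" "q < n" using n by (simp_all add: p_def q_def)
  have "(p + q + 1) mod n = (i * m + j * m + m * b) mod n"
   unfolding p_def q_def using b[unfolded cong_def] by (metis mod_add_cong mod_mod_trivial)
  also have "\<dots> = ((i + j + b) * m) mod n" by (simp add: algebra_simps)
  also have "\<dots> = 0" using z by (metis mod_mult_left_eq mod_0 mult_zero_left)
  finally have "n dvd p + q + 1" by (simp add: mod_eq_0_iff_dvd)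
  then obtain k where k: "p + q + 1 = n * k" by blast
  have "n * k < n * 2" using k pq by linarith
  hence "k = 1" using k by (cases k) auto
  hence "p + q + 1 = n" using k by simp
  thus ?thesis unfolding code_mod[OF mn] p_def[symmetric] q_def[symmetric] using mn by auto
 qed
 thus ?thesis by blast
qed

section \<open>Tent maps with a periodic turning point\<close>

text \<open>Both letters are allowed at the turning point, so that the condition is closed and
  survives limits; \<open>ssid\<close> is the strict version.\<close>

definition side :: "bool \<Rightarrow> real \<Rightarrow> bool" where
 "side a y \<longleftrightarrow> (if a then 1/2 \<le> y else y \<le> 1/2)"

lemma side_both: "side a y \<Longrightarrow> side b y \<Longrightarrow> a \<noteq> b \<Longrightarrow> y = 1/2"
 by (auto simp: side_def split: if_splits)

lemma tent_left: "t \<le> 1/2 \<Longrightarrow> 0 \<le> s \<Longrightarrow> tent s t = s * t"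
 unfolding tent_def min_def using mult_left_mono[of t "1 - t" s] by auto

lemma tent_right: "1/2 \<le> t \<Longrightarrow> 0 \<le> s \<Longrightarrow> tent s t = s * (1 - t)"
 unfolding tent_def min_def using mult_left_mono[of "1 - t" t s] by auto

definition sgnp :: "nat \<Rightarrow> real" where "sgnp k = (-1) ^ k"

lemma sgnp_simps [simp]: "sgnp 0 = 1" "sgnp (Suc k) = - sgnp k" "sgnp k * sgnp k = 1" "\<bar>sgnp k\<bar> = 1"
 "sgnp k \<noteq> 0"
 by (auto simp: sgnp_def power_mult_distrib[symmetric] simp flip: power_add mult_2)

lemma sgnp_parity: "sgnp k = (if even k then 1 else -1)"
 by (simp add: sgnp_def)

abbreviation onesl :: "bits \<Rightarrow> nat \<Rightarrow> nat" where
 "onesl a k \<equiv> ones (map a [0..<k])"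

lemma onesl_Suc [simp]: "onesl a (Suc k) = onesl a k + (if a k then 1 else 0)"
 by (simp add: upt_Suc)

lemma onesl_cong: "(\<And>i. i < k \<Longrightarrow> a i = b i) \<Longrightarrow> onesl a k = onesl b k"
 by (rule arg_cong[where f = ones]) simp

lemma tent_diff:
 assumes "side a x" "side a y" "0 \<le> s"
 shows "tent s x - tent s y = (if a then - s else s) * (x - y)"
 using assms by (auto simp: side_def tent_left tent_right algebra_simps split: if_splits)

lemma tent_iter_diff:
 assumes "\<And>i. i < k \<Longrightarrow> side (a i) ((tent s ^^ i) x)" "\<And>i. i < k \<Longrightarrow> side (a i) ((tent s ^^ i) y)" "0 \<le> s"
 shows "(tent s ^^ k) x - (tent s ^^ k) y = sgnp (onesl a k) * s ^ k * (x - y)"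
 using assms(1,2)
proof (induction k)
 case (Suc k)
 have "(tent s ^^ Suc k) x - (tent s ^^ Suc k) y = (if a k then - s else s) * ((tent s ^^ k) x - (tent s ^^ k) y)"
  using tent_diff[OF Suc.prems(1)[of k] Suc.prems(2)[of k] assms(3)] by simp
 thus ?case using Suc by simp
qed simp

locale tent_base =
 fixes s :: real
 assumes s1: "1 < s" and s2: "s \<le> 2"
begin

lemma s0 [simp]: "0 < s" "0 \<le> s" "s \<noteq> 0" using s1 by auto

lemma tent_unit: "t \<in> {0..1} \<Longrightarrow> tent s t \<in> {0..s/2}"
 using s2 by (cases "t \<le> 1/2") (auto simp: tent_left tent_right intro: mult_left_mono)

lemma half_s: "s/2 \<le> 1" "1/2 < s/2" using s1 s2 by auto

lemma iter_unit: "t \<in> {0..1} \<Longrightarrow> (tent s ^^ k) t \<in> {0..1}"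
proof (induction k)
 case (Suc k)
 thus ?case using tent_unit[of "(tent s ^^ k) t"] half_s by auto
qed simp

lemma tent_half: "tent s (1/2) = s/2" by (simp add: tent_left)

lemma tent_eq_max: "tent s t = s/2 \<Longrightarrow> t = 1/2"
 by (cases "t \<le> 1/2") (auto simp: tent_left tent_right field_simps)

lemma tent_le_max: "tent s t \<le> s/2"
proof (cases "t \<le> 1/2")
 case True thus ?thesis using mult_left_mono[OF True, of s] by (simp add: tent_left)
next
 case False thus ?thesis using mult_left_mono[of "1 - t" "1/2" s] by (simp add: tent_right)
qed

text \<open>As long as two orbits stay on the same sides, their distance grows by the factor
  \<open>s\<close> in every step, but it cannot exceed 1.\<close>

lemma itinerary_unique:
 assumes "x \<in> {0..1}" "y \<in> {0..1}" "\<And>i. side (a i) ((tent s ^^ i) x)" "\<And>i. side (a i) ((tent s ^^ i) y)"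
 shows "x = y"
proof (rule ccontr)
 assume "x \<noteq> y"
 then obtain k where k: "1 / \<bar>x - y\<bar> < s ^ k" using s1 real_arch_pow by blast
 have "\<bar>(tent s ^^ k) x - (tent s ^^ k) y\<bar> = s ^ k * \<bar>x - y\<bar>"
  using tent_iter_diff[of k a s x y] assms(3,4) by (simp add: abs_mult)
 moreover have "\<bar>(tent s ^^ k) x - (tent s ^^ k) y\<bar> \<le> 1"
  using iter_unit[OF assms(1), of k] iter_unit[OF assms(2), of k] by auto
 ultimately show False using k `x \<noteq> y` by (simp add: field_simps)
qed

lemma turning_unit: "(tent s ^^ k) (1/2) \<in> {0..1}" by (rule iter_unit) simp

end

text \<open>With \<open>b\<close> inverse to \<open>m\<close> modulo \<open>n\<close>, a shift of
  the index by \<open>b\<close> moves the rotation by one. A 1 followed at distance \<open>b\<close>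
  by a 0 thus marks a single residue class of indices, the one where the rotation stands at
  \<open>m - 1\<close>, and every period must preserve this class.\<close>

lemma code_min_period:
 assumes mn: "0 < m" "2 * m < n" and cpm: "coprime m n" and per: "\<And>i. code m n (i + N) = code m n i"
 shows "n dvd N"
proof -
 have n: "1 < n" using mn by simp
 obtain b where b0: "[m * b = 1] (mod n)" using cong_solve_coprime_nat[OF cpm] by auto
 hence b: "(b * m) mod n = 1" using n by (simp add: cong_def mult.commute)
 define k where "k = b * (m - 1)"
 have km: "(k * m) mod n = m - 1"
 proof -
  have "k * m = (m - 1) * (b * m)" by (simp add: k_def)
  hence "(k * m) mod n = (m - 1) * (b * m mod n) mod n" by (simp only: mod_mult_right_eq)
  thus ?thesis unfolding b using mn by simp
 qed
 have A: "code m n i \<and> \<not> code m n (i + b) \<longleftrightarrow> (i * m) mod n = m - 1" for i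
 proof -
  define x where "x = i * m mod n"
  have x: "x < n" using n by (simp add: x_def)
  have "(i + b) * m mod n = ((i * m mod n) + (b * m mod n)) mod n"
   unfolding add_mult_distrib mod_add_eq ..
  hence 1: "(i + b) * m mod n = Suc x mod n" unfolding b x_def by simp
  have 2: "Suc x mod n = (if Suc x = n then 0 else Suc x)" using mod_Suc[of x n] mod_less[OF x] by simp
  show ?thesis
  proof (cases "Suc x = n")
   case True
   thus ?thesis unfolding code_mod[OF mn] 1 2 x_def[symmetric] using mn by auto
  next
   case False
   thus ?thesis unfolding code_mod[OF mn] 1 2 x_def[symmetric] using mn x by auto
  qed
 qed
 have "((k + N) * m) mod n = m - 1"
 proof -
  have "code m n k \<and> \<not> code m n (k + b)" using A[of k] km by blast
  moreover have "code m n (k + N + b) = code m n (k + b)" using per[of "k + b"] by (simp add: add.commute add.left_commute)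
  ultimately show ?thesis using A[of "k + N"] per[of k] by blast
 qed
 hence "[k * m + N * m = k * m + 0] (mod n)" using km by (simp add: cong_def distrib_right)
 hence "[N * m = 0] (mod n)" by (simp only: cong_add_lcancel_nat)
 hence "n dvd N * m" by (simp add: cong_0_iff)
 thus ?thesis using coprime_dvd_mult_left_iff[of n m N] cpm by (simp add: coprime_commute)
qed

text \<open>The interface between combinatorics and dynamics. \<open>nu_last\<close> records which
  of the two periodic candidates is the smaller one; it makes the number of ones in a period
  even.\<close>

locale tent_lhe = tent_base +
 fixes n :: nat and \<nu> :: bits
 assumes sqrt2: "sqrt 2 < s"
  and n3: "3 \<le> n"
  and turning_period: "(tent s ^^ n) (1/2) = 1/2"
  and turning_exact: "\<And>j. 0 < j \<Longrightarrow> j < n \<Longrightarrow> (tent s ^^ j) (1/2) \<noteq> 1/2"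
  and nu_kneading: "kneading s = \<nu>"
  and nu_side: "\<And>i. side (\<nu> i) ((tent s ^^ Suc i) (1/2))"
  and nu_periodic: "\<And>i. \<nu> (i + n) = \<nu> i"
  and nu_last: "\<nu> (n - 1) \<longleftrightarrow> odd (onesl \<nu> (n - 1))"
  and admissible_rev: "\<And>w. admissible_word \<nu> w \<Longrightarrow> admissible_word \<nu> (rev w)"
  and nu_symmetric: "\<exists>d. \<forall>i j. (i + j + d) mod n = 0 \<longrightarrow> \<nu> i = \<nu> j"

text \<open>The two periodic candidates first differ at index \<open>N - 1\<close>; so the smaller
  one has a 1 there iff an odd number of ones precedes. The bound \<open>i < N - 1\<close> leaves
  out this ambiguous letter.\<close>

lemma kneading_cases:
 obtains "\<And>N. 0 < N \<Longrightarrow> (tent s ^^ N) (1/2) \<noteq> 1/2" "\<And>i. kneading s i \<longleftrightarrow> 1/2 \<le> (tent s ^^ Suc i) (1/2)"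
 | N where "0 < N" "(tent s ^^ N) (1/2) = 1/2" "\<And>j. 0 < j \<Longrightarrow> j < N \<Longrightarrow> (tent s ^^ j) (1/2) \<noteq> 1/2"
   "\<And>i. kneading s (i + N) = kneading s i"
   "\<And>i. i < N - 1 \<Longrightarrow> kneading s i \<longleftrightarrow> 1/2 \<le> (tent s ^^ Suc i) (1/2)"
   "kneading s (N - 1) \<longleftrightarrow> odd (onesl (kneading s) (N - 1))"
proof -
 define ret where "ret N \<longleftrightarrow> 0 < N \<and> (tent s ^^ N) (1/2) = 1/2" for N
 define letter where "letter i \<longleftrightarrow> 1/2 \<le> (tent s ^^ Suc i) (1/2)" for i
 show thesis
 proof (cases "\<exists>N. ret N")
  case False
  hence F: "\<not> (\<exists>N. 0 < N \<and> (tent s ^^ N) (1/2) = 1/2)" unfolding ret_def .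
  have "kneading s = letter" unfolding kneading_def Let_def if_not_P[OF F] letter_def by (rule refl)
  thus thesis using False that(1) unfolding ret_def letter_def by metis
 next
  case True
  define N where "N = (LEAST N. ret N)"
  define w where "w = map letter [0..<N - 1]"
  define a where "a = periodic_seq (w @ [False])"
  define b where "b = periodic_seq (w @ [True])"
  have N: "ret N" unfolding N_def using True by (rule LeastI_ex)
  have Nm: "ret j \<Longrightarrow> N \<le> j" for j unfolding N_def by (rule Least_le)
  have K: "kneading s = (if plex_less a b then a else b)"
   unfolding kneading_def Let_def a_def b_def w_def N_def
   using True unfolding ret_def letter_def by (simp only: if_True)
  have N0: "0 < N" using N by (simp add: ret_def)
  then obtain M where M: "N = Suc M" using gr0_implies_Suc by blast
  have len: "length (w @ [x]) = N" for x using N0 by (simp add: w_def)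
  have low: "periodic_seq (w @ [x]) i = letter i" if "i < M" for i x
   unfolding periodic_seq_def len using that by (simp add: w_def nth_append M)
  have top: "periodic_seq (w @ [x]) M = x" for x
   unfolding periodic_seq_def len by (simp add: w_def nth_append M)
  have per: "periodic_seq (w @ [x]) (i + N) = periodic_seq (w @ [x]) i" for i x
   unfolding periodic_seq_def len by simp
  have oa: "onesl (periodic_seq (w @ [x])) M = onesl letter M" for x
   by (rule onesl_cong) (simp add: low)
  have at: "plex_less_at M a b \<longleftrightarrow> even (onesl letter M)"
   unfolding plex_less_at_def a_def b_def oa top using low by simp
  have "plex_less a b \<longleftrightarrow> even (onesl letter M)"
  proof
   assume "plex_less a b"
   then obtain k where k: "plex_less_at k a b" unfolding plex_less_def by blast
   have "a k \<noteq> b k" using k unfolding plex_less_at_def by (auto split: if_splits)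
   hence "\<not> k < M" unfolding a_def b_def using low by auto
   moreover have "\<not> M < k" using k top unfolding plex_less_at_def a_def b_def by metis
   ultimately have "k = M" by simp
   thus "even (onesl letter M)" using k at by blast
  qed (use at in "auto simp: plex_less_def")
  hence K2: "kneading s = periodic_seq (w @ [odd (onesl letter M)])"
   unfolding K a_def b_def by auto
  show thesis
  proof (rule that(2)[of N])
   show "0 < N" by fact
   show "(tent s ^^ N) (1/2) = 1/2" using N by (simp add: ret_def)
   show "0 < j \<Longrightarrow> j < N \<Longrightarrow> (tent s ^^ j) (1/2) \<noteq> 1/2" for j using Nm[of j] by (auto simp: ret_def)
   show "kneading s (i + N) = kneading s i" for i unfolding K2 per ..
   show "i < N - 1 \<Longrightarrow> kneading s i \<longleftrightarrow> 1/2 \<le> (tent s ^^ Suc i) (1/2)" for i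
    unfolding K2 by (simp add: low letter_def M)
   show "kneading s (N - 1) \<longleftrightarrow> odd (onesl (kneading s) (N - 1))"
    unfolding K2 M diff_Suc_1 oa top ..
  qed
 qed
qed

lemma (in tent_base) turning_iter_mod:
 assumes "(tent s ^^ N) (1/2) = 1/2"
 shows "(tent s ^^ (i mod N)) (1/2) = (tent s ^^ i) (1/2)"
 by (rule funpow_mod_eq[OF assms])

text \<open>The code has period \<open>n\<close>, so the first and the \<open>n + 1\<close>-st
  iterate of the turning point share an itinerary and coincide; since only the turning point is
  mapped to the maximum, it returns after \<open>n\<close> steps. Conversely, a first return time
  \<open>N\<close> is a period of the code, hence a multiple of \<open>n\<close>.\<close>

theorem tent_lhe_if_kneading:
 assumes sq: "sqrt 2 < s" and s2: "s \<le> 2" and mn: "0 < m" "2 * m < n" and cpm: "coprime m n"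
  and kn: "kneading s = lhe m n"
 shows "tent_lhe s n (lhe m n)"
proof -
 have "1 < sqrt 2" by simp
 then interpret tent_base s using sq s2 by unfold_locales linarith+
 have C: "lhe m n = code m n" using lhe_code[OF mn cpm] by blast
 have kc: "kneading s = code m n" using kn C by simp
 have cper: "code m n (i + n) = code m n i" for i
  using code_periodic[OF mn, of "i + n"] code_periodic[OF mn, of i] by simp
 have n0: "0 < n" using mn by simp
 define p where "p i = (tent s ^^ i) (1/2)" for i
 have pi: "(tent s ^^ k) (p i) = p (k + i)" for k i by (simp add: p_def funpow_add)
 have ret: "p n = 1/2" if sd: "\<And>i. side (code m n i) (p (Suc i))"
 proof -
  have "p (Suc n) = p 1"
  proof (rule itinerary_unique[where a = "code m n"])
   show "p (Suc n) \<in> {0..1}" "p 1 \<in> {0..1}" unfolding p_def by (rule turning_unit)+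
   show "side (code m n i) ((tent s ^^ i) (p (Suc n)))" for i
    using sd[of "i + n"] cper unfolding pi by simp
   show "side (code m n i) ((tent s ^^ i) (p 1))" for i using sd[of i] unfolding pi by simp
  qed
  hence "tent s (p n) = s / 2" using tent_half unfolding p_def funpow.simps o_apply by simp
  thus ?thesis by (rule tent_eq_max)
 qed
 show ?thesis
 proof (cases rule: kneading_cases[of s])
  case 1
  have "side (code m n i) (p (Suc i))" for i
  proof -
   have "code m n i \<longleftrightarrow> 1/2 \<le> p (Suc i)" using 1(2)[of i] unfolding kc p_def .
   thus ?thesis by (auto simp: side_def)
  qed
  hence "p n = 1/2" by (rule ret)
  with 1(1)[OF n0] show ?thesis unfolding p_def by blast
 next
  case (2 N)
  have sd: "side (code m n i) (p (Suc i))" for i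
  proof (cases "i mod N = N - 1")
   case True
   hence "Suc i mod N = 0" using mod_Suc[of i N] 2(1) by simp
   hence "p (Suc i) = p 0" unfolding p_def using turning_iter_mod[OF 2(2), of "Suc i"] by simp
   thus ?thesis by (simp add: p_def side_def)
  next
   case False
   hence "i mod N < N - 1" using mod_less_divisor[OF 2(1), of i] by linarith
   hence "kneading s (i mod N) \<longleftrightarrow> 1/2 \<le> p (Suc (i mod N))" using 2(5) by (simp add: p_def)
   moreover have "kneading s (i mod N) = kneading s i"
   proof -
    have "kneading s (j + k * N) = kneading s j" for j k
    proof (induction k)
     case (Suc k)
     have "j + Suc k * N = (j + k * N) + N" by simp
     thus ?case using 2(4) Suc by metis
    qed simp
    from this[of "i mod N" "i div N"] show ?thesis by simp
   qed
   moreover have "p (Suc (i mod N)) = p (Suc i)" unfolding p_def using turning_iter_mod[OF 2(2)] by simp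
   ultimately show ?thesis using kc by (auto simp: side_def)
  qed
  have pn: "p n = 1/2" by (rule ret[OF sd])
  have "n dvd N" by (rule code_min_period[OF mn cpm]) (use 2(4) kc in simp)
  hence "n \<le> N" using 2(1) by (simp add: dvd_imp_le)
  moreover have "N \<le> n" using 2(3)[OF n0] pn by (force simp: p_def)
  ultimately have Nn: "N = n" by simp
  show ?thesis
  proof unfold_locales
   show "sqrt 2 < s" by fact
   show "3 \<le> n" using mn by simp
   show "(tent s ^^ n) (1 / 2) = 1 / 2" "\<And>j. 0 < j \<Longrightarrow> j < n \<Longrightarrow> (tent s ^^ j) (1 / 2) \<noteq> 1 / 2" using 2(2,3) unfolding Nn by blast+
   show "kneading s = lhe m n" by fact
   show "side (lhe m n i) ((tent s ^^ Suc i) (1 / 2))" for i using sd unfolding C p_def .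
   show "lhe m n (i + n) = lhe m n i" for i unfolding C cper ..
   show "lhe m n (n - 1) = odd (onesl (lhe m n) (n - 1))" using 2(6) unfolding Nn kn .
   show "admissible_word (lhe m n) w \<Longrightarrow> admissible_word (lhe m n) (rev w)" for w
    unfolding C by (rule admissible_word_code_rev[OF mn])
   show "\<exists>d. \<forall>i j. (i + j + d) mod n = 0 \<longrightarrow> lhe m n i = lhe m n j" unfolding C by (rule code_symmetric[OF mn cpm])
  qed
 qed
qed

section \<open>Itineraries and admissible sequences\<close>

declare One_nat_def [simp del]

lemma plex_less_at_cong:
 assumes "\<And>j. j \<le> k \<Longrightarrow> a j = a' j" "\<And>j. j \<le> k \<Longrightarrow> b j = b' j"
 shows "plex_less_at k a b \<longleftrightarrow> plex_less_at k a' b'"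
proof -
 have "onesl a k = onesl a' k" by (rule onesl_cong) (use assms in auto)
 thus ?thesis unfolding plex_less_at_def using assms by auto
qed

lemma plex_less_at_asym:
 assumes "plex_less_at k a b" shows "\<not> plex_less_at j b a"
proof
 assume j: "plex_less_at j b a"
 have "a k \<noteq> b k" "b j \<noteq> a j" using assms j unfolding plex_less_at_def by (auto split: if_splits)
 hence "j = k" using assms j unfolding plex_less_at_def by (metis linorder_neqE_nat)
 moreover from this have "onesl a k = onesl b k" by (intro onesl_cong) (use assms in "auto simp: plex_less_at_def")
 ultimately show False using assms j unfolding plex_less_at_def by (auto split: if_splits)
qed

lemma plex_less_at_intro:
 assumes "\<And>j. j < k \<Longrightarrow> a j = b j" "a k \<noteq> b k"
 shows "plex_less_at k a b \<or> plex_less_at k b a"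
proof -
 have "onesl a k = onesl b k" by (rule onesl_cong) (use assms in auto)
 thus ?thesis unfolding plex_less_at_def using assms by auto
qed

lemma first_difference:
 fixes a b :: "nat \<Rightarrow> 'a"
 assumes "a \<noteq> b" obtains k where "\<And>j. j < k \<Longrightarrow> a j = b j" "a k \<noteq> b k"
proof -
 have "\<exists>k. a k \<noteq> b k" using assms by auto
 thus thesis using that exists_least_iff[of "\<lambda>k. a k \<noteq> b k"] by blast
qed

lemma admissible_word_seq:
 "admissible_word \<nu> (map a [0..<N]) \<longleftrightarrow> (\<forall>i k. i + k < N \<longrightarrow>
   \<not> plex_less_at k (\<lambda>j. a (i + j)) (\<lambda>j. \<nu> (Suc j)) \<and> \<not> plex_less_at k \<nu> (\<lambda>j. a (i + j)))"
proof -
 have L: "length (map a [0..<N]) = N" by simp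
 have d: "drop i (map a [0..<N]) = map (\<lambda>j. a (i + j)) [0..<N - i]" for i
  by (rule nth_equalityI) auto
 have u: "map \<nu> [1..<1 + M] = map (\<lambda>j. \<nu> (Suc j)) [0..<M]" for M
  by (rule nth_equalityI) (auto simp: One_nat_def)
 have pl: "plexl (map f [0..<M]) (map g [0..<M]) \<longleftrightarrow> (\<exists>k<M. plex_less_at k f g)" for f g :: bits and M
 proof -
  have "plex_less_at k (nth (map f [0..<M])) (nth (map g [0..<M])) \<longleftrightarrow> plex_less_at k f g" if "k < M" for k
   by (rule plex_less_at_cong) (use that in auto)
  thus ?thesis using plexl_iff[of "map f [0..<M]" "map g [0..<M]"] by auto
 qed
 show ?thesis unfolding admissible_word_plexl L d u pl
  by (metis add.commute less_diff_conv add_lessD1)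
qed

definition ssid :: "bool \<Rightarrow> real \<Rightarrow> bool" where
 "ssid a y \<longleftrightarrow> (if a then 1/2 < y else y < 1/2)"

lemma ssid_side: "ssid a y \<Longrightarrow> side a y" by (auto simp: ssid_def side_def split: if_splits)
lemma ssid_iff: "ssid a y \<Longrightarrow> side b y \<longleftrightarrow> b = a" by (auto simp: ssid_def side_def split: if_splits)
lemma ssid_if: "side a y \<Longrightarrow> y \<noteq> 1/2 \<Longrightarrow> ssid a y" by (auto simp: ssid_def side_def split: if_splits)

context tent_lhe
begin

definition It :: "nat \<Rightarrow> real \<Rightarrow> real" where "It k y = (tent s ^^ k) y"

lemma It_0 [simp]: "It 0 y = y" and It_Suc: "It (Suc k) y = tent s (It k y)"
 and It_add: "It (j + k) y = It j (It k y)"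
 unfolding It_def by (simp_all add: funpow_add)

lemma It_Suc2: "It (Suc k) y = It k (tent s y)" unfolding It_def by (simp add: funpow_swap1)

lemma It_unit: "y \<in> {0..1} \<Longrightarrow> It k y \<in> {0..1}" unfolding It_def by (rule iter_unit)

lemma It_diff:
 assumes "\<And>i. i < k \<Longrightarrow> side (a i) (It i x)" "\<And>i. i < k \<Longrightarrow> side (a i) (It i y)"
 shows "It k x - It k y = sgnp (onesl a k) * s ^ k * (x - y)"
 using tent_iter_diff[of k a s x y] assms unfolding It_def by simp

lemma It_unique:
 assumes "x \<in> {0..1}" "y \<in> {0..1}" "\<And>i. side (a i) (It i x)" "\<And>i. side (a i) (It i y)"
 shows "x = y"
 using itinerary_unique[of x y a] assms unfolding It_def by blast

definition p :: "nat \<Rightarrow> real" where "p i = It i (1/2)"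

lemma p_0 [simp]: "p 0 = 1/2" and p_Suc: "p (Suc i) = tent s (p i)"
 and It_p: "It k (p i) = p (k + i)"
 unfolding p_def by (simp_all add: It_Suc It_add)

lemma p_1: "p 1 = s/2" "p (Suc 0) = s/2" using p_Suc[of 0] tent_half by (simp_all add: One_nat_def)

lemma It_p1: "It i (p 1) = p (Suc i)" by (simp add: It_p One_nat_def)

lemma n_pos: "0 < n" "1 < n" "2 < n" using n3 by auto

lemma p_mod: "p (i mod n) = p i"
 unfolding p_def It_def by (rule turning_iter_mod[OF turning_period])

lemma p_periodic: "p (i + n) = p i" "p (n + i) = p i" using p_mod[of "i + n"] p_mod[of i] by (simp_all add: add.commute)

lemma p_half_iff: "p i = 1/2 \<longleftrightarrow> i mod n = 0"
proof
 assume "p i = 1/2"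
 hence "It (i mod n) (1/2) = 1/2" using p_mod[of i] unfolding p_def by simp
 thus "i mod n = 0" using turning_exact[of "i mod n"] n_pos unfolding It_def by force
qed (use p_mod[of i] in simp)

lemma p_max_iff: "p (Suc i) = s/2 \<longleftrightarrow> i mod n = 0"
 using tent_eq_max[of "p i"] tent_half p_half_iff[of i] by (metis p_Suc)

lemma p_unit: "p i \<in> {0..1}" unfolding p_def by (rule It_unit) simp

text \<open>For \<open>s = 2\<close> the turning point would be mapped to 1, then to the fixed point
  0, and never return.\<close>

lemma s_lt2: "s < 2"
proof (rule ccontr)
 assume "\<not> s < 2"
 hence s: "s = 2" using s2 by simp
 have "p (Suc (Suc k)) = 0" for k
 proof (induction k)
  case 0
  have "p 1 = 1" using p_1 s by simp
  hence "p (Suc 1) = 0" using p_Suc[of 1] by (simp add: tent_def)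
  thus ?case by (simp add: One_nat_def)
 next
  case (Suc k)
  thus ?case using p_Suc[of "Suc (Suc k)"] by (simp add: tent_def)
 qed
 from this[of "n - 2"] have "p n = 0" using n3 by (simp add: numeral_2_eq_2 Suc_diff_Suc)
 thus False using p_half_iff[of n] by simp
qed

lemma p_2: "p 2 = s * (1 - s/2)" "p (Suc 1) = s * (1 - s/2)"
using p_Suc half_s by (auto simp: p_1 tent_right numeral_2_eq_2 One_nat_def)

lemma p2_pos: "0 < p 2" unfolding p_2 using s_lt2 by simp

lemma p2_lt: "p 2 < 1/2"
proof -
 have "0 \<le> (s - 1)^2" by simp
 hence "p 2 \<le> 1/2" unfolding p_2 by (simp add: power2_eq_square algebra_simps)
 moreover have "p 2 \<noteq> 1/2" using p_half_iff[of 2] n3 by simp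
 ultimately show ?thesis by simp
qed

lemma p1_gt: "1/2 < p 1" using p_1 half_s by simp

lemma core_inv: assumes "t \<in> {p 2..p 1}" shows "tent s t \<in> {p 2..p 1}"
proof -
 have "tent s t \<le> p 1" using tent_le_max[of t] p_1 by linarith
 moreover have "p 2 \<le> tent s t"
 proof (cases "t \<le> 1/2")
  case True
  have "p 2 \<le> s * p 2" using s1 p2_pos by simp
  also have "\<dots> \<le> s * t" using assms by (intro mult_left_mono) auto
  finally show ?thesis using True by (simp add: tent_left)
 next
  case False
  have "s * (1 - s/2) \<le> s * (1 - t)" using assms p_1 by (intro mult_left_mono) auto
  thus ?thesis using False p_2 by (simp add: tent_right)
 qed
 ultimately show ?thesis by simp
qed

lemma It_core: "t \<in> {p 2..p 1} \<Longrightarrow> It k t \<in> {p 2..p 1}"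
 by (induction k) (auto simp: It_Suc core_inv simp del: atLeastAtMost_iff)

lemma core_unit: "t \<in> {p 2..p 1} \<Longrightarrow> t \<in> {0..1}" using p2_pos p_1 half_s by auto

lemma right_core: "1/2 \<le> t \<Longrightarrow> t \<le> s/2 \<Longrightarrow> t \<in> {p 2..p 1}" using p2_lt p_1 by auto

lemma nu_side': "side (\<nu> i) (p (Suc i))" using nu_side[of i] unfolding p_def It_def .

lemma nu_mod: "\<nu> (i mod n) = \<nu> i"
proof -
 have "\<nu> (j + k * n) = \<nu> j" for j k
 proof (induction k)
  case (Suc k)
  have "j + Suc k * n = (j + k * n) + n" by simp
  thus ?case using nu_periodic Suc by metis
 qed simp
 from this[of "i mod n" "i div n"] show ?thesis by simp
qed

lemma nu_mod_cong: "i mod n = j mod n \<Longrightarrow> \<nu> i = \<nu> j" by (metis nu_mod)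

lemma nu_0: "\<nu> 0" using nu_side'[of 0] p1_gt by (auto simp: side_def p_1 split: if_splits)

lemma nu_1: "\<not> \<nu> 1" using nu_side'[of 1] p2_lt by (auto simp: side_def p_2 split: if_splits)

text \<open>At generic points the itinerary is unambiguous and each letter is locally constant. All
  but countably many points are generic, so every interval contains some.\<close>

definition generic :: "real \<Rightarrow> bool" where "generic y \<longleftrightarrow> (\<forall>i. It i y \<noteq> 1/2)"

lemma generic_It: "generic y \<Longrightarrow> generic (It k y)"
 unfolding generic_def by (metis It_add)

lemma countable_preimage: "countable A \<Longrightarrow> countable {y. tent s y \<in> A}"
proof -
 assume "countable A"
 have "{y. tent s y \<in> A} \<subseteq> (\<lambda>a. a / s) ` A \<union> (\<lambda>a. 1 - a / s) ` A"
 proof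
  fix y assume y: "y \<in> {y. tent s y \<in> A}"
  show "y \<in> (\<lambda>a. a / s) ` A \<union> (\<lambda>a. 1 - a / s) ` A"
  proof (cases "y \<le> 1/2")
   case True hence "y = tent s y / s" by (simp add: tent_left)
   thus ?thesis using y by blast
  next
   case False hence "y = 1 - tent s y / s" by (simp add: tent_right)
   thus ?thesis using y by blast
  qed
 qed
 thus ?thesis using `countable A` by (meson countable_Un countable_image countable_subset)
qed

lemma countable_nongeneric: "countable {y. \<not> generic y}"
proof -
 have "countable {y. It i y \<in> {1/2}}" for i
 proof (induction i)
  case (Suc i)
  have "{y. It (Suc i) y \<in> {1/2}} = {y. tent s y \<in> {y. It i y \<in> {1/2}}}" by (simp add: It_Suc2)
  thus ?case using countable_preimage[OF Suc] by simp
 next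
  case 0
  have "{y. It 0 y \<in> {1/2}} = {1/2}" by auto
  thus ?case by simp
 qed
 moreover have "{y. \<not> generic y} = (\<Union>i. {y. It i y \<in> {1/2}})" by (auto simp: generic_def)
 ultimately show ?thesis by simp
qed

lemma generic_dense: assumes "a < b" obtains y where "a < y" "y < b" "generic y"
proof -
 have "\<not> {a<..<b} \<subseteq> {y. \<not> generic y}"
  using countable_nongeneric uncountable_open_interval[of a b] assms countable_subset by blast
 thus thesis using that by auto
qed

lemma generic_not_p: "generic y \<Longrightarrow> It i y \<noteq> p j"
proof
 assume g: "generic y" and e: "It i y = p j"
 have "(n - 1) * j + j = n * j" using n_pos by (simp add: algebra_simps)
 hence "It ((n - 1) * j) (p j) = 1/2" using p_half_iff[of "n * j"] It_p by simp
 thus False using g e unfolding generic_def by (metis It_add)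
qed

definition it :: "real \<Rightarrow> nat \<Rightarrow> bool" where "it y i \<longleftrightarrow> 1/2 < It i y"

lemma it_side: "side (it y i) (It i y)" by (auto simp: it_def side_def)

lemma it_It: "it (It i y) j = it y (i + j)" by (simp add: it_def It_add[symmetric] add.commute)

lemma it_ssid: "generic y \<Longrightarrow> ssid (it y i) (It i y)" by (auto simp: it_def ssid_def generic_def less_le)

text \<open>While the letters agree the iterate is monotone, and decreasing iff the number of ones
  so far is odd; at the first difference the larger iterate receives the letter 1.\<close>

lemma itinerary_less:
 assumes "\<And>i. i \<le> k \<Longrightarrow> side (a i) (It i x)" "\<And>i. i \<le> k \<Longrightarrow> side (b i) (It i y)"
  and "\<And>i. i < k \<Longrightarrow> a i = b i" "a k \<noteq> b k" "x < y"
 shows "plex_less_at k a b"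
proof -
 have d: "It k y - It k x = sgnp (onesl a k) * s ^ k * (y - x)"
 proof (rule It_diff)
  fix i assume "i < k"
  thus "side (a i) (It i y)" "side (a i) (It i x)" using assms(1)[of i] assms(2)[of i] assms(3)[of i] by simp_all
 qed
 have pos: "0 < s ^ k * (y - x)" using assms(5) by simp
 have sd: "side (a k) (It k x)" "side (b k) (It k y)" using assms(1)[of k] assms(2)[of k] by simp_all
 show ?thesis
 using d pos sd assms(4) assms(3) by (auto simp: sgnp_parity side_def plex_less_at_def)
qed

lemma itinerary_le:
 assumes "\<And>i. i \<le> k \<Longrightarrow> side (a i) (It i x)" "\<And>i. i \<le> k \<Longrightarrow> side (b i) (It i y)"
  and pl: "plex_less_at k a b"
 shows "x \<le> y"
proof (rule ccontr)
 assume "\<not> x \<le> y"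
 have "a k \<noteq> b k" "\<And>i. i < k \<Longrightarrow> a i = b i" using pl unfolding plex_less_at_def by (auto split: if_splits)
 hence "plex_less_at k b a" using `\<not> x \<le> y` assms by (intro itinerary_less[of k b y a x]) auto
 thus False using pl plex_less_at_asym by blast
qed

section \<open>Admissible one-sided sequences and the points that realize them\<close>

definition Adm :: "bits \<Rightarrow> bool" where
 "Adm a \<longleftrightarrow> (\<forall>N. admissible_word \<nu> (map a [0..<N]))"

lemma Adm_iff: "Adm a \<longleftrightarrow> (\<forall>i k. \<not> plex_less_at k (\<lambda>j. a (i + j)) (\<lambda>j. \<nu> (Suc j)) \<and> \<not> plex_less_at k \<nu> (\<lambda>j. a (i + j)))"
 unfolding Adm_def admissible_word_seq by (metis less_add_Suc1)

lemma Adm_shift: "Adm a \<Longrightarrow> Adm (\<lambda>j. a (i + j))"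
 unfolding Adm_iff by (simp add: add.assoc[symmetric])

text \<open>Every shift is the itinerary of a point strictly between \<open>p 2\<close> and
  \<open>p 1\<close>, and these two bounds have the shift of \<open>\<nu>\<close> and
  \<open>\<nu>\<close> itself as itineraries.\<close>

lemma generic_Adm:
 assumes "generic y" "y \<in> {p 2..p 1}"
 shows "Adm (it y)"
 unfolding Adm_iff
proof (intro allI conjI notI)
 fix i k
 have z: "It i y \<in> {p 2..p 1}" "It i y \<noteq> p 2" "It i y \<noteq> p 1" using It_core[OF assms(2)] generic_not_p[OF assms(1)] by auto
 have sz: "side (it y (i + j)) (It j (It i y))" for j using it_side[of "It i y" j] by (simp add: it_It)
 { assume "plex_less_at k (\<lambda>j. it y (i + j)) (\<lambda>j. \<nu> (Suc j))"
  hence "It i y \<le> p 2"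
   by (rule itinerary_le[rotated 2]) (use sz nu_side' in "auto simp: It_p numeral_2_eq_2")
  thus False using z by auto }
 { assume "plex_less_at k \<nu> (\<lambda>j. it y (i + j))"
  hence "p 1 \<le> It i y"
   by (rule itinerary_le[rotated 2]) (use sz nu_side' in "auto simp: It_p1")
  thus False using z by auto }
qed

text \<open>Two itineraries of \<open>p 1\<close> can differ only where the orbit is at the turning
  point, at indices congruent to \<open>n - 1\<close>. Going back \<open>n - 1\<close> letters from
  the first difference, the shifted sequence follows \<open>\<nu>\<close> and then takes the other
  letter, which by \<open>nu_last\<close> makes it larger than \<open>\<nu>\<close>.\<close>

lemma nu_unique:
 assumes sd: "\<And>i. side (a i) (It i (p 1))" and ad: "\<And>i k. \<not> plex_less_at k \<nu> (\<lambda>j. a (i + j))"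
 shows "a = \<nu>"
proof (rule ccontr)
 assume "a \<noteq> \<nu>"
 then obtain i where i: "\<And>j. j < i \<Longrightarrow> a j = \<nu> j" "a i \<noteq> \<nu> i" by (rule first_difference) blast
 have "It i (p 1) = 1/2" using side_both[OF sd[of i], of "\<nu> i"] nu_side'[of i] i(2) unfolding It_p1 by blast
 hence m: "Suc i mod n = 0" using p_half_iff[of "Suc i"] unfolding It_p1 by blast
 hence "n \<le> Suc i" by (metis mod_less n_pos(1) not_less nat.distinct(1))
 define i0 where "i0 = Suc i - n"
 have i0: "i0 + (n - 1) = i" "i0 mod n = 0" using `n \<le> Suc i` m n_pos unfolding i0_def by (auto simp: le_mod_geq)
 have nu0: "\<nu> (i0 + j) = \<nu> j" for j
  by (rule nu_mod_cong) (metis i0(2) add_0 mod_add_left_eq)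
 have "plex_less_at (n - 1) \<nu> (\<lambda>j. a (i0 + j))"
  unfolding plex_less_at_def using i i0 nu0 nu_last nu0[of "n - 1"] by auto
 thus False using ad by blast
qed

lemma ssid_germ:
 assumes "k \<in> {1, -1}" "0 < c"
 shows "\<exists>r>0. \<forall>e. 0 < e \<longrightarrow> e < r \<longrightarrow> ssid (1/2 < x \<or> (x = 1/2 \<and> k = 1)) (x + k * c * e)"
proof (intro exI conjI allI impI)
 let ?r = "if x = 1/2 then 1 else \<bar>x - 1/2\<bar> / c"
 show "0 < ?r" using assms(2) by auto
 fix e assume "0 < e" "e < ?r"
 hence "0 < c * e" "x = 1/2 \<or> c * e < \<bar>x - 1/2\<bar>"
  using assms(2) by (auto simp: pos_less_divide_eq mult.commute split: if_splits)
 thus "ssid (1/2 < x \<or> (x = 1/2 \<and> k = 1)) (x + k * c * e)" using assms(1) by (auto simp: ssid_def)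
qed

text \<open>An iterate of the tent map is piecewise affine with slopes of modulus
  \<open>s ^ N\<close>, so it is affine on a small interval to each side of a point.\<close>

lemma It_germ:
 assumes "d \<in> {1, -1}"
 shows "\<exists>e0>0. \<exists>k\<in>{1,-1}. \<forall>e\<in>{0<..<e0}. It N (t + d * e) = It N t + k * s ^ N * e"
proof (induction N)
 case 0 thus ?case using assms by (intro exI[of _ 1]) auto
next
 case (Suc N)
 then obtain e0 k where e0: "0 < e0" "k \<in> {1,-1}" "\<And>e. e \<in> {0<..<e0} \<Longrightarrow> It N (t + d * e) = It N t + k * s ^ N * e" by blast
 define x where "x = It N t"
 define up where "up \<longleftrightarrow> 1/2 < x \<or> (x = 1/2 \<and> k = 1)"
 have "0 < s ^ N" by simp
 from ssid_germ[OF e0(2) this, of x] obtain r where r: "0 < r" "\<And>e. 0 < e \<Longrightarrow> e < r \<Longrightarrow> ssid up (x + k * s ^ N * e)"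
  unfolding up_def by blast
 have T: "tent s (x + k * s ^ N * e) = tent s x + (if up then - k else k) * s ^ Suc N * e" if "0 < e" "e < r" for e
  using r(2)[OF that] by (cases up) (auto simp: ssid_def up_def tent_left tent_right algebra_simps)
 show ?case
 proof (intro exI[of _ "min e0 r"] conjI bexI[of _ "if up then - k else k"] ballI)
  show "0 < min e0 r" using e0 r by simp
  show "(if up then - k else k) \<in> {1, -1}" using e0(2) by auto
  fix e assume "e \<in> {0<..<min e0 r}"
  thus "It (Suc N) (t + d * e) = It (Suc N) t + (if up then - k else k) * s ^ Suc N * e"
   using e0(3)[of e] T[of e] by (simp add: It_Suc x_def)
 qed
qed

text \<open>\<open>oit t d\<close> is the limit of the itineraries of \<open>t + d e\<close> for \<open>e\<close> tending to 0 from above.\<close>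

definition oit :: "real \<Rightarrow> real \<Rightarrow> nat \<Rightarrow> bool" where
 "oit t d N \<longleftrightarrow> (\<exists>e0>0. \<forall>e\<in>{0<..<e0}. 1/2 < It N (t + d * e))"

lemma oit_ssid1:
 assumes "d \<in> {1, -1}"
 shows "\<exists>e0>0. \<forall>e\<in>{0<..<e0}. ssid (oit t d N) (It N (t + d * e))"
  and "side (oit t d N) (It N t)"
proof -
 obtain e0 k where e0: "0 < e0" "k \<in> {1,-1}" "\<And>e. e \<in> {0<..<e0} \<Longrightarrow> It N (t + d * e) = It N t + k * s ^ N * e"
  using It_germ[OF assms] by metis
 define x where "x = It N t"
 define up where "up \<longleftrightarrow> 1/2 < x \<or> (x = 1/2 \<and> k = 1)"
 have "0 < s ^ N" by simp
 from ssid_germ[OF e0(2) this, of x] obtain r where r: "0 < r" "\<And>e. 0 < e \<Longrightarrow> e < r \<Longrightarrow> ssid up (x + k * s ^ N * e)"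
  unfolding up_def by blast
 define m where "m = min e0 r"
 have m: "0 < m" using r e0 by (simp add: m_def)
 have ss: "ssid up (It N (t + d * e))" if "e \<in> {0<..<m}" for e
  using e0(3)[of e] r(2)[of e] that by (simp add: x_def m_def)
 have "oit t d N = up"
 proof
  assume "oit t d N"
  then obtain e1 where e1: "0 < e1" "\<And>e. e \<in> {0<..<e1} \<Longrightarrow> 1/2 < It N (t + d * e)" unfolding oit_def by blast
  define e where "e = min e1 m / 2"
  have "e \<in> {0<..<e1}" "e \<in> {0<..<m}" using e1 m by (auto simp: e_def min_def)
  thus up using ss[of e] e1(2)[of e] by (auto simp: ssid_def split: if_splits)
 next
  assume up
  thus "oit t d N" using ss m unfolding oit_def by (auto simp: ssid_def)
 qed
 thus "\<exists>e0>0. \<forall>e\<in>{0<..<e0}. ssid (oit t d N) (It N (t + d * e))" "side (oit t d N) (It N t)"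
  using ss m by (auto simp: side_def up_def x_def)
qed

lemma oit_ssid:
 assumes "d \<in> {1, -1}"
 shows "\<exists>e0>0. \<forall>e\<in>{0<..<e0}. \<forall>i<N. ssid (oit t d i) (It i (t + d * e))"
proof (induction N)
 case 0 thus ?case by (intro exI[of _ 1]) simp
next
 case (Suc N)
 then obtain e1 where "0 < e1" "\<forall>e\<in>{0<..<e1}. \<forall>i<N. ssid (oit t d i) (It i (t + d * e))" by blast
 moreover obtain e2 where "0 < e2" "\<forall>e\<in>{0<..<e2}. ssid (oit t d N) (It N (t + d * e))"
  using oit_ssid1(1)[OF assms] by blast
 ultimately show ?case by (intro exI[of _ "min e1 e2"]) (auto simp: less_Suc_eq)
qed

lemma oit_generic:
 assumes "d \<in> {1, -1}" "0 < e1"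
 obtains e where "0 < e" "e < e1" "generic (t + d * e)" "\<And>i. i < N \<Longrightarrow> it (t + d * e) i = oit t d i"
proof -
 obtain e0 where e0: "0 < e0" "\<forall>e\<in>{0<..<e0}. \<forall>i<N. ssid (oit t d i) (It i (t + d * e))"
  using oit_ssid[OF assms(1)] by blast
 define m where "m = min e0 e1"
 have m: "0 < m" using e0 assms by (simp add: m_def)
 have "\<exists>e. 0 < e \<and> e < m \<and> generic (t + d * e)"
 proof (cases "d = 1")
  case True
  obtain y where "t < y" "y < t + m" "generic y" using generic_dense[of t "t + m"] m by auto
  thus ?thesis using True by (intro exI[of _ "y - t"]) auto
 next
  case False
  obtain y where "t - m < y" "y < t" "generic y" using generic_dense[of "t - m" t] m by auto
  thus ?thesis using False assms(1) by (intro exI[of _ "t - y"]) auto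
 qed
 then obtain e where e: "0 < e" "e < m" "generic (t + d * e)" by blast
 show thesis
 proof (rule that[of e])
  show "i < N \<Longrightarrow> it (t + d * e) i = oit t d i" for i
   using e0(2) e it_side[of "t + d * e" i] ssid_iff[of "oit t d i"] by (auto simp: m_def)
 qed (use e in "auto simp: m_def")
qed

lemma oit_Adm:
 assumes "d \<in> {1, -1}" "0 < e1" "\<And>e. 0 < e \<Longrightarrow> e < e1 \<Longrightarrow> t + d * e \<in> {p 2..p 1}"
 shows "Adm (oit t d)"
 unfolding Adm_def
proof
 fix N
 obtain e where e: "0 < e" "e < e1" "generic (t + d * e)" "\<And>i. i < N \<Longrightarrow> it (t + d * e) i = oit t d i"
  using oit_generic[OF assms(1,2)] by metis
 have eq: "map (oit t d) [0..<N] = map (it (t + d * e)) [0..<N]" using e(4) by auto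
 show "admissible_word \<nu> (map (oit t d) [0..<N])"
  unfolding eq using generic_Adm[OF e(3) assms(3)[OF e(1,2)]] unfolding Adm_def by blast
qed

text \<open>The limit itinerary from below is admissible, so uniqueness makes it
  \<open>\<nu>\<close>, ambiguous letters included. Hence long initial words of \<open>\<nu>\<close>
  are realized by generic points just below \<open>p 1\<close>.\<close>

lemma oit_p1: "oit (p 1) (-1) = \<nu>"
proof (rule nu_unique)
 show "side (oit (p 1) (-1) i) (It i (p 1))" for i using oit_ssid1(2) by simp
 have "p 2 < p 1" using p2_lt p1_gt by simp
 hence "Adm (oit (p 1) (-1))" by (intro oit_Adm[of _ "p 1 - p 2"]) auto
 thus "\<not> plex_less_at k \<nu> (\<lambda>j. oit (p 1) (-1) (i + j))" for i k unfolding Adm_iff by blast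
qed

lemma generic_near_p1:
 obtains y where "generic y" "y \<in> {p 2..p 1}" "\<And>i. i < N \<Longrightarrow> it y i = \<nu> i"
proof -
 have "p 2 < p 1" using p2_lt p1_gt by simp
 then obtain e where e: "0 < e" "e < p 1 - p 2" "generic (p 1 + -1 * e)" "\<And>i. i < N \<Longrightarrow> it (p 1 + -1 * e) i = oit (p 1) (-1) i"
  using oit_generic[of "-1" "p 1 - p 2" "p 1" N] by auto
 show thesis
 proof (rule that[of "p 1 + -1 * e"])
  show "i < N \<Longrightarrow> it (p 1 + -1 * e) i = \<nu> i" for i using e(4) by (simp only: oit_p1)
 qed (use e in auto)
qed

text \<open>Letters are added in front: a point \<open>z\<close> realizing the rest of the word gets
  a preimage on the side of the first letter. The left preimage lies in the core interval only if
  \<open>p 3 \<le> z\<close>. For smaller \<open>z\<close> the lower bound forces the whole word to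
  be an initial word of the shift of \<open>\<nu>\<close>, which is realized near
  \<open>p 2\<close>.\<close>

lemma word_realized:
 "admissible_word \<nu> (map a [0..<N]) \<Longrightarrow> \<exists>y. generic y \<and> y \<in> {p 2..p 1} \<and> (\<forall>i<N. it y i = a i)"
proof (induction N arbitrary: a)
 case 0
 thus ?case using generic_near_p1[of 0] by blast
next
 case (Suc N)
 have lo: "\<not> plex_less_at k (\<lambda>j. a (i + j)) (\<lambda>j. \<nu> (Suc j))" if "i + k < Suc N" for i k
  using Suc.prems that unfolding admissible_word_seq by blast
 have "admissible_word \<nu> (map (\<lambda>j. a (Suc j)) [0..<N])"
  unfolding admissible_word_seq
 proof (intro allI impI)
  fix i k assume "i + k < N"
  thus "\<not> plex_less_at k (\<lambda>j. a (Suc (i + j))) (\<lambda>j. \<nu> (Suc j)) \<and> \<not> plex_less_at k \<nu> (\<lambda>j. a (Suc (i + j)))"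
   using Suc.prems[unfolded admissible_word_seq, rule_format, of "Suc i" k] by simp
 qed
 then obtain z where z: "generic z" "z \<in> {p 2..p 1}" "\<And>i. i < N \<Longrightarrow> it z i = a (Suc i)" using Suc.IH by blast
 have z12: "p 2 < z" "z < p 1" using z(2) generic_not_p[OF z(1), of 0 2] generic_not_p[OF z(1), of 0 1] by auto
 have lift: ?case if y: "tent s y = z" "ssid (a 0) y" "y \<in> {p 2..p 1}" for y
 proof (intro exI[of _ y] conjI allI impI)
  have "It i y \<noteq> 1/2" for i
   using z(1) y(1,2) by (cases i) (auto simp: It_Suc2 generic_def ssid_def split: if_splits)
  thus "generic y" by (simp add: generic_def)
  fix i assume "i < Suc N"
  thus "it y i = a i"
   using z(3) y(1,2) by (cases i) (auto simp: it_def It_Suc2 ssid_def split: if_splits)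
 qed (fact y)
 show ?case
 proof (cases "a 0")
  case True
  have "z / s < 1/2" using z12 p_1 s1 by (simp add: field_simps)
  moreover have "1 - z / s < p 1"
  proof -
   have "1 - s/2 = p 2 / s" unfolding p_2 by simp
   also have "\<dots> < z / s" using z12 by (simp add: divide_strict_right_mono)
   finally show ?thesis unfolding p_1 by simp
  qed
  moreover have "p 2 \<le> 1 - z / s" using `z / s < 1/2` p2_lt by linarith
  ultimately show ?thesis using True
   by (intro lift[of "1 - z / s"]) (auto simp: tent_right ssid_def)
 next
  case False
  show ?thesis
  proof (cases "z < p 3")
   case False2: False
   have "p 3 = s * p 2" using p_Suc[of 2] p2_lt by (simp add: tent_left numeral_3_eq_3 numeral_2_eq_2)
   hence "p 2 \<le> z / s" using False2 by (simp add: field_simps)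
   moreover have "z / s < 1/2" using z12 p_1 s1 by (simp add: field_simps)
   moreover have "z / s \<le> p 1" using `z / s < 1/2` p1_gt by linarith
   ultimately show ?thesis using False by (intro lift[of "z / s"]) (auto simp: tent_left ssid_def)
  next
   case True
   have eq: "a i = \<nu> (Suc i)" if "i < Suc N" for i
   proof (rule ccontr)
    assume ne: "a i \<noteq> \<nu> (Suc i)"
    then obtain k where k: "a k \<noteq> \<nu> (Suc k)" "\<And>j. j < k \<Longrightarrow> a j = \<nu> (Suc j)"
     using exists_least_iff[of "\<lambda>k. a k \<noteq> \<nu> (Suc k)"] by blast
    have ki: "k \<le> i" using k ne by (meson not_le)
    obtain k' where k': "k = Suc k'" using k(1) False nu_1 by (cases k) (auto simp: One_nat_def)
    \<comment> \<open>A deviation would be downwards, because \<open>z < p 3\<close>; after the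
      common first letter 0 the word would violate the lower bound.\<close>
    have "plex_less_at k' (it z) (\<lambda>j. \<nu> (Suc (Suc j)))"
    proof (rule itinerary_less[of _ _ z _ "p 3"])
     show "side (it z i) (It i z)" for i by (rule it_side)
     show "side (\<nu> (Suc (Suc i))) (It i (p 3))" for i using nu_side'[of "Suc (Suc i)"] by (simp add: It_p numeral_3_eq_3)
     show "i < k' \<Longrightarrow> it z i = \<nu> (Suc (Suc i))" for i using k k' z(3)[of i] ki that by auto
     show "it z k' \<noteq> \<nu> (Suc (Suc k'))" using k k' z(3)[of k'] ki that by auto
    qed fact
    moreover have "\<And>j. j \<le> k' \<Longrightarrow> it z j = a (Suc j)" using z(3) k' ki that by auto
    ultimately have pl: "plex_less_at k' (\<lambda>j. a (Suc j)) (\<lambda>j. \<nu> (Suc (Suc j)))"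
     using plex_less_at_cong[of k' "it z" "\<lambda>j. a (Suc j)"] by blast
    have "onesl a (Suc k') = onesl (\<lambda>j. a (Suc j)) k'"
     using False by (simp add: map_upt_Suc del: onesl_Suc)
    hence "plex_less_at k a (\<lambda>j. \<nu> (Suc j))"
     using pl k(2) unfolding plex_less_at_def k' by (simp del: onesl_Suc)
    thus False using lo[of 0 k] ki that by simp
   qed
   obtain y where y: "generic y" "y \<in> {p 2..p 1}" "\<And>i. i < Suc (Suc N) \<Longrightarrow> it y i = \<nu> i"
    using generic_near_p1[of "Suc (Suc N)"] by blast
   have "it (It 1 y) i = a i" if "i < Suc N" for i using eq[OF that] y(3)[of "Suc i"] that by (simp add: it_It One_nat_def)
   thus ?thesis using generic_It[OF y(1)] It_core[OF y(2)] by blast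
  qed
 qed
qed

end

section \<open>Points of the inverse limit by left itinerary and zeroth coordinate\<close>

lemma decseq_finite_range:
 fixes f :: "nat \<Rightarrow> real"
 assumes "decseq f" "\<And>i. f i \<in> P" "finite P"
 obtains M where "\<And>N. M \<le> N \<Longrightarrow> f N = f M"
proof -
 have fin: "finite (range f)" using assms by (meson finite_subset image_subsetI)
 hence "Min (range f) \<in> range f" by (intro Min_in) auto
 then obtain M where M: "Min (range f) = f M" by auto
 have "f N = f M" if "M \<le> N" for N
  using decseqD[OF assms(1) that] Min_le[OF fin, of "f N"] M by auto
 thus thesis using that by blast
qed

lemma finite_separated:
 fixes P :: "real set"
 assumes "finite P"
 obtains d where "0 < d" "\<And>x y. x \<in> P \<Longrightarrow> y \<in> P \<Longrightarrow> x \<noteq> y \<Longrightarrow> d \<le> \<bar>x - y\<bar>"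
proof -
 define D where "D = insert 1 ((\<lambda>(x, y). \<bar>x - y\<bar>) ` {(x, y) \<in> P \<times> P. x \<noteq> y})"
 have "finite {(x, y) \<in> P \<times> P. x \<noteq> y}" by (rule finite_subset[of _ "P \<times> P"]) (use assms in auto)
 hence fin: "finite D" unfolding D_def by simp
 have "Min D \<in> D" using fin by (intro Min_in) (auto simp: D_def)
 hence "0 < Min D" by (auto simp: D_def)
 moreover have "Min D \<le> \<bar>x - y\<bar>" if "x \<in> P" "y \<in> P" "x \<noteq> y" for x y
  using that by (intro Min_le[OF fin]) (auto simp: D_def)
 ultimately show thesis using that by blast
qed

lemma neg_int_obtain: assumes "(i::int) < 0" obtains j where "i = - int j - 1"
 using that[of "nat (- i - 1)"] assms by simp

lemma sgnp_add1 [simp]: "sgnp (k + 1) = - sgnp k" by (simp add: sgnp_def power_add)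

context tent_lhe
begin

text \<open>Backward orbit of \<open>t\<close> along the branches chosen by \<open>l\<close>. For
  fixed \<open>l\<close> it is affine in \<open>t\<close>, whether or not the values lie in the
  range of the tent map.\<close>

primrec lb :: "bits \<Rightarrow> nat \<Rightarrow> real \<Rightarrow> real" where
 "lb l 0 t = t"
| "lb l (Suc j) t = (if l j then 1 - lb l j t / s else lb l j t / s)"

lemma lb_diff: "lb l j t - lb l j t' = sgnp (onesl l j) / s ^ j * (t - t')"
proof (induction j)
 case (Suc j)
 have "lb l (Suc j) t - lb l (Suc j) t' = (if l j then -1 else 1) * (lb l j t - lb l j t') / s"
  by (simp add: diff_divide_distrib)
 also have "\<dots> = sgnp (onesl l (Suc j)) / s ^ Suc j * (t - t')" unfolding Suc.IH by (simp add: mult.commute)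
 finally show ?case .
qed simp

lemma lb_inj: "lb l j t = lb l j t' \<Longrightarrow> t = t'" using lb_diff[of l j t t'] by simp

lemma lb_cong: "(\<And>i. i < j \<Longrightarrow> l i = l' i) \<Longrightarrow> lb l j t = lb l' j t"
 by (induction j) auto

lemma lb_add: "lb l (j + i) t = lb (\<lambda>k. l (j + k)) i (lb l j t)"
 by (induction i) auto

lemma tent_lb: "lb l j t \<le> s/2 \<Longrightarrow> tent s (lb l (Suc j) t) = lb l j t"
 using s1 by (auto simp: tent_right tent_left field_simps)

lemma side_lb: "side (l j) (lb l (Suc j) t) \<longleftrightarrow> lb l j t \<le> s/2"
 using s1 by (auto simp: side_def field_simps)

lemma It_lb:
 assumes "\<And>k. j \<le> k \<Longrightarrow> k < j + i \<Longrightarrow> lb l k t \<le> s/2"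
 shows "It i (lb l (j + i) t) = lb l j t"
 using assms
proof (induction i)
 case (Suc i)
 have "It (Suc i) (lb l (j + Suc i) t) = It i (tent s (lb l (Suc (j + i)) t))" by (simp add: It_Suc2)
 also have "\<dots> = It i (lb l (j + i) t)" using Suc.prems[of "j + i"] tent_lb[of l "j + i" t] by simp
 also have "\<dots> = lb l j t" using Suc by simp
 finally show ?case .
qed simp

lemma lb_nonneg: "0 \<le> t \<Longrightarrow> (\<And>j. j < k \<Longrightarrow> lb l j t \<le> s/2) \<Longrightarrow> 0 \<le> lb l k t"
proof (induction k)
 case (Suc k)
 have "0 \<le> lb l k t" "lb l k t \<le> s/2" using Suc by auto
 thus ?case using s1 by (auto simp: field_simps)
qed simp

lemma lb_between: "t \<le> u \<Longrightarrow> u \<le> t' \<Longrightarrow> lb l j u \<le> max (lb l j t) (lb l j t')"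
proof -
 assume a: "t \<le> u" "u \<le> t'"
 define A where "A = 1 / s ^ j * (u - t)"
 define D where "D = 1 / s ^ j * (t' - u)"
 have "0 \<le> A" "0 \<le> D" unfolding A_def D_def using a by (intro mult_nonneg_nonneg; simp)+
 moreover have "lb l j u - lb l j t = sgnp (onesl l j) * A" "lb l j t' - lb l j u = sgnp (onesl l j) * D"
  unfolding A_def D_def lb_diff by simp_all
 ultimately show ?thesis by (auto simp: sgnp_parity max_def split: if_splits)
qed

lemma lb_continuous: "continuous_on A (lb l j)"
proof -
 define c where "c = lb l j 0"
 define k where "k = sgnp (onesl l j) / s ^ j"
 have eq: "lb l j = (\<lambda>t. c + k * t)"
 proof
  show "lb l j t = c + k * t" for t using lb_diff[of l j t 0] unfolding c_def k_def by simp
 qed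
 show ?thesis unfolding eq by (intro continuous_intros)
qed

lemma lb_close: "\<bar>lb l j t - lb l j t'\<bar> \<le> \<bar>t - t'\<bar>"
proof -
 have "1 \<le> s ^ j" using s1 by simp
 hence "\<bar>t - t'\<bar> / s ^ j \<le> \<bar>t - t'\<bar>" using mult_left_mono[of 1 "s ^ j" "\<bar>t - t'\<bar>"] by (simp add: divide_le_eq)
 thus ?thesis unfolding lb_diff by (simp add: abs_mult)
qed

text \<open>A backward orbit along \<open>l\<close> is genuine iff all coordinates stay below the
  maximum \<open>s/2\<close> of the tent map. Finite \<open>A\<close> give outer approximations; the
  full set of constraints gives the projection of the basic arc.\<close>

definition BB :: "bits \<Rightarrow> nat set \<Rightarrow> real set" where
 "BB l A = {t. 0 \<le> t \<and> (\<forall>j\<in>A. lb l j t \<le> s/2)}"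

definition B :: "bits \<Rightarrow> real set" where "B l = BB l UNIV"

definition H :: "bits \<Rightarrow> bool" where "H l \<longleftrightarrow> (\<exists>t\<in>B l. \<exists>t'\<in>B l. t \<noteq> t')"

lemma B_def2: "t \<in> B l \<longleftrightarrow> 0 \<le> t \<and> (\<forall>j. lb l j t \<le> s/2)" by (simp add: B_def BB_def)

lemma BB_mono: "A \<subseteq> A' \<Longrightarrow> BB l A' \<subseteq> BB l A" by (auto simp: BB_def)

lemma BB_convex: "t \<in> BB l A \<Longrightarrow> t' \<in> BB l A \<Longrightarrow> t \<le> u \<Longrightarrow> u \<le> t' \<Longrightarrow> u \<in> BB l A"
proof -
 assume a: "t \<in> BB l A" "t' \<in> BB l A" "t \<le> u" "u \<le> t'"
 have "lb l j u \<le> s/2" if "j \<in> A" for j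
 proof -
  have "lb l j t \<le> s/2" "lb l j t' \<le> s/2" using a(1,2) that by (simp_all add: BB_def)
  hence "max (lb l j t) (lb l j t') \<le> s/2" by simp
  thus ?thesis using lb_between[OF a(3,4), of l j] by linarith
 qed
 thus ?thesis using a unfolding BB_def by simp
qed

lemma BB_compact: assumes "0 \<in> A" shows "compact (BB l A)"
proof -
 have "BB l A = {0..s/2} \<inter> (\<Inter>j\<in>A. {t. lb l j t \<le> s/2})" using assms by (auto simp: BB_def)
 moreover have "closed (\<Inter>j\<in>A. {t. lb l j t \<le> s/2})"
  by (intro closed_INT ballI closed_Collect_le lb_continuous continuous_on_const)
 ultimately show ?thesis by (simp add: compact_Int_closed)
qed

text \<open>The orbit of the turning point; 0 is added because of the bound \<open>0 \<le> t\<close>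
  in \<open>BB\<close>.\<close>

definition P :: "real set" where "P = insert 0 (p ` {..<n})"

lemma finite_P: "finite P" by (simp add: P_def)

lemma p_in_P: "p i \<in> P" using p_mod[of i] n_pos unfolding P_def by (metis image_eqI insertCI lessThan_iff mod_less_divisor)

text \<open>The constraint is tight at \<open>j\<close> if the coordinate there is
  \<open>p 1\<close>. The coordinates with smaller index are then iterates of the turning
  point.\<close>

lemma tight_p:
 assumes "lb l j t = s/2" "\<And>k. k < j \<Longrightarrow> lb l k t \<le> s/2"
 shows "t = p (Suc j)"
proof -
 have "It j (lb l (0 + j) t) = lb l 0 t" by (rule It_lb) (use assms in auto)
 hence "t = It j (p 1)" using assms(1) unfolding p_1(1) by simp
 thus ?thesis unfolding It_p1 .
qed

lemma tight_min_index:
 assumes "lb l j t = s/2"  "\<And>k. k \<in> A \<Longrightarrow> lb l k t \<le> s/2" "{..j} \<subseteq> A"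
 shows "t \<in> P"
 using tight_p[OF assms(1)] assms(2,3) p_in_P by (metis atMost_iff less_imp_le subsetD)

text \<open>Where none of the finitely many constraints is tight, the point can be moved a little in
  both directions, since \<open>lb l j\<close> does not increase distances. So an end is caused by a
  tight constraint or by the bound 0.\<close>

lemma BN_max:
 assumes "BB l {..N} \<noteq> {}"
 shows "Sup (BB l {..N}) \<in> BB l {..N}" "\<exists>j\<le>N. lb l j (Sup (BB l {..N})) = s/2"
  "Inf (BB l {..N}) \<in> BB l {..N}" "Inf (BB l {..N}) = 0 \<or> (\<exists>j\<le>N. lb l j (Inf (BB l {..N})) = s/2)"
proof -
 let ?S = "BB l {..N}"
 have c: "compact ?S" by (rule BB_compact) simp
 hence bd: "bdd_above ?S" "bdd_below ?S" "closed ?S"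
  by (auto simp: compact_imp_closed compact_imp_bounded bounded_imp_bdd_above bounded_imp_bdd_below)
 show sup: "Sup ?S \<in> ?S" and inf: "Inf ?S \<in> ?S"
  using closed_contains_Sup[OF assms bd(1,3)] closed_contains_Inf[OF assms bd(2,3)] by auto
 have mem: "t \<in> ?S \<longleftrightarrow> 0 \<le> t \<and> (\<forall>j\<le>N. lb l j t \<le> s/2)" for t by (auto simp: BB_def)
 have room: "\<exists>e>0. \<forall>u. \<bar>u - t\<bar> < e \<and> 0 \<le> u \<longrightarrow> u \<in> ?S" if t: "t \<in> ?S" "\<not> (\<exists>j\<le>N. lb l j t = s/2)" for t
 proof -
  define e where "e = Min ((\<lambda>j. s/2 - lb l j t) ` {..N})"
  have "lb l j t < s/2" if "j \<le> N" for j using t that unfolding mem by (metis less_le)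
  hence "0 < e" unfolding e_def by (subst Min_gr_iff) auto
  moreover have "lb l j u \<le> s/2" if "\<bar>u - t\<bar> < e" "j \<le> N" for u j
  proof -
   have "e \<le> s/2 - lb l j t" unfolding e_def using `j \<le> N` by (intro Min_le) auto
   thus ?thesis using lb_close[of l j u t] `\<bar>u - t\<bar> < e` by linarith
  qed
  ultimately show ?thesis unfolding mem by blast
 qed
 show "\<exists>j\<le>N. lb l j (Sup ?S) = s/2"
 proof (rule ccontr)
  assume "\<not> ?thesis"
  from room[OF sup this] obtain e where e: "0 < e" "\<And>u. \<bar>u - Sup ?S\<bar> < e \<Longrightarrow> 0 \<le> u \<Longrightarrow> u \<in> ?S" by metis
  have "0 \<le> Sup ?S" using sup mem by blast
  hence "Sup ?S + e/2 \<in> ?S" using e by simp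
  thus False using cSup_upper[OF _ bd(1)] e(1) by fastforce
 qed
 show "Inf ?S = 0 \<or> (\<exists>j\<le>N. lb l j (Inf ?S) = s/2)"
 proof (rule ccontr)
  assume a: "\<not> ?thesis"
  then obtain e where e: "0 < e" "\<And>u. \<bar>u - Inf ?S\<bar> < e \<Longrightarrow> 0 \<le> u \<Longrightarrow> u \<in> ?S" using room[OF inf] by metis
  define d where "d = min e (Inf ?S) / 2"
  have "0 < Inf ?S" using a inf mem by (metis less_le)
  hence d: "0 < d" "d < e" "d < Inf ?S" using e(1) by (auto simp: d_def min_def)
  hence "Inf ?S - d \<in> ?S" using e(2) by simp
  thus False using cInf_lower[OF _ bd(2)] d(1) by fastforce
 qed
qed

lemma BN_ends_P:
 assumes "BB l {..N} \<noteq> {}"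
 shows "Sup (BB l {..N}) \<in> P" "Inf (BB l {..N}) \<in> P"
proof -
 obtain j where "j \<le> N" "lb l j (Sup (BB l {..N})) = s/2" using BN_max(2)[OF assms] by blast
 thus "Sup (BB l {..N}) \<in> P"
  using BN_max(1)[OF assms] by (intro tight_min_index[of l j _ "{..N}"]) (auto simp: BB_def)
 show "Inf (BB l {..N}) \<in> P"
 proof (cases "Inf (BB l {..N}) = 0")
  case False
  then obtain j where "j \<le> N" "lb l j (Inf (BB l {..N})) = s/2" using BN_max(4)[OF assms] by blast
  thus ?thesis using BN_max(3)[OF assms] by (intro tight_min_index[of l j _ "{..N}"]) (auto simp: BB_def)
 qed (simp add: P_def)
qed

lemma B_Int: "t \<in> B l \<longleftrightarrow> (\<forall>N. t \<in> BB l {..N})" by (auto simp: B_def BB_def)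

text \<open>The endpoints of the finite approximations lie in a finite set, so they stabilise.\<close>

lemma BN_stable:
 assumes ne: "\<And>N. BB l {..N} \<noteq> {}"
 obtains M where "\<And>N. M \<le> N \<Longrightarrow> Sup (BB l {..N}) = Sup (BB l {..M})" "\<And>N. M \<le> N \<Longrightarrow> Inf (BB l {..N}) = Inf (BB l {..M})"
  "Sup (BB l {..M}) \<in> B l" "Inf (BB l {..M}) \<in> B l" "B l \<subseteq> {Inf (BB l {..M})..Sup (BB l {..M})}"
proof -
 let ?S = "\<lambda>N. BB l {..N}"
 have c: "compact (?S N)" for N by (rule BB_compact) simp
 hence bd: "bdd_above (?S N)" "bdd_below (?S N)" for N
  by (auto simp: compact_imp_closed compact_imp_bounded bounded_imp_bdd_above bounded_imp_bdd_below)
 have mono: "N \<le> N' \<Longrightarrow> ?S N' \<subseteq> ?S N" for N N' by (rule BB_mono) auto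
 have d1: "decseq (\<lambda>N. Sup (?S N))" unfolding decseq_def by (auto intro!: cSup_subset_mono ne bd mono)
 have d2: "decseq (\<lambda>N. - Inf (?S N))" unfolding decseq_def by (auto intro!: cInf_superset_mono ne bd mono)
 obtain M1 where M1: "\<And>N. M1 \<le> N \<Longrightarrow> Sup (?S N) = Sup (?S M1)"
  by (rule decseq_finite_range[OF d1, of P]) (use BN_ends_P ne finite_P in auto)
 obtain M2 where M2: "\<And>N. M2 \<le> N \<Longrightarrow> - Inf (?S N) = - Inf (?S M2)"
  by (rule decseq_finite_range[OF d2, of "uminus ` P"]) (use BN_ends_P ne finite_P in auto)
 define M where "M = max M1 M2"
 show thesis
 proof (rule that[of M])
  show s: "Sup (?S N) = Sup (?S M)" if "M \<le> N" for N using M1[of N] M1[of M] that by (simp add: M_def)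
  show i: "Inf (?S N) = Inf (?S M)" if "M \<le> N" for N using M2[of N] M2[of M] that by (simp add: M_def)
  show "Sup (?S M) \<in> B l" unfolding B_Int
  proof
   fix N
   have "Sup (?S (max M N)) \<in> ?S (max M N)" using BN_max(1)[OF ne] .
   thus "Sup (?S M) \<in> ?S N" using s[of "max M N"] mono[of N "max M N"] by auto
  qed
  show "Inf (?S M) \<in> B l" unfolding B_Int
  proof
   fix N
   have "Inf (?S (max M N)) \<in> ?S (max M N)" using BN_max(3)[OF ne] .
   thus "Inf (?S M) \<in> ?S N" using i[of "max M N"] mono[of N "max M N"] by auto
  qed
  show "B l \<subseteq> {Inf (?S M)..Sup (?S M)}" using cSup_upper[OF _ bd(1)] cInf_lower[OF _ bd(2)] by (auto simp: B_Int)
 qed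
qed

text \<open>The ends of the approximations are eventually constant, so nondegeneracy passes to the
  limit.\<close>

lemma H_if_approx:
 assumes two: "\<And>N. \<exists>t\<in>BB l {..N}. \<exists>t'\<in>BB l {..N}. t \<noteq> t'"
 shows "H l"
proof -
 have ne: "BB l {..N} \<noteq> {}" for N using two by blast
 obtain M where M: "Sup (BB l {..M}) \<in> B l" "Inf (BB l {..M}) \<in> B l" using BN_stable[OF ne] by metis
 have c: "compact (BB l {..M})" by (rule BB_compact) simp
 hence bd: "bdd_above (BB l {..M})" "bdd_below (BB l {..M})"
  by (auto simp: compact_imp_bounded bounded_imp_bdd_above bounded_imp_bdd_below)
 obtain t t' where tt: "t \<in> BB l {..M}" "t' \<in> BB l {..M}" "t \<noteq> t'" using two[of M] by (elim bexE)
 hence "Inf (BB l {..M}) < Sup (BB l {..M})"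
  using cSup_upper[OF tt(1) bd(1)] cSup_upper[OF tt(2) bd(1)] cInf_lower[OF tt(1) bd(2)] cInf_lower[OF tt(2) bd(2)]
  by linarith
 hence "Sup (BB l {..M}) \<noteq> Inf (BB l {..M})" by simp
 thus ?thesis unfolding H_def by (rule bexI[OF bexI[OF _ M(2)] M(1)])
qed

definition hi :: "bits \<Rightarrow> real" where "hi l = Sup (B l)"
definition lo :: "bits \<Rightarrow> real" where "lo l = Inf (B l)"

lemma B_ends:
 assumes "H l"
 shows "B l = {lo l..hi l}" "lo l < hi l" "\<exists>j. lb l j (hi l) = s/2" "lo l = 0 \<or> (\<exists>j. lb l j (lo l) = s/2)"
  "lo l \<in> P" "hi l \<in> P"
proof -
 have ne: "BB l {..N} \<noteq> {}" for N
 proof -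
  obtain t where "t \<in> B l" using assms unfolding H_def by blast
  hence "t \<in> BB l {..N}" by (simp add: B_Int)
  thus ?thesis by blast
 qed
 obtain M where M: "Sup (BB l {..M}) \<in> B l" "Inf (BB l {..M}) \<in> B l" "B l \<subseteq> {Inf (BB l {..M})..Sup (BB l {..M})}"
  using BN_stable[OF ne] by metis
 have "hi l = Sup (BB l {..M})" unfolding hi_def using M by (intro cSup_eq_maximum) auto
 moreover have "lo l = Inf (BB l {..M})" unfolding lo_def using M by (intro cInf_eq_minimum) auto
 ultimately have M': "hi l \<in> B l" "lo l \<in> B l" "B l \<subseteq> {lo l..hi l}" "hi l = Sup (BB l {..M})" "lo l = Inf (BB l {..M})" using M by auto
 show "B l = {lo l..hi l}"
  using M'(1-3) BB_convex[of "lo l" l UNIV "hi l"] unfolding B_def[symmetric] by (auto simp del: B_def2)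
 thus "lo l < hi l" using assms unfolding H_def by (metis atLeastAtMost_iff antisym linorder_not_le order.trans)
 show "\<exists>j. lb l j (hi l) = s/2" "lo l = 0 \<or> (\<exists>j. lb l j (lo l) = s/2)"
  using BN_max(2,4)[OF ne, of M] M'(4,5) by auto
 show "lo l \<in> P" "hi l \<in> P" using BN_ends_P[OF ne, of M] M' by auto
qed

lemma H_ends_in: "H l \<Longrightarrow> lo l \<in> B l" "H l \<Longrightarrow> hi l \<in> B l" using B_ends[of l] by auto

lemma lb_interior:
 assumes "H l" "lo l < t" "t < hi l" shows "lb l j t < s/2"
proof -
 have "lo l \<in> B l" "hi l \<in> B l" "t \<in> B l" using B_ends[OF assms(1)] assms(2,3) by auto
 hence le: "lb l j (lo l) \<le> s/2" "lb l j (hi l) \<le> s/2" "lb l j t \<le> s/2" by (auto simp: B_def2)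
 define A where "A = 1 / s ^ j * (t - lo l)"
 define D where "D = 1 / s ^ j * (hi l - t)"
 have "0 < A" "0 < D" unfolding A_def D_def using assms(2,3) by auto
 moreover have "lb l j t - lb l j (lo l) = sgnp (onesl l j) * A" "lb l j (hi l) - lb l j t = sgnp (onesl l j) * D"
  unfolding A_def D_def lb_diff by simp_all
 ultimately have "lb l j t < lb l j (hi l) \<or> lb l j t < lb l j (lo l)" by (auto simp: sgnp_parity split: if_splits)
 thus ?thesis using le by auto
qed

definition pt :: "bits \<Rightarrow> real \<Rightarrow> nat \<Rightarrow> real" where "pt l t = (\<lambda>j. lb l j t)"

lemma pt_0 [simp]: "pt l t 0 = t" by (simp add: pt_def)

lemma pt_inv_lim: assumes "t \<in> B l" shows "pt l t \<in> inv_lim s"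
proof -
 have t: "0 \<le> t" "\<And>j. lb l j t \<le> s/2" using assms by (auto simp: B_def2)
 have "lb l j t \<in> {0..1}" for j using lb_nonneg[OF t(1), of j l] t(2) half_s order_trans[OF t(2)[of j]] by auto
 thus ?thesis unfolding inv_lim_def pt_def using tent_lb t(2) by auto
qed

lemma inv_lim_le: "x \<in> inv_lim s \<Longrightarrow> x j \<le> s/2" "x \<in> inv_lim s \<Longrightarrow> 0 \<le> x j"
 unfolding inv_lim_def using tent_le_max by (metis (mono_tags, lifting) mem_Collect_eq, auto)

lemma inv_lim_pt:
 assumes x: "x \<in> inv_lim s" and sd: "\<And>j. side (l j) (x (Suc j))"
 shows "x = pt l (x 0)" "x 0 \<in> B l"
proof -
 have T: "tent s (x (Suc j)) = x j" for j using x by (simp add: inv_lim_def)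
 have step: "x (Suc j) = (if l j then 1 - x j / s else x j / s)" for j
 proof (cases "l j")
  case True
  hence "x j = s * (1 - x (Suc j))" using sd[of j] T[of j] by (simp add: side_def tent_right)
  thus ?thesis using True by (simp add: field_simps)
 next
  case False
  hence "x j = s * x (Suc j)" using sd[of j] T[of j] by (simp add: side_def tent_left)
  thus ?thesis using False by simp
 qed
 have xj: "x j = lb l j (x 0)" for j by (induction j) (auto simp: step)
 show "x = pt l (x 0)"
 proof
  show "x j = pt l (x 0) j" for j unfolding pt_def by (rule xj)
 qed
 show "x 0 \<in> B l" unfolding B_def2 using inv_lim_le[OF x] xj by metis
qed

section \<open>Two-sided sequences and the shape of basic arcs\<close>

lemma coord_neg: "coord s x (- int j) = x j" "coord s x (- int j - 1) = x (Suc j)"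
proof -
 have 1: "nat (- (- int j - 1)) = Suc j" "- int j - 1 \<le> 0" by linarith+
 have 2: "nat (- (- int j)) = j" "- int j \<le> 0" by simp_all
 show "coord s x (- int j) = x j" unfolding coord_def if_P[OF 2(2)] 2(1) ..
 show "coord s x (- int j - 1) = x (Suc j)" unfolding coord_def if_P[OF 1(2)] 1(1) ..
qed

lemma coord_pos: "coord s x (int k) = It k (x 0)"
proof (cases k)
 case (Suc j)
 hence "nat (int k) = k" "\<not> int k \<le> 0" by simp_all
 thus ?thesis unfolding coord_def It_def by simp
qed (simp add: coord_def)

lemma coord_step: assumes "x \<in> inv_lim s" shows "coord s x (i + 1) = tent s (coord s x i)"
proof (cases "0 \<le> i")
 case True
 then obtain k where k: "i = int k" using nonneg_int_cases by blast
 thus ?thesis using coord_pos[of x "Suc k"] coord_pos[of x k] by (simp add: It_Suc add.commute)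
next
 case False
 hence "i < 0" by simp
 then obtain k where k: "i = - int k - 1" by (rule neg_int_obtain)
 thus ?thesis using coord_neg[of x k] assms by (simp add: inv_lim_def)
qed

lemma coord_It: assumes "x \<in> inv_lim s" shows "coord s x (i + int k) = It k (coord s x i)"
proof (induction k)
 case (Suc k)
 have "coord s x (i + int (Suc k)) = coord s x ((i + int k) + 1)" by (simp add: algebra_simps)
 thus ?case using coord_step[OF assms] Suc by (simp add: It_Suc)
qed simp

lemma coord_le: "x \<in> inv_lim s \<Longrightarrow> coord s x i \<le> s/2" "x \<in> inv_lim s \<Longrightarrow> coord s x i \<in> {0..1}"
proof -
 assume x: "x \<in> inv_lim s"
 have "coord s x i = tent s (coord s x (i - 1))" using coord_step[OF x, of "i - 1"] by simp
 thus "coord s x i \<le> s/2" using tent_le_max by simp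
 show "coord s x i \<in> {0..1}"
 proof (cases "0 \<le> i")
  case True
  have "x 0 \<in> {0..1}" using x by (simp add: inv_lim_def)
  thus ?thesis using coord_pos[of x "nat i"] True It_unit by auto
 next
  case False
  thus ?thesis using x by (auto simp: coord_def inv_lim_def)
 qed
qed

lemma represents_iff: "represents s a x \<longleftrightarrow> x \<in> inv_lim s \<and> admissible \<nu> a \<and> (\<forall>i. side (a i) (coord s x i))"
 by (auto simp: represents_def side_def nu_kneading)

lemma left_part_side:
 assumes "\<And>i. side (a i) (coord s x i)" shows "side (left_part a j) (x (Suc j))"
 using assms[of "- int j - 1"] by (simp add: left_part_def coord_neg)

lemma represents_left:
 assumes "represents s a x" shows "x = pt (left_part a) (x 0)" "x 0 \<in> B (left_part a)"
 using assms inv_lim_pt[of x "left_part a"] left_part_side[of a x] by (auto simp: represents_iff)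

lemma subword_seq: "subword a i N = map (\<lambda>j. a (i + int j)) [0..<N]" by (simp add: subword_def)

lemma lb_It:
 assumes "\<And>i. i < k \<Longrightarrow> side (l (k - 1 - i)) (It i y)"
 shows "j \<le> k \<Longrightarrow> lb l j (It k y) = It (k - j) y"
proof (induction j)
 case (Suc j)
 hence IH: "lb l j (It k y) = It (k - j) y" by simp
 obtain i where i: "k - j = Suc i" "i = k - Suc j" using Suc.prems by (metis Suc_diff_Suc Suc_le_lessD)
 have "side (l j) (It i y)" using assms[of i] i Suc.prems by simp
 thus ?case unfolding lb.simps IH i(1) It_Suc i(2)[symmetric]
  by (auto simp: side_def tent_left tent_right)
qed simp

lemma BB_two_if_strict:
 assumes "0 < t" "\<And>j. j \<le> N \<Longrightarrow> lb l j t < s/2"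
 shows "\<exists>t\<in>BB l {..N}. \<exists>t'\<in>BB l {..N}. t \<noteq> t'"
proof -
 have tin: "t \<in> BB l {..N}" using assms unfolding BB_def by (auto intro: less_imp_le)
 hence ne: "BB l {..N} \<noteq> {}" by blast
 have "Sup (BB l {..N}) \<noteq> t" using BN_max(2)[OF ne] assms(2) by fastforce
 thus ?thesis using BN_max(1)[OF ne] tin by metis
qed

lemma H_zero: "H (\<lambda>_. False)" "B (\<lambda>_. False) = {0..s/2}"
proof -
 have lz: "lb (\<lambda>_. False) j t = t / s ^ j" for j t by (induction j) auto
 have "t / s ^ j \<le> s/2" if "0 \<le> t" "t \<le> s/2" for t j
 proof -
  have "1 \<le> s ^ j" using s1 by simp
  hence "t / s ^ j \<le> t" using that mult_left_mono[of 1 "s ^ j" t] by (simp add: divide_le_eq)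
  thus ?thesis using that by linarith
 qed
 hence "t \<in> B (\<lambda>_. False)" if "0 \<le> t" "t \<le> s/2" for t using that unfolding B_def2 lz by auto
 moreover have "t \<le> s/2" "0 \<le> t" if "t \<in> B (\<lambda>_. False)" for t using that unfolding B_def2 by (auto dest: spec[of _ 0])
 ultimately show e: "B (\<lambda>_. False) = {0..s/2}" by auto
 show "H (\<lambda>_. False)" unfolding H_def e using s0 by (intro bexI[of _ 0] bexI[of _ "s/2"]) auto
qed

lemma H_if_words:
 assumes w: "\<And>N. admissible_word \<nu> (map (\<lambda>j. l (N - 1 - j)) [0..<N])"
 shows "H l"
proof (rule H_if_approx)
 fix N
 obtain y where y: "generic y" "y \<in> {p 2..p 1}" "\<And>i. i < Suc N \<Longrightarrow> it y i = l (N - i)"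
  using word_realized[OF w[of "Suc N"]] by auto
 have lbe: "lb l j (It (Suc N) y) = It (Suc N - j) y" if "j \<le> Suc N" for j
 proof (rule lb_It)
  show "side (l (Suc N - 1 - i)) (It i y)" if "i < Suc N" for i using y(3)[OF that] it_side[of y i] by simp
 qed fact
 have "It (Suc N - j) y < s/2" for j
  using It_core[OF y(2), of "Suc N - j"] generic_not_p[OF y(1), of "Suc N - j" 1] p_1 by auto
 hence "lb l j (It (Suc N) y) < s/2" if "j \<le> N" for j using lbe[of j] that by simp
 moreover have "0 < It (Suc N) y" using It_core[OF y(2), of "Suc N"] p2_pos by auto
 ultimately show "\<exists>t\<in>BB l {..N}. \<exists>t'\<in>BB l {..N}. t \<noteq> t'" by (intro BB_two_if_strict)
qed

text \<open>Basic arcs are never single points: the words of the sequence are realized by generic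
  points, at which no constraint is tight, so every approximation is a proper interval. Leading
  zeros are harmless, since going back along them only shrinks the coordinate.\<close>

lemma represents_H:
 assumes "represents s a x" shows "H (left_part a)"
proof -
 let ?l = "left_part a"
 have ad: "admissible \<nu> a" using assms by (simp add: represents_iff)
 have sw: "subword a (- int N) N = map (\<lambda>j. ?l (N - 1 - j)) [0..<N]" for N
  by (auto simp: subword_seq left_part_def of_nat_diff intro!: arg_cong[where f = a])
 consider "\<And>i N. admissible_word \<nu> (subword a i N)"
  | k where "\<And>i. i < k \<Longrightarrow> \<not> a i" "a k" "\<And>i N. k \<le> i \<Longrightarrow> admissible_word \<nu> (subword a i N)"
  | "\<And>i. \<not> a i" using ad unfolding admissible_def by metis
 thus ?thesis
 proof cases
  case 1
  thus ?thesis using sw by (intro H_if_words) metis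
 next
  case 3
  hence "?l = (\<lambda>_. False)" by (auto simp: left_part_def)
  thus ?thesis using H_zero by simp
 next
  case (2 k)
  show ?thesis
  proof (cases "0 \<le> k")
   case True
   hence "?l = (\<lambda>_. False)" using 2(1) by (auto simp: left_part_def)
   thus ?thesis using H_zero by simp
  next
   case False
   define K where "K = nat (- k)"
   have K: "k = - int K" "0 < K" using False by (auto simp: K_def)
   have lz: "\<not> ?l j" if "K \<le> j" for j using 2(1)[of "- int j - 1"] that K by (auto simp: left_part_def)
   obtain y where y: "generic y" "y \<in> {p 2..p 1}" "\<And>i. i < K \<Longrightarrow> it y i = ?l (K - 1 - i)"
    using word_realized[of "\<lambda>j. ?l (K - 1 - j)" K] 2(3)[of k K] sw[of K] K by auto
   define t where "t = It K y"
   have lbe: "lb ?l j t = It (K - j) y" if "j \<le> K" for j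
    unfolding t_def
   proof (rule lb_It)
    show "side (?l (K - 1 - i)) (It i y)" if "i < K" for i using y(3)[OF that] it_side[of y i] by simp
   qed fact
   have lt: "It i y < s/2" for i
    using It_core[OF y(2), of i] generic_not_p[OF y(1), of i 1] p_1 by auto
   have "lb ?l j t < s/2" for j
   proof (cases "j \<le> K")
    case True thus ?thesis using lbe lt by simp
   next
    case F: False
    have z: "lb (\<lambda>k. ?l (K + k)) i y = y / s ^ i" for i by (induction i) (auto simp: lz)
    have "lb ?l j t = lb (\<lambda>k. ?l (K + k)) (j - K) (lb ?l K t)" using lb_add[of ?l K "j - K" t] F by simp
    hence "lb ?l j t = y / s ^ (j - K)" using lbe[of K] z by simp
    moreover have "y / s ^ (j - K) \<le> y"
    using s1 y(2) p2_pos mult_left_mono by (auto simp: divide_le_eq)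
    ultimately show ?thesis using lt[of 0] unfolding It_0 by linarith
   qed
   moreover have "0 < t" using It_core[OF y(2), of K] p2_pos by (auto simp: t_def)
   ultimately show ?thesis by (intro H_if_approx BB_two_if_strict)
  qed
 qed
qed

text \<open>The right part is the limit of the itineraries of points of \<open>B l\<close> that
  approach \<open>t\<close> from inside. A word of the sequence that starts at or after a 1 is a
  word of the unambiguous itinerary of such a generic point, hence admissible.\<close>

lemma representative_exists:
 assumes Hl: "H l" and t: "t \<in> B l"
 obtains a where "represents s a (pt l t)" "left_part a = l"
proof -
 \<comment> \<open>The direction from \<open>t\<close> into \<open>B l\<close>: upwards unless
   \<open>t\<close> is the upper end.\<close>
 define d where "d = (if t < hi l then 1 else -1 :: real)"
 define e1 where "e1 = (if t < hi l then hi l - t else t - lo l)"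
 have d: "d \<in> {1, -1}" and e1: "0 < e1" using B_ends[OF Hl] t by (auto simp: d_def e1_def)
 have int: "lo l < t + d * e" "t + d * e < hi l" if "0 < e" "e < e1" for e
  using that B_ends[OF Hl] t by (auto simp: d_def e1_def split: if_splits)
 define tw where "tw r i = (if i < 0 then l (nat (- i - 1)) else r (nat i))" for r :: bits and i :: int
 define a where "a = tw (oit t d)"
 define x where "x = pt l t"
 have lp: "left_part (tw r) = l" for r unfolding tw_def left_part_def by auto
 have x: "x \<in> inv_lim s" unfolding x_def by (rule pt_inv_lim[OF t])
 have sd: "side (a i) (coord s x i)" for i
 proof (cases "i < 0")
  case True
  then obtain j where j: "i = - int j - 1" by (auto elim: neg_int_obtain)
  have "side (l j) (lb l (Suc j) t)" using side_lb[of l j t] t by (simp add: B_def2)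
  thus ?thesis unfolding a_def tw_def j coord_neg x_def pt_def by simp
 next
  case False
  hence "coord s x i = It (nat i) t" using coord_pos[of x "nat i"] by (simp add: x_def)
  thus ?thesis using oit_ssid1(2)[OF d, of t "nat i"] False by (simp add: a_def tw_def)
 qed
 have adm: "admissible_word \<nu> (subword a i N)" if k: "a k" "k \<le> i" for k i N
 proof -
  define M where "M = nat (\<bar>k\<bar> + \<bar>i\<bar> + int N + 1)"
  obtain e where e: "0 < e" "e < e1" "generic (t + d * e)" "\<And>i. i < M \<Longrightarrow> it (t + d * e) i = oit t d i"
   using oit_generic[OF d e1] by metis
  define t' where "t' = t + d * e"
  define x' where "x' = pt l t'"
  define a' where "a' = tw (it t')"
  have t': "lo l < t'" "t' < hi l" using int[OF e(1,2)] by (auto simp: t'_def)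
  hence t'B: "t' \<in> B l" using B_ends[OF Hl] by auto
  have x': "x' \<in> inv_lim s" unfolding x'_def by (rule pt_inv_lim[OF t'B])
  have aa: "a' j = a j" if "\<bar>j\<bar> < int M" for j
   using that e(4)[of "nat j"] unfolding a'_def a_def tw_def t'_def by auto
  have sd': "side (a' i) (coord s x' i) \<and> coord s x' i \<noteq> 1/2" for i
  proof (cases "i < 0")
   case True
   then obtain j where j: "i = - int j - 1" by (auto elim: neg_int_obtain)
   have lt: "lb l j t' < s/2" by (rule lb_interior[OF Hl t'])
   have "side (l j) (lb l (Suc j) t')" using side_lb[of l j t'] lt by simp
   moreover have "lb l (Suc j) t' \<noteq> 1/2"
    using tent_lb[of l j t'] lt tent_half by auto
   ultimately show ?thesis unfolding a'_def tw_def j coord_neg x'_def pt_def by simp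
  next
   case False
   hence "coord s x' i = It (nat i) t'" using coord_pos[of x' "nat i"] by (simp add: x'_def)
   thus ?thesis using it_side[of t' "nat i"] False e(3) by (auto simp: a'_def tw_def t'_def generic_def)
  qed
  have gen: "generic (coord s x' i)" for i
   unfolding generic_def using sd' coord_It[OF x'] by metis
  \<comment> \<open>A coordinate with letter 1 lies in the right half and thus in the core interval,
    where all later coordinates remain.\<close>
  have "a' k" using aa[of k] k(1) by (simp add: M_def)
  hence "coord s x' k \<in> {p 2..p 1}"
   using sd'[of k] coord_le(1)[OF x', of k] by (intro right_core) (auto simp: side_def)
  hence core: "coord s x' i \<in> {p 2..p 1}" using coord_It[OF x', of k "nat (i - k)"] It_core k(2) by simp
  have "subword a i N = map (it (coord s x' i)) [0..<N]"
   unfolding subword_seq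
  proof (intro map_cong refl)
   fix j assume "j \<in> set [0..<N]"
   hence "a (i + int j) = a' (i + int j)" using aa[of "i + int j"] by (auto simp: M_def)
   also have "\<dots> = it (coord s x' i) j"
    using sd'[of "i + int j"] coord_It[OF x', of i j] by (auto simp: it_def side_def split: if_splits)
   finally show "a (i + int j) = it (coord s x' i) j" .
  qed
  thus ?thesis using generic_Adm[OF gen core] unfolding Adm_def by simp
 qed
 have "admissible \<nu> a"
 proof (cases "\<forall>i. \<exists>k\<le>i. a k")
  case True
  thus ?thesis unfolding admissible_def using adm by blast
 next
  case False
  then obtain i0 where i0: "\<And>k. k \<le> i0 \<Longrightarrow> \<not> a k" by blast
  show ?thesis
  proof (cases "\<exists>k. a k")
   case True
   then obtain k1 where k1: "a k1" by blast
   define K where "K = (LEAST j. a (i0 + int j))"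
   have k1': "a (i0 + int (nat (k1 - i0)))" using k1 i0[of k1] by (cases "k1 \<le> i0") auto
   have "a (i0 + int K)" unfolding K_def by (rule LeastI[of "\<lambda>j. a (i0 + int j)", OF k1'])
   moreover have "\<not> a i" if "i < i0 + int K" for i
   proof (cases "i \<le> i0")
    case False
    hence "i = i0 + int (nat (i - i0))" "nat (i - i0) < K" using that by auto
    thus ?thesis using not_less_Least[of "nat (i - i0)" "\<lambda>j. a (i0 + int j)"] unfolding K_def by metis
   qed (use i0 in blast)
   ultimately show ?thesis unfolding admissible_def using adm by blast
  qed (auto simp: admissible_def)
 qed
 hence "represents s a x" using x sd by (simp add: represents_iff)
 thus thesis using that lp unfolding x_def a_def by blast
qed

theorem basic_arc_eq: "basic_arc s l = (if H l then pt l ` B l else {})"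
proof (cases "H l")
 case True
 show ?thesis
 proof (intro set_eqI iffI)
  fix x assume "x \<in> basic_arc s l"
  then obtain a where "represents s a x" "left_part a = l" by (auto simp: basic_arc_def)
  thus "x \<in> (if H l then pt l ` B l else {})" using represents_left[of a x] True by auto
 next
  fix x assume "x \<in> (if H l then pt l ` B l else {})"
  then obtain t where "t \<in> B l" "x = pt l t" using True by auto
  thus "x \<in> basic_arc s l" using representative_exists[OF True] by (metis (mono_tags, lifting) basic_arc_def mem_Collect_eq)
 qed
qed (use represents_H in "auto simp: basic_arc_def")

end

section \<open>Ends of basic arcs and identifications\<close>

context tent_lhe
begin

declare lb.simps(2) [simp del]

lemma onesl_nu_even: "even (onesl \<nu> n)"
 using onesl_Suc[of \<nu> "n - 1"] nu_last n_pos by auto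

lemma It_n_max: "It n (s/2) = s/2"
 using It_p1[of n] p_periodic(2)[of 1] unfolding p_1(1) Suc_eq_plus1 by simp

lemma tight_It:
 assumes "t \<in> B l" "lb l j t = s/2" "i \<le> j" shows "lb l i t = p (Suc (j - i))"
proof -
 have "It (j - i) (lb l (i + (j - i)) t) = lb l i t" by (rule It_lb) (use assms in "auto simp: B_def2")
 hence "lb l i t = It (j - i) (p 1)" using assms by (simp add: p_1)
 thus ?thesis unfolding It_p1 .
qed

text \<open>The \<open>n\<close>-th iterate fixes \<open>p 1\<close>. Together with
  \<open>tight_cong\<close> this shows that the tight indices form an initial piece of one residue
  class modulo \<open>n\<close>, or all of it.\<close>

lemma tight_reduce: assumes "t \<in> B l" "lb l (j + n) t = s/2" shows "lb l j t = s/2"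
 using tight_It[OF assms, of j] p_max_iff[of n] by simp

lemma tight_cong: assumes "t \<in> B l" "lb l j t = s/2" "lb l k t = s/2" "k \<le> j" shows "(j - k) mod n = 0"
 using tight_It[OF assms(1,2,4)] assms(3) p_max_iff[of "j - k"] by simp

lemma tight_reduce_mult: assumes "t \<in> B l" "lb l (j + k * n) t = s/2" shows "lb l j t = s/2"
 using assms(2)
proof (induction k)
 case (Suc k)
 have "j + Suc k * n = (j + k * n) + n" by simp
 thus ?case using tight_reduce[OF assms(1)] Suc by metis
qed simp

lemma tight_small: assumes "t \<in> B l" "lb l j t = s/2" shows "lb l (j mod n) t = s/2"
 by (rule tight_reduce_mult[OF assms(1), of _ "j div n"]) (use assms(2) in simp)

text \<open>On one side of the turning orbit the letter at the turning point is forced; this is the letter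
 chosen in the kneading sequence.\<close>

lemma forced_letters:
 assumes Hl: "H l" and t: "t \<in> B l" and tg: "lb l (j + n) t = s/2" and i: "i < n"
 shows "l (j + n - 1 - i) = \<nu> i"
proof -
 have early: "l (j + n - 1 - i) = \<nu> i" if "Suc i < n" for i
 proof -
  have e: "Suc (j + n - 1 - i) = j + n - i" using that by simp
  have "lb l (j + n - i) t = p (Suc i)" using tight_It[OF t tg, of "j + n - i"] that by simp
  moreover have "side (l (j + n - 1 - i)) (lb l (j + n - i) t)"
   using side_lb[of l "j + n - 1 - i" t] t e by (simp add: B_def2)
  moreover have "p (Suc i) \<noteq> 1/2" using p_half_iff[of "Suc i"] that by simp
  ultimately show ?thesis using ssid_if[OF nu_side'[of i]] ssid_iff by metis
 qed
 show ?thesis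
 proof (cases "Suc i < n")
  case False
  hence i: "i = n - 1" using i by simp
  obtain u where u: "u \<in> B l" "u \<noteq> t" using Hl unfolding H_def by metis
  define y where "y = lb l (j + n) u"
  have "y \<le> s/2" using u by (simp add: y_def B_def2)
  moreover have "y \<noteq> s/2" using lb_inj[of l "j + n" u t] tg u(2) by (auto simp: y_def)
  ultimately have y: "y < p 1" using p_1 by simp
  have It_y: "It k y = lb l (j + n - k) u" if "k \<le> n" for k
  proof -
   have "It k (lb l (j + n - k + k) u) = lb l (j + n - k) u" by (rule It_lb) (use u in "auto simp: B_def2")
   thus ?thesis using that by (simp add: y_def)
  qed
  have "It (n - 1) y - It (n - 1) (p 1) = sgnp (onesl \<nu> (n - 1)) * s ^ (n - 1) * (y - p 1)"
  proof (rule It_diff)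
   fix k assume k: "k < n - 1"
   hence e: "Suc (j + n - 1 - k) = j + n - k" by simp
   show "side (\<nu> k) (It k y)"
    using side_lb[of l "j + n - 1 - k" u] u early[of k] It_y[of k] e k by (simp add: B_def2)
   show "side (\<nu> k) (It k (p 1))" using nu_side'[of k] by (simp add: It_p1)
  qed
  moreover have "It (n - 1) (p 1) = 1/2" using p_half_iff[of n] n_pos by (simp add: It_p1)
  moreover have "It (n - 1) y = lb l (Suc j) u" using It_y[of "n - 1"] n_pos by (simp flip: Suc_eq_plus1)
  moreover have "0 < s ^ (n - 1) * (p 1 - y)" using y by simp
  ultimately have d: "lb l (Suc j) u - 1/2 = - sgnp (onesl \<nu> (n - 1)) * (s ^ (n - 1) * (p 1 - y))" "0 < s ^ (n - 1) * (p 1 - y)"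
   by (simp_all add: algebra_simps)
  have "side (l j) (lb l (Suc j) u)" using side_lb[of l j u] u by (simp add: B_def2)
  hence "l j = \<nu> (n - 1)" using d nu_last by (auto simp: sgnp_parity side_def split: if_splits)
  thus ?thesis using i n_pos by simp
 qed (use early in blast)
qed

text \<open>\<open>lb l j\<close> is increasing or decreasing in \<open>t\<close> according to the
  parity; where it reaches its bound, \<open>B l\<close> must end in the direction of
  increase.\<close>

lemma tight_end:
 assumes Hl: "H l" and t: "t \<in> B l" and tg: "lb l j t = s/2"
 shows "if even (onesl l j) then t = hi l else t = lo l"
proof -
 have le: "lb l j (hi l) \<le> s/2" "lb l j (lo l) \<le> s/2" using H_ends_in[OF Hl] by (auto simp: B_def2)
 have tt: "lo l \<le> t" "t \<le> hi l" using B_ends(1)[OF Hl] t by auto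
 define A where "A = 1 / s ^ j * (hi l - t)"
 define D where "D = 1 / s ^ j * (t - lo l)"
 have "lb l j (hi l) - lb l j t = sgnp (onesl l j) * A" "lb l j t - lb l j (lo l) = sgnp (onesl l j) * D"
  unfolding lb_diff A_def D_def by simp_all
 moreover have "0 \<le> A" "0 \<le> D" using tt by (auto simp: A_def D_def)
 ultimately have "if even (onesl l j) then A = 0 else D = 0" using le tg by (auto simp: sgnp_parity)
 moreover have "A = 0 \<Longrightarrow> t = hi l" "D = 0 \<Longrightarrow> t = lo l" by (auto simp: A_def D_def)
 ultimately show ?thesis by (auto split: if_splits)
qed

lemma hi_tight: assumes "H l" obtains j where "j < n" "lb l j (hi l) = s/2" "even (onesl l j)"
proof -
 obtain j where "lb l j (hi l) = s/2" using B_ends(3)[OF assms] by blast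
 hence "lb l (j mod n) (hi l) = s/2" using tight_small H_ends_in[OF assms] by blast
 moreover have "even (onesl l (j mod n))"
  using tight_end[OF assms _ calculation] H_ends_in[OF assms] B_ends(2)[OF assms] by (auto split: if_splits)
 ultimately show thesis using that[of "j mod n"] n_pos by simp
qed

lemma lo_zero: assumes "H l" "lo l = 0" shows "l = (\<lambda>_. False)"
proof -
 have z: "0 \<in> B l" using H_ends_in[OF assms(1)] assms(2) by simp
 have "\<not> l j \<and> lb l j 0 = 0" for j
 proof (induction j)
  case 0
  thus ?case using z half_s(2) s_lt2 by (auto simp: B_def2 lb.simps(2) dest!: spec[of _ "Suc 0"])
 next
  case (Suc j)
  hence e: "lb l (Suc j) 0 = 0" by (simp add: lb.simps(2))
  have "lb l (Suc (Suc j)) 0 \<le> s/2" using z by (simp only: B_def2)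
  thus ?case using e s_lt2 by (auto simp: lb.simps(2)[of l "Suc j"] split: if_splits)
 qed
 thus ?thesis by auto
qed

lemma lo_tight: assumes "H l" "lo l \<noteq> 0" obtains j where "j < n" "lb l j (lo l) = s/2" "odd (onesl l j)"
proof -
 obtain j where "lb l j (lo l) = s/2" using B_ends(4)[OF assms(1)] assms(2) by blast
 hence "lb l (j mod n) (lo l) = s/2" using tight_small H_ends_in[OF assms(1)] by blast
 moreover have "odd (onesl l (j mod n))"
  using tight_end[OF assms(1) _ calculation] H_ends_in[OF assms(1)] B_ends(2)[OF assms(1)] by (auto split: if_splits)
 ultimately show thesis using that[of "j mod n"] n_pos by simp
qed

text \<open>Unless it is the bound 0, an end is caused by a tight constraint of index below
  \<open>n\<close>, which is the same condition for both sequences.\<close>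

lemma hi_le_if_agree:
 assumes "H l" "H l'" "\<And>i. i < n \<Longrightarrow> l i = l' i" shows "hi l' \<le> hi l" "lo l \<le> lo l'"
proof -
 obtain j where j: "j < n" "lb l j (hi l) = s/2" "even (onesl l j)" by (rule hi_tight[OF assms(1)])
 have c: "lb l j = lb l' j" if "j < n" for j using lb_cong[of j l l'] assms(3) that by auto
 have "lb l j (hi l') \<le> s/2" using H_ends_in(2)[OF assms(2)] c[OF j(1)] by (simp add: B_def2)
 hence "lb l j (hi l') - lb l j (hi l) \<le> 0" using j by simp
 hence "1 / s ^ j * (hi l' - hi l) \<le> 0" unfolding lb_diff using j(3) by (simp add: sgnp_parity)
 thus "hi l' \<le> hi l" using zero_less_power[OF s0(1), of j] by (auto simp: divide_le_0_iff)
 show "lo l \<le> lo l'"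
 proof (cases "lo l = 0")
  case True
  thus ?thesis using H_ends_in(1)[OF assms(2)] by (simp add: B_def2)
 next
  case False
  then obtain j where j: "j < n" "lb l j (lo l) = s/2" "odd (onesl l j)" by (rule lo_tight[OF assms(1)])
  have "lb l j (lo l') \<le> s/2" using H_ends_in(1)[OF assms(2)] c[OF j(1)] by (simp add: B_def2)
  hence "lb l j (lo l') - lb l j (lo l) \<le> 0" using j by simp
  hence "- (1 / s ^ j * (lo l' - lo l)) \<le> 0" unfolding lb_diff using j(3) by (simp add: sgnp_parity)
  thus ?thesis using zero_less_power[OF s0(1), of j] by (auto simp: divide_le_0_iff zero_le_divide_iff)
 qed
qed

text \<open>A Markov property: \<open>lo\<close> and \<open>hi\<close> are locally constant as
  functions of the sequence. The continuity of the drawing rests on this.\<close>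

lemma B_markov:
 assumes "H l" "H l'" "\<And>i. i < n \<Longrightarrow> l i = l' i"
 shows "hi l' = hi l" "lo l' = lo l" "B l' = B l"
proof -
 show a: "hi l' = hi l" "lo l' = lo l" using hi_le_if_agree[OF assms] hi_le_if_agree[of l' l] assms by force+
 show "B l' = B l" using B_ends(1) assms(1,2) a by simp
qed

text \<open>The coordinate after the last tight index is the turning point with a free letter,
  whereas at earlier tight indices \<open>forced_letters\<close> applies. So an end with a last
  tight index is joined to another arc; an end that is tight infinitely often is an
  endpoint.\<close>

definition lastt :: "bits \<Rightarrow> real \<Rightarrow> nat \<Rightarrow> bool" where
 "lastt l t J \<longleftrightarrow> lb l J t = s/2 \<and> (\<forall>j>J. lb l j t \<noteq> s/2)"

lemma lastt_unique: "lastt l t J \<Longrightarrow> lastt l t J' \<Longrightarrow> J = J'"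
 unfolding lastt_def by (metis linorder_neqE_nat)

lemma lastt_iff: assumes "t \<in> B l" shows "lastt l t J \<longleftrightarrow> lb l J t = s/2 \<and> lb l (J + n) t \<noteq> s/2"
proof
 assume a: "lb l J t = s/2 \<and> lb l (J + n) t \<noteq> s/2"
 have "lb l j t \<noteq> s/2" if "J < j" for j
 proof
  assume tg: "lb l j t = s/2"
  hence "(j - J) mod n = 0" using tight_cong[OF assms] a that by simp
  then obtain k where k: "j - J = k * n" by (metis mod_0_imp_dvd dvdE mult.commute)
  hence "k \<noteq> 0" using that by (intro notI) simp
  then obtain k' where "k = Suc k'" by (cases k) auto
  hence "j = (J + n) + k' * n" using k that by simp
  thus False using tight_reduce_mult[OF assms] tg a by blast
 qed
 thus "lastt l t J" using a by (simp add: lastt_def)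
qed (use n_pos in "auto simp: lastt_def")

definition flip :: "bits \<Rightarrow> nat \<Rightarrow> nat \<Rightarrow> bool" where "flip l J = l(J := \<not> l J)"

lemma flip_simps [simp]: "flip l J J = (\<not> l J)" "j \<noteq> J \<Longrightarrow> flip l J j = l j" "flip (flip l J) J = l"
 by (auto simp: flip_def)

lemma onesl_flip: "j \<le> J \<Longrightarrow> onesl (flip l J) j = onesl l j" by (rule onesl_cong) simp

lemma lb_flip_le: "j \<le> J \<Longrightarrow> lb (flip l J) j t = lb l j t" by (rule lb_cong) simp

lemma lb_flip: assumes "lb l J t = s/2" shows "lb (flip l J) j t = lb l j t"
proof (induction j)
 case (Suc j)
 show ?case
 proof (cases "j = J")
  case True
  have e: "lb (flip l J) J t = s/2" using Suc assms unfolding True by (simp only:)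
  show ?thesis unfolding True lb.simps(2) e assms by simp
 qed (use Suc in "simp add: lb.simps(2)")
qed simp

text \<open>Changing the letter at \<open>J\<close> keeps the point, as both branches meet at the
  turning point. The new arc is nondegenerate: the constraints up to \<open>J\<close> are unchanged,
  and the later ones are strict at \<open>t\<close>, so points of \<open>B l\<close> close to
  \<open>t\<close> satisfy any finite number of them.\<close>

lemma mate:
 assumes Hl: "H l" and t: "t \<in> B l" and last: "lastt l t J"
 shows "H (flip l J)" "t \<in> B (flip l J)" "lastt (flip l J) t J" "pt (flip l J) t = pt l t"
proof -
 have tg: "lb l J t = s/2" "\<And>j. J < j \<Longrightarrow> lb l j t \<noteq> s/2" using last by (auto simp: lastt_def)
 note fl = lb_flip[OF tg(1)]
 show "t \<in> B (flip l J)" using t by (simp add: B_def2 fl)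
 show "lastt (flip l J) t J" using last by (simp add: lastt_def fl)
 show "pt (flip l J) t = pt l t" by (simp add: pt_def fl)
 obtain u where u: "u \<in> B l" "u \<noteq> t" using Hl unfolding H_def by metis
 show "H (flip l J)"
 proof (rule H_if_approx)
  fix N
  have strict: "lb l j t < s/2" if "J < j" for j using t tg(2)[OF that] by (simp add: B_def2 less_le)
  define e where "e = Min (insert 1 ((\<lambda>j. s/2 - lb l j t) ` {J<..N}))"
  have e0: "0 < e" unfolding e_def using strict by (subst Min_gr_iff) auto
  have e: "e \<le> s/2 - lb l j t" if "J < j" "j \<le> N" for j unfolding e_def using that by (intro Min_le) auto
  define h where "h = min 1 (e / (1 + \<bar>u - t\<bar>))"
  have h: "0 < h" "h \<le> 1" using e0 by (auto simp: h_def)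
  have "h * \<bar>u - t\<bar> \<le> e / (1 + \<bar>u - t\<bar>) * \<bar>u - t\<bar>" by (intro mult_right_mono) (auto simp: h_def)
  also have "\<dots> \<le> e" using e0 by (simp add: field_simps)
  finally have hu: "h * \<bar>u - t\<bar> \<le> e" .
  define v where "v = t + h * (u - t)"
  have vB: "v \<in> B l"
  using h mult_left_le_one_le mult_nonneg_nonneg t u BB_convex B_def by (smt (verit) v_def min_def max_def algebra_simps)
  have "lb (flip l J) j v \<le> s/2" if "j \<le> N" for j
  proof (cases "j \<le> J")
   case True thus ?thesis using vB by (simp add: lb_flip_le B_def2)
  next
   case False
   have "\<bar>v - t\<bar> \<le> e" using hu h by (simp add: v_def abs_mult)
   thus ?thesis using lb_close[of "flip l J" j v t] e[of j] that False by (simp add: fl)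
  qed
  hence "v \<in> BB (flip l J) {..N}" using vB by (simp add: BB_def B_def2)
  moreover have "t \<in> BB (flip l J) {..N}" using `t \<in> B (flip l J)` by (simp add: B_Int)
  moreover have "v \<noteq> t" using h u by (simp add: v_def)
  ultimately show "\<exists>t\<in>BB (flip l J) {..N}. \<exists>t'\<in>BB (flip l J) {..N}. t \<noteq> t'" by blast
 qed
qed

text \<open>A letter in which the two sequences differ belongs to a coordinate at the turning point.
  Were a later constraint tight, \<open>forced_letters\<close> would determine the letter in both;
  so the index is the last tight one, which is unique.\<close>

lemma same_point:
 assumes "H l" "H l'" "t \<in> B l" "t \<in> B l'" "pt l t = pt l' t" "l \<noteq> l'"
 obtains J where "lastt l t J" "l' = flip l J"
proof -
 have eq: "lb l j t = lb l' j t" for j using fun_cong[OF assms(5), of j] by (simp add: pt_def)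
 have dif: "lastt l t j" if "l j \<noteq> l' j" for j
 proof -
  have "side (l j) (lb l (Suc j) t)" "side (l' j) (lb l (Suc j) t)"
   using side_lb[of l j t] side_lb[of l' j t] assms(3,4) eq[of "Suc j"] by (auto simp: B_def2)
  hence h: "lb l (Suc j) t = 1/2" using side_both that by blast
  have "lb l j t \<le> s/2" using assms(3) by (simp add: B_def2)
  from tent_lb[OF this] have "lb l j t = s/2" unfolding h tent_half by simp
  moreover have "lb l (j + n) t \<noteq> s/2"
  proof
   assume tg: "lb l (j + n) t = s/2"
   hence "l j = \<nu> (n - 1)" "l' j = \<nu> (n - 1)"
    using forced_letters[OF assms(1,3) tg, of "n - 1"] forced_letters[OF assms(2,4), of j "n - 1"] eq[of "j + n"] n_pos by auto
   thus False using that by simp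
  qed
  ultimately show ?thesis using lastt_iff[OF assms(3)] by simp
 qed
 obtain J where J: "l J \<noteq> l' J" using assms(6) by auto
 have "l' = flip l J"
 proof
  show "l' j = flip l J j" for j using dif[of j] dif[OF J] lastt_unique J by (cases "j = J") auto
 qed
 thus thesis using that dif[OF J] by blast
qed

text \<open>From a coordinate \<open>p 1\<close> on, an admissible sequence is an itinerary of
  \<open>p 1\<close> and therefore \<open>\<nu>\<close>. This supplies the condition on the right
  part in \<open>identified_at\<close>.\<close>

lemma represents_nu:
 assumes r: "represents s a x" and c: "coord s x i = s/2"
 shows "a (i + int j) = \<nu> j"
proof -
 have x: "x \<in> inv_lim s" and sd: "\<And>i. side (a i) (coord s x i)" and ad: "admissible \<nu> a"
  using r by (auto simp: represents_iff)
 have ai: "a i" using sd[of i] c half_s by (auto simp: side_def split: if_splits)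
 have w: "admissible_word \<nu> (subword a i' N)" if "i \<le> i'" for i' N
 proof -
  have "\<not> (\<forall>i. \<not> a i)" using ai by blast
  then consider "\<And>i N. admissible_word \<nu> (subword a i N)"
   | k where "\<And>i. i < k \<Longrightarrow> \<not> a i" "a k" "\<And>i N. k \<le> i \<Longrightarrow> admissible_word \<nu> (subword a i N)"
   using ad unfolding admissible_def by metis
  thus ?thesis
  proof cases
   case (2 k)
   hence "k \<le> i" using ai by (meson not_le)
   thus ?thesis using 2(3) that by simp
  qed
 qed
 have "(\<lambda>j. a (i + int j)) = \<nu>"
 proof (rule nu_unique)
  show "side (a (i + int j)) (It j (p 1))" for j
   using sd[of "i + int j"] coord_It[OF x, of i j] c by (simp add: p_1)
  show "\<not> plex_less_at k \<nu> (\<lambda>j. a (i + int (i' + j)))" for i' k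
  proof -
   have "admissible_word \<nu> (map (\<lambda>j. a (i + int i' + int j)) [0..<Suc k])"
    using w[of "i + int i'" "Suc k"] by (simp add: subword_seq)
   from this[unfolded admissible_word_seq, rule_format, of 0 k] show ?thesis by (simp add: add.assoc)
  qed
 qed
 thus ?thesis by (rule fun_cong)
qed

lemma subword_ones: "ones (subword a (- int J) J) = onesl (left_part a) J"
proof -
 have "subword a (- int J) J = rev (map (left_part a) [0..<J])"
  by (rule nth_equalityI) (auto simp: subword_def rev_nth left_part_def of_nat_diff intro!: arg_cong[where f = a])
 moreover have "ones (rev w) = ones w" for w by (induction w) auto
 ultimately show ?thesis by simp
qed

lemma identified_mates:
 assumes a: "represents s a x" and b: "represents s b x" and k: "k < 0" and id: "identified_at \<nu> k a b"
 obtains J where "k = - int J - 1" "lastt (left_part a) (x 0) J" "left_part b = flip (left_part a) J"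
  "ones (subword a (k + 1) (nat (- k - 1))) = onesl (left_part a) J"
proof -
 obtain J where J: "k = - int J - 1" using neg_int_obtain[OF k] .
 have dif: "a k \<noteq> b k" "\<And>i. i \<noteq> k \<Longrightarrow> a i = b i" using id by (auto simp: identified_at_def)
 have lp: "left_part b = flip (left_part a) J"
 proof
  show "left_part b j = flip (left_part a) J j" for j
   using dif by (cases "j = J") (auto simp: left_part_def J)
 qed
 hence ne: "left_part a \<noteq> left_part b" by (metis flip_simps(1))
 obtain J' where J': "lastt (left_part a) (x 0) J'" "left_part b = flip (left_part a) J'"
  using same_point[of "left_part a" "left_part b" "x 0"] represents_left[OF a] represents_left[OF b] represents_H[OF a] represents_H[OF b] ne by metis
 have "J' = J" using lp J'(2) by (metis flip_simps(1,2))
 moreover have "k + 1 = - int J" "nat (- k - 1) = J" using J by auto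
 ultimately show thesis using that[OF J] J' subword_ones by metis
qed

lemma mates_identified:
 assumes "H l" "t \<in> B l" "lastt l t J"
 obtains a b where "represents s a (pt l t)" "represents s b (pt l t)" "identified_at \<nu> (- int J - 1) a b"
  "left_part a = l" "left_part b = flip l J"
proof -
 note m = mate[OF assms]
 obtain a where a: "represents s a (pt l t)" "left_part a = l" by (rule representative_exists[OF assms(1,2)])
 obtain b where b: "represents s b (pt l t)" "left_part b = flip l J"
  using representative_exists[OF m(1,2)] m(4) by metis
 have c: "coord s (pt l t) (- int J) = s/2" using assms(3) coord_neg(1)[of "pt l t" J] by (simp add: lastt_def pt_def)
 have nu: "a (- int J + int j) = \<nu> j" "b (- int J + int j) = \<nu> j" for j
  using represents_nu[OF a(1) c] represents_nu[OF b(1) c] by auto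
 have "identified_at \<nu> (- int J - 1) a b"
  unfolding identified_at_def
 proof (intro conjI allI impI)
  show "a (- int J - 1) \<noteq> b (- int J - 1)"
   using fun_cong[OF a(2), of J] fun_cong[OF b(2), of J] by (simp add: left_part_def)
  show "a (- int J - 1 + 1 + int j) = \<nu> j" for j using nu(1)[of j] by simp
  fix i assume i: "i \<noteq> - int J - 1"
  show "a i = b i"
  proof (cases "i < - int J")
   case True
   then obtain j where j: "i = - int j - 1" using neg_int_obtain[of i] by auto
   hence "j \<noteq> J" using i by auto
   thus ?thesis using fun_cong[OF a(2), of j] fun_cong[OF b(2), of j] j by (simp add: left_part_def)
  next
   case False
   hence "i = - int J + int (nat (i + int J))" by simp
   thus ?thesis using nu by metis
  qed
 qed
 thus thesis using that a b by blast
qed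

text \<open>The sequences of basic arcs in the core. With finitely many ones the coordinates tend to
  0, outside the core interval; with infinitely many, each coordinate is an iterate of one in the
  right half (\<open>pt_core_iff\<close>).\<close>

definition Hc :: "bits \<Rightarrow> bool" where "Hc l \<longleftrightarrow> H l \<and> (\<forall>M. \<exists>j\<ge>M. l j)"

lemma core_set: "core s = {x \<in> inv_lim s. \<forall>i. x i \<in> {p 2..p 1}}"
using tent_half p_1 p_Suc by (auto simp: numeral_2_eq_2 One_nat_def core_def)

lemma pt_core_iff: assumes Hl: "H l" and t: "t \<in> B l" shows "pt l t \<in> core s \<longleftrightarrow> (\<forall>M. \<exists>j\<ge>M. l j)"
proof
 assume c: "pt l t \<in> core s"
 show "\<forall>M. \<exists>j\<ge>M. l j"
 proof (rule ccontr)
  assume "\<not> ?thesis"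
  then obtain M where M: "\<And>j. M \<le> j \<Longrightarrow> \<not> l j" by blast
  have lz: "lb l (M + i) t = lb l M t / s ^ i" for i by (induction i) (auto simp: M lb.simps(2))
  have "p 2 \<le> lb l (M + i) t" for i using c unfolding core_set pt_def by auto
  hence "p 2 \<le> lb l M t / s ^ i" for i unfolding lz .
  hence "s ^ i \<le> lb l M t / p 2" for i using p2_pos by (simp add: field_simps)
  moreover obtain k where "lb l M t / p 2 < s ^ k" using s1 real_arch_pow by blast
  ultimately show False by (meson not_le)
 qed
next
 assume inf: "\<forall>M. \<exists>j\<ge>M. l j"
 have "lb l i t \<in> {p 2..p 1}" for i
 proof -
  obtain j where j: "i \<le> j" "l j" using inf by blast
  have "side True (lb l (Suc j) t)" using side_lb[of l j t] t j(2) by (simp add: B_def2)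
  hence "lb l (Suc j) t \<in> {p 2..p 1}" using t by (intro right_core) (auto simp: side_def B_def2)
  hence "It (Suc j - i) (lb l (i + (Suc j - i)) t) \<in> {p 2..p 1}" using It_core j(1) by simp
  moreover have "It (Suc j - i) (lb l (i + (Suc j - i)) t) = lb l i t" by (rule It_lb) (use t in "auto simp: B_def2")
  ultimately show ?thesis by simp
 qed
 thus "pt l t \<in> core s" unfolding core_set using pt_inv_lim[OF t] by (simp add: pt_def)
qed

text \<open>At coordinates equal to 1/2 the letter \<open>\<nu> (n - 1)\<close> is chosen. As
  \<open>\<nu>\<close> has an even number of ones per period, the parities at all tight indices then
  agree, so one movement of \<open>t\<close> relaxes all tight constraints at once and the sequence
  is nondegenerate.\<close>

lemma inv_lim_rep:
 assumes x: "x \<in> inv_lim s"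
 obtains l where "H l" "x 0 \<in> B l" "x = pt l (x 0)"
proof -
 define l where "l j = (if x (Suc j) \<noteq> 1/2 then 1/2 < x (Suc j) else \<nu> (n - 1))" for j
 define t where "t = x 0"
 have xl: "x = pt l t" "t \<in> B l" unfolding t_def by (rule inv_lim_pt[OF x]; auto simp: side_def l_def)+
 have lx: "lb l j t = x j" for j using fun_cong[OF xl(1), of j] by (simp add: pt_def)
 have "H l"
 proof (cases "\<exists>j. lb l j t = s/2")
  case False
  show ?thesis
  proof (cases "t = 0")
   case True
   have "x j = 0" for j
   proof (induction j)
    case (Suc j)
    have "tent s (x (Suc j)) = 0" using x Suc by (simp add: inv_lim_def)
    hence "x (Suc j) = 0 \<or> x (Suc j) = 1"
     by (cases "x (Suc j) \<le> 1/2") (auto simp: tent_left tent_right)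
    moreover have "x (Suc j) \<le> s/2" by (rule inv_lim_le[OF x])
    ultimately show ?case using s_lt2 by auto
   qed (use True t_def in simp)
   hence "l = (\<lambda>_. False)" by (auto simp: l_def)
   thus ?thesis using H_zero by simp
  next
   case F: False
   have "lb l j t < s/2" for j using xl(2) False by (auto simp: B_def2 less_le)
   moreover have "0 < t" using F xl(2) by (simp add: B_def2 less_le)
   ultimately show ?thesis by (intro H_if_approx BB_two_if_strict)
  qed
 next
  case True
  have per: "onesl l (j + n) = onesl l j + onesl \<nu> n" if tg: "lb l (j + n) t = s/2" for j
  proof -
   have le: "l (j + n - 1 - i) = \<nu> i" if i: "i < n" for i
   proof -
    have e: "Suc (j + n - 1 - i) = j + n - i" using i by simp
    have "x (Suc (j + n - 1 - i)) = p (Suc i)" unfolding e using tight_It[OF xl(2) tg, of "j + n - i"] i lx by simp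
    moreover have "p (Suc i) = 1/2 \<Longrightarrow> i = n - 1"
     using p_half_iff[of "Suc i"] i by (metis Suc_lessI diff_Suc_1 mod_less nat.distinct(1))
    ultimately show ?thesis using nu_side'[of i] unfolding l_def by (auto simp: side_def split: if_splits)
   qed
   have "map l [j..<j + n] = rev (map \<nu> [0..<n])"
   proof (rule nth_equalityI)
    fix i assume "i < length (map l [j..<j + n])"
    hence i: "i < n" by simp
    hence "j + n - 1 - (n - 1 - i) = j + i" "n - 1 - i < n" by auto
    hence "l (j + i) = \<nu> (n - 1 - i)" using le[of "n - 1 - i"] by simp
    thus "map l [j..<j + n] ! i = rev (map \<nu> [0..<n]) ! i" using i by (simp add: rev_nth One_nat_def)
   qed simp
   moreover have "map l [0..<j + n] = map l [0..<j] @ map l [j..<j + n]" by (metis le_add1 map_append upt_add_eq_append add_0)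
   moreover have "ones (rev w) = ones w" for w by (induction w) auto
   ultimately show ?thesis by simp
  qed
  have par: "even (onesl l (j + k * n)) = even (onesl l j)" if "lb l (j + k * n) t = s/2" for j k
   using that
  proof (induction k)
   case (Suc k)
   have e: "j + Suc k * n = (j + k * n) + n" by simp
   have tg: "lb l ((j + k * n) + n) t = s/2" using Suc.prems unfolding e .
   thus ?case using per[OF tg] onesl_nu_even Suc.IH tight_reduce[OF xl(2) tg] unfolding e by simp
  qed simp
  have same: "even (onesl l j) = even (onesl l i)" if "lb l j t = s/2" "lb l i t = s/2" "i \<le> j" for i j
  proof -
   have "(j - i) mod n = 0" by (rule tight_cong[OF xl(2) that])
   then obtain k where "j - i = k * n" by (metis mod_0_imp_dvd dvdE mult.commute)
   hence "j = i + k * n" using that(3) by simp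
   thus ?thesis using par that(1) by blast
  qed
  obtain j0 where j0: "lb l j0 t = s/2" using True by blast
  \<comment> \<open>The common sign at the tight indices; moving \<open>t\<close> against it lowers
    every tight coordinate.\<close>
  define k where "k = sgnp (onesl l j0)"
  have k: "sgnp (onesl l j) = k" if "lb l j t = s/2" for j
   using same[OF that j0] same[OF j0 that] nat_le_linear[of j j0] by (auto simp: k_def sgnp_parity)
  have "t = p (Suc j0)" using tight_It[OF xl(2) j0, of 0] by simp
  moreover have "p (Suc j0) \<in> {p 2..p 1}"
   using It_core[of "p 1" j0] p2_lt p1_gt unfolding It_p1 by simp
  ultimately have t0: "0 < t" using p2_pos by auto
  show ?thesis
  proof (rule H_if_approx)
   fix N
   define e where "e = Min (insert 1 ((\<lambda>j. s/2 - lb l j t) ` {j. j \<le> N \<and> lb l j t \<noteq> s/2}))"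
   have fin: "finite (insert 1 ((\<lambda>j. s/2 - lb l j t) ` {j. j \<le> N \<and> lb l j t \<noteq> s/2}))" by simp
   have e0: "0 < e" unfolding e_def using xl(2) by (subst Min_gr_iff[OF fin]) (auto simp: B_def2 less_le)
   have e: "e \<le> s/2 - lb l j t" if "j \<le> N" "lb l j t \<noteq> s/2" for j unfolding e_def using that by (intro Min_le[OF fin]) auto
   define h where "h = min e t"
   have h: "0 < h" "h \<le> e" "h \<le> t" using e0 t0 by (auto simp: h_def)
   define u where "u = t - k * h"
   have kk: "k = 1 \<or> k = -1" by (simp add: k_def sgnp_parity)
   have "lb l j u \<le> s/2" if "j \<le> N" for j
   proof (cases "lb l j t = s/2")
    case T: True
    have "lb l j u - lb l j t = - (1 / s ^ j * h)" unfolding lb_diff u_def k[OF T] using kk by auto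
    moreover have "0 < 1 / s ^ j * h" using h by simp
    ultimately show ?thesis using T by linarith
   next
    case F: False
    have "\<bar>u - t\<bar> \<le> e" using h kk by (auto simp: u_def)
    thus ?thesis using lb_close[of l j u t] e[OF that F] by linarith
   qed
   moreover have "0 \<le> u" "u \<noteq> t" using h kk by (auto simp: u_def)
   ultimately have "u \<in> BB l {..N}" "t \<in> BB l {..N}" using xl(2) by (auto simp: BB_def B_def2)
   thus "\<exists>t\<in>BB l {..N}. \<exists>t'\<in>BB l {..N}. t \<noteq> t'" using `u \<noteq> t` by blast
  qed
 qed
 moreover have "x 0 \<in> B l" using xl(2) unfolding t_def .
 moreover have "x = pt l (x 0)" using xl(1) unfolding t_def .
 ultimately show thesis by (rule that)
qed

lemma core_eq: "core s = (\<Union>l\<in>{l. Hc l}. pt l ` B l)"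
proof (intro set_eqI iffI)
 fix x assume x: "x \<in> core s"
 hence "x \<in> inv_lim s" by (simp add: core_def)
 then obtain l where "H l" "x 0 \<in> B l" "x = pt l (x 0)" by (rule inv_lim_rep)
 thus "x \<in> (\<Union>l\<in>{l. Hc l}. pt l ` B l)" using pt_core_iff[of l "x 0"] x unfolding Hc_def by auto
qed (use pt_core_iff in "auto simp: Hc_def")

lemma Hc_iff: assumes "H l" "t \<in> B l" shows "Hc l \<longleftrightarrow> pt l t \<in> core s"
 using pt_core_iff[OF assms] assms by (simp add: Hc_def)

lemma Hc_flip: "Hc l \<Longrightarrow> t \<in> B l \<Longrightarrow> lastt l t J \<Longrightarrow> Hc (flip l J)"
 using mate[of l t J] Hc_iff[of l t] Hc_iff[of "flip l J" t] unfolding Hc_def by metis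

section \<open>Left itineraries of the core are forward itineraries of the core interval\<close>

lemma generic_int: assumes "H l" obtains t where "lo l < t" "t < hi l" "generic t" "t \<in> B l"
 using generic_dense[OF B_ends(2)[OF assms]] B_ends(1)[OF assms] by (metis atLeastAtMost_iff less_imp_le)

lemma Hc_words: assumes "Hc l" shows "admissible_word \<nu> (map (\<lambda>j. l (N - 1 - j)) [0..<N])"
proof -
 have Hl: "H l" using assms by (simp add: Hc_def)
 obtain t where t: "lo l < t" "t < hi l" "generic t" "t \<in> B l" by (rule generic_int[OF Hl])
 define y where "y = lb l N t"
 have It_y: "It k y = lb l (N - k) t" if "k \<le> N" for k
 proof -
  have "It k (lb l (N - k + k) t) = lb l (N - k) t" by (rule It_lb) (use t in "auto simp: B_def2")
  thus ?thesis using that by (simp add: y_def)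
 qed
 have core: "lb l k t \<in> {p 2..p 1}" for k
 using Hc_iff Hl t(4) assms by (auto simp: core_set pt_def)
 have nh: "lb l k t \<noteq> 1/2" for k
 proof (cases k)
  case 0 thus ?thesis using t(3) unfolding generic_def by (auto dest: spec[of _ 0])
 next
  case (Suc k')
  have lt: "lb l k' t < s/2" by (rule lb_interior[OF Hl t(1,2)])
  hence "tent s (lb l k t) \<noteq> s/2" using tent_lb[of l k' t] Suc by simp
  thus ?thesis using tent_half by metis
 qed
 have gy: "generic y" unfolding generic_def
 proof
  fix i show "It i y \<noteq> 1/2"
  proof (cases "i \<le> N")
   case True thus ?thesis using It_y nh by simp
  next
   case False
   hence "It i y = It (i - N) (It N y)" using It_add[of "i - N" N y] by simp
   also have "\<dots> = It (i - N) t" using It_y[of N] by simp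
   finally show ?thesis using t(3) by (simp add: generic_def)
  qed
 qed
 have "it y j = l (N - 1 - j)" if "j < N" for j
 proof -
  have e: "N - j = Suc (N - 1 - j)" using that by simp
  have "side (l (N - 1 - j)) (It j y)"
   using It_y[of j] that side_lb[of l "N - 1 - j" t] t(4) by (simp add: e B_def2)
  thus ?thesis using ssid_iff[OF it_ssid[OF gy, of j]] by simp
 qed
 hence "map (\<lambda>j. l (N - 1 - j)) [0..<N] = map (it y) [0..<N]" by simp
 thus ?thesis using generic_Adm[OF gy] core[of N] unfolding Adm_def y_def by metis
qed

lemma rev_seq: "rev (map (\<lambda>j. l (N - 1 - j)) [0..<N]) = map l [0..<N]"
 by (rule nth_equalityI) (auto simp: rev_nth)

text \<open>During a run of zeros the point is multiplied by \<open>s\<close> in each step, starting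
  from at least \<open>p 2 > 0\<close>.\<close>

lemma Adm_zeros_bounded:
 assumes "\<And>N. admissible_word \<nu> (replicate N False)" shows False
proof -
 obtain N where N: "1 / p 2 < s ^ N" using s1 real_arch_pow by blast
 have "map (\<lambda>_. False) [0..<N] = replicate N False" by (simp add: map_replicate_const)
 then obtain y where y: "y \<in> {p 2..p 1}" "\<And>i. i < N \<Longrightarrow> \<not> it y i"
  using word_realized[of "\<lambda>_. False" N] assms[of N] by auto
 have "It k y = s ^ k * y" if "k \<le> N" for k
  using that
 proof (induction k)
  case (Suc k)
  hence "It k y \<le> 1/2" using y(2)[of k] by (simp add: it_def)
  thus ?case using Suc by (simp add: It_Suc tent_left)
 qed simp
 hence e: "It N y = s ^ N * y" by simp
 have "It N y \<le> 1" using It_core[OF y(1), of N] core_unit by (meson atLeastAtMost_iff)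
 moreover have "1 < s ^ N * p 2" using N p2_pos by (simp add: field_simps)
 moreover have "s ^ N * p 2 \<le> s ^ N * y" using y(1) by (intro mult_left_mono) auto
 ultimately show False using e by linarith
qed

text \<open>A left-infinite sequence read in the direction of time yields the reversed words. Here
  \<open>admissible_rev\<close> turns left parts of core points into forward itineraries.\<close>

lemma Hc_iff_Adm: "Hc l \<longleftrightarrow> Adm l"
proof
 assume "Hc l"
 thus "Adm l" unfolding Adm_def using Hc_words[of l] admissible_rev rev_seq[of l] by metis
next
 assume a: "Adm l"
 have "admissible_word \<nu> (map (\<lambda>j. l (N - 1 - j)) [0..<N])" for N
 using a admissible_rev rev_seq rev_rev_ident by (metis Adm_def)
 hence Hl: "H l" by (rule H_if_words)
 moreover have "\<exists>j\<ge>M. l j" for M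
 proof (rule ccontr)
  assume "\<not> ?thesis"
  hence z: "\<And>j. \<not> l (M + j)" by auto
  have "admissible_word \<nu> (replicate N False)" for N
  proof -
   have "map (\<lambda>j. l (M + j)) [0..<N] = replicate N False" using z by (intro nth_equalityI) auto
   thus ?thesis using Adm_shift[OF a, of M] unfolding Adm_def by metis
  qed
  thus False by (rule Adm_zeros_bounded)
 qed
 ultimately show "Hc l" by (simp add: Hc_def)
qed

lemma It_continuous: "continuous_on UNIV (It k)"
proof (induction k)
 case (Suc k)
 have "It (Suc k) = (\<lambda>y. min (s * It k y) (s * (1 - It k y)))" by (auto simp: It_Suc tent_def)
 thus ?case using Suc by (simp add: continuous_on_min continuous_on_mult_left continuous_on_diff)
next
 case 0
 have "It 0 = (\<lambda>y. y)" by auto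
 thus ?case by simp
qed

lemma Adm_point:
 assumes "Adm l" obtains y where "y \<in> {p 2..p 1}" "\<And>i. side (l i) (It i y)"
proof -
 define F where "F N = {p 2..p 1} \<inter> (\<Inter>i\<in>{..<N}. {y. side (l i) (It i y)})" for N :: nat
 have cl: "closed {y. side a (It i y)}" for a i
 proof (cases a)
  case True
  hence "{y. side a (It i y)} = {y. 1/2 \<le> It i y}" by (auto simp: side_def)
  thus ?thesis using closed_Collect_le[OF continuous_on_const It_continuous] by metis
 next
  case False
  hence "{y. side a (It i y)} = {y. It i y \<le> 1/2}" by (auto simp: side_def)
  thus ?thesis using closed_Collect_le[OF It_continuous continuous_on_const] by metis
 qed
 have "\<Inter> (range F) \<noteq> {}"
 proof (rule compact_nest)
  show "compact (F N)" for N unfolding F_def by (intro compact_Int_closed closed_INT ballI cl) simp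
  show "F N \<noteq> {}" for N
  proof -
   obtain y where y: "y \<in> {p 2..p 1}" "\<forall>i<N. it y i = l i"
    using word_realized[of l N] assms unfolding Adm_def by blast
   have "side (l i) (It i y)" if "i < N" for i using y(2) it_side[of y i] that by simp
   hence "y \<in> F N" using y(1) by (auto simp: F_def)
   thus ?thesis by blast
  qed
  show "M \<le> N \<Longrightarrow> F N \<subseteq> F M" for M N by (auto simp: F_def)
 qed
 then obtain y where y: "\<And>N. y \<in> F N" by auto
 have "side (l i) (It i y)" for i using y[of "Suc i"] by (auto simp: F_def)
 moreover have "y \<in> {p 2..p 1}" using y[of 0] by (simp add: F_def)
 ultimately show thesis using that by blast
qed

end

section \<open>Heights\<close>

text \<open>The coefficient of \<open>1 / 3 ^ Suc i\<close> in \<open>psi\<close>; the minus sign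
  stems from the single 1 of \<open>L_C\<close>.\<close>

definition eps :: "bits \<Rightarrow> nat \<Rightarrow> real" where
 "eps l i = - sgnp (onesl l (Suc i))"

definition ht :: "bits \<Rightarrow> real" where "ht l = psi L_C l"

text \<open>The centre of the heights of all sequences with the same first \<open>J\<close> letters.
  By \<open>ht_flip\<close> it is the height of the centre of the semicircle that joins
  \<open>l\<close> and \<open>flip l J\<close>.\<close>

definition yc :: "bits \<Rightarrow> nat \<Rightarrow> real" where
 "yc l J = 1/2 + (\<Sum>i<J. eps l i / 3 ^ Suc i)"

lemma abs_eps: "\<bar>eps l i\<bar> = 1" by (simp add: eps_def)

lemma eps_cases: "eps l i = 1 \<or> eps l i = -1" by (simp add: eps_def sgnp_parity)

lemma eps_cong: "(\<And>j. j \<le> i \<Longrightarrow> l j = l' j) \<Longrightarrow> eps l i = eps l' i"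
 unfolding eps_def using onesl_cong[of "Suc i" l l'] by (simp)

lemma yc_cong: "(\<And>j. j < J \<Longrightarrow> l j = l' j) \<Longrightarrow> yc l J = yc l' J"
 unfolding yc_def using eps_cong[of _ l l'] by (auto intro!: sum.cong)

lemma yc_Suc: "yc l (Suc J) = yc l J + eps l J / 3 ^ Suc J" by (simp add: yc_def)

lemma onesl_L_C: "onesl L_C (Suc i) = 1"
 by (induction i) (simp_all add: L_C_def)

lemma weighted_bound:
 fixes f :: "nat \<Rightarrow> real" assumes "\<And>i. \<bar>f i\<bar> \<le> 1"
 shows "summable (\<lambda>i. f i / 3 ^ Suc i)" "\<bar>\<Sum>i. f i / 3 ^ Suc i\<bar> \<le> 1/2"
proof -
 have g: "(\<lambda>i. (1/3) ^ i / 3) sums ((1 / (1 - 1/3)) / 3 :: real)" by (intro sums_divide geometric_sums) simp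
 have b: "\<bar>f i / 3 ^ Suc i\<bar> \<le> (1/3) ^ i / 3" for i
 proof -
  have "\<bar>f i\<bar> / (3 * 3 ^ i) \<le> 1 / (3 * 3 ^ i)" by (rule divide_right_mono) (use assms in auto)
  thus ?thesis by (simp add: power_one_over)
 qed
 have s: "summable (\<lambda>i. \<bar>f i / 3 ^ Suc i\<bar>)"
  by (rule summable_comparison_test'[OF sums_summable[OF g], of 0]) (use b in auto)
 show sf: "summable (\<lambda>i. f i / 3 ^ Suc i)" by (rule summable_rabs_cancel[OF s])
 have "\<bar>\<Sum>i. f i / 3 ^ Suc i\<bar> \<le> (\<Sum>i. \<bar>f i / 3 ^ Suc i\<bar>)" by (rule summable_rabs[OF s])
 also have "\<dots> \<le> (\<Sum>i. (1/3) ^ i / 3)" by (rule suminf_le[OF b s sums_summable[OF g]])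
 also have "\<dots> = 1/2" using sums_unique[OF g] by simp
 finally show "\<bar>\<Sum>i. f i / 3 ^ Suc i\<bar> \<le> 1/2" .
qed

lemma eps_summable: "summable (\<lambda>i. eps l (i + J) / 3 ^ Suc i)"
 by (rule weighted_bound(1)) (simp add: abs_eps)

lemma ht_eq: "ht l = (\<Sum>i. eps l i / 3 ^ Suc i) + 1/2"
proof -
 have "(-1::real) powi (int (onesl L_C (Suc i)) - int (onesl l (Suc i))) = eps l i" for i
 proof -
  have "(-1::real) powi (1 - int k) = - sgnp k" for k
   by (cases k) (auto simp: power_int_diff sgnp_def power_int_minus minus_one_power_iff)
  thus ?thesis unfolding eps_def onesl_L_C by (simp del: onesl_Suc)
 qed
 thus ?thesis unfolding ht_def psi_def by simp
qed

lemma ht_split: "ht l = yc l J + (\<Sum>i. eps l (i + J) / 3 ^ Suc i) / 3 ^ J"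
proof -
 have sm: "summable (\<lambda>i. eps l i / 3 ^ Suc i)" using eps_summable[of l 0] by simp
 have "(\<Sum>i. eps l i / 3 ^ Suc i) = (\<Sum>i. eps l (i + J) / 3 ^ Suc (i + J)) + (\<Sum>i<J. eps l i / 3 ^ Suc i)"
  by (rule suminf_split_initial_segment[OF sm])
 moreover have "(\<Sum>i. eps l (i + J) / 3 ^ Suc (i + J)) = (\<Sum>i. eps l (i + J) / 3 ^ Suc i / 3 ^ J)"
  by (simp add: power_add mult.assoc)
 moreover have "\<dots> = (\<Sum>i. eps l (i + J) / 3 ^ Suc i) / 3 ^ J" by (rule suminf_divide[OF eps_summable])
 ultimately show ?thesis unfolding ht_eq yc_def by simp
qed

lemma ht_yc: "\<bar>ht l - yc l J\<bar> \<le> 1 / (2 * 3 ^ J)"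
proof -
 have "\<bar>\<Sum>i. eps l (i + J) / 3 ^ Suc i\<bar> \<le> 1/2" by (rule weighted_bound(2)) (simp add: abs_eps)
 hence "\<bar>\<Sum>i. eps l (i + J) / 3 ^ Suc i\<bar> / 3 ^ J \<le> (1/2) / 3 ^ J" by (rule divide_right_mono) simp
 thus ?thesis using ht_split[of l J] by (simp)
qed

text \<open>The terms after index \<open>J\<close> amount to at most half of the leading term
  \<open>1 / 3 ^ Suc J\<close>, and the other half is \<open>1 / (6 * 3 ^ J)\<close>.\<close>

lemma ht_yc_sign: "1 / (6 * 3 ^ J) \<le> eps l J * (ht l - yc l J)"
proof -
 define d where "d = 1 / (6 * 3 ^ J :: real)"
 have 1: "\<bar>ht l - yc l (Suc J)\<bar> \<le> d" using ht_yc[of l "Suc J"] by (simp add: d_def)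
 have "eps l J / 3 ^ Suc J = eps l J * (2 * d)" by (simp add: d_def)
 hence 2: "yc l (Suc J) = yc l J + eps l J * (2 * d)" unfolding yc_Suc by (simp only:)
 show ?thesis
 proof (cases "eps l J = 1")
  case True
  thus ?thesis using 1 2 unfolding d_def[symmetric] True mult_1 by linarith
 next
  case False
  hence e: "eps l J = -1" using eps_cases by blast
  show ?thesis using 1 2 unfolding d_def[symmetric] e mult_minus1 by linarith
 qed
qed

lemma ht_ne_yc: "ht l \<noteq> yc l J"
proof
 assume e: "ht l = yc l J"
 have "0 < 1 / (6 * 3 ^ J :: real)" by simp
 moreover have "1 / (6 * 3 ^ J :: real) \<le> 0"
  using ht_yc_sign[of J l] by (simp only: e diff_self mult_zero_right)
 ultimately show False by linarith
qed

lemma ht_close: assumes "\<And>i. i < M \<Longrightarrow> l i = l' i" shows "\<bar>ht l - ht l'\<bar> \<le> 1 / 3 ^ M"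
proof -
 have "yc l M = yc l' M" by (rule yc_cong) (use assms in auto)
 moreover have "1 / (2 * 3 ^ M) + 1 / (2 * 3 ^ M) = (1 / 3 ^ M :: real)" by simp
 ultimately show ?thesis using ht_yc[of l M] ht_yc[of l' M] by linarith
qed

text \<open>At the first difference the smaller sequence has coefficient -1 and the larger one 1. So
  for \<open>L_C\<close> the heights are ordered as the sequences are.\<close>

lemma plex_ht:
 assumes "plex_less_at k a b" shows "ht a + 1 / 3 ^ Suc k \<le> ht b" "ht a < yc a k" "yc a k < ht b" "yc a k = yc b k"
  "\<bar>ht a - yc a k\<bar> \<ge> 1 / (6 * 3 ^ k)"
proof -
 have ag: "\<And>j. j < k \<Longrightarrow> a j = b j" using assms by (auto simp: plex_less_at_def)
 hence "onesl a k = onesl b k" by (rule onesl_cong)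
 hence "eps a k = -1" "eps b k = 1"
  using assms unfolding plex_less_at_def eps_def by (auto simp: sgnp_parity split: if_splits)
 moreover show y: "yc a k = yc b k" by (rule yc_cong[OF ag])
 ultimately have 1: "1 / (6 * 3 ^ k) \<le> yc a k - ht a" "1 / (6 * 3 ^ k) \<le> ht b - yc b k"
  using ht_yc_sign[of k a] ht_yc_sign[of k b] by simp_all
 moreover have p: "0 < 1 / (6 * 3 ^ k :: real)" by simp
 ultimately show "ht a < yc a k" "yc a k < ht b" "\<bar>ht a - yc a k\<bar> \<ge> 1 / (6 * 3 ^ k)" using y by linarith+
 have "1 / (6 * 3 ^ k) + 1 / (6 * 3 ^ k) = (1 / 3 ^ Suc k :: real)" by simp
 thus "ht a + 1 / 3 ^ Suc k \<le> ht b" using 1 y by linarith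
qed

lemma ht_cases:
 assumes "a \<noteq> b" shows "(\<exists>k. plex_less_at k a b \<and> ht a < ht b) \<or> (\<exists>k. plex_less_at k b a \<and> ht b < ht a)"
proof -
 obtain k where k: "\<And>j. j < k \<Longrightarrow> a j = b j" "a k \<noteq> b k" using first_difference[OF assms] by blast
 have "plex_less_at k a b \<or> plex_less_at k b a" by (rule plex_less_at_intro) (use k in auto)
 thus ?thesis using plex_ht(2,3)[of k a b] plex_ht(2,3)[of k b a] by (meson less_trans)
qed

lemma ht_inj: "ht a = ht b \<longleftrightarrow> a = b" using ht_cases[of a b] by force

lemma ht_less_plex: "ht a < ht b \<Longrightarrow> \<exists>k. plex_less_at k a b" using ht_cases[of a b] by auto

text \<open>Cylinder sets are intervals of the parity-lexicographical order.\<close>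

lemma ht_convex:
 assumes "\<And>i. i < M \<Longrightarrow> l i = l' i" "ht l \<le> ht x" "ht x \<le> ht l'" "i < M"
 shows "x i = l i"
proof (cases "x = l \<or> x = l'")
 case False
 hence "ht l < ht x" "ht x < ht l'" using assms(2,3) ht_inj by (metis order_le_less)+
 then obtain k k' where k: "plex_less_at k l x" "plex_less_at k' x l'" using ht_less_plex by metis
 show ?thesis
 proof (rule ccontr)
  assume ne: "x i \<noteq> l i"
  have "\<not> i < k" using ne k(1) unfolding plex_less_at_def by metis
  hence kM: "k < M" using assms(4) by simp
  have "plex_less_at k l' x"
  proof -
   have e: "l' j = l j" if "j \<le> k" for j using assms(1)[of j] kM that by simp
   hence o: "onesl l' k = onesl l k" by (intro onesl_cong) simp
   show ?thesis using k(1) e unfolding plex_less_at_def o by (cases "even (onesl l k)") simp_all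
  qed
  thus False using plex_ht(2,3)[of k l' x] `ht x < ht l'` by linarith
 qed
qed (use assms in auto)

lemma ht_far:
 assumes "\<exists>i<M. l i \<noteq> l' i" shows "1 / 3 ^ M + 1 / (2 * 3 ^ M) \<le> \<bar>ht l' - yc l M\<bar>"
proof -
 have "l \<noteq> l'" using assms by auto
 then obtain k where k: "\<And>j. j < k \<Longrightarrow> l j = l' j" "l k \<noteq> l' k" using first_difference by blast
 hence kM: "k < M" using assms by (metis linorder_neqE_nat less_trans)
 define d where "d = (1 / 3 ^ Suc k :: real)"
 have main: "d + 1 / (2 * 3 ^ M) \<le> \<bar>ht l' - yc l M\<bar>"
 proof -
  have y: "yc l k = yc l' k" by (rule yc_cong[OF k(1)])
  have e: "eps l' k = - eps l k"
   unfolding eps_def using onesl_cong[of k l l'] k by (auto)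
  have a: "\<bar>ht l' - yc l' (Suc k)\<bar> \<le> d / 2" using ht_yc[of l' "Suc k"] by (simp add: d_def)
  have "Suc k \<le> j \<Longrightarrow> \<bar>yc l j - yc l (Suc k)\<bar> \<le> d / 2 - 1 / (2 * 3 ^ j)" for j
  proof (induction j rule: dec_induct)
   case (step j)
   have "1 / (2 * 3 ^ j) = 1 / 3 ^ Suc j + (1 / (2 * 3 ^ Suc j) :: real)" by simp
   moreover have "\<bar>yc l (Suc j) - yc l j\<bar> = 1 / 3 ^ Suc j" unfolding yc_Suc by (simp add: abs_eps)
   ultimately show ?case using step by linarith
  qed (simp add: d_def)
  hence b: "\<bar>yc l M - yc l (Suc k)\<bar> \<le> d / 2 - 1 / (2 * 3 ^ M)" using kM by simp
  have "yc l (Suc k) = yc l k + eps l k * d" "yc l' (Suc k) = yc l k - eps l k * d"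
   unfolding yc_Suc d_def y e by simp_all
  moreover define q where "q = 1 / (2 * 3 ^ M :: real)"
  ultimately have "d + q \<le> yc l M - ht l' \<or> d + q \<le> ht l' - yc l M"
   using a b[folded q_def] eps_cases[of l k] by (elim disjE) (simp_all only:, linarith+)
  thus ?thesis unfolding q_def[symmetric] by linarith
 qed
 have "1 / 3 ^ M \<le> d" unfolding d_def using kM by (intro divide_left_mono power_increasing) auto
 thus ?thesis using main by linarith
qed

context tent_lhe
begin

lemma eps_flip: "J \<le> i \<Longrightarrow> eps (flip l J) i = - eps l i"
proof -
 assume "J \<le> i"
 have "even (onesl (flip l J) (Suc k)) \<longleftrightarrow> odd (onesl l (Suc k))" if "J \<le> k" for k
  using that
 proof (induction k rule: dec_induct)
  case base
  thus ?case using onesl_flip[of J J l] by simp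
 next
  case (step k)
  thus ?case using onesl_Suc[of "flip l J" "Suc k"] onesl_Suc[of l "Suc k"] by (simp del: onesl_Suc)
 qed
 thus ?thesis using `J \<le> i` by (simp add: eps_def sgnp_parity del: onesl_Suc)
qed

text \<open>A changed letter at \<open>J\<close> reverses the sign of every term from
  \<open>J\<close> on.\<close>

lemma ht_flip: "ht (flip l J) - yc l J = - (ht l - yc l J)"
proof -
 have "(\<Sum>i. eps (flip l J) (i + J) / 3 ^ Suc i) = (\<Sum>i. - (eps l (i + J) / 3 ^ Suc i))"
  by (simp add: eps_flip)
 also have "\<dots> = - (\<Sum>i. eps l (i + J) / 3 ^ Suc i)" by (rule suminf_minus[OF eps_summable])
 finally have "(\<Sum>i. eps (flip l J) (i + J) / 3 ^ Suc i) = - (\<Sum>i. eps l (i + J) / 3 ^ Suc i)" .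
 moreover have "yc (flip l J) J = yc l J" by (rule yc_cong) simp
 ultimately show ?thesis using ht_split[of l J] ht_split[of "flip l J" J] by simp
qed

lemma itinerary_ht:
 assumes "\<And>i. side (l i) (It i y)" "\<And>i. side (l' i) (It i y')" "y < y'" "y \<in> {0..1}" "y' \<in> {0..1}"
 shows "ht l < ht l'"
proof -
 have "l \<noteq> l'" using It_unique[of y y' l] assms by auto
 then obtain k where k: "\<And>j. j < k \<Longrightarrow> l j = l' j" "l k \<noteq> l' k" using first_difference by blast
 have "plex_less_at k l l'" by (rule itinerary_less[OF assms(1,2) k assms(3)])
 thus ?thesis using plex_ht(2,3) by (meson less_trans)
qed

lemma Adm_after_turn:
 assumes "Adm l" "\<And>i. side (l i) (It i y)" "It j y = 1/2"
 shows "l (Suc j + k) = \<nu> k"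
proof -
 have "(\<lambda>k. l (Suc j + k)) = \<nu>"
 proof (rule nu_unique)
  have t: "It (Suc j) y = p 1" unfolding It_Suc assms(3) tent_half p_1(1) ..
  show "side (l (Suc j + i)) (It i (p 1))" for i
   using assms(2)[of "Suc j + i"] It_add[of i "Suc j" y] t by (simp add: add.commute)
  show "\<not> plex_less_at k \<nu> (\<lambda>k. l (Suc j + (i + k)))" for i k
   using assms(1)[unfolded Adm_iff, rule_format, of k "Suc j + i"] by (simp add: add.assoc)
 qed
 thus ?thesis by (rule fun_cong)
qed

definition ntail :: "bits \<Rightarrow> bool" where "ntail l \<longleftrightarrow> (\<exists>i. \<forall>k. l (i + k) = \<nu> k)"

text \<open>Both sides of a gap are itineraries of one preimage of the turning point.\<close>

lemma adjacent_tail: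
 assumes a: "Adm l" "Adm l'" "ht l < ht l'" and gap: "\<And>x. Adm x \<Longrightarrow> \<not> (ht l < ht x \<and> ht x < ht l')"
 shows "\<exists>i. \<forall>k. l (i + k) = \<nu> k \<and> l' (i + k) = \<nu> k"
proof -
 obtain y where y: "y \<in> {p 2..p 1}" "\<And>i. side (l i) (It i y)" by (rule Adm_point[OF a(1)]) blast
 obtain y' where y': "y' \<in> {p 2..p 1}" "\<And>i. side (l' i) (It i y')" by (rule Adm_point[OF a(2)]) blast
 have u: "y \<in> {0..1}" "y' \<in> {0..1}" using y(1) y'(1) core_unit by blast+
 have "y = y'"
 proof (rule ccontr)
  assume "y \<noteq> y'"
  moreover have "\<not> y' < y" using itinerary_ht[OF y'(2) y(2)] u a(3) by (meson less_asym)
  ultimately have "y < y'" by simp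
  then obtain z where z: "y < z" "z < y'" "generic z" by (rule generic_dense)
  have zc: "z \<in> {p 2..p 1}" using z y(1) y'(1) by auto
  hence "Adm (it z)" by (rule generic_Adm[OF z(3)])
  moreover have "ht l < ht (it z)" by (rule itinerary_ht[OF y(2) it_side z(1) u(1) core_unit[OF zc]])
  moreover have "ht (it z) < ht l'" by (rule itinerary_ht[OF it_side y'(2) z(2) core_unit[OF zc] u(2)])
  ultimately show False using gap by blast
 qed
 have "l \<noteq> l'" using a(3) by auto
 then obtain k where k: "l k \<noteq> l' k" by auto
 have "It k y = 1/2" using side_both[OF y(2)[of k] _ k] y'(2)[of k] `y = y'` by simp
 thus ?thesis using Adm_after_turn[OF a(1) y(2)] Adm_after_turn[OF a(2) y'(2)] `y = y'` by metis
qed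

text \<open>The orbit of the point with itinerary \<open>l\<close> meets the turning point at some
  time \<open>j\<close>. On points with the same first \<open>j\<close> letters \<open>It j\<close>
  is monotone, and only one side of the turning point has the letter \<open>l j\<close>; so such
  points lie on one side only.\<close>

lemma tail_isolated:
 assumes a: "Adm l" and tl: "ntail l"
 shows "\<exists>M. (\<forall>x. Adm x \<and> (\<forall>i<M. x i = l i) \<longrightarrow> ht x \<le> ht l) \<or> (\<forall>x. Adm x \<and> (\<forall>i<M. x i = l i) \<longrightarrow> ht l \<le> ht x)"
proof -
 obtain y where y: "y \<in> {p 2..p 1}" "\<And>i. side (l i) (It i y)" by (rule Adm_point[OF a]) blast
 have yu: "y \<in> {0..1}" by (rule core_unit[OF y(1)])
 obtain i where i: "\<And>k. l (i + k) = \<nu> k" using tl by (auto simp: ntail_def)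
 have pu: "p 1 \<in> {0..1}" using core_unit[of "p 1"] p2_lt p1_gt by simp
 have "It i y = p 1"
 proof (rule It_unique[OF It_unit[OF yu] pu, of \<nu>])
  show "side (\<nu> k) (It k (It i y))" for k using y(2)[of "i + k"] i[of k] It_add[of k i y] by (simp add: add.commute)
  show "side (\<nu> k) (It k (p 1))" for k using nu_side' by (simp add: It_p1)
 qed
 hence "It (n - 1 + i) y = p n" using It_add[of "n - 1" i y] It_p1[of "n - 1"] n_pos by simp
 hence "It (n - 1 + i) y = 1/2" using p_half_iff[of n] by simp
 then obtain j where j: "It j y = 1/2" by blast
 show ?thesis
 proof (rule ccontr)
  assume "\<not> ?thesis"
  then obtain x x' where x: "Adm x" "\<And>i. i < Suc j \<Longrightarrow> x i = l i" "ht l < ht x"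
   and x': "Adm x'" "\<And>i. i < Suc j \<Longrightarrow> x' i = l i" "ht x' < ht l" by (metis not_le)
  have beyond: "z \<noteq> y" if z: "\<And>i. side (w i) (It i z)" "Adm w" "\<And>i. i < Suc j \<Longrightarrow> w i = l i" "ht w \<noteq> ht l" for z w
  proof
   assume "z = y"
   hence "w (Suc j + k) = l (Suc j + k)" for k
    using Adm_after_turn[OF that(2) z(1), of j k] Adm_after_turn[OF a y(2) j, of k] j by simp
   hence "w i = l i" for i using z(3)[of i] by (cases "i < Suc j") (auto simp: not_less dest!: le_Suc_ex)
   thus False using z(4) by (metis )
  qed
  obtain z where z: "z \<in> {p 2..p 1}" "\<And>i. side (x i) (It i z)" by (rule Adm_point[OF x(1)]) blast
  obtain z' where z': "z' \<in> {p 2..p 1}" "\<And>i. side (x' i) (It i z')" by (rule Adm_point[OF x'(1)]) blast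
  have "z \<noteq> y" "z' \<noteq> y" using beyond[OF z(2) x(1,2)] beyond[OF z'(2) x'(1,2)] x(3) x'(3) by auto
  moreover have "\<not> z < y" using itinerary_ht[OF z(2) y(2) _ core_unit[OF z(1)] yu] x(3) by (meson less_asym)
  moreover have "\<not> y < z'" using itinerary_ht[OF y(2) z'(2) _ yu core_unit[OF z'(1)]] x'(3) by (meson less_asym)
  ultimately have lt: "y < z" "z' < y" by auto
  have sx: "side (l i) (It i z)" "side (l i) (It i z')" if "i < j" for i
  proof -
   have e: "x i = l i" "x' i = l i" using x(2) x'(2) that by simp_all
   show "side (l i) (It i z)" "side (l i) (It i z')" using z(2)[of i] z'(2)[of i] unfolding e by simp_all
  qed
  have d: "It j z - It j y = sgnp (onesl l j) * s ^ j * (z - y)" "It j y - It j z' = sgnp (onesl l j) * s ^ j * (y - z')"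
   using It_diff[of j l z y] It_diff[of j l y z'] sx y(2) by simp_all
  have pos: "0 < s ^ j * (z - y)" "0 < s ^ j * (y - z')" using lt by auto
  have sd: "side (l j) (It j z)" "side (l j) (It j z')" using z(2)[of j] z'(2)[of j] x(2)[of j] x'(2)[of j] by simp_all
  show False
  proof (cases "even (onesl l j)")
   case True
   hence "1/2 < It j z" "It j z' < 1/2" using d pos j by (simp_all add: sgnp_parity)
   thus False using sd by (auto simp: side_def split: if_splits)
  next
   case False
   hence "It j z < 1/2" "1/2 < It j z'" using d pos j by (simp_all add: sgnp_parity)
   thus False using sd by (auto simp: side_def split: if_splits)
  qed
 qed
qed

text \<open>If the orbit met the turning point, the sequence would have the tail
  \<open>\<nu>\<close>. So the point is generic, its first letters are constant in a neighbourhood,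
  and generic points on both sides of it provide the sequences.\<close>

lemma nontail_accumulated:
 assumes a: "Adm l" and nt: "\<not> ntail l"
 shows "\<exists>x. Adm x \<and> (\<forall>i<M. x i = l i) \<and> ht l < ht x" "\<exists>x. Adm x \<and> (\<forall>i<M. x i = l i) \<and> ht x < ht l"
proof -
 obtain y where y: "y \<in> {p 2..p 1}" "\<And>i. side (l i) (It i y)" by (rule Adm_point[OF a]) blast
 have g: "generic y" unfolding generic_def using Adm_after_turn[OF a y(2)] nt unfolding ntail_def by blast
 have "y \<noteq> p 1" "y \<noteq> p 2" using generic_not_p[OF g, of 0] by auto
 hence int: "p 2 < y" "y < p 1" using y(1) by auto
 have oi: "oit y d i = l i" if "d \<in> {1, -1}" for d i
  using oit_ssid1(2)[OF that, of y i] ssid_if[OF y(2)[of i]] g ssid_iff by (metis generic_def)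
 have yu: "y \<in> {0..1}" by (rule core_unit[OF y(1)])
 obtain e where e: "0 < e" "e < p 1 - y" "generic (y + 1 * e)" "\<And>i. i < M \<Longrightarrow> it (y + 1 * e) i = oit y 1 i"
  using oit_generic[of 1 "p 1 - y" y M] int by auto
 have c: "y + 1 * e \<in> {p 2..p 1}" using int e by auto
 have "ht l < ht (it (y + 1 * e))" by (rule itinerary_ht[OF y(2) it_side _ yu core_unit[OF c]]) (use e in simp)
 thus "\<exists>x. Adm x \<and> (\<forall>i<M. x i = l i) \<and> ht l < ht x" using generic_Adm[OF e(3) c] e(4) oi by (metis insertI1)
 obtain e where e: "0 < e" "e < y - p 2" "generic (y + -1 * e)" "\<And>i. i < M \<Longrightarrow> it (y + -1 * e) i = oit y (-1) i"
  using oit_generic[of "-1" "y - p 2" y M] int by auto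
 have c: "y + -1 * e \<in> {p 2..p 1}" using int e by auto
 have "ht (it (y + -1 * e)) < ht l" by (rule itinerary_ht[OF it_side y(2) _ core_unit[OF c] yu]) (use e in simp)
 thus "\<exists>x. Adm x \<and> (\<forall>i<M. x i = l i) \<and> ht x < ht l" using generic_Adm[OF e(3) c] e(4) oi by (metis insertI1 insertI2)
qed

end

section \<open>The planar drawing\<close>

definition sg :: "bool \<Rightarrow> real" where "sg r = (if r then 1 else -1)"

lemma sg_simps [simp]: "sg True = 1" "sg False = -1" "\<bar>sg r\<bar> = 1" "sg r * sg r = 1" "sg r \<noteq> 0"
 by (auto simp: sg_def)

text \<open>\<open>capE d z\<close> is \<open>sgn d * sqrt (d\<^sup>2 - z\<^sup>2)\<close> for \<open>\<bar>z\<bar> \<le> \<bar>d\<bar>\<close>, in a form that is visibly continuous.\<close>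

definition capE :: "real \<Rightarrow> real \<Rightarrow> real" where
 "capE d z = sqrt (max 0 (d * \<bar>d\<bar> - z\<^sup>2)) - sqrt (max 0 (- (d * \<bar>d\<bar>) - z\<^sup>2))"

lemma capE_pos: "0 \<le> d \<Longrightarrow> \<bar>z\<bar> \<le> \<bar>d\<bar> \<Longrightarrow> capE d z = sqrt (d\<^sup>2 - z\<^sup>2)"
proof -
 assume a: "0 \<le> d" "\<bar>z\<bar> \<le> \<bar>d\<bar>"
 have "z\<^sup>2 \<le> d\<^sup>2" using a(2) by (rule abs_le_square_iff[THEN iffD1])
 moreover have "d * \<bar>d\<bar> = d\<^sup>2" using a(1) by (simp add: power2_eq_square)
 moreover have "max 0 (- (d\<^sup>2) - z\<^sup>2) = 0" by (rule max_absorb1) simp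
 moreover have "max 0 (d\<^sup>2 - z\<^sup>2) = d\<^sup>2 - z\<^sup>2" by (rule max_absorb2) (use `z\<^sup>2 \<le> d\<^sup>2` in simp)
 ultimately show ?thesis unfolding capE_def by simp
qed

lemma capE_minus: "capE (- d) z = - capE d z" by (simp add: capE_def)

lemma capE_sq:
 assumes "\<bar>z\<bar> \<le> \<bar>d\<bar>" shows "(capE d z)\<^sup>2 = d\<^sup>2 - z\<^sup>2" "0 \<le> capE d z * d"
proof -
 have z: "z\<^sup>2 \<le> d\<^sup>2" using assms by (rule abs_le_square_iff[THEN iffD1])
 have e: "capE d z = (if 0 \<le> d then 1 else -1) * sqrt (d\<^sup>2 - z\<^sup>2)"
 proof (cases "0 \<le> d")
  case False
  hence "capE (- d) z = sqrt ((- d)\<^sup>2 - z\<^sup>2)" using assms by (intro capE_pos) auto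
  thus ?thesis using False capE_minus[of d z] by simp
 qed (use assms in "simp add: capE_pos")
 show "(capE d z)\<^sup>2 = d\<^sup>2 - z\<^sup>2" unfolding e using z by (simp add: power_mult_distrib)
 have "0 \<le> sqrt (d\<^sup>2 - z\<^sup>2)" using z by simp
 thus "0 \<le> capE d z * d" unfolding e by (auto simp: mult_nonneg_nonneg mult_nonneg_nonpos)
qed

lemma capE_unique:
 assumes "w\<^sup>2 = d\<^sup>2 - z\<^sup>2" "0 \<le> w * d" "d \<noteq> 0" shows "w = capE d z" "\<bar>z\<bar> \<le> \<bar>d\<bar>"
proof -
 have "z\<^sup>2 \<le> d\<^sup>2" using assms(1) zero_le_power2[of w] by linarith
 thus z: "\<bar>z\<bar> \<le> \<bar>d\<bar>" by (rule abs_le_square_iff[THEN iffD2])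
 have "(capE d z)\<^sup>2 = w\<^sup>2" using capE_sq(1)[OF z] assms(1) by simp
 hence "w = capE d z \<or> w = - capE d z" by (metis power2_eq_iff)
 moreover have "w = 0" if "w = - capE d z"
 using that capE_sq(2) z assms(2) assms(3) by force
 ultimately show "w = capE d z" by auto
qed

lemma capE_0 [simp]: "capE d 0 = d"
proof (cases "d = 0")
 case False
 thus ?thesis using capE_unique(1)[of d d 0] by simp
qed (simp add: capE_def)

lemma capE_tip [simp]: "capE d \<bar>d\<bar> = 0" using capE_sq(1)[of "\<bar>d\<bar>" d] by simp

text \<open>The centre \<open>u'\<close> of the smaller circle lies on or before the vertical line
  through \<open>u\<close>, so a point beyond this line is at least as far from \<open>u'\<close> as
  from \<open>u\<close> horizontally. One may thus argue as if \<open>u' = u\<close>, where the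
  smaller disc lies strictly inside the larger one.\<close>

lemma cap_disjoint:
 assumes "(X - u')\<^sup>2 + (Y - c')\<^sup>2 = r'\<^sup>2" "(X - u)\<^sup>2 + (Y - c)\<^sup>2 = r\<^sup>2" "\<bar>c - c'\<bar> + \<bar>r'\<bar> < \<bar>r\<bar>"
  "0 \<le> sg b * (X - u)" "sg b * (u' - u) \<le> 0"
 shows False
proof -
 define e where "e = \<bar>c - c'\<bar>"
 have "\<bar>X - u\<bar> \<le> \<bar>X - u'\<bar>" using assms(4,5) by (cases b) auto
 hence 1: "(X - u)\<^sup>2 \<le> (X - u')\<^sup>2" by (rule abs_le_square_iff[THEN iffD1])
 have "\<bar>Y - c\<bar> \<le> \<bar>\<bar>Y - c'\<bar> + e\<bar>" unfolding e_def by linarith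
 hence 2: "(Y - c)\<^sup>2 \<le> (\<bar>Y - c'\<bar> + e)\<^sup>2" by (rule abs_le_square_iff[THEN iffD1])
 have "(Y - c')\<^sup>2 \<le> r'\<^sup>2" using assms(1) zero_le_power2[of "X - u'"] by linarith
 hence 3: "\<bar>Y - c'\<bar> \<le> \<bar>r'\<bar>" by (rule abs_le_square_iff[THEN iffD2])
 have "r\<^sup>2 \<le> (X - u')\<^sup>2 + (\<bar>Y - c'\<bar> + e)\<^sup>2" using 1 2 assms(2) by linarith
 also have "\<dots> = r'\<^sup>2 + 2 * \<bar>Y - c'\<bar> * e + e\<^sup>2" using assms(1) by (simp add: power2_sum)
 also have "\<dots> \<le> r'\<^sup>2 + 2 * \<bar>r'\<bar> * e + e\<^sup>2" using 3 by (simp add: e_def mult_right_mono)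
 also have "\<dots> = (\<bar>r'\<bar> + e)\<^sup>2" by (simp add: power2_sum)
 also have "\<dots> < \<bar>r\<bar>\<^sup>2" using assms(3) by (intro power_strict_mono) (auto simp: e_def)
 finally show False by simp
qed

context tent_lhe
begin

definition en :: "bits \<Rightarrow> bool \<Rightarrow> real" where "en l r = (if r then hi l else lo l)"

definition fin :: "bits \<Rightarrow> bool \<Rightarrow> bool" where "fin l r \<longleftrightarrow> (\<exists>J. lastt l (en l r) J)"

definition Jl :: "bits \<Rightarrow> bool \<Rightarrow> nat" where "Jl l r = (THE J. lastt l (en l r) J)"

text \<open>The signed radius of the semicircle at the end \<open>r\<close> (\<open>True\<close> for
  the upper end). The value 0 at an end without semicircle lets the formulas below do without a case
  distinction.\<close>

definition dl :: "bits \<Rightarrow> bool \<Rightarrow> real" where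
 "dl l r = (if fin l r then ht l - yc l (Jl l r) else 0)"

lemma Jl_eq: "lastt l (en l r) J \<Longrightarrow> Jl l r = J"
 unfolding Jl_def using lastt_unique by (intro the_equality)

lemma fin_Jl: "fin l r \<Longrightarrow> lastt l (en l r) (Jl l r)" using Jl_eq by (auto simp: fin_def)

lemma dl_fin: "fin l r \<Longrightarrow> dl l r = ht l - yc l (Jl l r)" by (simp add: dl_def)

lemma dl_ne: "fin l r \<Longrightarrow> dl l r \<noteq> 0" using ht_ne_yc[of l] by (simp add: dl_def)

lemma dl_0: "dl l r \<noteq> 0 \<Longrightarrow> fin l r" by (auto simp: dl_def split: if_splits)

lemma dl_bound: "\<bar>dl l r\<bar> \<le> 1 / (2 * 3 ^ Jl l r)" using ht_yc[of l "Jl l r"] by (auto simp: dl_def)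

lemma en_in: "H l \<Longrightarrow> en l r \<in> B l" using H_ends_in by (simp add: en_def)

lemma tight_en: assumes "H l" "t \<in> B l" "lb l j t = s/2" shows "t = en l (even (onesl l j))"
 using tight_end[OF assms] by (simp add: en_def)

lemma en_parity: assumes "H l" "lb l j (en l r) = s/2" shows "even (onesl l j) = r" "sgnp (onesl l j) = sg r"
proof -
 show "even (onesl l j) = r" using tight_en[OF assms(1) en_in[OF assms(1)] assms(2)] B_ends(2)[OF assms(1)]
  by (cases r; cases "even (onesl l j)") (auto simp: en_def)
 thus "sgnp (onesl l j) = sg r" by (auto simp: sgnp_parity sg_def)
qed

lemma lastt_side:
 assumes "H l" "t \<in> B l" "lastt l t J"
 shows "t = en l (even (onesl l J))" "fin l (even (onesl l J))" "Jl l (even (onesl l J)) = J"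
using tight_en assms(1,2) assms(3) Jl_eq by (auto simp: lastt_def fin_def)

definition mt :: "bits \<Rightarrow> bool \<Rightarrow> nat \<Rightarrow> bool" where "mt l r = flip l (Jl l r)"

lemma mt_facts:
 assumes Hl: "H l" and f: "fin l r"
 shows "H (mt l r)" "en (mt l r) r = en l r" "fin (mt l r) r" "Jl (mt l r) r = Jl l r" "dl (mt l r) r = - dl l r"
  "pt (mt l r) (en l r) = pt l (en l r)" "mt l r \<noteq> l" "yc (mt l r) (Jl l r) = yc l (Jl l r)" "en l r \<in> B (mt l r)"
  "ht (mt l r) = yc l (Jl l r) - dl l r" "ht l = yc l (Jl l r) + dl l r" "mt (mt l r) r = l"
proof -
 define J where "J = Jl l r"
 have J: "lastt l (en l r) J" using fin_Jl[OF f] by (simp add: J_def)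
 note m = mate[OF Hl en_in[OF Hl] J]
 have mt: "mt l r = flip l J" by (simp add: mt_def J_def)
 show H': "H (mt l r)" and "en l r \<in> B (mt l r)" "pt (mt l r) (en l r) = pt l (en l r)" using m by (simp_all add: mt)
 have "even (onesl (flip l J) J) = r" using en_parity(1)[OF Hl, of J r] J onesl_flip[of J J l] by (simp add: lastt_def)
 hence s: "en l r = en (flip l J) r" "fin (flip l J) r" "Jl (flip l J) r = J" using lastt_side[OF m(1-3)] by auto
 thus "en (mt l r) r = en l r" "fin (mt l r) r" "Jl (mt l r) r = Jl l r" by (simp_all add: mt J_def)
 show "mt l r \<noteq> l" unfolding mt by (metis flip_simps(1))
 show y: "yc (mt l r) (Jl l r) = yc l (Jl l r)" unfolding mt J_def[symmetric] by (rule yc_cong) simp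
 show l: "ht l = yc l (Jl l r) + dl l r" using f by (simp add: dl_def)
 show h: "ht (mt l r) = yc l (Jl l r) - dl l r" using ht_flip[of l J] l by (simp add: mt J_def)
 show "dl (mt l r) r = - dl l r" using h y s(2,3) by (simp add: dl_def mt J_def)
 show "mt (mt l r) r = l" unfolding mt using s(3) by (simp add: mt_def)
qed

section \<open>Each basic arc drawn as a graph over an interval\<close>

definition out :: "bits \<Rightarrow> bool \<Rightarrow> real \<Rightarrow> real" where "out l r X = max 0 (sg r * (X - en l r))"

text \<open>A semicircle is divided at its tip between the two arcs that it joins. A segment with
  its quarter circles is then the graph of a function of the first coordinate.\<close>

definition gh :: "bits \<Rightarrow> real \<Rightarrow> real" where
 "gh l X = ht l - (dl l True - capE (dl l True) (out l True X)) - (dl l False - capE (dl l False) (out l False X))"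

text \<open>The affine map of \<open>B l\<close> onto the base of this graph, which exceeds
  \<open>B l\<close> by the radii at both ends.\<close>

definition sx :: "bits \<Rightarrow> real \<Rightarrow> real" where
 "sx l t = lo l - \<bar>dl l False\<bar> + (t - lo l) * ((hi l - lo l + \<bar>dl l False\<bar> + \<bar>dl l True\<bar>) / (hi l - lo l))"

definition Phi :: "bits \<Rightarrow> real \<Rightarrow> real \<times> real" where "Phi l t = (sx l t, gh l (sx l t))"

definition cap :: "bits \<Rightarrow> bool \<Rightarrow> real \<times> real \<Rightarrow> bool" where
 "cap l r z \<longleftrightarrow> fin l r \<and> 0 \<le> sg r * (fst z - en l r) \<and>
   (fst z - en l r)\<^sup>2 + (snd z - yc l (Jl l r))\<^sup>2 = (dl l r)\<^sup>2 \<and> 0 \<le> (snd z - yc l (Jl l r)) * dl l r"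

definition seg :: "bits \<Rightarrow> real \<times> real \<Rightarrow> bool" where
 "seg l z \<longleftrightarrow> lo l \<le> fst z \<and> fst z \<le> hi l \<and> snd z = ht l"

lemma sx_ends: assumes "H l" shows "sx l (lo l) = lo l - \<bar>dl l False\<bar>" "sx l (hi l) = hi l + \<bar>dl l True\<bar>"
 using B_ends(2)[OF assms] by (auto simp: sx_def)

lemma sx_less: assumes "H l" shows "sx l t < sx l t' \<longleftrightarrow> t < t'"
proof -
 define k where "k = (hi l - lo l + \<bar>dl l False\<bar> + \<bar>dl l True\<bar>) / (hi l - lo l)"
 have "0 < k" unfolding k_def using B_ends(2)[OF assms] by (intro divide_pos_pos) auto
 thus ?thesis unfolding sx_def k_def[symmetric] by simp
qed

lemma sx_inj: assumes "H l" shows "sx l t = sx l t' \<longleftrightarrow> t = t'"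
 using sx_less[OF assms, of t t'] sx_less[OF assms, of t' t] by force

lemma sx_range: assumes "H l" "t \<in> B l" shows "lo l - \<bar>dl l False\<bar> \<le> sx l t" "sx l t \<le> hi l + \<bar>dl l True\<bar>"
proof -
 have "\<not> t < lo l" "\<not> hi l < t" using B_ends(1)[OF assms(1)] assms(2) by auto
 thus "lo l - \<bar>dl l False\<bar> \<le> sx l t" "sx l t \<le> hi l + \<bar>dl l True\<bar>"
  using sx_less[OF assms(1), of t "lo l"] sx_less[OF assms(1), of "hi l" t] sx_ends[OF assms(1)] by auto
qed

lemma sx_surj:
 assumes "H l" "lo l - \<bar>dl l False\<bar> \<le> X" "X \<le> hi l + \<bar>dl l True\<bar>"
 obtains t where "t \<in> B l" "sx l t = X"
proof -
 define k where "k = (hi l - lo l + \<bar>dl l False\<bar> + \<bar>dl l True\<bar>) / (hi l - lo l)"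
 have k: "0 < k" unfolding k_def using B_ends(2)[OF assms(1)] by (intro divide_pos_pos) auto
 define t where "t = lo l + (X - (lo l - \<bar>dl l False\<bar>)) / k"
 have e: "sx l t = X" unfolding sx_def k_def[symmetric] t_def using k by simp
 have "lo l \<le> t" "t \<le> hi l"
  using sx_less[OF assms(1), of t "lo l"] sx_less[OF assms(1), of "hi l" t] sx_ends[OF assms(1)] assms(2,3) e by auto
 thus thesis using that e B_ends(1)[OF assms(1)] by auto
qed

lemma out_other: assumes "H l" "0 \<le> sg r * (X - en l r)" shows "out l (\<not> r) X = 0"
 using assms B_ends(2)[OF assms(1)] by (cases r) (auto simp: out_def en_def)

lemma gh_seg: "lo l \<le> X \<Longrightarrow> X \<le> hi l \<Longrightarrow> gh l X = ht l" by (simp add: gh_def out_def en_def)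

lemma gh_cap:
 assumes "H l" "0 \<le> sg r * (X - en l r)"
 shows "gh l X = ht l - dl l r + capE (dl l r) (sg r * (X - en l r))"
 using out_other[OF assms] assms(2) by (cases r) (simp_all add: gh_def out_def)

definition DD :: "bits \<Rightarrow> (real \<times> real) set" where "DD l = Phi l ` B l"

lemma DD_graph: assumes "H l" shows "DD l = {z. lo l - \<bar>dl l False\<bar> \<le> fst z \<and> fst z \<le> hi l + \<bar>dl l True\<bar> \<and> snd z = gh l (fst z)}"
proof (intro set_eqI iffI)
 fix z assume "z \<in> DD l"
 thus "z \<in> {z. lo l - \<bar>dl l False\<bar> \<le> fst z \<and> fst z \<le> hi l + \<bar>dl l True\<bar> \<and> snd z = gh l (fst z)}"
  using sx_range[OF assms] by (auto simp: DD_def Phi_def)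
next
 fix z assume z: "z \<in> {z. lo l - \<bar>dl l False\<bar> \<le> fst z \<and> fst z \<le> hi l + \<bar>dl l True\<bar> \<and> snd z = gh l (fst z)}"
 then obtain t where "t \<in> B l" "sx l t = fst z" using sx_surj[OF assms, of "fst z"] by blast
 hence "z = Phi l t" using z by (auto simp: Phi_def prod_eq_iff)
 thus "z \<in> DD l" using `t \<in> B l` by (simp add: DD_def)
qed

lemma DD_iff: assumes Hl: "H l" shows "z \<in> DD l \<longleftrightarrow> seg l z \<or> (\<exists>r. cap l r z)"
proof
 assume "z \<in> DD l"
 hence z: "lo l - \<bar>dl l False\<bar> \<le> fst z" "fst z \<le> hi l + \<bar>dl l True\<bar>" "snd z = gh l (fst z)" using DD_graph[OF Hl] by auto
 show "seg l z \<or> (\<exists>r. cap l r z)"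
 proof (cases "lo l \<le> fst z \<and> fst z \<le> hi l")
  case True
  thus ?thesis using z gh_seg by (simp add: seg_def)
 next
  case False
  define r where "r = (hi l < fst z)"
  define w where "w = sg r * (fst z - en l r)"
  have w: "0 < w" "w \<le> \<bar>dl l r\<bar>" using False z by (auto simp: w_def r_def en_def)
  hence f: "fin l r" using dl_0 by fastforce
  have "snd z = ht l - dl l r + capE (dl l r) w" using gh_cap[OF Hl, of r "fst z"] w z(3) by (simp add: w_def)
  hence y: "snd z - yc l (Jl l r) = capE (dl l r) w" using f by (simp add: dl_fin)
  have "\<bar>w\<bar> \<le> \<bar>dl l r\<bar>" using w by simp
  from capE_sq[OF this] have "w\<^sup>2 + (snd z - yc l (Jl l r))\<^sup>2 = (dl l r)\<^sup>2" "0 \<le> (snd z - yc l (Jl l r)) * dl l r"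
   unfolding y by simp_all
  moreover have "w\<^sup>2 = (fst z - en l r)\<^sup>2" unfolding w_def by (cases r) (simp_all add: power2_commute)
  ultimately have "cap l r z" using f w(1) unfolding cap_def w_def by simp
  thus ?thesis by blast
 qed
next
 assume "seg l z \<or> (\<exists>r. cap l r z)"
 thus "z \<in> DD l"
 proof
  assume "seg l z"
  hence "lo l \<le> fst z" "fst z \<le> hi l" "snd z = gh l (fst z)" using gh_seg[of l "fst z"] by (simp_all add: seg_def)
  moreover have "0 \<le> \<bar>dl l False\<bar>" "0 \<le> \<bar>dl l True\<bar>" by simp_all
  ultimately show ?thesis unfolding DD_graph[OF Hl] mem_Collect_eq by (intro conjI; linarith)
 next
  assume "\<exists>r. cap l r z"
  then obtain r where c: "cap l r z" by blast
  define w where "w = sg r * (fst z - en l r)"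
  have w2: "w\<^sup>2 = (fst z - en l r)\<^sup>2" unfolding w_def by (cases r) (simp_all add: power2_commute)
  have f: "fin l r" and w0: "0 \<le> w" using c by (auto simp: cap_def w_def)
  have "(snd z - yc l (Jl l r))\<^sup>2 = (dl l r)\<^sup>2 - w\<^sup>2" "0 \<le> (snd z - yc l (Jl l r)) * dl l r"
   using c unfolding cap_def w2 by simp_all
  from capE_unique[OF this dl_ne[OF f]] have y: "snd z - yc l (Jl l r) = capE (dl l r) w" "\<bar>w\<bar> \<le> \<bar>dl l r\<bar>" .
  have "snd z = gh l (fst z)"
   using gh_cap[OF Hl, of r "fst z"] w0 y(1) f by (simp add: w_def dl_fin)
  moreover have "lo l - \<bar>dl l False\<bar> \<le> fst z \<and> fst z \<le> hi l + \<bar>dl l True\<bar>"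
   using y(2) w0 B_ends(2)[OF Hl] by (cases r) (auto simp: w_def en_def)
  ultimately show ?thesis unfolding DD_graph[OF Hl] by simp
 qed
qed

section \<open>Disjointness of segments and semicircles\<close>

lemma cap_height: assumes "cap l r z" shows "\<bar>snd z - yc l (Jl l r)\<bar> \<le> \<bar>dl l r\<bar>"
proof -
 have "(snd z - yc l (Jl l r))\<^sup>2 \<le> (dl l r)\<^sup>2"
  using assms zero_le_power2[of "fst z - en l r"] unfolding cap_def by linarith
 thus ?thesis by (rule abs_le_square_iff[THEN iffD2])
qed

text \<open>A sequence with a height between the two ends of a semicircle shares the first
  \<open>Jl l r\<close> letters, hence also the constraint that is tight at that end; its arc cannot
  extend beyond it. This keeps segments from running into semicircles.\<close>

lemma between_cap:
 assumes Hl: "H l" and f: "fin l r" and x: "\<bar>ht x - yc l (Jl l r)\<bar> \<le> \<bar>dl l r\<bar>" "H x"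
 shows "\<And>i. i < Jl l r \<Longrightarrow> x i = l i" "\<And>u. u \<in> B x \<Longrightarrow> sg r * (u - en l r) \<le> 0"
proof -
 define J where "J = Jl l r"
 have J: "lastt l (en l r) J" using fin_Jl[OF f] by (simp add: J_def)
 have ag: "l i = mt l r i" if "i < J" for i using that by (simp add: mt_def J_def)
 have "(ht l \<le> ht x \<and> ht x \<le> ht (mt l r)) \<or> (ht (mt l r) \<le> ht x \<and> ht x \<le> ht l)"
  using mt_facts(10,11)[OF Hl f] x(1) by (auto simp: abs_le_iff abs_if split: if_splits)
 hence xe: "x i = l i" if "i < J" for i
  using ht_convex[of J l "mt l r" x i] ht_convex[of J "mt l r" l x i] ag that by metis
 thus "\<And>i. i < Jl l r \<Longrightarrow> x i = l i" by (simp add: J_def)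
 fix u assume u: "u \<in> B x"
 have "lb x J u = lb l J u" by (rule lb_cong) (use xe in auto)
 moreover have "lb x J u \<le> s/2" using u by (simp add: B_def2)
 moreover have "lb l J (en l r) = s/2" using J by (simp add: lastt_def)
 ultimately have "lb l J u - lb l J (en l r) \<le> 0" by linarith
 hence "1 / s ^ J * (sg r * (u - en l r)) \<le> 0"
  unfolding lb_diff using en_parity(2)[OF Hl, of J r] J by (simp add: lastt_def)
 moreover have "0 < 1 / s ^ J" by simp
 ultimately show "sg r * (u - en l r) \<le> 0" by (metis mult_le_cancel_left_pos mult_zero_right)
qed

lemma cap_nested:
 assumes l: "H l" "fin l r" and l': "H l'" "fin l' r"
  and ne: "l \<noteq> l'" "mt l r \<noteq> l'" "l \<noteq> mt l' r" "mt l r \<noteq> mt l' r"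
  and k: "\<bar>ht l' - yc l (Jl l r)\<bar> \<le> \<bar>dl l r\<bar>" "\<bar>ht (mt l' r) - yc l (Jl l r)\<bar> \<le> \<bar>dl l r\<bar>"
 shows "\<bar>yc l (Jl l r) - yc l' (Jl l' r)\<bar> + \<bar>dl l' r\<bar> < \<bar>dl l r\<bar> \<and> sg r * (en l' r - en l r) \<le> 0"
proof -
 define c c' d d' where defs: "c = yc l (Jl l r)" "c' = yc l' (Jl l' r)" "d = \<bar>dl l r\<bar>" "d' = \<bar>dl l' r\<bar>"
 have "c + d = ht l \<or> c + d = ht (mt l r)" "c - d = ht l \<or> c - d = ht (mt l r)"
  using mt_facts(10,11)[OF l] by (auto simp: defs abs_if)
 hence "ht l' \<noteq> c + d" "ht l' \<noteq> c - d" "ht (mt l' r) \<noteq> c + d" "ht (mt l' r) \<noteq> c - d"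
  using ne ht_inj by metis+
 moreover have e: "c' + d' = ht l' \<or> c' + d' = ht (mt l' r)" "c' - d' = ht l' \<or> c' - d' = ht (mt l' r)"
  using mt_facts(10,11)[OF l'] by (auto simp: defs abs_if)
 ultimately have "c' + d' \<noteq> c + d" "c' - d' \<noteq> c - d" by metis+
 moreover have "\<bar>(c' + d') - c\<bar> \<le> d" "\<bar>(c' - d') - c\<bar> \<le> d" using e k by (metis defs)+
 ultimately have "\<bar>c - c'\<bar> + d' < d" by linarith
 thus ?thesis using between_cap(2)[OF l, of l'] k(1) l'(1) en_in[OF l'(1)] by (simp add: defs)
qed

text \<open>If the height intervals of two semicircles on the same side overlap without inclusion,
  each contains an end of the other. Then \<open>between_cap\<close> in both directions makes the
  ends equal, and with them the indices and prefixes, so the semicircles have a common centre. In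
  case of inclusion they are strictly nested or have a common centre.\<close>

lemma cap_laminar:
 assumes l: "H l" "fin l r" and l': "H l'" "fin l' r"
  and Y: "\<bar>Y - yc l (Jl l r)\<bar> \<le> \<bar>dl l r\<bar>" "\<bar>Y - yc l' (Jl l' r)\<bar> \<le> \<bar>dl l' r\<bar>"
 shows "(Jl l r = Jl l' r \<and> (\<forall>i<Jl l r. l i = l' i) \<and> en l r = en l' r \<and> yc l (Jl l r) = yc l' (Jl l' r)) \<or>
   (\<bar>yc l (Jl l r) - yc l' (Jl l' r)\<bar> + \<bar>dl l' r\<bar> < \<bar>dl l r\<bar> \<and> sg r * (en l' r - en l r) \<le> 0) \<or>
   (\<bar>yc l' (Jl l' r) - yc l (Jl l r)\<bar> + \<bar>dl l r\<bar> < \<bar>dl l' r\<bar> \<and> sg r * (en l r - en l' r) \<le> 0)"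
proof -
 define c c' d d' where defs: "c = yc l (Jl l r)" "c' = yc l' (Jl l' r)" "d = \<bar>dl l r\<bar>" "d' = \<bar>dl l' r\<bar>"
 define conc where "conc \<longleftrightarrow> Jl l r = Jl l' r \<and> (\<forall>i<Jl l r. l i = l' i)"
 have conc: "en l r = en l' r \<and> yc l (Jl l r) = yc l' (Jl l' r)" if c: conc
 proof
  have "lb l (Jl l r) (en l r) = s/2" "lb l' (Jl l r) (en l' r) = s/2"
   using fin_Jl[OF l(2)] fin_Jl[OF l'(2)] c by (simp_all add: lastt_def conc_def)
  moreover have "lb l' (Jl l r) t = lb l (Jl l r) t" for t by (rule lb_cong) (use c in "simp add: conc_def")
  ultimately show "en l r = en l' r" using lb_inj[of l "Jl l r"] by simp
  show "yc l (Jl l r) = yc l' (Jl l' r)" using c yc_cong[of "Jl l r" l l'] by (simp add: conc_def)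
 qed
 note m = mt_facts[OF l] note m' = mt_facts[OF l']
 have in_conc: conc if a: "a = l \<or> a = mt l r" and b: "b = l' \<or> b = mt l' r" and e: "a = b" for a b
 proof -
  have "en l r = en l' r \<and> Jl l r = Jl l' r" using a b e m(2,4) m'(2,4) by auto
  moreover have "\<forall>i<Jl l r. l i = l' i" using a b e calculation unfolding mt_def by (metis flip_simps(2) less_irrefl)
  ultimately show ?thesis by (simp add: conc_def)
 qed
 have ne: "l \<noteq> l'" "mt l r \<noteq> l'" "l \<noteq> mt l' r" "mt l r \<noteq> mt l' r" if "\<not> conc" using in_conc that by blast+
 have nested: ?thesis if "\<not> conc" "\<bar>ht l' - c\<bar> \<le> d" "\<bar>ht (mt l' r) - c\<bar> \<le> d"
  using cap_nested[OF l l' ne[OF that(1)]] that by (simp add: defs)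
 have nested': ?thesis if "\<not> conc" "\<bar>ht l - c'\<bar> \<le> d'" "\<bar>ht (mt l r) - c'\<bar> \<le> d'"
  using cap_nested[OF l' l ne(1,3,2,4)[OF that(1), symmetric]] that by (simp add: defs)
 have crossing: conc if a: "a = l \<or> a = mt l r" "\<bar>ht a - c'\<bar> \<le> d'" and b: "b = l' \<or> b = mt l' r" "\<bar>ht b - c\<bar> \<le> d" for a b
 proof -
  have Ha: "H a" "lastt a (en l r) (Jl l r)" "en l r \<in> B a" using a(1) l m fin_Jl[OF l(2)] fin_Jl[OF m(3)] en_in[OF l(1)] by auto
  have Hb: "H b" "lastt b (en l' r) (Jl l' r)" "en l' r \<in> B b" using b(1) l' m' fin_Jl[OF l'(2)] fin_Jl[OF m'(3)] en_in[OF l'(1)] by auto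
  have Ab: "\<And>i. i < Jl l r \<Longrightarrow> b i = l i" "sg r * (en l' r - en l r) \<le> 0"
   using between_cap[OF l, of b] b(2) Hb by (auto simp: defs)
  have Ba: "\<And>i. i < Jl l' r \<Longrightarrow> a i = l' i" "sg r * (en l r - en l' r) \<le> 0"
   using between_cap[OF l', of a] a(2) Ha by (auto simp: defs)
  have e: "en l r = en l' r" using Ab(2) Ba(2) by (cases r) auto
  have al: "i < Jl l r \<Longrightarrow> a i = l i" for i using a(1) by (auto simp: mt_def)
  have bl: "i < Jl l' r \<Longrightarrow> b i = l' i" for i using b(1) by (auto simp: mt_def)
  have "\<not> Jl l r < Jl l' r"
  proof
   assume lt: "Jl l r < Jl l' r"
   have "lb a (Jl l' r) (en l r) = lb b (Jl l' r) (en l r)" by (rule lb_cong) (simp add: Ba(1) bl)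
   moreover have "lb a (Jl l' r) (en l r) \<noteq> s/2" using Ha(2) lt unfolding lastt_def by blast
   moreover have "lb b (Jl l' r) (en l' r) = s/2" using Hb(2) unfolding lastt_def by blast
   ultimately show False using e by simp
  qed
  moreover have "\<not> Jl l' r < Jl l r"
  proof
   assume lt: "Jl l' r < Jl l r"
   have "lb b (Jl l r) (en l r) = lb a (Jl l r) (en l r)" by (rule lb_cong) (simp add: Ab(1) al)
   moreover have "lb b (Jl l r) (en l' r) \<noteq> s/2" using Hb(2) lt unfolding lastt_def by blast
   moreover have "lb a (Jl l r) (en l r) = s/2" using Ha(2) unfolding lastt_def by blast
   ultimately show False using e by simp
  qed
  ultimately have J: "Jl l r = Jl l' r" by simp
  moreover have "l i = l' i" if "i < Jl l r" for i using Ab(1)[OF that] bl[of i] that J by simp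
  ultimately show ?thesis by (simp add: conc_def)
 qed
 show ?thesis
 proof (cases conc)
  case True
  thus ?thesis using conc by (simp add: conc_def)
 next
  case nc: False
  have hl: "{ht l, ht (mt l r)} = {c + d, c - d}" using m(10,11) by (auto simp: defs abs_if)
  have hl': "{ht l', ht (mt l' r)} = {c' + d', c' - d'}" using m'(10,11) by (auto simp: defs abs_if)
  obtain a1 a2 where a: "{a1, a2} = {l, mt l r}" "ht a1 = c + d" "ht a2 = c - d"
   using m(10,11) by (cases "0 \<le> dl l r") (force simp: defs)+
  obtain b1 b2 where b: "{b1, b2} = {l', mt l' r}" "ht b1 = c' + d'" "ht b2 = c' - d'"
   using m'(10,11) by (cases "0 \<le> dl l' r") (force simp: defs)+
  have Yd: "c - d \<le> Y" "Y \<le> c + d" "c' - d' \<le> Y" "Y \<le> c' + d'" using Y by (auto simp: defs abs_le_iff)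
  have am: "a1 = l \<or> a1 = mt l r" "a2 = l \<or> a2 = mt l r" "b1 = l' \<or> b1 = mt l' r" "b2 = l' \<or> b2 = mt l' r" using a(1) b(1) by blast+
  consider "c' + d' \<le> c + d" "c - d \<le> c' - d'" | "c + d \<le> c' + d'" "c' - d' \<le> c - d"
   | "c' + d' \<le> c + d" "c' - d' \<le> c - d" | "c + d \<le> c' + d'" "c - d \<le> c' - d'" by linarith
  thus ?thesis
  proof cases
   case 1
   have "\<bar>h - c\<bar> \<le> d" if "h \<in> {ht l', ht (mt l' r)}" for h using that 1 Yd unfolding hl' by (auto simp: abs_le_iff)
   thus ?thesis using nested[OF nc] by simp
  next
   case 2
   have "\<bar>h - c'\<bar> \<le> d'" if "h \<in> {ht l, ht (mt l r)}" for h using that 2 Yd unfolding hl by (auto simp: abs_le_iff)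
   thus ?thesis using nested'[OF nc] by simp
  next
   case 3
   have "\<bar>ht a2 - c'\<bar> \<le> d'" "\<bar>ht b1 - c\<bar> \<le> d" using 3 Yd a b by (auto simp: abs_le_iff)
   thus ?thesis using crossing[of a2 b1] am nc by blast
  next
   case 4
   have "\<bar>ht a1 - c'\<bar> \<le> d'" "\<bar>ht b2 - c\<bar> \<le> d" using 4 Yd a b by (auto simp: abs_le_iff)
   thus ?thesis using crossing[of a1 b2] am nc by blast
  qed
 qed
qed

lemma seg_cap:
 assumes "H l" "H l'" "seg l' z" "cap l r z" shows "l' = l"
proof -
 have f: "fin l r" using assms(4) by (simp add: cap_def)
 have "\<bar>ht l' - yc l (Jl l r)\<bar> \<le> \<bar>dl l r\<bar>" using cap_height[OF assms(4)] assms(3) by (simp add: seg_def)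
 moreover have "fst z \<in> B l'" using assms(3) B_ends(1)[OF assms(2)] by (simp add: seg_def)
 ultimately have "sg r * (fst z - en l r) \<le> 0" using between_cap(2)[OF assms(1) f _ assms(2)] by blast
 hence "fst z - en l r = 0" using assms(4) by (cases r) (auto simp: cap_def)
 hence e: "(ht l' - yc l (Jl l r))\<^sup>2 = (dl l r)\<^sup>2" "0 \<le> (ht l' - yc l (Jl l r)) * dl l r"
  using assms(3,4) by (auto simp: cap_def seg_def)
 hence "ht l' - yc l (Jl l r) = dl l r" using capE_unique(1)[of _ "dl l r" 0] dl_ne[OF f] by simp
 hence "ht l' = ht l" using mt_facts(11)[OF assms(1) f] by simp
 thus ?thesis by (simp add: ht_inj)
qed

text \<open>The lower of the two upper ends has a height within the other semicircle. By
  \<open>between_cap\<close> its whole arc would lie on one side of that semicircle, although the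
  meeting point puts it on the other.\<close>

lemma cap_cap_opposite:
 assumes "H l" "H l'" "cap l True z" "cap l' False z" shows False
proof -
 have f: "fin l True" "fin l' False" and X: "hi l \<le> fst z" "fst z \<le> lo l'" using assms by (auto simp: cap_def en_def)
 note Y = cap_height[OF assms(3)] cap_height[OF assms(4)]
 note m = mt_facts[OF assms(1) f(1)] note m' = mt_facts[OF assms(2) f(2)]
 have A: False if "b = l' \<or> b = mt l' False" "\<bar>ht b - yc l (Jl l True)\<bar> \<le> \<bar>dl l True\<bar>" for b
 proof -
  have Hb: "H b" "lo b = lo l'" using that(1) assms(2) m'(1,2) by (auto simp: en_def)
  have "hi b \<le> hi l" using between_cap(2)[OF assms(1) f(1) that(2) Hb(1), of "hi b"] H_ends_in[OF Hb(1)] by (simp add: en_def)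
  thus False using X Hb B_ends(2)[OF Hb(1)] by simp
 qed
 have A': False if "b = l \<or> b = mt l True" "\<bar>ht b - yc l' (Jl l' False)\<bar> \<le> \<bar>dl l' False\<bar>" for b
 proof -
  have Hb: "H b" "hi b = hi l" using that(1) assms(1) m(1,2) by (auto simp: en_def)
  have "lo l' \<le> lo b" using between_cap(2)[OF assms(2) f(2) that(2) Hb(1), of "lo b"] H_ends_in[OF Hb(1)] by (simp add: en_def)
  thus False using X Hb B_ends(2)[OF Hb(1)] by simp
 qed
 define c c' d d' where defs: "c = yc l (Jl l True)" "c' = yc l' (Jl l' False)" "d = \<bar>dl l True\<bar>" "d' = \<bar>dl l' False\<bar>"
 obtain a1 where a: "a1 = l \<or> a1 = mt l True" "ht a1 = c + d" using m(10,11) by (cases "0 \<le> dl l True") (force simp: defs)+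
 obtain b1 where b: "b1 = l' \<or> b1 = mt l' False" "ht b1 = c' + d'" using m'(10,11) by (cases "0 \<le> dl l' False") (force simp: defs)+
 have Yd: "c - d \<le> snd z" "snd z \<le> c + d" "c' - d' \<le> snd z" "snd z \<le> c' + d'" using Y by (auto simp: defs abs_le_iff)
 show False
 proof (cases "c + d \<le> c' + d'")
  case True
  hence "\<bar>ht a1 - c'\<bar> \<le> d'" using a Yd by (auto simp: abs_le_iff)
  thus False using A'[OF a(1)] unfolding defs by blast
 next
  case False
  hence "\<bar>ht b1 - c\<bar> \<le> d" using b Yd by (auto simp: abs_le_iff)
  thus False using A[OF b(1)] unfolding defs by blast
 qed
qed

text \<open>Heights are injective, so segments do not meet each other; by the preceding lemmas only
  quarter circles with a common centre can meet, and two different ones are those of mates, which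
  share just the tip.\<close>

lemma DD_meet:
 assumes l: "H l" "z \<in> DD l" and l': "H l'" "z \<in> DD l'" and ne: "l \<noteq> l'"
 obtains r where "fin l r" "l' = mt l r" "fst z = en l r + sg r * \<bar>dl l r\<bar>"
proof -
 have "\<not> seg l z" "\<not> seg l' z"
 proof -
  show "\<not> seg l z"
  proof
   assume s: "seg l z"
   hence "\<not> seg l' z" using ne ht_inj by (auto simp: seg_def)
   then obtain r where "cap l' r z" using l' DD_iff by blast
   thus False using seg_cap[OF l'(1) l(1) s] ne by blast
  qed
  show "\<not> seg l' z"
  proof
   assume s: "seg l' z"
   hence "\<not> seg l z" using ne ht_inj by (auto simp: seg_def)
   then obtain r where "cap l r z" using l DD_iff by blast
   thus False using seg_cap[OF l(1) l'(1) s] ne by blast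
  qed
 qed
 then obtain r r' where c: "cap l r z" "cap l' r' z" using l l' DD_iff by metis
 have rr: "r' = r" using cap_cap_opposite[OF l(1) l'(1), of z] cap_cap_opposite[OF l'(1) l(1), of z] c by (cases r; cases r') auto
 have c: "cap l r z" "cap l' r z" using c rr by auto
 have f: "fin l r" "fin l' r" using c by (auto simp: cap_def)
 have cc: "(fst z - en l r)\<^sup>2 + (snd z - yc l (Jl l r))\<^sup>2 = (dl l r)\<^sup>2" "0 \<le> sg r * (fst z - en l r)"
  "(fst z - en l' r)\<^sup>2 + (snd z - yc l' (Jl l' r))\<^sup>2 = (dl l' r)\<^sup>2" "0 \<le> sg r * (fst z - en l' r)"
  "0 \<le> (snd z - yc l (Jl l r)) * dl l r" "0 \<le> (snd z - yc l' (Jl l' r)) * dl l' r"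
  using c by (auto simp: cap_def)
 have conc: "Jl l r = Jl l' r" "\<forall>i<Jl l r. l i = l' i" "en l r = en l' r" "yc l (Jl l r) = yc l' (Jl l' r)"
  using cap_laminar[OF l(1) f(1) l'(1) f(2) cap_height[OF c(1)] cap_height[OF c(2)]]
   cap_disjoint[OF cc(3) cc(1) _ cc(2)] cap_disjoint[OF cc(1) cc(3) _ cc(4)] by blast+
 hence "(dl l r)\<^sup>2 = (dl l' r)\<^sup>2" using cc(1,3) by simp
 then consider "dl l' r = dl l r" | "dl l' r = - dl l r" by (metis power2_eq_iff)
 thus thesis
 proof cases
  case 1
  hence "ht l = ht l'" using mt_facts(11)[OF l(1) f(1)] mt_facts(11)[OF l'(1) f(2)] conc by simp
  thus ?thesis using ne ht_inj by blast
 next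
  case 2
  hence "ht l' = ht (mt l r)" using mt_facts(10)[OF l(1) f(1)] mt_facts(11)[OF l'(1) f(2)] conc by simp
  hence m: "l' = mt l r" by (simp add: ht_inj)
  have "(snd z - yc l (Jl l r)) * dl l r = 0" using cc(5,6) 2 conc by simp
  hence "snd z = yc l (Jl l r)" using dl_ne[OF f(1)] by simp
  hence "(fst z - en l r)\<^sup>2 = (dl l r)\<^sup>2" using cc(1) by simp
  hence "\<bar>fst z - en l r\<bar> = \<bar>dl l r\<bar>" by (simp add: power2_eq_iff abs_eq_iff)
  hence "fst z = en l r + sg r * \<bar>dl l r\<bar>" using cc(2) by (cases r) auto
  thus ?thesis using that f m by blast
 qed
qed

end

section \<open>Existence of the drawing\<close>

lemma capE_continuous [continuous_intros]:
 assumes "continuous_on A f" "continuous_on A g" shows "continuous_on A (\<lambda>x. capE (f x) (g x))"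
 unfolding capE_def by (intro continuous_intros assms)

text \<open>\<open>Phi\<close> for fixed ends \<open>a\<close> and \<open>b\<close>, as a function
  of both radii, the height and the point. It is jointly continuous, and \<open>B_markov\<close>
  makes the ends locally constant.\<close>

definition GG :: "real \<Rightarrow> real \<Rightarrow> real \<times> real \<times> real \<times> real \<Rightarrow> real \<times> real" where
 "GG a b q = (let dF = fst q; dT = fst (snd q); h = fst (snd (snd q)); t = snd (snd (snd q));
   X = a - \<bar>dF\<bar> + (t - a) * ((b - a + \<bar>dF\<bar> + \<bar>dT\<bar>) / (b - a))
  in (X, h - (dT - capE dT (max 0 (X - b))) - (dF - capE dF (max 0 (a - X)))))"

lemma GG_continuous: "continuous_on UNIV (GG a b)"
 unfolding GG_def Let_def by (cases "b - a = 0") (auto intro!: continuous_intros)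

lemma tent_continuous: "continuous_on UNIV (tent s)"
 unfolding tent_def by (intro continuous_intros)

lemma coordinate_tendsto: fixes x :: "nat \<Rightarrow> real" shows "((\<lambda>y. y j) \<longlongrightarrow> x j) (at x within S)"
proof -
 have "continuous_on UNIV (\<lambda>y :: nat \<Rightarrow> real. y j)" by simp
 hence "((\<lambda>y. y j) \<longlongrightarrow> x j) (at x)" unfolding continuous_on_def by simp
 thus ?thesis by (rule tendsto_within_subset) simp
qed

lemma compact_inv_lim: "compact (inv_lim s)"
proof -
 have "compactin (product_topology (\<lambda>_::nat. euclidean) UNIV) (PiE UNIV (\<lambda>_. {0..1::real}))"
  by (subst compactin_PiE) simp
 hence c: "compact (PiE (UNIV::nat set) (\<lambda>_. {0..1::real}))"
  unfolding euclidean_product_topology compactin_euclidean_iff .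
 have t: "continuous_on UNIV (\<lambda>x :: nat \<Rightarrow> real. tent s (x i))" for i
  using continuous_on_compose2[OF tent_continuous, of UNIV "\<lambda>x :: nat \<Rightarrow> real. x i"] by simp
 have "closed {x. tent s (x (Suc i)) = x i}" for i
  by (rule closed_Collect_eq[OF t]) simp
 hence "closed (\<Inter>i. {x. tent s (x (Suc i)) = x i})" by (intro closed_INT) auto
 moreover have "inv_lim s = PiE UNIV (\<lambda>_. {0..1}) \<inter> (\<Inter>i. {x. tent s (x (Suc i)) = x i})"
  by (auto simp: inv_lim_def)
 ultimately show ?thesis using compact_Int_closed[OF c] by simp
qed

lemma compact_core: "compact (core s)"
proof -
 have "closed {x :: nat \<Rightarrow> real. a \<le> x i \<and> x i \<le> b}" for i a b
  by (intro closed_Collect_conj closed_Collect_le) simp_all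
 hence "closed {x :: nat \<Rightarrow> real. x i \<in> {a..b}}" for i a b by simp
 hence "closed (\<Inter>i. {x :: nat \<Rightarrow> real. x i \<in> {tent s (tent s (1/2)) .. tent s (1/2)}})" by (intro closed_INT) blast
 moreover have "core s = inv_lim s \<inter> (\<Inter>i. {x. x i \<in> {tent s (tent s (1/2)) .. tent s (1/2)}})" by (auto simp: core_def)
 ultimately show ?thesis using compact_Int_closed[OF compact_inv_lim] by simp
qed

context tent_lhe
begin

lemma Phi_GG: "Phi l t = GG (lo l) (hi l) (dl l False, dl l True, ht l, t)"
by (auto simp: out_def en_def Phi_def GG_def Let_def gh_def sx_def)

lemma Phi_tip:
 assumes "H l" "fin l r" shows "Phi l (en l r) = (en l r + sg r * \<bar>dl l r\<bar>, yc l (Jl l r))"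
proof -
 have X: "sx l (en l r) = en l r + sg r * \<bar>dl l r\<bar>" using sx_ends[OF assms(1)] by (cases r) (simp_all add: en_def)
 have w: "sg r * (en l r + sg r * \<bar>dl l r\<bar> - en l r) = \<bar>dl l r\<bar>" by (cases r) simp_all
 have "gh l (en l r + sg r * \<bar>dl l r\<bar>) = ht l - dl l r + capE (dl l r) \<bar>dl l r\<bar>"
  using gh_cap[OF assms(1), of r "en l r + sg r * \<bar>dl l r\<bar>"] unfolding w by simp
 thus ?thesis using assms(2) unfolding Phi_def X by (simp add: dl_fin)
qed

lemma Phi_mate: "H l \<Longrightarrow> fin l r \<Longrightarrow> Phi (mt l r) (en l r) = Phi l (en l r)"
 using Phi_tip[of l r] Phi_tip[of "mt l r" r] mt_facts[of l r] by simp

lemma reps_mate: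
 assumes "H l" "H l'" "t \<in> B l" "t \<in> B l'" "pt l t = pt l' t" "l \<noteq> l'"
 obtains r where "fin l r" "t = en l r" "l' = mt l r"
using that same_point assms lastt_side assms(1,3) by (metis mt_def)

section \<open>The map to the plane: independence of the representation, injectivity,
  continuity\<close>

definition isrep :: "bits \<Rightarrow> (nat \<Rightarrow> real) \<Rightarrow> bool" where
 "isrep l x \<longleftrightarrow> H l \<and> x 0 \<in> B l \<and> x = pt l (x 0)"

lemma isrep_pt: "H l \<Longrightarrow> t \<in> B l \<Longrightarrow> isrep l (pt l t)" by (simp add: isrep_def)

lemma isrep_ex: "x \<in> inv_lim s \<Longrightarrow> \<exists>l. isrep l x" using inv_lim_rep[of x] by (metis isrep_def)

lemma isrep_lb: "isrep l x \<Longrightarrow> lb l j (x 0) = x j" by (metis isrep_def pt_def)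

lemma isrep_inv_lim: "isrep l x \<Longrightarrow> x \<in> inv_lim s" using pt_inv_lim by (metis isrep_def)

lemma isrep_side: "isrep l x \<Longrightarrow> side (l j) (x (Suc j))"
 using side_lb[of l j "x 0"] isrep_lb[of l x] by (simp add: isrep_def B_def2)

lemma isrep_basic_arc: "isrep l x \<longleftrightarrow> H l \<and> x \<in> basic_arc s l"
 by (auto simp: isrep_def basic_arc_eq)

definition drw :: "(nat \<Rightarrow> real) \<Rightarrow> real \<times> real" where "drw x = Phi (SOME l. isrep l x) (x 0)"

text \<open>Two different representations of a point are mates, and for both of them
  \<open>Phi\<close> sends the common end to the tip of the joining semicircle.\<close>

lemma drw_rep: assumes "isrep l x" shows "drw x = Phi l (x 0)"
proof -
 define l0 where "l0 = (SOME l. isrep l x)"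
 have r: "isrep l0 x" unfolding l0_def by (rule someI[where P="\<lambda>l. isrep l x", OF assms])
 have e: "pt l (x 0) = pt l0 (x 0)" using assms r by (metis isrep_def)
 show ?thesis
 proof (cases "l0 = l")
  case False
  then obtain r' where "fin l r'" "x 0 = en l r'" "l0 = mt l r'"
   using reps_mate[of l l0 "x 0"] assms r e by (metis isrep_def)
  thus ?thesis using Phi_mate[of l r'] assms unfolding drw_def l0_def[symmetric] by (simp add: isrep_def)
 qed (simp add: drw_def l0_def)
qed

lemma drw_pt: "H l \<Longrightarrow> t \<in> B l \<Longrightarrow> drw (pt l t) = Phi l t"
 using drw_rep[OF isrep_pt] by simp

lemma drw_inj: "inj_on drw (inv_lim s)"
proof (rule inj_onI)
 fix x y assume xy: "x \<in> inv_lim s" "y \<in> inv_lim s" "drw x = drw y"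
 obtain l l' where r: "isrep l x" "isrep l' y" using isrep_ex xy by metis
 define z where "z = Phi l (x 0)"
 have z: "z = Phi l' (y 0)" using xy(3) drw_rep[OF r(1)] drw_rep[OF r(2)] by (simp add: z_def)
 have r': "H l" "x 0 \<in> B l" "H l'" "y 0 \<in> B l'" using r by (auto simp: isrep_def)
 have zD: "z \<in> DD l" unfolding DD_def z_def by (rule imageI[OF r'(2)])
 have zD': "z \<in> DD l'" unfolding DD_def z by (rule imageI[OF r'(4)])
 show "x = y"
 proof (cases "l = l'")
  case True
  hence "sx l (x 0) = sx l (y 0)" using z by (simp add: z_def Phi_def)
  hence "x 0 = y 0" using sx_inj[OF r'(1)] by simp
  thus ?thesis using r True unfolding isrep_def by metis
 next
  case False
  then obtain q where q: "fin l q" "l' = mt l q" "fst z = en l q + sg q * \<bar>dl l q\<bar>"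
   by (rule DD_meet[OF r'(1) zD r'(3) zD'])
  note m = mt_facts[OF r'(1) q(1)]
  have "sx l (x 0) = sx l (en l q)" using q(3) Phi_tip[OF r'(1) q(1)] by (simp add: z_def Phi_def)
  hence x0: "x 0 = en l q" using sx_inj[OF r'(1)] by simp
  have "sx l' (y 0) = sx l' (en l' q)"
   using q(2,3) Phi_tip[of l' q] r'(3) m(2,3,5) z by (simp add: Phi_def)
  hence y0: "y 0 = en l q" using sx_inj[OF r'(3)] m(2) q(2) by simp
  have "x = pt l (en l q)" using r(1) unfolding isrep_def x0 by blast
  moreover have "y = pt l' (en l q)" using r(2) unfolding isrep_def y0 by blast
  ultimately show ?thesis using m(6) q(2) by simp
 qed
qed

lemma en_agree: assumes "H l" "H l'" "\<And>i. i < n \<Longrightarrow> l i = l' i" shows "en l' r = en l r"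
 using B_markov[OF assms] by (simp add: en_def)

lemma lastt_agree:
 assumes "H l" "H l'" "\<And>i. i < M \<Longrightarrow> l i = l' i" "J + n \<le> M" "lastt l (en l r) J"
 shows "lastt l' (en l' r) J"
proof -
 have e: "en l' r = en l r" by (rule en_agree[OF assms(1,2)]) (use assms in auto)
 have c: "lb l' j t = lb l j t" if "j \<le> M" for j t by (rule lb_cong) (use assms that in auto)
 show ?thesis using assms(4,5) c[of J] c[of "J + n"] e lastt_iff[OF en_in[OF assms(1)]] lastt_iff[OF en_in[OF assms(2)]]
  by (metis add_leD1)
qed

text \<open>If the last tight index is visible in the first \<open>M\<close> letters, both sequences
  have it in common and only the heights differ, by at most \<open>1 / 3 ^ M\<close>. Otherwise both
  radii are small, because the index exceeds \<open>M - n\<close> or there is no semicircle.\<close>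

lemma dl_agree:
 assumes "H l" "H l'" "\<And>i. i < M \<Longrightarrow> l i = l' i" "n \<le> M"
 shows "\<bar>dl l r - dl l' r\<bar> \<le> 2 * 3 ^ n / 3 ^ M"
proof (cases "\<exists>J. lastt l (en l r) J \<and> J + n \<le> M")
 case True
 then obtain J where J: "lastt l (en l r) J" "J + n \<le> M" by blast
 have J': "lastt l' (en l' r) J" by (rule lastt_agree[OF assms(1-3) J(2,1)])
 have "dl l r = ht l - yc l J" "dl l' r = ht l' - yc l' J"
  using J J' Jl_eq by (auto simp: dl_def fin_def)
 moreover have "yc l J = yc l' J" by (rule yc_cong) (use assms(3) J in auto)
 ultimately have "\<bar>dl l r - dl l' r\<bar> \<le> 1 / 3 ^ M" using ht_close[of M l l'] assms(3) by simp
 also have "\<dots> \<le> 2 * 3 ^ n / 3 ^ M"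
 proof (rule divide_right_mono)
  have "(1::real) \<le> 3 ^ n" by simp
  thus "(1::real) \<le> 2 * 3 ^ n" by linarith
 qed simp
 finally show ?thesis .
next
 case False
 have small: "\<bar>dl x r\<bar> \<le> 3 ^ n / 3 ^ M" if x: "\<not> (\<exists>J. lastt x (en x r) J \<and> J + n \<le> M)" for x
 proof (cases "fin x r")
  case True
  have "M < Jl x r + n" using x fin_Jl[OF True] by (meson not_le)
  hence "(3::real) ^ M \<le> 3 ^ (Jl x r + n)" by (intro power_increasing) auto
  hence "(3::real) ^ M \<le> 3 ^ n * 3 ^ Jl x r" by (simp add: power_add mult.commute)
  moreover have "(0::real) < 3 ^ n * 3 ^ Jl x r" by simp
  ultimately have "(3::real) ^ M \<le> 2 * (3 ^ n * 3 ^ Jl x r)" by linarith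
  hence "(3::real) ^ M \<le> 3 ^ n * (2 * 3 ^ Jl x r)" by (simp only: mult.left_commute)
  hence "1 / (2 * 3 ^ Jl x r) \<le> (3 ^ n / 3 ^ M :: real)" by (simp add: field_simps)
  thus ?thesis using dl_bound[of x r] by linarith
 qed (simp add: dl_def)
 have "\<not> (\<exists>J. lastt l' (en l' r) J \<and> J + n \<le> M)"
 proof
  assume "\<exists>J. lastt l' (en l' r) J \<and> J + n \<le> M"
  then obtain J where J: "lastt l' (en l' r) J" "J + n \<le> M" by blast
  have "lastt l (en l r) J" by (rule lastt_agree[OF assms(2,1) _ J(2,1)]) (use assms(3) in auto)
  thus False using False J(2) by blast
 qed
 hence "\<bar>dl l' r\<bar> \<le> 3 ^ n / 3 ^ M" by (rule small)
 moreover have "\<bar>dl l r\<bar> \<le> 3 ^ n / 3 ^ M" by (rule small[OF False])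
 moreover have "2 * 3 ^ n / 3 ^ M = 3 ^ n / 3 ^ M + (3 ^ n / 3 ^ M :: real)" by simp
 ultimately show ?thesis by linarith
qed

lemma inv_lim_It: "x \<in> inv_lim s \<Longrightarrow> It k (x (j + k)) = x j"
proof (induction k arbitrary: j)
 case (Suc k)
 have "It (Suc k) (x (j + Suc k)) = tent s (It k (x (Suc j + k)))" by (simp add: It_Suc)
 also have "\<dots> = tent s (x (Suc j))" using Suc.IH[OF Suc.prems, of "Suc j"] by simp
 finally show ?case using Suc.prems by (simp add: inv_lim_def)
qed simp

text \<open>Away from the turning point letters are locally constant. At the turning point, if
  \<open>j\<close> is not the last tight index, the coordinate \<open>j + n\<close> is
  \<open>p 1\<close>; nearby it is \<open>p 1\<close> or slightly less, and in both cases the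
  letters after it follow \<open>\<nu>\<close>.\<close>

lemma nearby_letter:
 assumes x: "isrep l x" and nl: "\<not> lastt l (x 0) j"
 shows "\<forall>\<^sub>F y in at x within inv_lim s. \<forall>l'. isrep l' y \<longrightarrow> l' j = l j"
proof -
 have xi: "x \<in> inv_lim s" by (rule isrep_inv_lim[OF x])
 have xB: "H l" "x 0 \<in> B l" using x by (auto simp: isrep_def)
 note lim = coordinate_tendsto[of _ x "inv_lim s"]
 show ?thesis
 proof (cases "x (Suc j) = 1/2")
  case False
  hence ss: "ssid (l j) (x (Suc j))" using ssid_if[OF isrep_side[OF x]] by simp
  have "\<forall>\<^sub>F y in at x within inv_lim s. ssid (l j) (y (Suc j))"
  proof (cases "l j")
   case True
   hence "1/2 < x (Suc j)" using ss by (simp add: ssid_def)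
   from order_tendstoD(1)[OF lim this] show ?thesis using True by (simp add: ssid_def)
  next
   case False
   hence "x (Suc j) < 1/2" using ss by (simp add: ssid_def)
   from order_tendstoD(2)[OF lim this] show ?thesis using False by (simp add: ssid_def)
  qed
  thus ?thesis by (rule eventually_mono) (use isrep_side ssid_iff in blast)
 next
  case True
  have "x j = s/2" using xi True tent_half by (metis (mono_tags, lifting) inv_lim_def mem_Collect_eq)
  hence tg: "lb l (j + n) (x 0) = s/2"
   using nl lastt_iff[OF xB(2), of j] isrep_lb[OF x] by auto
  hence xn: "x (j + n) = p 1" using isrep_lb[OF x] p_1 by simp
  have fl: "l j = \<nu> (n - 1)" using forced_letters[OF xB tg, of "n - 1"] n_pos by simp
  obtain e0 where e0: "0 < e0" "\<forall>e\<in>{0<..<e0}. \<forall>i<n. ssid (oit (p 1) (-1) i) (It i (p 1 + -1 * e))"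
   using oit_ssid[of "-1" n "p 1"] by blast
  have "p 1 - e0 < x (j + n)" using xn e0 by simp
  from order_tendstoD(1)[OF lim this]
  have ev: "\<forall>\<^sub>F y in at x within inv_lim s. p 1 - e0 < y (j + n)" .
  show ?thesis
  proof (rule eventually_mono[OF ev], intro allI impI)
   fix y l' assume y: "p 1 - e0 < y (j + n)" and r: "isrep l' y"
   have yi: "y \<in> inv_lim s" by (rule isrep_inv_lim[OF r])
   show "l' j = l j"
   proof (cases "y (j + n) = s/2")
    case True
    thus ?thesis using forced_letters[of l' "y 0" j "n - 1"] isrep_lb[OF r] r fl n_pos by (simp add: isrep_def)
   next
    case False
    define e where "e = p 1 - y (j + n)"
    have "y (j + n) \<le> s/2" by (rule inv_lim_le[OF yi])
    hence e: "e \<in> {0<..<e0}" using False y p_1 by (auto simp: e_def)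
    have "p 1 + -1 * e = y (j + n)" by (simp add: e_def)
    hence "ssid (\<nu> (n - 1)) (It (n - 1) (y (j + n)))"
     using e0(2)[rule_format, OF e, of "n - 1"] n_pos by (simp add: oit_p1)
    moreover have "It (n - 1) (y (j + n)) = y (Suc j)" using inv_lim_It[OF yi, of "n - 1" "Suc j"] n_pos by simp
    ultimately show ?thesis using ssid_iff isrep_side[OF r, of j] fl by metis
   qed
  qed
 qed
qed

text \<open>Only the letter at the last tight index can vary near \<open>x\<close>, and both of its
  values belong to representations of \<open>x\<close>.\<close>

lemma nearby_rep:
 assumes x: "x \<in> inv_lim s"
 shows "\<forall>\<^sub>F y in at x within inv_lim s. \<forall>l'. isrep l' y \<longrightarrow> (\<exists>l. isrep l x \<and> (\<forall>i<M. l' i = l i))"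
proof -
 obtain l where l: "isrep l x" using isrep_ex[OF x] by blast
 have "\<forall>\<^sub>F y in at x within inv_lim s. \<forall>j\<in>{j. j < M \<and> \<not> lastt l (x 0) j}. \<forall>l'. isrep l' y \<longrightarrow> l' j = l j"
  by (rule eventually_ball_finite) (use nearby_letter[OF l] in auto)
 thus ?thesis
 proof (rule eventually_mono, intro allI impI)
  fix y l' assume a: "\<forall>j\<in>{j. j < M \<and> \<not> lastt l (x 0) j}. \<forall>l'. isrep l' y \<longrightarrow> l' j = l j" and r: "isrep l' y"
  show "\<exists>l. isrep l x \<and> (\<forall>i<M. l' i = l i)"
  proof (cases "\<forall>i<M. l' i = l i")
   case False
   then obtain J where J: "J < M" "l' J \<noteq> l J" by blast
   hence la: "lastt l (x 0) J" using a r by auto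
   have "isrep (flip l J) x" using mate[of l "x 0" J] la l unfolding isrep_def by metis
   moreover have "l' i = flip l J i" if "i < M" for i
    using a r that J lastt_unique[OF la] by (cases "i = J") auto
   ultimately show ?thesis by blast
  qed (use l in blast)
 qed
qed

lemma Phi_near:
 assumes l: "H l" and e: "0 < e"
 shows "\<exists>M d. 0 < d \<and> (\<forall>l' t'. H l' \<and> (\<forall>i<M. l' i = l i) \<and> \<bar>t' - t\<bar> < d \<longrightarrow> dist (Phi l' t') (Phi l t) < e)"
proof -
 define q where "q = (dl l False, dl l True, ht l, t)"
 have "isCont (GG (lo l) (hi l)) q" using GG_continuous[of "lo l" "hi l"] unfolding continuous_on_eq_continuous_at[OF open_UNIV] by blast
 then obtain d where d: "0 < d" "\<And>q'. dist q' q < d \<Longrightarrow> dist (GG (lo l) (hi l) q') (GG (lo l) (hi l) q) < e"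
  using e unfolding continuous_at_eps_delta by metis
 \<comment> \<open>Chosen so that by \<open>dl_agree\<close>, with its constant
   \<open>2 * 3 ^ n\<close>, and \<open>ht_close\<close> the two radii and the height differ by at
   most \<open>d / 8\<close> each.\<close>
 have "0 < d / (16 * 3 ^ n)" using d by simp
 then obtain M0 where M0: "(1/3::real) ^ M0 < d / (16 * 3 ^ n)" using real_arch_pow_inv[of _ "1/3"] by auto
 define M where "M = max n M0"
 have "(1/3::real) ^ M \<le> (1/3) ^ M0" by (rule power_decreasing) (auto simp: M_def)
 hence M: "1 / 3 ^ M < d / (16 * 3 ^ n)" "n \<le> M" using M0 by (auto simp: power_one_over M_def)
 have b1: "2 * 3 ^ n / 3 ^ M \<le> d / 8" using M by (simp add: field_simps)
 have "(1::real) \<le> 3 ^ n" by simp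
 hence "(1::real) \<le> 2 * 3 ^ n" by linarith
 hence "d / (16 * 3 ^ n) \<le> d / 8" using d(1) by (simp add: field_simps)
 hence b2: "1 / 3 ^ M \<le> d / 8" using M by linarith
 show ?thesis
 proof (intro exI conjI allI impI)
  show "0 < d / 8" using d by simp
  fix l' t' assume a: "H l' \<and> (\<forall>i<M. l' i = l i) \<and> \<bar>t' - t\<bar> < d / 8"
  hence ag: "\<And>i. i < M \<Longrightarrow> l i = l' i" by simp
  define q' where "q' = (dl l' False, dl l' True, ht l', t')"
  have "lo l' = lo l" "hi l' = hi l" using B_markov[OF l, of l'] a M(2) by auto
  hence P: "Phi l' t' = GG (lo l) (hi l) q'" by (simp add: Phi_GG q'_def)
  have "dist q' q \<le> \<bar>dl l' False - dl l False\<bar> + (\<bar>dl l' True - dl l True\<bar> + (\<bar>ht l' - ht l\<bar> + \<bar>t' - t\<bar>))"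
  proof -
   have D: "dist (a, b) (a', b') \<le> \<bar>a - a'\<bar> + dist b b'" for a a' :: real and b b' :: "'x :: metric_space"
    using sqrt_sum_squares_le_sum_abs[of "dist a a'" "dist b b'"] by (simp add: dist_Pair_Pair dist_real_def)
   show ?thesis unfolding q_def q'_def
    by (intro order_trans[OF D] add_mono) (simp_all add: dist_real_def)
  qed
  moreover have "\<bar>dl l' r - dl l r\<bar> \<le> d / 8" for r using dl_agree[OF l _ ag M(2), of r] a b1 by (simp add: abs_minus_commute)
  moreover have "\<bar>ht l' - ht l\<bar> \<le> d / 8" using ht_close[of M l l'] ag b2 by (simp add: abs_minus_commute)
  ultimately have "dist q' q \<le> d / 8 + (d / 8 + (d / 8 + \<bar>t' - t\<bar>))" by (meson add_mono order_trans order_refl)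
  hence "dist q' q < d" using a d(1) by linarith
  thus "dist (Phi l' t') (Phi l t) < e" using d(2) P Phi_GG[of l t] by (simp add: q_def)
 qed
qed

lemma drw_continuous: "continuous_on (inv_lim s) drw"
 unfolding continuous_on_def
proof (intro ballI tendstoI)
 fix x and e :: real assume x: "x \<in> inv_lim s" and e: "0 < e"
 obtain l where l: "isrep l x" using isrep_ex[OF x] by blast
 have reps: "finite {l. isrep l x}"
 proof -
  have "{l. isrep l x} \<subseteq> insert l {mt l True, mt l False}"
  proof
   fix l' assume "l' \<in> {l. isrep l x}"
   hence r: "isrep l' x" by simp
   show "l' \<in> insert l {mt l True, mt l False}"
   proof (cases "l' = l")
    case False
    have "pt l (x 0) = pt l' (x 0)" using l r by (metis isrep_def)
    then obtain b where "l' = mt l b" using reps_mate[of l l' "x 0"] l r False by (metis isrep_def)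
    thus ?thesis by (cases b) auto
   qed simp
  qed
  thus ?thesis by (rule finite_subset) simp
 qed
 have "\<forall>l. \<exists>M d. isrep l x \<longrightarrow> 0 < d \<and> (\<forall>l' t'. H l' \<and> (\<forall>i<M. l' i = l i) \<and> \<bar>t' - x 0\<bar> < d \<longrightarrow> dist (Phi l' t') (Phi l (x 0)) < e)"
  using Phi_near[OF _ e] by (metis isrep_def)
 then obtain M d where Md: "\<And>l. isrep l x \<Longrightarrow> 0 < d l \<and> (\<forall>l' t'. H l' \<and> (\<forall>i<M l. l' i = l i) \<and> \<bar>t' - x 0\<bar> < d l \<longrightarrow> dist (Phi l' t') (Phi l (x 0)) < e)"
  by metis
 define MM where "MM = Max (M ` {l. isrep l x})"
 have MM: "M l \<le> MM" if "isrep l x" for l unfolding MM_def using reps that by (intro Max_ge) auto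
 define D where "D = Min (d ` {l. isrep l x})"
 have ne: "d ` {l. isrep l x} \<noteq> {}" using l by blast
 have D: "0 < D" "\<And>l. isrep l x \<Longrightarrow> D \<le> d l"
  unfolding D_def using reps Md ne by (auto intro!: Min_le simp: Min_gr_iff)
 have "\<forall>\<^sub>F y in at x within inv_lim s. dist (y 0) (x 0) < D" by (rule tendstoD[OF coordinate_tendsto D(1)])
 moreover have "\<forall>\<^sub>F y in at x within inv_lim s. y \<in> inv_lim s" by (simp add: eventually_at_filter)
 ultimately show "\<forall>\<^sub>F y in at x within inv_lim s. dist (drw y) (drw x) < e"
  using nearby_rep[OF x, of MM]
 proof eventually_elim
  case (elim y)
  obtain l' where r: "isrep l' y" using isrep_ex[OF elim(2)] by blast
  then obtain l where l: "isrep l x" "\<forall>i<MM. l' i = l i" using elim(3) by blast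
  have "H l' \<and> (\<forall>i<M l. l' i = l i) \<and> \<bar>y 0 - x 0\<bar> < d l"
   using r l MM[OF l(1)] D(2)[OF l(1)] elim(1) by (auto simp: isrep_def dist_real_def)
  hence "dist (Phi l' (y 0)) (Phi l (x 0)) < e" using Md[OF l(1)] by blast
  thus ?case using drw_rep[OF r] drw_rep[OF l(1)] by simp
 qed
qed

section \<open>Agreement with the prescribed segments and semicircles\<close>

lemma semicircle_iff:
 "z \<in> semicircle b u y w \<longleftrightarrow> (fst z - u)\<^sup>2 + (snd z - (y + w) / 2)\<^sup>2 = ((y - w) / 2)\<^sup>2 \<and> (if b then fst z \<le> u else u \<le> fst z)"
using real_sqrt_eq_iff by (fastforce simp: dist_prod_def dist_real_def semicircle_def mem_Collect_eq)

lemma semicircle_cap: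
 assumes Hl: "H l" and f: "fin l r"
 shows "z \<in> semicircle (\<not> r) (en l r) (ht l) (ht (mt l r)) \<longleftrightarrow> cap l r z \<or> cap (mt l r) r z"
proof -
 note m = mt_facts[OF Hl f]
 have 1: "(ht l + ht (mt l r)) / 2 = yc l (Jl l r)" "(ht l - ht (mt l r)) / 2 = dl l r" using m(10,11) by auto
 have 2: "(if \<not> r then fst z \<le> en l r else en l r \<le> fst z) \<longleftrightarrow> 0 \<le> sg r * (fst z - en l r)" by (cases r) auto
 show ?thesis unfolding semicircle_iff 1 2 cap_def m(2,4,5,8) using f m(3) by (auto simp: linorder_le_cases)
qed

lemma drawn_semicircle_iff:
 "z \<in> drawn_semicircle s L_C x \<longleftrightarrow> (\<exists>l r. isrep l x \<and> fin l r \<and> x 0 = en l r \<and> cap l r z)"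
proof
 assume "z \<in> drawn_semicircle s L_C x"
 then obtain a b k where ab: "represents s a x" "represents s b x" "k < 0" "identified_at \<nu> k a b"
  "z \<in> semicircle (odd (ones (subword a (k + 1) (nat (- k - 1))))) (x 0) (ht (left_part a)) (ht (left_part b))"
  unfolding drawn_semicircle_def nu_kneading ht_def[symmetric] by blast
 define l where "l = left_part a"
 obtain J where J: "lastt l (x 0) J" "left_part b = flip l J" "ones (subword a (k + 1) (nat (- k - 1))) = onesl l J"
  using identified_mates[OF ab(1-4)] unfolding l_def by metis
 have r: "H l" "x 0 \<in> B l" "x = pt l (x 0)" using represents_H[OF ab(1)] represents_left[OF ab(1)] by (simp_all add: l_def)
 define r where "r = even (onesl l J)"
 have ls: "x 0 = en l r" "fin l r" "Jl l r = J" using lastt_side[OF r(1,2) J(1)] by (simp_all add: r_def)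
 have "z \<in> semicircle (\<not> r) (en l r) (ht l) (ht (mt l r))"
  using ab(5) J(2,3) ls by (simp add: r_def l_def[symmetric] mt_def)
 hence "cap l r z \<or> cap (mt l r) r z" using semicircle_cap[OF r(1) ls(2)] by blast
 moreover have "isrep l x" using r by (simp add: isrep_def)
 moreover have "isrep (mt l r) x" "fin (mt l r) r" "x 0 = en (mt l r) r"
  using mt_facts[OF r(1) ls(2)] r ls(1) unfolding isrep_def by auto
 ultimately show "\<exists>l r. isrep l x \<and> fin l r \<and> x 0 = en l r \<and> cap l r z" using ls by blast
next
 assume "\<exists>l r. isrep l x \<and> fin l r \<and> x 0 = en l r \<and> cap l r z"
 then obtain l r where l: "isrep l x" "fin l r" "x 0 = en l r" "cap l r z" by blast
 define J where "J = Jl l r"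
 have Hl: "H l" "x 0 \<in> B l" "x = pt l (x 0)" using l by (auto simp: isrep_def)
 have la: "lastt l (x 0) J" using fin_Jl[OF l(2)] l(3) by (simp add: J_def)
 obtain a b where ab: "represents s a x" "represents s b x" "identified_at \<nu> (- int J - 1) a b"
  "left_part a = l" "left_part b = flip l J" using mates_identified[OF Hl(1,2) la] Hl(3) by metis
 have "ones (subword a (- int J - 1 + 1) (nat (- (- int J - 1) - 1))) = onesl l J"
  using subword_ones[of a J] ab(4) by simp
 moreover have "even (onesl l J) = r" using en_parity(1)[OF Hl(1), of J r] la l(3) by (simp add: lastt_def)
 moreover have "z \<in> semicircle (\<not> r) (en l r) (ht l) (ht (mt l r))" using semicircle_cap[OF Hl(1) l(2)] l(4) by blast
 ultimately have "z \<in> semicircle (odd (ones (subword a (- int J - 1 + 1) (nat (- (- int J - 1) - 1))))) (x 0) (ht (left_part a)) (ht (left_part b))"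
  using l(3) ab(4,5) by (simp add: mt_def J_def)
 moreover have "- int J - 1 < 0" by simp
 ultimately show "z \<in> drawn_semicircle s L_C x"
  unfolding drawn_semicircle_def nu_kneading ht_def[symmetric] using ab by blast
qed

lemma drawn_segment_iff: "H l \<Longrightarrow> z \<in> drawn_segment s L_C l \<longleftrightarrow> seg l z"
proof -
 assume Hl: "H l"
 have "(\<lambda>x. x 0) ` basic_arc s l = B l" using Hl by (simp add: basic_arc_eq image_image)
 thus ?thesis unfolding drawn_segment_def ht_def[symmetric] seg_def B_ends(1)[OF Hl] by (cases z) auto
qed

lemma drw_basic_arc: "H l \<Longrightarrow> drw ` basic_arc s l = DD l"
 by (force simp: basic_arc_eq DD_def drw_pt)

lemma drw_draws: "draws s L_C drw"
 unfolding draws_def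
proof (intro conjI allI ballI)
 show "embedding_map (top_of_set (inv_lim s)) euclidean drw"
 proof (rule continuous_imp_embedding_map)
  show "compact_space (top_of_set (inv_lim s))" using compact_inv_lim by (simp add: compact_space_subtopology)
  show "Hausdorff_space (euclidean :: (real \<times> real) topology)" by (rule Hausdorff_space_euclidean)
  show "continuous_map (top_of_set (inv_lim s)) euclidean drw" using drw_continuous by simp
  show "inj_on drw (topspace (top_of_set (inv_lim s)))" using drw_inj by simp
 qed
 fix l
 show "drawn_segment s L_C l \<subseteq> drw ` basic_arc s l"
 proof (cases "H l")
  case True
  show ?thesis unfolding drw_basic_arc[OF True] using DD_iff[OF True] drawn_segment_iff[OF True] by (intro subsetI) simp
 qed (simp add: drawn_segment_def basic_arc_eq)
 show "drw ` basic_arc s l \<subseteq> drawn_segment s L_C l \<union> (\<Union>x\<in>basic_arc s l. drawn_semicircle s L_C x)"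
 proof (cases "H l")
  case True
  show ?thesis
  proof
   fix z assume "z \<in> drw ` basic_arc s l"
   hence "seg l z \<or> (\<exists>r. cap l r z)" unfolding drw_basic_arc[OF True] DD_iff[OF True] .
   thus "z \<in> drawn_segment s L_C l \<union> (\<Union>x\<in>basic_arc s l. drawn_semicircle s L_C x)"
   proof
    assume "\<exists>r. cap l r z"
    then obtain r where c: "cap l r z" by blast
    have "isrep l (pt l (en l r))" by (rule isrep_pt[OF True en_in[OF True]])
    moreover have "fin l r" using c by (simp add: cap_def)
    ultimately have "z \<in> drawn_semicircle s L_C (pt l (en l r))" unfolding drawn_semicircle_iff using c by auto
    moreover have "pt l (en l r) \<in> basic_arc s l" using True en_in[OF True] by (simp add: basic_arc_eq)
    ultimately show ?thesis by (intro UnI2 UN_I)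
   qed (simp add: drawn_segment_iff[OF True])
  qed
 qed (simp add: basic_arc_eq)
next
 fix x assume "x \<in> inv_lim s"
 show "drawn_semicircle s L_C x \<subseteq> drw ` (\<Union>l\<in>{l. x \<in> basic_arc s l}. basic_arc s l)"
 proof
  fix z assume "z \<in> drawn_semicircle s L_C x"
  then obtain l r where l: "isrep l x" "cap l r z" unfolding drawn_semicircle_iff by blast
  hence h: "H l" "x \<in> basic_arc s l" by (auto simp: isrep_basic_arc)
  have "z \<in> drw ` basic_arc s l" unfolding drw_basic_arc[OF h(1)] DD_iff[OF h(1)] using l(2) by blast
  thus "z \<in> drw ` (\<Union>l\<in>{l. x \<in> basic_arc s l}. basic_arc s l)" using h(2) by blast
 qed
qed

lemma phi_draws: "draws s L_C (phi_C s)"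
 unfolding phi_def by (rule someI[of "draws s L_C", OF drw_draws])

text \<open>A map satisfying \<open>draws\<close> may divide a semicircle between its two arcs in
  any way, so the image of a single arc is not determined. A family closed under mates covers whole
  semicircles, and its image is the same for every such map.\<close>

lemma draws_image:
 assumes f: "draws s L_C f" and S: "\<And>l. l \<in> S \<Longrightarrow> H l" "\<And>l r. l \<in> S \<Longrightarrow> fin l r \<Longrightarrow> mt l r \<in> S"
 shows "f ` (\<Union>l\<in>S. basic_arc s l) = (\<Union>l\<in>S. DD l)"
proof -
 have dI: "z \<in> (\<Union>l\<in>S. DD l)" if "l \<in> S" "seg l z \<or> (\<exists>r. cap l r z)" for l z
  using that DD_iff[OF S(1)[OF that(1)]] by blast
 have f1: "f ` basic_arc s l \<subseteq> drawn_segment s L_C l \<union> (\<Union>x\<in>basic_arc s l. drawn_semicircle s L_C x)"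
  and f2: "drawn_segment s L_C l \<subseteq> f ` basic_arc s l" for l
  using f unfolding draws_def by blast+
 have f3: "drawn_semicircle s L_C x \<subseteq> f ` (\<Union>l\<in>{l. x \<in> basic_arc s l}. basic_arc s l)" if "x \<in> inv_lim s" for x
  using f that unfolding draws_def by blast
 have reps: "l' \<in> S" if "l \<in> S" "isrep l x" "isrep l' x" for l l' x
 proof (cases "l' = l")
  case False
  have h: "H l" "H l'" "x 0 \<in> B l" "x 0 \<in> B l'" "x = pt l (x 0)" "x = pt l' (x 0)"
   using that(2,3) unfolding isrep_def by blast+
  hence "pt l (x 0) = pt l' (x 0)" by (rule_tac trans[OF sym[of x]])
  then obtain r where "fin l r" "l' = mt l r" using reps_mate[OF h(1-4)] False by blast
  thus ?thesis using S(2) that(1) by blast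
 qed (use that in simp)
 show ?thesis
 proof (intro set_eqI iffI)
  fix z assume "z \<in> f ` (\<Union>l\<in>S. basic_arc s l)"
  then obtain l x where l: "l \<in> S" "x \<in> basic_arc s l" "z = f x" by blast
  hence "z \<in> drawn_segment s L_C l \<union> (\<Union>x\<in>basic_arc s l. drawn_semicircle s L_C x)" using f1[of l] by blast
  thus "z \<in> (\<Union>l\<in>S. DD l)"
  proof
   assume "z \<in> drawn_segment s L_C l"
   thus ?thesis using drawn_segment_iff[OF S(1)[OF l(1)]] dI[OF l(1)] by simp
  next
   assume "z \<in> (\<Union>x\<in>basic_arc s l. drawn_semicircle s L_C x)"
   then obtain y where y: "y \<in> basic_arc s l" "z \<in> drawn_semicircle s L_C y" by blast
   then obtain l' r where l': "isrep l' y" "cap l' r z" unfolding drawn_semicircle_iff by blast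
   have "isrep l y" using y S(1) l(1) by (simp add: isrep_basic_arc)
   hence "l' \<in> S" using reps l(1) l'(1) by blast
   thus ?thesis using dI l'(2) by blast
  qed
 next
  fix z assume "z \<in> (\<Union>l\<in>S. DD l)"
  then obtain l where l: "l \<in> S" "z \<in> DD l" by blast
  hence "seg l z \<or> (\<exists>r. cap l r z)" using DD_iff[OF S(1)[OF l(1)]] by simp
  thus "z \<in> f ` (\<Union>l\<in>S. basic_arc s l)"
  proof
   assume "seg l z"
   hence "z \<in> f ` basic_arc s l" using f2[of l] drawn_segment_iff[OF S(1)[OF l(1)]] by blast
   thus ?thesis using l(1) by blast
  next
   assume "\<exists>r. cap l r z"
   then obtain r where c: "cap l r z" by blast
   have r: "isrep l (pt l (en l r))" by (rule isrep_pt[OF _ en_in]) (rule S(1)[OF l(1)])+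
   hence "z \<in> drawn_semicircle s L_C (pt l (en l r))"
    unfolding drawn_semicircle_iff using c by (auto simp: cap_def)
   hence "z \<in> f ` (\<Union>l'\<in>{l'. pt l (en l r) \<in> basic_arc s l'}. basic_arc s l')"
    using f3[OF isrep_inv_lim[OF r]] by blast
   then obtain l' where l': "pt l (en l r) \<in> basic_arc s l'" "z \<in> f ` basic_arc s l'" by blast
   have "H l'" using l'(1) by (auto simp: basic_arc_eq split: if_splits)
   hence "l' \<in> S" using reps[OF l(1) r] l'(1) by (simp add: isrep_basic_arc)
   thus ?thesis using l'(2) by blast
  qed
 qed
qed

lemma phi_image:
 assumes "\<And>l. l \<in> S \<Longrightarrow> H l" "\<And>l r. l \<in> S \<Longrightarrow> fin l r \<Longrightarrow> mt l r \<in> S"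
 shows "phi_C s ` (\<Union>l\<in>S. basic_arc s l) = drw ` (\<Union>l\<in>S. basic_arc s l)" "drw ` (\<Union>l\<in>S. basic_arc s l) = (\<Union>l\<in>S. DD l)"
 using draws_image[OF phi_draws assms] draws_image[OF drw_draws assms] by simp_all

lemma Hc_mt: "Hc l \<Longrightarrow> fin l r \<Longrightarrow> Hc (mt l r)"
 unfolding mt_def using Hc_flip[of l "en l r" "Jl l r"] en_in fin_Jl by (simp add: Hc_def)

definition KK :: "(real \<times> real) set" where "KK = (\<Union>l\<in>{l. Hc l}. DD l)"

lemma core_arcs: "core s = (\<Union>l\<in>{l. Hc l}. basic_arc s l)"
 unfolding core_eq by (auto simp: basic_arc_eq Hc_def)

lemma KK_eq: "phi_C s ` core s = KK" "drw ` core s = KK"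
proof -
 have a: "H l" if "l \<in> {l. Hc l}" for l using that by (simp add: Hc_def)
 have b: "mt l r \<in> {l. Hc l}" if "l \<in> {l. Hc l}" "fin l r" for l r using Hc_mt that by simp
 show "phi_C s ` core s = KK" "drw ` core s = KK"
  unfolding core_arcs KK_def using phi_image[OF a b] by simp_all
qed

end

section \<open>Rays and arc-components\<close>

context tent_lhe
begin

text \<open>Corresponds to the shift \<open>i = -c\<close> in
  \<open>described_by_kneading_tail\<close>. Only \<open>c\<close> modulo \<open>n\<close> matters,
  by periodicity.\<close>

definition tl :: "nat \<Rightarrow> bits \<Rightarrow> bool" where
 "tl c l \<longleftrightarrow> (\<exists>N. \<forall>j\<ge>N. l j = \<nu> (j + c))"

definition UU :: "nat \<Rightarrow> (nat \<Rightarrow> real) set" where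
 "UU c = {x. \<exists>l. isrep l x \<and> tl c l}"

lemma tl_agree: assumes "\<And>j. N \<le> j \<Longrightarrow> l j = l' j" "tl c l" shows "tl c l'"
proof -
 obtain M where M: "\<And>j. M \<le> j \<Longrightarrow> l j = \<nu> (j + c)" using assms(2) by (auto simp: tl_def)
 have "l' j = \<nu> (j + c)" if "max N M \<le> j" for j using assms(1)[of j] M[of j] that by simp
 thus ?thesis unfolding tl_def by blast
qed

lemma tl_flip: "tl c (flip l J) \<longleftrightarrow> tl c l"
proof -
 have "flip l J j = l j" if "Suc J \<le> j" for j using that by simp
 thus ?thesis using tl_agree[of "Suc J" l "flip l J" c] tl_agree[of "Suc J" "flip l J" l c] by auto
qed

lemma tl_rep: assumes "isrep l x" "isrep l' x" shows "tl c l \<longleftrightarrow> tl c l'"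
using assms same_point by (metis isrep_def tl_flip)

lemma UU_rep: "isrep l x \<Longrightarrow> x \<in> UU c \<longleftrightarrow> tl c l"
 unfolding UU_def using tl_rep by blast

lemma le_n_mult: "k \<le> n * k" using n_pos mult_le_mono1[of 1 n k] by (simp add: One_nat_def)

lemma It_n_p1: "It n (p 1) = p 1" using It_n_max unfolding p_1(1) .

lemma inv_lim_p1: "x \<in> inv_lim s \<Longrightarrow> x j \<le> p 1" using inv_lim_le(1) unfolding p_1(1) .

lemma nat_shift_mod: "(a + n * b + c) mod n = (a + c) mod n"
 by (metis add.assoc add.commute mod_mult_self2)

lemma tl_ones: assumes "tl c l" shows "\<exists>j\<ge>M. l j"
proof -
 obtain N where N: "\<And>j. N \<le> j \<Longrightarrow> l j = \<nu> (j + c)" using assms by (auto simp: tl_def)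
 define j where "j = n * (M + N + c) - c"
 have j: "M \<le> j" "N \<le> j" "j + c = n * (M + N + c)" using le_n_mult[of "M + N + c"] unfolding j_def by linarith+
 have "(j + c) mod n = 0 mod n" unfolding j(3) by simp
 hence "\<nu> (j + c) = \<nu> 0" by (rule nu_mod_cong)
 thus ?thesis using N[OF j(2)] nu_0 j(1) by auto
qed

lemma tl_Hc: "H l \<Longrightarrow> tl c l \<Longrightarrow> Hc l" unfolding Hc_def using tl_ones by blast

lemma UU_core: "UU c \<subseteq> core s"
using Hc_iff tl_Hc by (force simp: UU_def isrep_def)

lemma UU_arcs: "UU c = (\<Union>l\<in>{l. H l \<and> tl c l}. basic_arc s l)"
 unfolding UU_def using isrep_basic_arc by blast

lemma UU_described: "described_by_kneading_tail s (UU c)"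
 unfolding described_by_kneading_tail_def
proof (intro exI)
 have "(\<forall>\<^sub>F k in sequentially. l (nat (int k + - int c)) = kneading s k) \<longleftrightarrow> tl c l" for l
 proof
  assume "\<forall>\<^sub>F k in sequentially. l (nat (int k + - int c)) = kneading s k"
  then obtain N where N: "\<And>k. N \<le> k \<Longrightarrow> l (nat (int k + - int c)) = \<nu> k"
   unfolding nu_kneading eventually_sequentially by blast
  have "l j = \<nu> (j + c)" if "N \<le> j" for j using N[of "j + c"] that by simp
  thus "tl c l" unfolding tl_def by blast
 next
  assume "tl c l"
  then obtain N where N: "\<And>j. N \<le> j \<Longrightarrow> l j = \<nu> (j + c)" by (auto simp: tl_def)
  have "l (nat (int k + - int c)) = \<nu> k" if "N + c \<le> k" for k
  proof -
   have "nat (int k + - int c) = k - c" using that by simp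
   thus ?thesis using N[of "k - c"] that by simp
  qed
  thus "\<forall>\<^sub>F k in sequentially. l (nat (int k + - int c)) = kneading s k"
   unfolding nu_kneading eventually_sequentially by blast
 qed
 moreover have "basic_arc s l = {}" if "\<not> H l" for l using that by (simp add: basic_arc_eq)
 ultimately show "UU c = (\<Union>l\<in>{l. \<forall>\<^sub>F k in sequentially. l (nat (int k + - int c)) = kneading s k}. basic_arc s l)"
  unfolding UU_arcs by fastforce
qed

lemma ntail_tl: assumes "\<And>k. l (i + k) = \<nu> k" shows "tl ((n - i mod n) mod n) l"
proof -
 have "l j = \<nu> (j + (n - i mod n) mod n)" if "i \<le> j" for j
 proof -
  have "l j = \<nu> (j - i)" using assms[of "j - i"] that by simp
  moreover have "(j + (n - i mod n) mod n) mod n = (j - i) mod n"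
  proof -
   have "i mod n \<le> n" using n_pos by simp
   hence "(i + (n - i mod n)) mod n = 0" by (metis le_add_diff_inverse mod_add_left_eq mod_self)
   moreover have "(j + (n - i mod n) mod n) mod n = ((j - i) + (i + (n - i mod n))) mod n"
    using that by (simp add: mod_add_right_eq)
   ultimately show ?thesis by (metis add.right_neutral mod_add_right_eq)
  qed
  ultimately show ?thesis using nu_mod_cong by metis
 qed
 thus ?thesis unfolding tl_def by blast
qed

lemma tl_ntail: assumes "tl c l" shows "ntail l"
proof -
 obtain N where N: "\<And>j. N \<le> j \<Longrightarrow> l j = \<nu> (j + c)" using assms by (auto simp: tl_def)
 define i where "i = n * (N + c) - c"
 have i: "N \<le> i" "i + c = n * (N + c)" using le_n_mult[of "N + c"] unfolding i_def by linarith+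
 have "l (i + k) = \<nu> k" for k
 proof -
  have "i + k + c = k + n * (N + c)" using i(2) by simp
  hence "(i + k + c) mod n = k mod n" by (simp only: mod_mult_self2)
  thus ?thesis using N[of "i + k"] i(1) nu_mod_cong by (metis trans_le_add1)
 qed
 thus ?thesis unfolding ntail_def by blast
qed

lemma ntail_iff: "ntail l \<longleftrightarrow> (\<exists>c<n. tl c l)"
proof
 assume "ntail l"
 then obtain i where "\<And>k. l (i + k) = \<nu> k" by (auto simp: ntail_def)
 hence "tl ((n - i mod n) mod n) l" by (rule ntail_tl)
 moreover have "(n - i mod n) mod n < n" using n_pos by simp
 ultimately show "\<exists>c<n. tl c l" by blast
qed (use tl_ntail in blast)

lemma p_eq_mod: assumes "p i = p j" shows "i mod n = j mod n"
proof -
 define k where "k = n - i mod n"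
 have "i mod n \<le> n" using n_pos by simp
 hence ik: "(i + k) mod n = 0" unfolding k_def by (metis le_add_diff_inverse mod_add_left_eq mod_self)
 have "p (k + i) = p (k + j)" using assms It_p[of k i] It_p[of k j] by simp
 hence "(k + j) mod n = 0" using ik p_half_iff[of "k + i"] p_half_iff[of "k + j"] by (simp add: add.commute)
 hence "(i + k) mod n = (j + k) mod n" using ik by (simp add: add.commute)
 hence "[i + k = j + k] (mod n)" by (simp add: cong_def)
 hence "[i = j] (mod n)" using cong_add_rcancel_nat by blast
 thus ?thesis by (simp add: cong_def)
qed

text \<open>Otherwise two points of the turning orbit would have the same itinerary.\<close>

lemma tl_inj: assumes "tl c l" "tl c' l" "c < n" "c' < n" shows "c = c'"
proof -
 obtain N where N: "\<And>j. N \<le> j \<Longrightarrow> l j = \<nu> (j + c)" using assms(1) by (auto simp: tl_def)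
 obtain N' where N': "\<And>j. N' \<le> j \<Longrightarrow> l j = \<nu> (j + c')" using assms(2) by (auto simp: tl_def)
 define m where "m = n * (N + N')"
 have "N + N' \<le> m" unfolding m_def by (rule le_n_mult)
 have e: "\<nu> (j + c) = \<nu> (j + c')" for j
 proof -
  have "\<nu> (j + m + c) = \<nu> (j + m + c')" using N[of "j + m"] N'[of "j + m"] `N + N' \<le> m` by simp
  moreover have "(j + m + c) mod n = (j + c) mod n" "(j + m + c') mod n = (j + c') mod n"
   unfolding m_def by (rule nat_shift_mod)+
  ultimately show ?thesis using nu_mod_cong by metis
 qed
 have "p (Suc c) = p (Suc c')"
 proof (rule It_unique[where a = "\<lambda>i. \<nu> (i + c)"])
  show "side (\<nu> (i + c)) (It i (p (Suc c)))" for i using nu_side'[of "i + c"] by (simp add: It_p)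
  show "side (\<nu> (i + c)) (It i (p (Suc c')))" for i using nu_side'[of "i + c'"] by (simp add: It_p e)
 qed (rule p_unit)+
 hence "Suc c mod n = Suc c' mod n" by (rule p_eq_mod)
 hence "[c + 1 = c' + 1] (mod n)" by (simp add: cong_def One_nat_def)
 hence "[c = c'] (mod n)" using cong_add_rcancel_nat by blast
 thus ?thesis using assms(3,4) by (simp add: cong_def)
qed

lemma UU_disjoint: "c < n \<Longrightarrow> c' < n \<Longrightarrow> c \<noteq> c' \<Longrightarrow> UU c \<inter> UU c' = {}"
 using tl_inj UU_rep unfolding UU_def by blast

lemma sgnp_period: "sgnp (onesl \<nu> n) = 1"
 using onesl_nu_even by (simp add: sgnp_parity)

text \<open>On \<open>[p 1 - e0, p 1]\<close> the return map is affine and expanding with fixed point \<open>p 1\<close>.\<close>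

definition e0 :: real where
 "e0 = (SOME e. 0 < e \<and> (\<forall>d\<in>{0<..e}. \<forall>i<n. ssid (\<nu> i) (It i (p 1 - d))) \<and> e \<le> p 1 - p 2)"

lemma e0: "0 < e0" "0 < d \<Longrightarrow> d \<le> e0 \<Longrightarrow> i < n \<Longrightarrow> ssid (\<nu> i) (It i (p 1 - d))" "e0 \<le> p 1 - p 2"
proof -
 obtain e where e: "0 < e" "\<forall>d\<in>{0<..<e}. \<forall>i<n. ssid (oit (p 1) (-1) i) (It i (p 1 + -1 * d))"
  using oit_ssid[of "-1" n "p 1"] by blast
 define f where "f = min (e / 2) (p 1 - p 2)"
 have "0 < p 1 - p 2" using p2_lt p1_gt by linarith
 hence "0 < f" "f < e" "f \<le> p 1 - p 2" using e(1) by (auto simp: f_def)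
 hence "\<exists>f. 0 < f \<and> (\<forall>d\<in>{0<..f}. \<forall>i<n. ssid (\<nu> i) (It i (p 1 - d))) \<and> f \<le> p 1 - p 2"
  using e(2) by (intro exI[of _ f]) (auto simp: oit_p1)
 from someI_ex[OF this] show "0 < e0" "0 < d \<Longrightarrow> d \<le> e0 \<Longrightarrow> i < n \<Longrightarrow> ssid (\<nu> i) (It i (p 1 - d))" "e0 \<le> p 1 - p 2"
  by (auto simp: e0_def)
qed

lemma return_expand:
 assumes "\<And>i. i < n \<Longrightarrow> side (\<nu> i) (It i y)" shows "p 1 - It n y = s ^ n * (p 1 - y)"
proof -
 have "It n (p 1) - It n y = sgnp (onesl \<nu> n) * s ^ n * (p 1 - y)"
  by (rule It_diff) (use nu_side' assms in "auto simp: It_p1")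
 thus ?thesis unfolding It_n_p1 by (simp add: sgnp_period)
qed

lemma return_e0: assumes "0 \<le> d" "d \<le> e0" shows "It n (p 1 - d) = p 1 - s ^ n * d"
proof (cases "d = 0")
 case True
 thus ?thesis using It_n_p1 by simp
next
 case False
 hence "side (\<nu> i) (It i (p 1 - d))" if "i < n" for i using e0(2)[of d i] assms that ssid_side by simp
 from return_expand[of "p 1 - d", OF this] show ?thesis by simp
qed

definition dd :: nat where "dd = (SOME d. \<forall>i j. (i + j + d) mod n = 0 \<longrightarrow> \<nu> i = \<nu> j)"

lemma dd: assumes "(i + j + dd) mod n = 0" shows "\<nu> i = \<nu> j"
proof -
 have "\<forall>i j. (i + j + dd) mod n = 0 \<longrightarrow> \<nu> i = \<nu> j" unfolding dd_def by (rule someI_ex[OF nu_symmetric])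
 from this[rule_format, OF assms] show ?thesis .
qed

text \<open>\<open>kk c N\<close> are the indices at which the endpoint of the ray \<open>UU c\<close> takes the value \<open>s/2\<close>.\<close>

definition kk :: "nat \<Rightarrow> nat \<Rightarrow> nat" where "kk c N = nat ((1 - int c - int dd) mod int n) + n * N"

lemma kk_Suc: "kk c (Suc N) = kk c N + n" by (simp add: kk_def)

lemma kk_ge: "n * N \<le> kk c N" "N \<le> kk c N"
proof -
 show "n * N \<le> kk c N" by (simp add: kk_def)
 thus "N \<le> kk c N" using le_n_mult[of N] by linarith
qed

lemma kk_mono: "N \<le> N' \<Longrightarrow> kk c N \<le> kk c N'" by (simp add: kk_def)

text \<open>From a coordinate near \<open>p 1\<close> at index \<open>kk c N\<close>, going forward
  in time reads \<open>\<nu>\<close> from its start, which is \<open>\<nu>\<close> against the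
  direction of the index. The reflection symmetry turns this into the tail of class
  \<open>c\<close>.\<close>

lemma kk_letter: assumes "i + Suc j = kk c N" shows "\<nu> (j + c) = \<nu> i"
proof -
 have "int (i + (j + c) + dd) = int (kk c N) - 1 + int c + int dd" using assms by simp
 also have "int (kk c N) = (1 - int c - int dd) mod int n + int n * int N"
  unfolding kk_def using n_pos by simp
 finally have "int (i + (j + c) + dd) = (1 - int c - int dd) mod int n + (- 1 + int c + int dd) + int n * int N" by linarith
 hence "int (i + (j + c) + dd) mod int n = ((1 - int c - int dd) mod int n + (- 1 + int c + int dd)) mod int n"
  by (simp only: mod_mult_self2)
 also have "\<dots> = ((1 - int c - int dd) + (- 1 + int c + int dd)) mod int n" by (rule mod_add_left_eq)
 also have "\<dots> = 0" by simp
 finally have "(i + (j + c) + dd) mod n = 0" by (metis of_nat_eq_0_iff of_nat_mod)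
 thus ?thesis using dd by metis
qed

lemma pow_kk: "real N \<le> s ^ kk c N"
proof -
 have "2 ^ N \<le> s ^ (2 * N)"
 proof -
  have "(2::real) \<le> s\<^sup>2" using power_mono[of "sqrt 2" s 2] sqrt2 by simp
  hence "(2::real) ^ N \<le> (s\<^sup>2) ^ N" by (rule power_mono) simp
  thus ?thesis by (simp add: power_mult)
 qed
 also have "\<dots> \<le> s ^ kk c N"
 proof (rule power_increasing)
  have "2 * N \<le> n * N" using n_pos by (intro mult_le_mono1) simp
  thus "2 * N \<le> kk c N" using kk_ge(1)[of N c] by linarith
 qed (use s1 in simp)
 finally have "2 ^ N \<le> s ^ kk c N" .
 moreover have "real N \<le> 2 ^ N" using of_nat_less_two_power[of N] by (simp add: less_imp_le)
 ultimately show ?thesis by linarith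
qed

definition NN :: "real \<Rightarrow> nat" where "NN b = nat \<lceil>b / e0\<rceil>"

lemma NN: assumes "NN b \<le> N" "b' \<le> b" shows "b' / s ^ kk c N \<le> e0"
proof -
 have "b / e0 \<le> real (NN b)" by (simp add: NN_def real_nat_ceiling_ge)
 hence "b / e0 \<le> s ^ kk c N" using pow_kk[of N c] assms by linarith
 hence "b \<le> e0 * s ^ kk c N" using e0(1) by (simp add: field_simps)
 hence "b' \<le> e0 * s ^ kk c N" using assms by simp
 thus ?thesis using s1 by (simp add: field_simps)
qed

text \<open>Parametrizes the ray by \<open>b \<ge> 0\<close>: for all large \<open>N\<close> the
  coordinate \<open>kk c N\<close> lies below \<open>p 1\<close> by \<open>b / s ^ kk c N\<close>,
  which is consistent because the return map expands by \<open>s ^ n\<close>. The value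
  \<open>b = 0\<close> gives the endpoint. \<open>NN b\<close> keeps the distance at most
  \<open>e0\<close>, and the addend \<open>j\<close> brings the index to at least
  \<open>j\<close>.\<close>

definition gr :: "nat \<Rightarrow> real \<Rightarrow> nat \<Rightarrow> real" where
 "gr c b j = It (kk c (NN b + j) - j) (p 1 - b / s ^ kk c (NN b + j))"

lemma gr_step:
 assumes "0 \<le> b" "b / s ^ kk c N \<le> e0" "j \<le> kk c N"
 shows "It (kk c (N + k) - j) (p 1 - b / s ^ kk c (N + k)) = It (kk c N - j) (p 1 - b / s ^ kk c N)"
proof (induction k)
 case (Suc k)
 define y where "y = b / s ^ kk c (N + Suc k)"
 have y0: "0 \<le> y" using assms s1 by (simp add: y_def)
 have y: "s ^ n * y = b / s ^ kk c (N + k)" using s1 by (simp add: y_def kk_Suc power_add)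
 have "s ^ kk c N \<le> s ^ kk c (N + Suc k)" using kk_mono[of N "N + Suc k"] s1 by (intro power_increasing) auto
 hence "y \<le> b / s ^ kk c N" unfolding y_def using assms(1) s1 by (intro divide_left_mono) auto
 hence "It n (p 1 - y) = p 1 - b / s ^ kk c (N + k)" using return_e0[OF y0] assms(2) y by simp
 moreover have "kk c (N + Suc k) - j = (kk c (N + k) - j) + n"
  using kk_Suc[of c "N + k"] kk_mono[of N "N + k" c] assms(3) by simp
 ultimately show ?case using Suc by (simp only: It_add y_def[symmetric])
qed simp

lemma gr_eq:
 assumes "0 \<le> b" "b \<le> b'" "NN b' \<le> N" "j \<le> N"
 shows "gr c b j = It (kk c N - j) (p 1 - b / s ^ kk c N)"
proof -
 have NNmono: "NN b \<le> NN b'" unfolding NN_def using assms(2) e0(1) by (intro nat_mono ceiling_mono divide_right_mono) auto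
 define M where "M = NN b + j"
 have g: "gr c b j = It (kk c M - j) (p 1 - b / s ^ kk c M)" by (simp add: gr_def M_def)
 have M: "b / s ^ kk c M \<le> e0" "j \<le> kk c M" using NN[of b M b] kk_ge(2)[of M c] by (auto simp: M_def)
 have N: "b / s ^ kk c N \<le> e0" "j \<le> kk c N" using NN[of b' N b] kk_ge(2)[of N c] assms by auto
 show ?thesis
 proof (cases "M \<le> N")
  case True
  thus ?thesis using gr_step[OF assms(1) M, of "N - M"] g by simp
 next
  case False
  thus ?thesis using gr_step[OF assms(1) N, of "M - N"] g by simp
 qed
qed

lemma gr_kk:
 assumes "0 \<le> b" "NN b \<le> N" shows "gr c b (kk c N) = p 1 - b / s ^ kk c N"
proof -
 have N: "b / s ^ kk c N \<le> e0" using NN[of b N b] assms by auto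
 have "gr c b (kk c N) = It (kk c (N + kk c N) - kk c N) (p 1 - b / s ^ kk c (N + kk c N))"
  by (rule gr_eq[OF assms(1) order_refl]) (use assms in auto)
 also have "\<dots> = p 1 - b / s ^ kk c N" using gr_step[OF assms(1) N order_refl] by simp
 finally show ?thesis .
qed

lemma gr_core: assumes "0 \<le> b" shows "gr c b \<in> core s"
proof -
 have v: "p 1 - b / s ^ kk c N \<in> {p 2..p 1}" if "NN b \<le> N" for N
  using NN[OF that order_refl, of c] e0(3) assms s1 by (auto simp: divide_nonneg_nonneg)
 have c: "gr c b j \<in> {p 2..p 1}" for j unfolding gr_def by (rule It_core[OF v]) simp
 moreover have "tent s (gr c b (Suc j)) = gr c b j" for j
 proof -
  define N where "N = NN b + Suc j"
  have k: "kk c N - j = Suc (kk c N - Suc j)" using kk_ge(2)[of N c] by (simp add: N_def)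
  have "gr c b (Suc j) = It (kk c N - Suc j) (p 1 - b / s ^ kk c N)" by (rule gr_eq[OF assms order_refl]) (simp_all add: N_def)
  moreover have "gr c b j = It (kk c N - j) (p 1 - b / s ^ kk c N)" by (rule gr_eq[OF assms order_refl]) (simp_all add: N_def)
  ultimately show ?thesis by (simp add: k It_Suc)
 qed
 ultimately show ?thesis unfolding core_set inv_lim_def using core_unit by blast
qed

lemma gr_continuous: "continuous_on {0..} (gr c)"
proof (rule continuous_on_coordinatewise_then_product)
 fix j
 have T: "continuous_on {0..T} (\<lambda>b. gr c b j)" for T
 proof -
  define N where "N = NN T + j"
  have "continuous_on {0..T} (\<lambda>b. It (kk c N - j) (p 1 - b / s ^ kk c N))"
   by (rule continuous_on_compose2[OF It_continuous]) (use s1 in "auto intro!: continuous_intros")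
  moreover have "gr c b j = It (kk c N - j) (p 1 - b / s ^ kk c N)" if "b \<in> {0..T}" for b
   using that by (intro gr_eq[of b T]) (auto simp: N_def)
  ultimately show ?thesis using continuous_on_cong[of "{0..T}" "{0..T}" "\<lambda>b. gr c b j"] by simp
 qed
 show "continuous_on {0..} (\<lambda>b. gr c b j)"
  unfolding continuous_on_def
 proof
  fix b :: real assume t: "b \<in> {0..}"
  have "((\<lambda>b. gr c b j) \<longlongrightarrow> gr c b j) (at b within {0..b + 1})" using T[of "b + 1"] t unfolding continuous_on_def by simp
  moreover have "at b within {0..b + 1} = at b within {0..}"
   by (rule at_within_nhd[of _ "{..<b + 1}"]) auto
  ultimately show "((\<lambda>b. gr c b j) \<longlongrightarrow> gr c b j) (at b within {0..})" by simp
 qed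
qed

lemma gr_inj: "inj_on (gr c) {0..}"
proof (rule inj_onI)
 fix b b' :: real assume t: "b \<in> {0..}" "b' \<in> {0..}" "gr c b = gr c b'"
 define N where "N = max (NN b) (NN b')"
 have "gr c b (kk c N) = gr c b' (kk c N)" using t(3) by simp
 hence "p 1 - b / s ^ kk c N = p 1 - b' / s ^ kk c N" using gr_kk[of b N] gr_kk[of b' N] t(1,2) by (simp add: N_def)
 thus "b = b'" using s1 by simp
qed

lemma gr_UU: assumes "0 \<le> b" shows "gr c b \<in> UU c"
proof -
 define x where "x = gr c b"
 have xi: "x \<in> inv_lim s" using gr_core[OF assms, of c] by (simp add: core_set x_def)
 obtain l where l: "isrep l x" using isrep_ex[OF xi] by blast
 have lH: "H l" "x 0 \<in> B l" using l by (auto simp: isrep_def)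
 have "l j = \<nu> (j + c)" if j: "kk c (NN b) \<le> j" for j
 proof -
  define N where "N = NN b + (j - kk c (NN b)) div n"
  have "kk c N = kk c (NN b) + n * ((j - kk c (NN b)) div n)" by (simp add: N_def kk_def algebra_simps)
  moreover have "n * ((j - kk c (NN b)) div n) + (j - kk c (NN b)) mod n = j - kk c (NN b)" by simp
  moreover have "(j - kk c (NN b)) mod n < n" using n_pos by simp
  ultimately have jN: "kk c N \<le> j" "j < kk c N + n" using j by linarith+
  define i where "i = kk c N + n - Suc j"
  have i: "i < n" "i + Suc j = kk c (Suc N)" "j = kk c N + n - 1 - i" using jN by (auto simp: i_def kk_Suc)
  define d where "d = b / s ^ kk c (Suc N)"
  have xk: "x (kk c (Suc N)) = p 1 - d" using gr_kk[OF assms, of "Suc N" c] by (simp add: x_def d_def N_def)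
  have d: "0 \<le> d" "d \<le> e0" using NN[of b "Suc N" b c] assms s1 by (auto simp: d_def N_def)
  have "l j = \<nu> i"
  proof (cases "d = 0")
   case True
   hence "lb l (kk c N + n) (x 0) = s/2" using xk isrep_lb[OF l] p_1 by (simp add: kk_Suc)
   thus ?thesis using forced_letters[OF lH _ i(1), of "kk c N"] i(3) by simp
  next
   case False
   hence "ssid (\<nu> i) (It i (x (kk c (Suc N))))" using e0(2) d i(1) xk by simp
   moreover have "It i (x (kk c (Suc N))) = x (Suc j)" using inv_lim_It[OF xi, of i "Suc j"] i(2) by (simp add: add.commute)
   ultimately show ?thesis using ssid_iff isrep_side[OF l, of j] by metis
  qed
  thus ?thesis using kk_letter[OF i(2)] by simp
 qed
 hence "tl c l" unfolding tl_def by blast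
 thus ?thesis using l unfolding UU_def x_def by blast
qed

text \<open>On the tail each return multiplies the distance to \<open>p 1\<close> by exactly
  \<open>s ^ n\<close>. The distance at index \<open>kk c N\<close> times \<open>s ^ kk c N\<close>
  is therefore constant in \<open>N\<close>; this constant is the parameter
  \<open>b\<close>.\<close>

lemma UU_gr: assumes "x \<in> UU c" obtains b where "0 \<le> b" "x = gr c b"
proof -
 obtain l where l: "isrep l x" "tl c l" using assms by (auto simp: UU_def)
 obtain M where M: "\<And>j. M \<le> j \<Longrightarrow> l j = \<nu> (j + c)" using l(2) by (auto simp: tl_def)
 have xi: "x \<in> inv_lim s" by (rule isrep_inv_lim[OF l(1)])
 have step: "p 1 - x (kk c N) = s ^ n * (p 1 - x (kk c (Suc N)))" if N: "M \<le> N" for N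
 proof -
  have "p 1 - It n (x (kk c (Suc N))) = s ^ n * (p 1 - x (kk c (Suc N)))"
  proof (rule return_expand)
   fix i assume i: "i < n"
   define j where "j = kk c (Suc N) - Suc i"
   have j: "i + Suc j = kk c (Suc N)" "M \<le> j" using i kk_ge(2)[of N c] N by (auto simp: j_def kk_Suc)
   have "It i (x (kk c (Suc N))) = x (Suc j)" using inv_lim_It[OF xi, of i "Suc j"] j(1) by (simp add: add.commute)
   thus "side (\<nu> i) (It i (x (kk c (Suc N))))" using isrep_side[OF l(1), of j] M[OF j(2)] kk_letter[OF j(1)] by simp
  qed
  moreover have "It n (x (kk c (Suc N))) = x (kk c N)" using inv_lim_It[OF xi, of n "kk c N"] by (simp add: kk_Suc)
  ultimately show ?thesis by simp
 qed
 define b where "b = s ^ kk c M * (p 1 - x (kk c M))"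
 have "x (kk c M) \<le> p 1" by (rule inv_lim_p1[OF xi])
 hence t0: "0 \<le> b" using s1 by (simp add: b_def)
 have xk: "p 1 - x (kk c (M + k)) = b / s ^ kk c (M + k)" for k
 proof (induction k)
  case 0
  thus ?case using s1 by (simp add: b_def)
 next
  case (Suc k)
  have "s ^ n * (p 1 - x (kk c (M + Suc k))) = b / s ^ kk c (M + k)" using step[of "M + k"] Suc by simp
  hence "p 1 - x (kk c (M + Suc k)) = b / s ^ kk c (M + k) / s ^ n" using s1 by (simp add: field_simps)
  thus ?case by (simp add: kk_Suc power_add)
 qed
 have "x j = gr c b j" for j
 proof -
  define N where "N = M + (NN b + j)"
  have "j \<le> kk c N" using kk_ge(2)[of N c] by (simp add: N_def)
  hence "x j = It (kk c N - j) (x (kk c N))" using inv_lim_It[OF xi, of "kk c N - j" j] by simp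
  also have "x (kk c N) = p 1 - b / s ^ kk c N" using xk[of "NN b + j"] by (simp add: N_def)
  also have "It (kk c N - j) (p 1 - b / s ^ kk c N) = gr c b j"
   by (rule gr_eq[OF t0 order_refl, symmetric]) (simp_all add: N_def)
  finally show ?thesis .
 qed
 thus thesis using that[OF t0] by auto
qed

lemma UU_ray: "UU c = gr c ` {0..}"
 using gr_UU UU_gr by (auto simp: image_iff) (metis atLeast_iff)

text \<open>The coordinate \<open>Suc k\<close> is 1/2 only where the coordinate \<open>k\<close> is
  \<open>s/2\<close>. On a connected set avoiding this value the letter cannot change.\<close>

lemma connected_core_side:
 assumes C: "connected C" "C \<subseteq> inv_lim s" and k: "\<And>y. y \<in> C \<Longrightarrow> y k \<noteq> s/2" and xy: "x \<in> C" "y \<in> C"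
 shows "y (Suc k) \<noteq> 1/2" "1/2 < y (Suc k) \<longleftrightarrow> 1/2 < x (Suc k)"
proof -
 have ne: "z (Suc k) \<noteq> 1/2" if z: "z \<in> C" for z
 proof
  assume h: "z (Suc k) = 1/2"
  have "tent s (z (Suc k)) = z k" using C(2) z by (auto simp: inv_lim_def)
  thus False using k[OF z] tent_half unfolding h by simp
 qed
 show "y (Suc k) \<noteq> 1/2" by (rule ne[OF xy(2)])
 have "connected ((\<lambda>z. z (Suc k)) ` C)"
  by (rule connected_continuous_image[OF continuous_on_subset[OF _ subset_UNIV] C(1)]) simp
 moreover have "1/2 \<notin> (\<lambda>z. z (Suc k)) ` C" using ne by force
 ultimately have "(1/2::real) < y (Suc k)" if "1/2 < x (Suc k)" "x \<in> C" "y \<in> C" for x y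
  using that connectedD_interval[of "(\<lambda>z. z (Suc k)) ` C" "y (Suc k)" "x (Suc k)" "1/2"] by (metis image_eqI less_imp_le not_le)
 thus "1/2 < y (Suc k) \<longleftrightarrow> 1/2 < x (Suc k)" using xy by blast
qed

lemma open_coordinate_ne: "finite I \<Longrightarrow> open {y :: nat \<Rightarrow> real. \<forall>k\<in>I. y k \<noteq> a}"
proof -
 assume f: "finite I"
 have "open {y :: nat \<Rightarrow> real. y k \<noteq> a}" for k by (intro open_Collect_neq) simp_all
 hence "open (\<Inter>k\<in>I. {y :: nat \<Rightarrow> real. y k \<noteq> a})" using f by (intro open_INT) auto
 moreover have "(\<Inter>k\<in>I. {y :: nat \<Rightarrow> real. y k \<noteq> a}) = {y. \<forall>k\<in>I. y k \<noteq> a}" by auto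
 ultimately show ?thesis by simp
qed

text \<open>Locally the class of the tail cannot change along connected sets, which makes a ray a
  whole arc-component. If only finitely many coordinates of \<open>x\<close> are \<open>s/2\<close>,
  excluding this value at \<open>n\<close> further indices excludes it at all later ones. If
  \<open>x\<close> is an endpoint, it is excluded off one residue class of indices; inside this
  class the neighbouring letters force \<open>\<nu> (n - 1)\<close>, so nearby points keep the
  sequence of \<open>x\<close>.\<close>

lemma UU_local:
 assumes x: "x \<in> core s"
 obtains N where "open N" "x \<in> N"
  "\<And>C y. connected C \<Longrightarrow> x \<in> C \<Longrightarrow> C \<subseteq> N \<inter> core s \<Longrightarrow> y \<in> C \<Longrightarrow> y \<in> UU c \<longleftrightarrow> x \<in> UU c"
proof -
 have ci: "core s \<subseteq> inv_lim s" by (auto simp: core_set)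
 have xi: "x \<in> inv_lim s" using x ci by blast
 obtain l where l: "isrep l x" using isrep_ex[OF xi] by blast
 have lH: "H l" "x 0 \<in> B l" using l by (auto simp: isrep_def)
 have red: "y (k - n * i) = s/2" if "y \<in> inv_lim s" "y k = s/2" "n * i \<le> k" for y k i
  using that(3)
 proof (induction i)
  case (Suc i)
  have "y (k - n * i) = s/2" using Suc by simp
  moreover have "y (k - n * Suc i) = It n (y (k - n * Suc i + n))" using inv_lim_It[OF that(1), of n "k - n * Suc i"] by simp
  moreover have "k - n * Suc i + n = k - n * i" using Suc.prems by simp
  ultimately show ?case using It_n_max by metis
 qed (use that in simp)
 show thesis
 proof (cases "\<exists>J. \<forall>k>J. x k \<noteq> s/2")
  case True
  then obtain J where J: "\<And>k. J < k \<Longrightarrow> x k \<noteq> s/2" by blast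
  define N where "N = {y :: nat \<Rightarrow> real. \<forall>k\<in>{J<..J+n}. y k \<noteq> s/2}"
  have Nk: "y k \<noteq> s/2" if "y \<in> N \<inter> core s" "J < k" for y k
  proof
   assume a: "y k = s/2"
   define i where "i = (k - Suc J) div n"
   have i: "n * i + (k - Suc J) mod n = k - Suc J" by (simp add: i_def)
   have m: "(k - Suc J) mod n < n" using n_pos by simp
   have ki: "J < k - n * i" "k - n * i \<le> J + n" "n * i \<le> k" using i m that(2) by linarith+
   have "y (k - n * i) = s/2" using red[of y k i] a that(1) ci ki by blast
   thus False using that(1) ki by (auto simp: N_def)
  qed
  show thesis
  proof (rule that[of N])
   show "open N" unfolding N_def by (rule open_coordinate_ne) simp
   show "x \<in> N" using J by (auto simp: N_def)
   fix C y assume C: "connected C" "x \<in> C" "C \<subseteq> N \<inter> core s" and y: "y \<in> C"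
   obtain l' where l': "isrep l' y" using isrep_ex y C(3) ci by blast
   have "l' j = l j" if JJ: "Suc J \<le> j" for j
   proof -
    have Cj1: "C \<subseteq> inv_lim s" using C(3) ci by blast
    have Cj2: "z j \<noteq> s/2" if "z \<in> C" for z by (rule Nk) (use that C(3) JJ in auto)
    have "y (Suc j) \<noteq> 1/2" "x (Suc j) \<noteq> 1/2" "1/2 < y (Suc j) \<longleftrightarrow> 1/2 < x (Suc j)"
     by (rule connected_core_side[OF C(1) Cj1 Cj2 C(2) y] connected_core_side(1)[OF C(1) Cj1 Cj2 y C(2)]; assumption)+
    thus ?thesis using isrep_side[OF l, of j] isrep_side[OF l', of j] by (auto simp: side_def split: if_splits)
   qed
   thus "y \<in> UU c \<longleftrightarrow> x \<in> UU c"
    using UU_rep[OF l] UU_rep[OF l'] tl_agree[of "Suc J" l l' c] tl_agree[of "Suc J" l' l c] by auto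
  qed
 next
  case False
  hence inf: "\<exists>k>J. x k = s/2" for J by blast
  have xb: "lb l k (x 0) = x k" for k by (rule isrep_lb[OF l])
  obtain k0 where k0: "x k0 = s/2" using inf by blast
  define r where "r = k0 mod n"
  have xr: "x k = s/2 \<longleftrightarrow> k mod n = r" for k
  proof
   assume k: "x k = s/2"
   obtain m where m: "k0 < m" "k < m" "x m = s/2" using inf[of "max k0 k"] by auto
   have "(m - k) mod n = 0" "(m - k0) mod n = 0" using tight_cong[OF lH(2), of m] m k k0 xb by auto
   hence "[k = m] (mod n)" "[k0 = m] (mod n)" using m by (metis cong_altdef_nat cong_sym less_imp_le mod_0_imp_dvd)+
   thus "k mod n = r" by (simp add: r_def cong_def)
  next
   assume k: "k mod n = r"
   obtain m where m: "max k0 k < m" "x m = s/2" using inf by blast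
   have "(m - k0) mod n = 0" using tight_cong[OF lH(2), of m] m k0 xb by auto
   hence "[k0 = m] (mod n)" using m by (metis cong_altdef_nat cong_sym less_imp_le max.strict_boundedE mod_0_imp_dvd)
   hence "k mod n = m mod n" using k by (simp add: r_def cong_def)
   hence "n dvd m - k" using m by (metis mod_eq_dvd_iff_nat less_imp_le max.strict_boundedE)
   then obtain i where i: "m - k = n * i" by (rule dvdE)
   hence "k = m - n * i" "n * i \<le> m" using m by auto
   thus "x k = s/2" using red[OF xi m(2), of i] by simp
  qed
  define N where "N = {y :: nat \<Rightarrow> real. \<forall>k\<in>{k. k < n \<and> k \<noteq> r}. y k \<noteq> s/2}"
  have Nk: "y k \<noteq> s/2" if "y \<in> N \<inter> core s" "k mod n \<noteq> r" for y k
  proof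
   assume a: "y k = s/2"
   have "k - n * (k div n) = k mod n" by (rule minus_mult_div_eq_mod)
   hence "y (k mod n) = s/2" using red[of y k "k div n"] a that(1) ci by auto
   thus False using that n_pos by (auto simp: N_def)
  qed
  show thesis
  proof (rule that[of N])
   show "open N" unfolding N_def by (rule open_coordinate_ne) simp
   show "x \<in> N" using xr by (auto simp: N_def)
   fix C y assume C: "connected C" "x \<in> C" "C \<subseteq> N \<inter> core s" and y: "y \<in> C"
   have yi: "y \<in> inv_lim s" using y C(3) ci by blast
   have off: "y (Suc j) \<noteq> 1/2" "1/2 < y (Suc j) \<longleftrightarrow> 1/2 < x (Suc j)" "x (Suc j) \<noteq> 1/2" if JJ: "j mod n \<noteq> r" for j
   proof -
    have Cj1: "C \<subseteq> inv_lim s" using C(3) ci by blast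
    have Cj2: "z j \<noteq> s/2" if "z \<in> C" for z by (rule Nk) (use that C(3) JJ in auto)
    show "y (Suc j) \<noteq> 1/2" "1/2 < y (Suc j) \<longleftrightarrow> 1/2 < x (Suc j)" "x (Suc j) \<noteq> 1/2"
     by (rule connected_core_side[OF C(1) Cj1 Cj2 C(2) y] connected_core_side(1)[OF C(1) Cj1 Cj2 y C(2)]; assumption)+
   qed
   have "side (l j) (y (Suc j))" for j
   proof (cases "j mod n = r")
    case False
    thus ?thesis using off[OF False] isrep_side[OF l, of j] by (auto simp: side_def split: if_splits)
   next
    case True
    have xn: "x (j + n) = p 1" using xr[of "j + n"] True p_1 by simp
    hence lj: "l j = \<nu> (n - 1)" using forced_letters[OF lH, of j "n - 1"] xb n_pos p_1 by simp
    have sides: "side (\<nu> i) (It i (p 1))" "side (\<nu> i) (It i (y (j + n)))" if i: "i < n - 1" for i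
    proof -
     define q where "q = j + (n - 1 - i)"
     have q: "i + Suc q = j + n" "q = j + (n - 1 - i)" using i by (auto simp: q_def)
     have "q mod n \<noteq> r"
     proof
      assume "q mod n = r"
      hence "[j + (n - 1 - i) = j] (mod n)" using True by (simp add: cong_def q_def)
      hence "n dvd n - 1 - i" using cong_add_lcancel_0_nat cong_0_iff by blast
      thus False using i by (auto dest: dvd_imp_le)
     qed
     hence o: "y (Suc q) \<noteq> 1/2" "1/2 < y (Suc q) \<longleftrightarrow> 1/2 < x (Suc q)" "x (Suc q) \<noteq> 1/2" using off by auto
     have xq: "It i (x (j + n)) = x (Suc q)" "It i (y (j + n)) = y (Suc q)"
      using inv_lim_It[OF xi, of i "Suc q"] inv_lim_It[OF yi, of i "Suc q"] q(1) by (simp_all add: add.commute)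
     show s1: "side (\<nu> i) (It i (p 1))" using nu_side'[of i] by (simp add: It_p1)
     thus "side (\<nu> i) (It i (y (j + n)))" using o xq xn by (auto simp: side_def split: if_splits)
    qed
    have "It (n - 1) (p 1) - It (n - 1) (y (j + n)) = sgnp (onesl \<nu> (n - 1)) * s ^ (n - 1) * (p 1 - y (j + n))"
     by (rule It_diff) (use sides in auto)
    moreover have "It (n - 1) (p 1) = 1/2" using p_half_iff[of n] n_pos It_p1[of "n - 1"] by simp
    moreover have "It (n - 1) (y (j + n)) = y (Suc j)" using inv_lim_It[OF yi, of "n - 1" "Suc j"] n_pos by simp
    moreover have "0 \<le> s ^ (n - 1) * (p 1 - y (j + n))" using inv_lim_le(1)[OF yi, of "j + n"] p_1 s1 by simp
    ultimately have "sgnp (onesl \<nu> (n - 1)) = 1 \<longrightarrow> y (Suc j) \<le> 1/2" "sgnp (onesl \<nu> (n - 1)) = -1 \<longrightarrow> 1/2 \<le> y (Suc j)" by auto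
    thus ?thesis unfolding lj side_def using nu_last by (auto simp: sgnp_parity)
   qed
   hence "isrep l y" using inv_lim_pt[OF yi, of l] lH(1) unfolding isrep_def by blast
   thus "y \<in> UU c \<longleftrightarrow> x \<in> UU c" using UU_rep l by blast
  qed
 qed
qed

lemma UU_path:
 assumes g: "path g" "path_image g \<subseteq> core s" and t: "t \<in> {0..1}" "g t \<in> UU c" and u: "u \<in> {0..1}"
 shows "g u \<in> UU c"
proof -
 have "(g u \<in> UU c) = (g t \<in> UU c)"
 proof (rule connected_local_const[of "{0..1}" u t "\<lambda>t. g t \<in> UU c"])
  show "\<forall>v\<in>{0..1}. \<forall>\<^sub>F w in at v within {0..1}. (g v \<in> UU c) = (g w \<in> UU c)"
  proof
   fix v :: real assume v: "v \<in> {0..1}"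
   have gv: "g v \<in> core s" using g(2) v by (auto simp: path_image_def)
   obtain N where N: "open N" "g v \<in> N"
    "\<And>C y. connected C \<Longrightarrow> g v \<in> C \<Longrightarrow> C \<subseteq> N \<inter> core s \<Longrightarrow> y \<in> C \<Longrightarrow> y \<in> UU c \<longleftrightarrow> g v \<in> UU c"
    using UU_local[OF gv] by blast
   have cont: "continuous_on {0..1} g" using g(1) by (simp add: path_def)
   then obtain A where A: "open A" "A \<inter> {0..1} = g -` N \<inter> {0..1}" using N(1) by (metis continuous_on_open_invariant)
   have "v \<in> A" using A v N(2) by blast
   then obtain d where d: "0 < d" "ball v d \<subseteq> A" using A(1) open_contains_ball by blast
   have "(g v \<in> UU c) = (g w \<in> UU c)" if w: "w \<in> {0..1}" "dist w v < d" for w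
   proof -
    define C where "C = g ` (ball v d \<inter> {0..1})"
    have "connected (ball v d \<inter> {0..1})" by (intro convex_connected convex_Int) auto
    hence "connected C" unfolding C_def
     by (rule connected_continuous_image[OF continuous_on_subset[OF cont], rotated]) auto
    moreover have "g v \<in> C" "g w \<in> C" using v w d by (auto simp: C_def dist_commute)
    moreover have "C \<subseteq> N \<inter> core s" using d(2) A(2) g(2) unfolding C_def path_image_def by blast
    ultimately show ?thesis using N(3) by blast
   qed
   thus "\<forall>\<^sub>F w in at v within {0..1}. (g v \<in> UU c) = (g w \<in> UU c)"
    unfolding eventually_at using d(1) by blast
  qed
 qed (use t u in auto)
 thus ?thesis using t by simp
qed

lemma UU_arc_component: "UU c = arc_component (core s) (gr c 0)"
proof (rule set_eqI, rule iffI)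
 fix x assume "x \<in> UU c"
 then obtain b where t: "0 \<le> b" "x = gr c b" by (rule UU_gr)
 define T where "T = b + 1"
 define g where "g = (\<lambda>u. gr c (T * u))"
 have im: "(\<lambda>u. T * u) ` {0..1} \<subseteq> {0..}" using t by (auto simp: T_def)
 have "path g" unfolding path_def g_def
  by (rule continuous_on_compose2[OF gr_continuous _ im]) (intro continuous_intros)
 moreover have "inj_on g {0..1}"
 proof (rule inj_onI)
  fix u v :: real assume uv: "u \<in> {0..1}" "v \<in> {0..1}" "g u = g v"
  have "T * u \<in> {0..}" "T * v \<in> {0..}" using im uv(1,2) by blast+
  moreover have "gr c (T * u) = gr c (T * v)" using uv(3) by (simp add: g_def)
  ultimately have "gr c (T * u) = gr c (T * v)" "T * u \<in> {0..}" "T * v \<in> {0..}" by blast+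
  hence "T * u = T * v" by (rule inj_onD[OF gr_inj])
  thus "u = v" using t by (simp add: T_def)
 qed
 ultimately have "arc g" by (simp add: arc_def)
 moreover have "path_image g \<subseteq> core s" using gr_core im by (fastforce simp: path_image_def g_def)
 moreover have "gr c 0 \<in> path_image g" unfolding path_image_def g_def by (rule image_eqI[of _ _ 0]) auto
 moreover have "x \<in> path_image g" unfolding path_image_def g_def
  by (rule image_eqI[of _ _ "b / T"]) (use t in "auto simp: T_def")
 ultimately show "x \<in> arc_component (core s) (gr c 0)" unfolding arc_component_def by blast
next
 fix x assume "x \<in> arc_component (core s) (gr c 0)"
 then obtain g where g: "arc g" "path_image g \<subseteq> core s" "gr c 0 \<in> path_image g" "x \<in> path_image g"
  unfolding arc_component_def by blast
 then obtain t u where "t \<in> {0..1}" "g t = gr c 0" "u \<in> {0..1}" "g u = x" by (auto simp: path_image_def)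
 thus "x \<in> UU c" using UU_path[OF arc_imp_path[OF g(1)] g(2), of t c u] gr_UU[of 0 c] by simp
qed

end

section \<open>Crosscuts and prime ends of plane continua with dense accessible rays\<close>

text \<open>Identifies the plane with \<open>complex\<close>, where Janiszewski's theorem is
  stated.\<close>

definition cx :: "real \<times> real \<Rightarrow> complex" where "cx z = Complex (fst z) (snd z)"
definition xc :: "complex \<Rightarrow> real \<times> real" where "xc w = (Re w, Im w)"

lemma xc_cx [simp]: "xc (cx z) = z" and cx_xc [simp]: "cx (xc w) = w" by (simp_all add: cx_def xc_def)

lemma continuous_on_cx [continuous_intros]: "continuous_on S cx"
proof -
 have "cx z = of_real (fst z) + \<i> * of_real (snd z)" for z by (simp add: cx_def Complex_eq)
 hence "cx = (\<lambda>z. of_real (fst z) + \<i> * of_real (snd z))" by blast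
 moreover have "continuous_on S (\<lambda>z :: real \<times> real. complex_of_real (fst z) + \<i> * complex_of_real (snd z))"
  by (intro continuous_intros)
 ultimately show ?thesis by metis
qed

lemma continuous_on_xc [continuous_intros]: "continuous_on S xc"
 unfolding xc_def by (intro continuous_intros)

lemma cx_inj: "inj_on cx S" by (rule inj_on_inverseI[of _ xc]) simp

lemma cx_Compl: "cx ` (- S) = - (cx ` S)"
proof -
 have "surj cx" by (rule surjI[of _ xc]) simp
 thus ?thesis using cx_inj[of UNIV] by (rule_tac bij_image_Compl_eq) (simp add: bij_def)
qed

lemma cx_connected: "connected (cx ` S) \<longleftrightarrow> connected S"
proof
 assume "connected (cx ` S)"
 hence "connected (xc ` cx ` S)" by (rule connected_continuous_image[OF continuous_on_xc])
 thus "connected S" by (simp add: image_image)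
qed (rule connected_continuous_image[OF continuous_on_cx])

lemma cx_connected_component: "connected_component (cx ` S) (cx a) (cx b) \<longleftrightarrow> connected_component S a b"
proof
 assume "connected_component (cx ` S) (cx a) (cx b)"
 then obtain C where C: "connected C" "C \<subseteq> cx ` S" "cx a \<in> C" "cx b \<in> C" by (auto simp: connected_component_def)
 have "connected (xc ` C)" by (rule connected_continuous_image[OF continuous_on_xc C(1)])
 moreover have "xc ` C \<subseteq> S" using C(2) by fastforce
 moreover have "a \<in> xc ` C" "b \<in> xc ` C" using C(3,4) by (metis image_eqI xc_cx)+
 ultimately show "connected_component S a b" by (auto simp: connected_component_def)
next
 assume "connected_component S a b"
 then obtain C where C: "connected C" "C \<subseteq> S" "a \<in> C" "b \<in> C" by (auto simp: connected_component_def)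
 hence "connected (cx ` C)" "cx ` C \<subseteq> cx ` S" "cx a \<in> cx ` C" "cx b \<in> cx ` C"
  using connected_continuous_image[OF continuous_on_cx C(1)] by auto
 thus "connected_component (cx ` S) (cx a) (cx b)" by (auto simp: connected_component_def)
qed

lemma cx_compact: "compact S \<Longrightarrow> compact (cx ` S)" by (rule compact_continuous_image[OF continuous_on_cx])

lemma Janiszewski_plane:
 fixes a b :: "real \<times> real"
 assumes "compact S" "compact T" "connected (S \<inter> T)" "connected_component (- S) a b" "connected_component (- T) a b"
 shows "connected_component (- (S \<union> T)) a b"
proof -
 have i: "cx ` (S \<inter> T) = cx ` S \<inter> cx ` T" by (rule inj_on_image_Int[OF cx_inj[of UNIV]]) auto
 have "connected_component (- (cx ` S \<union> cx ` T)) (cx a) (cx b)"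
 proof (rule Janiszewski)
  show "compact (cx ` S)" using assms cx_compact by blast
  show "closed (cx ` T)" using assms cx_compact compact_imp_closed by blast
  show "connected (cx ` S \<inter> cx ` T)" using assms(3) by (simp add: i[symmetric] cx_connected)
  show "connected_component (- (cx ` S)) (cx a) (cx b)" "connected_component (- (cx ` T)) (cx a) (cx b)"
   using assms(4,5) by (simp_all add: cx_Compl[symmetric] cx_connected_component)
 qed
 thus ?thesis by (simp only: image_Un[symmetric] cx_Compl[symmetric] cx_connected_component)
qed

lemma Janiszewski_dual_plane:
 fixes S T :: "(real \<times> real) set"
 assumes "compact S" "compact T" "connected S" "connected T" "connected (- (S \<union> T))"
 shows "connected (S \<inter> T)"
proof -
 have i: "cx ` (S \<inter> T) = cx ` S \<inter> cx ` T" by (rule inj_on_image_Int[OF cx_inj[of UNIV]]) auto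
 have "connected (cx ` S \<inter> cx ` T)"
 using Janiszewski_dual assms cx_compact assms(5) image_Un cx_Compl cx_connected by (metis cx_connected)
 thus ?thesis by (simp add: i[symmetric] cx_connected)
qed

section \<open>Domains of crosscuts of a nonseparating continuum\<close>

lemma crosscutE:
 assumes "crosscut K Q"
 obtains a b where "a \<noteq> b" "Q \<inter> K = {a, b}" "compact Q" "connected Q" "connected (Q - K)" "Q \<subseteq> closure (Q - K)" "Q - K \<noteq> {}"
proof -
 obtain g where g: "arc g" "Q = path_image g" "Q \<inter> K = {pathstart g, pathfinish g}" using assms by (auto simp: crosscut_def)
 have inj: "inj_on g {0..1}" and cont: "continuous_on {0..1} g" using g(1) by (auto simp: arc_def path_def)
 have "Q - K = path_image g - {pathstart g, pathfinish g}" using g(2,3) by blast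
 also have "\<dots> = g ` {0<..<1}"
 proof -
  have "{0..1} - {0, 1::real} = {0<..<1}" by auto
  moreover have "g ` ({0..1} - {0, 1}) = g ` {0..1} - g ` {0, 1}" by (rule inj_on_image_set_diff[OF inj]) auto
  ultimately show ?thesis by (simp add: path_image_def pathstart_def pathfinish_def)
 qed
 finally have o: "Q - K = g ` {0<..<1}" .
 have "connected (Q - K)" unfolding o
  by (rule connected_continuous_image[OF continuous_on_subset[OF cont]]) auto
 moreover have "Q \<subseteq> closure (Q - K)"
 proof -
  have "g ` closure {0<..<1} \<subseteq> closure (g ` {0<..<1})"
   by (rule image_closure_subset[OF _ closed_closure closure_subset]) (simp add: cont)
  thus ?thesis using g(2) o by (simp add: path_image_def)
 qed
 moreover have "g (1/2) \<in> Q - K" unfolding o by simp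
 moreover have "pathstart g \<noteq> pathfinish g" using arc_distinct_ends[OF g(1)] by auto
 moreover have "compact Q" "connected Q" using g by (simp_all add: compact_arc_image connected_arc_image)
 ultimately show thesis using that[OF _ g(3)] by blast
qed

text \<open>If \<open>K\<close> together with the crosscut did not separate the plane, the dual form
  of Janiszewski's theorem would make their intersection connected, but it consists of two
  points.\<close>

lemma crosscut_domain_nonempty:
 assumes K: "compact K" "connected K" and Q: "crosscut K Q"
 shows "crosscut_domain K Q \<noteq> {}"
proof
 obtain a b where q: "a \<noteq> b" "Q \<inter> K = {a, b}" "compact Q" "connected Q" by (rule crosscutE[OF Q])
 assume "crosscut_domain K Q = {}"
 hence "- (K \<union> Q) = outside (K \<union> Q)" using inside_Un_outside[of "K \<union> Q"] by (simp add: crosscut_domain_def)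
 moreover have "connected (outside (K \<union> Q))"
  by (rule connected_outside) (use K q in "simp_all add: compact_imp_bounded")
 ultimately have "connected (K \<inter> Q)" using Janiszewski_dual_plane[OF K(1) q(3) K(2) q(4)] by simp
 hence "connected {a, b}" using q(2) by (simp add: Int_commute)
 thus False using q(1) connected_finite_iff_sing[of "{a, b}"] by auto
qed

text \<open>Otherwise the bounded domain would be open and closed in the connected complement of
  \<open>K\<close>, hence equal to this unbounded set.\<close>

lemma crosscut_domain_frontier:
 assumes K: "compact K" "connected K" "connected (- K)" and Q: "crosscut K Q"
 shows "closure (crosscut_domain K Q) \<inter> (Q - K) \<noteq> {}"
proof
 obtain a b where q: "Q \<inter> K = {a, b}" "compact Q" "connected Q" by (rule crosscutE[OF Q])
 define D where "D = crosscut_domain K Q"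
 have cl: "closed (K \<union> Q)" using K q by (intro closed_Un compact_imp_closed)
 have bd: "bounded D" unfolding D_def crosscut_domain_def
  by (intro bounded_inside) (use K q in "simp add: compact_imp_bounded")
 have op: "open D" unfolding D_def crosscut_domain_def by (rule open_inside[OF cl])
 have clD: "closure D \<subseteq> (K \<union> Q) \<union> D" unfolding D_def crosscut_domain_def by (rule closure_inside_subset[OF cl])
 assume "closure (crosscut_domain K Q) \<inter> (Q - K) = {}"
 hence c: "closure D \<inter> - K \<subseteq> D" using clD by (auto simp: D_def)
 have ne: "D \<noteq> {}" unfolding D_def by (rule crosscut_domain_nonempty[OF K(1,2) Q])
 have DK: "D \<subseteq> - K" unfolding D_def crosscut_domain_def using inside_no_overlap by blast
 have "openin (top_of_set (- K)) D" using op DK by (simp add: openin_open_eq K compact_imp_closed open_Compl)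
 moreover have "closedin (top_of_set (- K)) D"
  using c DK closure_subset by (auto simp: closedin_closed intro!: exI[of _ "closure D"])
 ultimately have "D = - K" using K(3) ne unfolding connected_clopen by blast
 hence "bounded (- K)" using bd by simp
 thus False using K(1) by (metis bounded_Un compact_imp_bounded Compl_partition not_bounded_UNIV)
qed

text \<open>\<open>W\<close> joins the rest of \<open>K\<close> to a far point without touching the
  closed-up piece \<open>g \<union> Q\<close>, so the latter encloses nothing of
  \<open>K - g\<close>. A point enclosed by \<open>K \<union> Q\<close> but not by
  \<open>g \<union> Q\<close> could be joined to the far point off \<open>K\<close> and off
  \<open>g \<union> Q\<close> separately. These two sets meet in the connected set \<open>g\<close>,
  so Janiszewski's theorem would join the points off the union.\<close>

lemma crosscut_domain_same_piece:
 fixes K :: "(real \<times> real) set"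
 assumes K: "compact K" "connected (- K)" and Q: "compact Q" "connected Q" "Q \<inter> K \<subseteq> g"
  and g: "compact g" "g \<subseteq> K" "connected g" "connected (K - g)"
  and W: "connected W" "W \<inter> (g \<union> Q) = {}" "W \<inter> (K - g) \<noteq> {}" "w \<in> W" "w \<notin> cball 0 r" "K \<union> Q \<subseteq> cball 0 r"
 shows "K - g \<subseteq> outside (g \<union> Q)" "inside (K \<union> Q) \<subseteq> inside (g \<union> Q)"
proof -
 define J where "J = g \<union> Q"
 have J: "compact J" "J \<subseteq> cball 0 r" using g Q W(6) by (auto simp: J_def)
 have o: "- cball 0 r \<subseteq> outside J" "- cball 0 r \<subseteq> outside K"
  by (rule outside_subset_convex; use J W(6) in auto)+
 have wJ: "w \<in> outside J" "w \<in> outside K" using o W(5) by auto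
 have "connected ((K - g) \<union> W)" using g(4) W(1,3) by (intro connected_Un) auto
 moreover have "(K - g) \<union> W \<subseteq> - J" using W(2) Q(3) by (auto simp: J_def)
 ultimately have cc: "connected_component (- J) w x" if "x \<in> K - g" for x
  using that W(4) unfolding connected_component_def by blast
 thus "K - g \<subseteq> outside (g \<union> Q)" using outside_same_component[OF _ wJ(1)] by (auto simp: J_def)
 show "inside (K \<union> Q) \<subseteq> inside (g \<union> Q)"
 proof
  fix z assume z: "z \<in> inside (K \<union> Q)"
  hence zn: "z \<notin> K \<union> Q" using inside_no_overlap by blast
  show "z \<in> inside (g \<union> Q)"
  proof (rule ccontr)
   assume "z \<notin> inside (g \<union> Q)"
   moreover have "z \<notin> J" using zn g(2) by (auto simp: J_def)
   ultimately have zo: "z \<in> outside J" using inside_Un_outside[of J] unfolding J_def by blast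
   have "connected (outside J)" by (rule connected_outside) (use J in "simp_all add: compact_imp_bounded")
   hence 1: "connected_component (- J) z w"
    using zo wJ(1) inside_Un_outside[of J] unfolding connected_component_def by blast
   have "w \<notin> K" using W(5,6) by blast
   hence 2: "connected_component (- K) z w" using K(2) zn unfolding connected_component_def by blast
   have "J \<inter> K = g" using g(2) Q(3) by (auto simp: J_def)
   hence "connected (J \<inter> K)" using g(3) by simp
   hence "connected_component (- (J \<union> K)) z w" by (rule Janiszewski_plane[OF J(1) K(1) _ 1 2])
   moreover have "J \<union> K = K \<union> Q" using g(2) by (auto simp: J_def)
   ultimately have "w \<in> inside (K \<union> Q)" using inside_same_component[OF _ z] by simp
   moreover have "w \<in> outside (K \<union> Q)" using outside_subset_convex[OF convex_cball W(6)] W(5) by blast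
   ultimately show False using inside_Int_outside[of "K \<union> Q"] by blast
  qed
 qed
qed

text \<open>A nested crosscut reaches into the inside of \<open>g \<union> Q\<close> and does not
  cross it, so its closure stays there, where all points of \<open>K\<close> belong to
  \<open>g\<close>.\<close>

lemma crosscut_ends_in_piece:
 assumes K: "compact K" "connected K" "connected (- K)" and Q: "closed (g \<union> Q)"
  and o: "K - g \<subseteq> outside (g \<union> Q)" and i: "inside (K \<union> Q) \<subseteq> inside (g \<union> Q)" and gK: "g \<subseteq> K"
  and Q': "crosscut K Q'" "crosscut_domain K Q' \<subseteq> crosscut_domain K Q" "Q' \<inter> Q = {}"
 shows "Q' \<inter> K \<subseteq> g"
proof -
 obtain a b where q: "Q' \<inter> K = {a, b}" "connected (Q' - K)" "Q' \<subseteq> closure (Q' - K)" by (rule crosscutE[OF Q'(1)])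
 have "closure (crosscut_domain K Q') \<subseteq> closure (inside (g \<union> Q))"
  using Q'(2) i by (intro closure_mono) (auto simp: crosscut_domain_def)
 also have "\<dots> \<subseteq> (g \<union> Q) \<union> inside (g \<union> Q)" by (rule closure_inside_subset[OF Q])
 finally obtain z where z: "z \<in> Q' - K" "z \<in> (g \<union> Q) \<union> inside (g \<union> Q)"
  using crosscut_domain_frontier[OF K Q'(1)] by blast
 have dj: "(Q' - K) \<inter> (g \<union> Q) = {}" using Q'(3) gK by blast
 hence zi: "z \<in> inside (g \<union> Q)" using z by blast
 have "Q' - K \<subseteq> inside (g \<union> Q)"
 proof
  fix y assume y: "y \<in> Q' - K"
  have "connected_component (- (g \<union> Q)) z y" using q(2) dj z(1) y unfolding connected_component_def by blast
  thus "y \<in> inside (g \<union> Q)" by (rule inside_same_component[OF _ zi])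
 qed
 hence "Q' \<subseteq> (g \<union> Q) \<union> inside (g \<union> Q)"
  using q(3) closure_inside_subset[OF Q] closure_mono by blast
 thus ?thesis using o Q'(3) inside_Int_outside[of "g \<union> Q"] by blast
qed

lemma crosscut_chain_mono:
 assumes "crosscut_chain K Q" "i \<le> j" shows "crosscut_domain K (Q j) \<subseteq> crosscut_domain K (Q i)"
 using assms(2) by (rule lift_Suc_antimono_le[rotated]) (use assms(1) in "auto simp: crosscut_chain_def")

lemma crosscut_limit_in:
 assumes "\<And>i. crosscut K (Q i)" "\<And>e. 0 < e \<Longrightarrow> \<forall>\<^sub>F i in sequentially. Q i \<subseteq> ball p e"
  and "closed g" "\<forall>\<^sub>F i in sequentially. Q i \<inter> K \<subseteq> g"
 shows "p \<in> g"
proof -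
 have "p \<in> closure g" unfolding closure_approachable
 proof (intro allI impI)
  fix e :: real assume "0 < e"
  then obtain i where "Q i \<subseteq> ball p e" "Q i \<inter> K \<subseteq> g"
   using eventually_happens[OF eventually_conj[OF assms(2)[OF `0 < e`] assms(4)]] by auto
  moreover obtain z where "z \<in> Q i \<inter> K" using assms(1)[of i] by (rule crosscutE) blast
  ultimately show "\<exists>y\<in>g. dist y p < e" by (auto simp: dist_commute intro!: bexI[of _ z])
 qed
 thus ?thesis using assms(3) by simp
qed

text \<open>A connected set off \<open>K\<close> near \<open>p\<close> cannot meet infinitely many crosscuts of a chain
 if an equivalent chain converges elsewhere, as it would have to cross the latter.\<close>

lemma chain_limit_unique_if_bridge:
 assumes K: "compact K" "connected K" "connected (- K)"
  and eq: "(Q, Q') \<in> chain_equivalence K"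
  and lim: "\<And>e. 0 < e \<Longrightarrow> \<forall>\<^sub>F i in sequentially. Q i \<subseteq> ball p e" "\<And>e. 0 < e \<Longrightarrow> \<forall>\<^sub>F i in sequentially. Q' i \<subseteq> ball q e"
  and G: "\<And>e. 0 < e \<Longrightarrow> \<exists>G. connected G \<and> G \<subseteq> - K \<inter> ball p e \<and> (\<forall>\<^sub>F k in sequentially. Q k \<inter> G \<noteq> {})"
 shows "p = q"
proof (rule ccontr)
 assume "p \<noteq> q"
 define e where "e = dist p q / 2"
 have e: "0 < e" using `p \<noteq> q` by (simp add: e_def)
 have dj: "ball p e \<inter> ball q e = {}" by (rule disjoint_ballI) (simp add: e_def)
 have ch: "crosscut_chain K Q" "crosscut_chain K Q'" using eq by (auto simp: chain_equivalence_def)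
 hence cr: "crosscut K (Q i)" "crosscut K (Q' i)" for i by (auto simp: crosscut_chain_def)
 obtain G where G: "connected G" "G \<subseteq> - K \<inter> ball p e" "\<forall>\<^sub>F k in sequentially. Q k \<inter> G \<noteq> {}" using assms(7)[OF e] by blast
 obtain k0 where k0: "\<And>k. k0 \<le> k \<Longrightarrow> Q k \<inter> G \<noteq> {} \<and> Q k \<subseteq> ball p e"
  using eventually_conj[OF G(3) lim(1)[OF e]] by (auto simp: eventually_sequentially)
 obtain j0 where j0: "\<And>j. j0 \<le> j \<Longrightarrow> Q' j \<subseteq> ball q e" using lim(2)[OF e] by (auto simp: eventually_sequentially)
 obtain j1 where j1: "crosscut_domain K (Q' j1) \<subseteq> crosscut_domain K (Q k0)" using eq unfolding chain_equivalence_def by blast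
 define j where "j = max j0 j1"
 have j: "crosscut_domain K (Q' j) \<subseteq> crosscut_domain K (Q k0)" "Q' j \<subseteq> ball q e"
  using crosscut_chain_mono[OF ch(2), of j1 j] j1 j0[of j] by (auto simp: j_def)
 obtain k1 where k1: "crosscut_domain K (Q k1) \<subseteq> crosscut_domain K (Q' j)" using eq unfolding chain_equivalence_def by blast
 define k where "k = max k0 k1"
 have k: "crosscut_domain K (Q k) \<subseteq> crosscut_domain K (Q' j)" "k0 \<le> k"
  using crosscut_chain_mono[OF ch(1), of k1 k] k1 by (auto simp: k_def)
 define E where "E = (Q k - K) \<union> G \<union> (Q k0 - K)"
 have co: "connected (Q i - K)" for i using cr(1)[of i] by (rule crosscutE)
 have "(Q k - K) \<inter> G \<noteq> {}" "(Q k0 - K) \<inter> G \<noteq> {}" using k0[OF k(2)] k0[of k0] G(2) by blast+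
 hence "connected E" unfolding E_def using co G(1)
  by (intro connected_Un) auto
 moreover have "E \<subseteq> - (K \<union> Q' j)" using G(2) k0[OF k(2)] k0[of k0] j(2) dj unfolding E_def by blast
 ultimately have cc: "connected_component (- (K \<union> Q' j)) x y" if "x \<in> E" "y \<in> E" for x y
  using that unfolding connected_component_def by blast
 have cl: "closed (K \<union> Q' j)"
 using cr(2) crosscutE K closed_Un compact_imp_closed by metis
 obtain z where z: "z \<in> Q k - K" "z \<in> closure (crosscut_domain K (Q k))" using crosscut_domain_frontier[OF K cr(1)[of k]] by blast
 have "z \<in> closure (inside (K \<union> Q' j))" using z(2) closure_mono[OF k(1)] by (auto simp: crosscut_domain_def)
 hence "z \<in> (K \<union> Q' j) \<union> inside (K \<union> Q' j)" using closure_inside_subset[OF cl] by blast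
 moreover have zE: "z \<in> E" using z(1) by (simp add: E_def)
 ultimately have zi: "z \<in> inside (K \<union> Q' j)" using `E \<subseteq> - (K \<union> Q' j)` by blast
 obtain y where y: "y \<in> Q k0 - K" using cr(1)[of k0] by (rule crosscutE) blast
 hence "y \<in> inside (K \<union> Q' j)" using inside_same_component[OF cc[OF zE] zi] by (simp add: E_def)
 hence "y \<in> inside (K \<union> Q k0)" using j(1) by (auto simp: crosscut_domain_def)
 thus False using y inside_no_overlap[of "K \<union> Q k0"] by blast
qed

text \<open>The arc that reaches \<open>a\<close> is prolonged by a path in the connected open
  complement of \<open>K\<close>.\<close>

lemma accessible_escape:
 assumes K: "compact K" "connected (- K)" and a: "accessible K a"
 obtains W w where "compact W" "connected W" "W \<inter> K = {a}" "w \<in> W" "w \<notin> cball 0 r"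
proof -
 obtain g where g: "arc g" "path_image g \<inter> K = {a}" using a by (auto simp: accessible_def)
 have "infinite (path_image g)"
  using arc_distinct_ends[OF g(1)] connected_finite_iff_sing[of "path_image g"] connected_arc_image[OF g(1)]
   pathstart_in_path_image[of g] pathfinish_in_path_image[of g] by (metis empty_iff singletonD)
 then obtain z where z: "z \<in> path_image g" "z \<noteq> a" by (metis finite.emptyI finite_insert infinite_imp_nonempty rev_finite_subset singletonI subsetI)
 hence zK: "z \<notin> K" using g(2) by blast
 obtain R where R: "r \<le> R" "K \<subseteq> cball 0 R"
 proof -
  obtain R where "\<forall>x\<in>K. norm x \<le> R" using compact_imp_bounded[OF K(1)] by (auto simp: bounded_iff)
  hence "K \<subseteq> cball 0 (max r R)" by (force simp: le_max_iff_disj)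
  thus ?thesis using that[of "max r R"] by simp
 qed
 define w where "w = (\<bar>R\<bar> + 1, 0 :: real)"
 have w: "w \<notin> cball 0 R" by (simp add: w_def norm_Pair)
 have "path_connected (- K)" using K by (intro connected_open_path_connected) (auto simp: compact_imp_closed open_Compl)
 then obtain h where h: "path h" "path_image h \<subseteq> - K" "pathstart h = z" "pathfinish h = w"
  using zK w R(2) unfolding path_connected_def by blast
 define W where "W = path_image g \<union> path_image h"
 have "z \<in> path_image h" "w \<in> path_image h" using h pathstart_in_path_image pathfinish_in_path_image by metis+
 moreover have "connected W" unfolding W_def
  using connected_arc_image[OF g(1)] connected_path_image[OF h(1)] z(1) calculation(1) by (intro connected_Un) auto
 moreover have "compact W" unfolding W_def by (intro compact_Un compact_arc_image compact_path_image g h)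
 moreover have "W \<inter> K = {a}" unfolding W_def using g(2) h(2) by blast
 moreover have "w \<notin> cball 0 r" using w R(1) by auto
 ultimately show thesis using that[of W w] by (simp add: W_def)
qed

text \<open>The topological setting, freed from dynamics. A dense ray avoiding a piece of
  \<open>K\<close> makes the rest of \<open>K\<close> connected, and its accessible point links this
  rest to the unbounded side.\<close>

locale ray_continuum =
 fixes K :: "(real \<times> real) set" and n :: nat and R :: "nat \<Rightarrow> (real \<times> real) set" and g :: "nat \<Rightarrow> real \<Rightarrow> real \<times> real"
 assumes K: "compact K" "connected K" "connected (- K)" and n3: "3 \<le> n"
  and R: "\<And>c. c < n \<Longrightarrow> R c = g c ` {0..}" "\<And>c. c < n \<Longrightarrow> continuous_on {0..} (g c)" "\<And>c. c < n \<Longrightarrow> inj_on (g c) {0..}"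
  and R_dense: "\<And>c. c < n \<Longrightarrow> R c \<subseteq> K \<and> K \<subseteq> closure (R c)"
  and R_disjoint: "\<And>c c'. c < n \<Longrightarrow> c' < n \<Longrightarrow> c \<noteq> c' \<Longrightarrow> R c \<inter> R c' = {}"
  and R_accessible: "\<And>c. c < n \<Longrightarrow> \<exists>a\<in>R c. accessible K a"
begin

text \<open>A crosscut with both ends on one ray confines all later crosscuts, and also the limit
  \<open>q\<close> of the equivalent chain, to the subarc between its ends. As the crosscuts shrink
  to \<open>p\<close>, the parameters of their ends approach that of \<open>p\<close>, and
  \<open>q\<close> is squeezed in between.\<close>

lemma chain_limit_unique_if_same_ray:
 assumes eq: "(Q, Q') \<in> chain_equivalence K"
  and lim: "\<And>e. 0 < e \<Longrightarrow> \<forall>\<^sub>F i in sequentially. Q i \<subseteq> ball p e" "\<And>e. 0 < e \<Longrightarrow> \<forall>\<^sub>F i in sequentially. Q' i \<subseteq> ball q e"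
  and pK: "p \<in> K" and same: "\<exists>\<^sub>F k in sequentially. \<exists>c<n. Q k \<inter> K \<subseteq> R c"
 shows "p = q"
proof (rule ccontr)
 assume ne: "p \<noteq> q"
 have ch: "crosscut_chain K Q" "crosscut_chain K Q'" using eq by (auto simp: chain_equivalence_def)
 hence cr: "crosscut K (Q i)" "crosscut K (Q' i)" for i by (auto simp: crosscut_chain_def)
 obtain a where a: "\<And>c. c < n \<Longrightarrow> a c \<in> R c \<and> accessible K (a c)" using R_accessible by metis
 obtain r0 where r0: "\<And>x. x \<in> K \<Longrightarrow> norm x \<le> r0" using compact_imp_bounded[OF K(1)] by (auto simp: bounded_iff)
 define r where "r = r0 + 1"
 have ball_r: "K \<union> ball p 1 \<subseteq> cball 0 r"
 proof
  fix x assume x: "x \<in> K \<union> ball p 1"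
  show "x \<in> cball 0 r"
  proof (cases "x \<in> K")
   case True
   thus ?thesis using r0[OF True] by (simp add: r_def)
  next
   case False
   hence "dist p x < 1" using x by auto
   hence "norm x \<le> norm p + 1" using norm_triangle_sub[of x p] by (simp add: dist_norm norm_minus_commute)
   thus ?thesis using r0[OF pK] by (simp add: r_def)
  qed
 qed
 have "\<forall>c. \<exists>W w. c < n \<longrightarrow> compact W \<and> connected W \<and> W \<inter> K = {a c} \<and> w \<in> W \<and> w \<notin> cball 0 r"
  using accessible_escape[OF K(1,3)] a by metis
 then obtain W w where W: "\<And>c. c < n \<Longrightarrow> compact (W c) \<and> connected (W c) \<and> W c \<inter> K = {a c} \<and> w c \<in> W c \<and> w c \<notin> cball 0 r"
  by metis
 have "\<forall>\<^sub>F i in sequentially. \<forall>c\<in>{c. c < n \<and> a c \<noteq> p}. Q i \<inter> W c = {}"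
 proof (rule eventually_ball_finite)
  show "\<forall>c\<in>{c. c < n \<and> a c \<noteq> p}. \<forall>\<^sub>F i in sequentially. Q i \<inter> W c = {}"
  proof
   fix c assume c: "c \<in> {c. c < n \<and> a c \<noteq> p}"
   hence Wc: "W c \<inter> K = {a c}" "compact (W c)" "a c \<noteq> p" using W[of c] by auto
   have "p \<notin> W c" using Wc(1,3) pK by (metis IntI singletonD)
   moreover have "closed (W c)" by (rule compact_imp_closed[OF Wc(2)])
   ultimately obtain e where e: "0 < e" "ball p e \<subseteq> - W c" by (meson ComplI open_Compl open_contains_ball)
   show "\<forall>\<^sub>F i in sequentially. Q i \<inter> W c = {}" by (rule eventually_mono[OF lim(1)[OF e(1)]]) (use e(2) in blast)
  qed
 qed simp
 moreover define e where "e = min 1 (dist p q / 2)"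
 have e: "0 < e" using ne by (simp add: e_def)
 have dj: "ball p e \<inter> ball q e = {}" by (rule disjoint_ballI) (simp add: e_def)
 ultimately have "\<forall>\<^sub>F i in sequentially. (\<forall>c\<in>{c. c < n \<and> a c \<noteq> p}. Q i \<inter> W c = {}) \<and> Q i \<subseteq> ball p e"
  using lim(1)[OF e] by (rule_tac eventually_conj)
 then obtain k0 where k00: "\<And>k. k0 \<le> k \<Longrightarrow> (\<forall>c\<in>{c. c < n \<and> a c \<noteq> p}. Q k \<inter> W c = {}) \<and> Q k \<subseteq> ball p e"
  unfolding eventually_sequentially by blast
 have k0: "\<And>k c. k0 \<le> k \<Longrightarrow> c < n \<Longrightarrow> a c \<noteq> p \<Longrightarrow> Q k \<inter> W c = {}" "\<And>k. k0 \<le> k \<Longrightarrow> Q k \<subseteq> ball p e"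
  using k00 by blast+
 have main: "\<exists>t u. 0 \<le> t \<and> t \<le> u \<and> Q k \<inter> K = {g c t, g c u} \<and> (\<forall>k'>k. Q k' \<inter> K \<subseteq> g c ` {t..u}) \<and> q \<in> g c ` {t..u}"
  if k: "k0 \<le> k" and c: "c < n" "Q k \<inter> K \<subseteq> R c" for k c
 proof -
  obtain x y where xy: "x \<noteq> y" "Q k \<inter> K = {x, y}" "compact (Q k)" "connected (Q k)" by (rule crosscutE[OF cr(1)[of k]])
  obtain t0 u0 where tu0: "0 \<le> t0" "0 \<le> u0" "x = g c t0" "y = g c u0" using xy(2) c(2) R(1)[OF c(1)] by auto
  define t u where tu_def: "t = min t0 u0" "u = max t0 u0"
  have tu: "0 \<le> t" "t \<le> u" "Q k \<inter> K = {g c t, g c u}" using tu0 xy(2) by (auto simp: tu_def min_def max_def)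
  define C where "C = g c ` {t..u}"
  have co: "continuous_on {t..u} (g c)" by (rule continuous_on_subset[OF R(2)[OF c(1)]]) (use tu in auto)
  have C: "compact C" "connected C" "C \<subseteq> R c" "Q k \<inter> K \<subseteq> C"
   unfolding C_def using tu R(1)[OF c(1)] by (auto intro!: compact_continuous_image connected_continuous_image co)
  have CK: "C \<subseteq> K" using C(3) R_dense[OF c(1)] by blast
  \<comment> \<open>Of two further rays at most one has \<open>p\<close> as its chosen accessible
    point. The ray \<open>c'\<close> makes \<open>K - C\<close> connected, and \<open>W c'\<close>
    leads outside without meeting the crosscut.\<close>
  obtain c' where c': "c' < n" "c' \<noteq> c" "a c' \<noteq> p"
  proof -
   define d1 d2 :: nat where "d1 = (if c = 0 then 1 else 0)" and "d2 = (if c = 2 then 1 else 2)"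
   have d: "d1 < n" "d2 < n" "d1 \<noteq> c" "d2 \<noteq> c" "d1 \<noteq> d2" using n3 by (auto simp: d1_def d2_def)
   have "a d1 \<noteq> a d2" using R_disjoint[OF d(1,2,5)] a[OF d(1)] a[OF d(2)] by auto
   thus ?thesis using that d by metis
  qed
  have R': "R c' \<subseteq> K - C" using R_disjoint[OF c'(1) c(1) c'(2)] C(3) R_dense[OF c'(1)] by blast
  have "connected (R c')" unfolding R(1)[OF c'(1)] by (rule connected_continuous_image[OF R(2)[OF c'(1)]]) auto
  hence cK: "connected (K - C)" by (rule connected_intermediate_closure[OF _ R']) (use R_dense[OF c'(1)] in blast)
  note Wc = W[OF c'(1)]
  have aR: "a c' \<in> K - C" using a[OF c'(1)] R' by blast
  have "W c' \<inter> K = {a c'}" using Wc by blast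
  hence "x = a c'" if "x \<in> W c'" "x \<in> C" for x using that CK by (metis IntI singletonD subsetD)
  hence "W c' \<inter> C = {}" using aR by (metis DiffD2 disjoint_iff)
  moreover have "W c' \<inter> Q k = {}" using k0(1)[OF k c'(1,3)] by (simp add: Int_commute)
  ultimately have 1: "W c' \<inter> (C \<union> Q k) = {}" by (simp add: Int_Un_distrib)
  have 2: "W c' \<inter> (K - C) \<noteq> {}" using Wc aR by blast
  have "ball p e \<subseteq> ball p 1" by (rule subset_ball) (simp add: e_def)
  hence 3: "K \<union> Q k \<subseteq> cball 0 r" using ball_r k0(2)[OF k] by blast
  have Wc': "connected (W c')" "w c' \<in> W c'" "w c' \<notin> cball 0 r" using Wc by blast+
  note s = crosscut_domain_same_piece[OF K(1,3) xy(3,4) C(4,1) CK C(2) cK Wc'(1) 1 2 Wc'(2,3) 3]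
  have clg: "closed (C \<union> Q k)" using C(1) xy(3) by (intro closed_Un compact_imp_closed)
  note ends = crosscut_ends_in_piece[OF K clg s CK]
  have later: "Q k' \<inter> K \<subseteq> C" if "k < k'" for k'
   by (rule ends[OF cr(1) crosscut_chain_mono[OF ch(1)]]) (use that ch(1) in "auto simp: crosscut_chain_def")
  have "q \<in> C"
  proof -
   obtain j1 where j1: "crosscut_domain K (Q' j1) \<subseteq> crosscut_domain K (Q k)" using eq unfolding chain_equivalence_def by blast
   have "\<forall>\<^sub>F j in sequentially. Q' j \<subseteq> ball q e \<and> j1 \<le> j" by (intro eventually_conj lim(2) e eventually_ge_at_top)
   hence "\<forall>\<^sub>F j in sequentially. Q' j \<inter> K \<subseteq> C"
   proof eventually_elim
    case (elim j)
    hence "crosscut_domain K (Q' j) \<subseteq> crosscut_domain K (Q k)" using crosscut_chain_mono[OF ch(2), of j1 j] j1 by blast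
    moreover have "Q' j \<inter> Q k = {}" using elim k0(2)[OF k] dj by blast
    ultimately show ?case by (rule ends[OF cr(2)])
   qed
   thus ?thesis using crosscut_limit_in[of K Q' q C, OF cr(2) lim(2) compact_imp_closed[OF C(1)]] by blast
  qed
  thus ?thesis using tu later unfolding C_def by blast
 qed
 obtain k1 c where k1: "k0 \<le> k1" "c < n" "Q k1 \<inter> K \<subseteq> R c" using same unfolding frequently_sequentially by blast
 obtain t u where tu: "0 \<le> t" "t \<le> u" "\<forall>k'>k1. Q k' \<inter> K \<subseteq> g c ` {t..u}" "q \<in> g c ` {t..u}" using main[OF k1] by blast
 define C where "C = g c ` {t..u}"
 have co: "continuous_on {t..u} (g c)" by (rule continuous_on_subset[OF R(2)[OF k1(2)]]) (use tu in auto)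
 have inj: "inj_on (g c) {t..u}" by (rule inj_on_subset[OF R(3)[OF k1(2)]]) (use tu in auto)
 have cg: "compact C" unfolding C_def by (rule compact_continuous_image[OF co]) simp
 \<comment> \<open>The parameter as a function on the compact subarc is continuous, so closeness to
   \<open>p\<close> in the plane gives closeness of parameters.\<close>
 define h where "h = the_inv_into {t..u} (g c)"
 have hg: "h (g c x) = x" if "x \<in> {t..u}" for x unfolding h_def using inj that by (rule the_inv_into_f_f)
 have ch': "continuous_on C h" unfolding C_def by (rule continuous_on_inv[OF co]) (use hg in auto)
 have "\<forall>\<^sub>F j in sequentially. Q j \<inter> K \<subseteq> C" using eventually_gt_at_top[of k1] by (rule eventually_mono) (use tu(3) in "simp add: C_def")
 hence pg: "p \<in> C" using crosscut_limit_in[of K Q p C, OF cr(1) lim(1) compact_imp_closed[OF cg]] by blast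
 obtain tp where tp: "tp \<in> {t..u}" "p = g c tp" using pg by (auto simp: C_def)
 obtain tq where tq: "tq \<in> {t..u}" "q = g c tq" using tu(4) by auto
 have "0 < \<bar>tp - tq\<bar>" using ne tp tq by auto
 then obtain d where d: "0 < d" "\<And>x. x \<in> C \<Longrightarrow> dist x p < d \<Longrightarrow> dist (h x) (h p) < \<bar>tp - tq\<bar>"
  using ch' pg unfolding continuous_on_iff by metis
 obtain j0 where j0: "\<And>j. j0 \<le> j \<Longrightarrow> Q j \<subseteq> ball p d" using lim(1)[OF d(1)] by (auto simp: eventually_sequentially)
 obtain k c1 where k: "max (Suc k1) j0 \<le> k" "c1 < n" "Q k \<inter> K \<subseteq> R c1" using same unfolding frequently_sequentially by blast
 have kg: "Q k \<inter> K \<subseteq> C" using tu(3) k(1) by (auto simp: C_def)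
 hence "Q k \<inter> K \<subseteq> R c" using R(1)[OF k1(2)] tu(1) by (auto simp: C_def)
 then obtain t' u' where tu': "0 \<le> t'" "t' \<le> u'" "Q k \<inter> K = {g c t', g c u'}" "q \<in> g c ` {t'..u'}"
  using main[of k c] k k1 by (meson le_trans max.boundedE Suc_leD)
 have injR: "inj_on (g c) {0..}" by (rule R(3)[OF k1(2)])
 have in': "x \<in> {t..u}" if "g c x \<in> C" "0 \<le> x" for x
 proof -
  have "\<exists>y\<in>{t..u}. g c x = g c y" using that(1) unfolding C_def image_iff .
  then obtain y where "y \<in> {t..u}" "g c x = g c y" by (elim bexE)
  thus ?thesis using inj_onD[OF injR, of x y] that(2) tu(1) by auto
 qed
 have ends: "\<bar>x - tp\<bar> < \<bar>tp - tq\<bar>" if "g c x \<in> Q k \<inter> K" "0 \<le> x" for x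
 proof -
  have gx: "g c x \<in> C" using that(1) kg by blast
  have "dist (g c x) p < d" using that(1) j0[of k] k(1) by (auto simp: dist_commute)
  hence "dist (h (g c x)) (h p) < \<bar>tp - tq\<bar>" by (rule d(2)[OF gx])
  thus ?thesis using hg[OF in'[OF gx that(2)]] hg[OF tp(1)] tp(2) by (simp add: dist_real_def)
 qed
 have "\<bar>t' - tp\<bar> < \<bar>tp - tq\<bar>" "\<bar>u' - tp\<bar> < \<bar>tp - tq\<bar>" using ends[of t'] ends[of u'] tu' by auto
 moreover obtain x where x: "x \<in> {t'..u'}" "q = g c x" using tu'(4) by auto
 moreover have "x = tq" using inj_onD[OF injR, of x tq] x tq tu'(1) tu(1) by auto
 ultimately show False by auto
qed

text \<open>A dichotomy for a chain converging to \<open>p\<close>: either infinitely many of its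
  crosscuts have both ends on one ray, or eventually all of them meet connected sets off
  \<open>K\<close> arbitrarily near \<open>p\<close>. In both cases an equivalent convergent chain
  has the same limit, so there is only one principal point.\<close>

theorem no_infinite_canal:
 assumes E: "\<And>p e. p \<in> K \<Longrightarrow> 0 < e \<Longrightarrow> \<exists>d>0. \<exists>G. connected G \<and> G \<subseteq> - K \<inter> ball p e \<and>
   (\<forall>Q. crosscut K Q \<and> Q \<subseteq> ball p d \<longrightarrow> (\<exists>c<n. Q \<inter> K \<subseteq> R c) \<or> Q \<inter> G \<noteq> {})"
 shows "\<not> infinite_canal K P"
proof
 assume "infinite_canal K P"
 then obtain p q where P: "P \<in> prime_ends K" "p \<in> principal_set P" "q \<in> principal_set P" "p \<noteq> q"
  by (auto simp: infinite_canal_def)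
 obtain Q0 where Q0: "P = chain_equivalence K `` {Q0}" using P(1) unfolding prime_ends_def by (rule quotientE)
 obtain Q where Q: "Q \<in> P" "\<And>e. 0 < e \<Longrightarrow> \<forall>\<^sub>F i in sequentially. Q i \<subseteq> ball p e" using P(2) by (auto simp: principal_set_def)
 obtain Q' where Q': "Q' \<in> P" "\<And>e. 0 < e \<Longrightarrow> \<forall>\<^sub>F i in sequentially. Q' i \<subseteq> ball q e" using P(3) by (auto simp: principal_set_def)
 have r: "(Q0, Q) \<in> chain_equivalence K" "(Q0, Q') \<in> chain_equivalence K" using Q(1) Q'(1) Q0 by auto
 have eq: "(Q, Q') \<in> chain_equivalence K"
 proof -
  have tr: "\<forall>i. \<exists>j. D j \<subseteq> F i" if "\<forall>i. \<exists>j. D j \<subseteq> E i" "\<forall>i. \<exists>j. E j \<subseteq> F i" for D E F :: "nat \<Rightarrow> (real \<times> real) set"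
   using that by (meson order_trans)
  let ?D = "\<lambda>Q i. crosscut_domain K (Q i)"
  have "crosscut_chain K Q" "crosscut_chain K Q'" "\<forall>i. \<exists>j. ?D Q' j \<subseteq> ?D Q0 i" "\<forall>i. \<exists>j. ?D Q0 j \<subseteq> ?D Q i"
   "\<forall>i. \<exists>j. ?D Q j \<subseteq> ?D Q0 i" "\<forall>i. \<exists>j. ?D Q0 j \<subseteq> ?D Q' i"
   using r unfolding chain_equivalence_def by auto
  thus ?thesis unfolding chain_equivalence_def using tr[of "?D Q'" "?D Q0" "?D Q"] tr[of "?D Q" "?D Q0" "?D Q'"] by simp
 qed
 have ch: "crosscut_chain K Q" using eq by (auto simp: chain_equivalence_def)
 hence cr: "crosscut K (Q i)" for i by (auto simp: crosscut_chain_def)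
 have pK: "p \<in> K" by (rule crosscut_limit_in[OF cr Q(2) compact_imp_closed[OF K(1)]]) simp_all
 show False
 proof (cases "\<exists>\<^sub>F k in sequentially. \<exists>c<n. Q k \<inter> K \<subseteq> R c")
  case True
  thus False using chain_limit_unique_if_same_ray[OF eq Q(2) Q'(2) pK] P(4) by blast
 next
  case False
  hence ns: "\<forall>\<^sub>F k in sequentially. \<not> (\<exists>c<n. Q k \<inter> K \<subseteq> R c)" by (simp add: frequently_def)
  have "p = q"
  proof (rule chain_limit_unique_if_bridge[OF K eq Q(2) Q'(2)])
   fix e :: real assume "0 < e"
   from E[OF pK this] obtain d G where d: "0 < d" "connected G" "G \<subseteq> - K \<inter> ball p e"
    and d4: "\<forall>Q. crosscut K Q \<and> Q \<subseteq> ball p d \<longrightarrow> (\<exists>c<n. Q \<inter> K \<subseteq> R c) \<or> Q \<inter> G \<noteq> {}"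
    by (elim exE conjE)
   have "\<forall>\<^sub>F k in sequentially. Q k \<inter> G \<noteq> {}"
    using ns Q(2)[OF d(1)]
   proof eventually_elim
    case (elim k)
    thus ?case using d4[rule_format, of "Q k"] cr[of k] by meson
   qed
   thus "\<exists>G. connected G \<and> G \<subseteq> - K \<inter> ball p e \<and> (\<forall>\<^sub>F k in sequentially. Q k \<inter> G \<noteq> {})" using d by blast
  qed
  thus False using P(4) by simp
 qed
qed

end

section \<open>Density of the rays and connectedness of the complement\<close>

lemma IVT_between:
 fixes f :: "real \<Rightarrow> real"
 assumes "continuous_on {a..b} f" "a \<le> b" "min (f a) (f b) \<le> y" "y \<le> max (f a) (f b)"
 shows "\<exists>x\<in>{a..b}. f x = y"
proof (cases "f a \<le> f b")
 case True
 thus ?thesis using IVT'[of f a y b] assms by auto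
next
 case False
 thus ?thesis using IVT2'[of f b y a] assms by auto
qed

context tent_lhe
begin

lemma It_between:
 assumes "a \<le> b" "min (It k a) (It k b) \<le> y" "y \<le> max (It k a) (It k b)"
 shows "\<exists>x\<in>{a..b}. It k x = y"
 by (rule IVT_between[OF continuous_on_subset[OF It_continuous] assms]) simp

text \<open>An interval without 1/2 in its interior is stretched by \<open>s\<close>. Otherwise the
  longer of its two halves at 1/2 is mapped to an interval ending at \<open>p 1\<close>; unless this
  reaches down to 1/2, it is stretched once more. Two steps thus give the factor
  \<open>s\<^sup>2 / 2\<close>, which exceeds 1 because of \<open>sqrt 2 < s\<close>.\<close>

lemma expanding_step:
 assumes ab: "a < b" "{a..b} \<subseteq> {p 2..p 1}"
 shows "\<exists>k a' b'. {a'..b'} \<subseteq> It k ` {a..b} \<and> {a'..b'} \<subseteq> {p 2..p 1} \<and> a' < b' \<and>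
   ((a' \<le> 1/2 \<and> b' = p 1) \<or> s\<^sup>2 / 2 * (b - a) \<le> b' - a')"
proof -
 have q: "s\<^sup>2 / 2 * (b - a) \<le> s * (b - a)"
 proof (rule mult_right_mono)
  show "s\<^sup>2 / 2 \<le> s" using s1 s2 mult_left_mono[of s 2 s] by (simp add: power2_eq_square)
 qed (use ab in simp)
 have mono: "\<exists>a' b'. {a'..b'} \<subseteq> It 1 ` {u..v} \<and> {a'..b'} \<subseteq> {p 2..p 1} \<and> a' < b' \<and> b' - a' = s * (v - u) \<and> (v = 1/2 \<or> u = 1/2 \<longrightarrow> b' = p 1)"
  if uv: "u < v" "{u..v} \<subseteq> {p 2..p 1}" "v \<le> 1/2 \<or> 1/2 \<le> u" for u v
 proof -
  define a' b' where "a' = min (It 1 u) (It 1 v)" and "b' = max (It 1 u) (It 1 v)"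
  have I: "It 1 t = tent s t" for t using It_Suc[of 0 t] by (simp add: One_nat_def)
  have 1: "{a'..b'} \<subseteq> It 1 ` {u..v}"
  proof
   fix y assume "y \<in> {a'..b'}"
   then obtain x where "x \<in> {u..v}" "It 1 x = y" using It_between[of u v 1 y] uv(1) by (auto simp: a'_def b'_def)
   thus "y \<in> It 1 ` {u..v}" by blast
  qed
  moreover have "{a'..b'} \<subseteq> {p 2..p 1}"
  proof
   fix y assume "y \<in> {a'..b'}"
   then obtain x where "x \<in> {u..v}" "y = It 1 x" using 1 by blast
   thus "y \<in> {p 2..p 1}" using It_core uv(2) by blast
  qed
  moreover have d: "b' - a' = s * (v - u)"
  proof (cases "v \<le> 1/2")
   case True
   hence "It 1 u = s * u" "It 1 v = s * v" using uv(1) s1 unfolding I by (auto intro!: tent_left)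
   moreover have "s * u \<le> s * v" using uv s1 by simp
   ultimately show ?thesis by (simp add: a'_def b'_def min_def max_def algebra_simps)
  next
   case False
   hence "It 1 u = s * (1 - u)" "It 1 v = s * (1 - v)" using uv s1 unfolding I by (auto intro!: tent_right)
   moreover have "s * (1 - v) \<le> s * (1 - u)" using uv s1 by simp
   ultimately have "a' = s * (1 - v)" "b' = s * (1 - u)" by (simp_all add: a'_def b'_def)
   thus ?thesis by (simp add: algebra_simps)
  qed
  moreover have "a' < b'" using d uv(1) s1 by (metis diff_gt_0_iff_gt mult_pos_pos less_trans zero_less_one)
  moreover have "b' = p 1" if "v = 1/2 \<or> u = 1/2"
  proof -
   have "It 1 (1/2) = p 1" by (simp add: I p_1 tent_half)
   moreover have "It 1 u \<le> p 1" "It 1 v \<le> p 1" using It_core[of u 1] It_core[of v 1] uv(1,2) by auto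
   ultimately show ?thesis using that unfolding b'_def by (elim disjE) (simp_all only: max_absorb1 max_absorb2)
  qed
  ultimately show ?thesis by blast
 qed
 show ?thesis
 proof (cases "b \<le> 1/2 \<or> 1/2 \<le> a")
  case True
  thus ?thesis using mono[OF ab True] q by metis
 next
  case False
  hence c: "a < 1/2" "1/2 < b" by auto
  obtain u v where uv: "u < v" "{u..v} \<subseteq> {a..b}" "v \<le> 1/2 \<or> 1/2 \<le> u" "v = 1/2 \<or> u = 1/2" "(b - a) / 2 \<le> v - u"
  proof (cases "1/2 - a \<le> b - 1/2")
   case True
   thus ?thesis using that[of "1/2" b] c by auto
  next
   case False
   thus ?thesis using that[of a "1/2"] c by auto
  qed
  obtain a' b' where ab': "{a'..b'} \<subseteq> It 1 ` {u..v}" "{a'..b'} \<subseteq> {p 2..p 1}" "a' < b'" "b' - a' = s * (v - u)" "b' = p 1"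
  using that uv(2) ab(2) order_trans mono uv(1) uv(3) uv(4) by (smt (verit))
  show ?thesis
  proof (cases "a' \<le> 1/2")
   case True
   have "{a'..b'} \<subseteq> It 1 ` {a..b}" using ab'(1) uv(2) by blast
   thus ?thesis using ab'(2,3,5) True by blast
  next
   case False
   then obtain a2 b2 where 2: "{a2..b2} \<subseteq> It 1 ` {a'..b'}" "{a2..b2} \<subseteq> {p 2..p 1}" "a2 < b2" "b2 - a2 = s * (b' - a')"
    using mono[OF ab'(3,2)] by auto
   have "It 1 ` {a'..b'} \<subseteq> It 2 ` {a..b}"
   proof
    fix y assume "y \<in> It 1 ` {a'..b'}"
    then obtain x where x: "x \<in> {a..b}" "y = It 1 (It 1 x)" using ab'(1) uv(2) by blast
    have "It 2 x = It 1 (It 1 x)" using It_add[of 1 1 x] by simp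
    thus "y \<in> It 2 ` {a..b}" unfolding image_iff using x by metis
   qed
   hence "{a2..b2} \<subseteq> It 2 ` {a..b}" using 2(1) by blast
   moreover have "s\<^sup>2 / 2 * (b - a) \<le> b2 - a2"
   proof -
    have "s * ((b - a) / 2) \<le> s * (v - u)" using uv(5) s1 by simp
    hence "s * (s * ((b - a) / 2)) \<le> s * (s * (v - u))" using s1 by simp
    thus ?thesis unfolding 2(4) ab'(4) by (simp add: power2_eq_square mult.assoc)
   qed
   ultimately show ?thesis using 2 by blast
  qed
 qed
qed

text \<open>Lengths cannot grow forever, so at some time the image contains the interval from 1/2 to
  \<open>p 1\<close>, which is mapped onto the core interval.\<close>

lemma eventually_onto:
 assumes ab: "a < b" "{a..b} \<subseteq> {p 2..p 1}"
 obtains k where "\<And>i. k \<le> i \<Longrightarrow> {p 2..p 1} \<subseteq> It i ` {a..b}"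
proof -
 define q where "q = s\<^sup>2 / 2"
 have "2 < s\<^sup>2" using power_strict_mono[of "sqrt 2" s 2] sqrt2 by simp
 hence q: "1 < q" by (simp add: q_def)
 have "\<exists>k a' b'. {a'..b'} \<subseteq> It k ` {a..b} \<and> {a'..b'} \<subseteq> {p 2..p 1} \<and> a' < b' \<and>
   ((a' \<le> 1/2 \<and> b' = p 1) \<or> q ^ m * (b - a) \<le> b' - a')" for m
 proof (induction m)
  case 0
  have "{a..b} \<subseteq> It 0 ` {a..b}" by simp
  thus ?case using ab by (intro exI[of _ "0::nat"] exI[of _ a] exI[of _ b]) simp
 next
  case (Suc m)
  then obtain k a' b' where 1: "{a'..b'} \<subseteq> It k ` {a..b}" "{a'..b'} \<subseteq> {p 2..p 1}" "a' < b'"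
   "(a' \<le> 1/2 \<and> b' = p 1) \<or> q ^ m * (b - a) \<le> b' - a'" by blast
  show ?case
  proof (cases "a' \<le> 1/2 \<and> b' = p 1")
   case True
   thus ?thesis using 1 by blast
  next
   case False
   obtain j a2 b2 where 2: "{a2..b2} \<subseteq> It j ` {a'..b'}" "{a2..b2} \<subseteq> {p 2..p 1}" "a2 < b2"
    "(a2 \<le> 1/2 \<and> b2 = p 1) \<or> q * (b' - a') \<le> b2 - a2" using expanding_step[OF 1(3,2)] unfolding q_def by blast
   have "It j ` {a'..b'} \<subseteq> It (j + k) ` {a..b}"
   proof
    fix y assume "y \<in> It j ` {a'..b'}"
    then obtain x where "x \<in> {a..b}" "y = It j (It k x)" using 1(1) by blast
    thus "y \<in> It (j + k) ` {a..b}" by (auto simp: It_add)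
   qed
   moreover have "q ^ Suc m * (b - a) \<le> q * (b' - a')" proof -
    have "q ^ m * (b - a) \<le> b' - a'" using 1(4) False by blast
    hence "q * (q ^ m * (b - a)) \<le> q * (b' - a')" using q by (intro mult_left_mono) auto
    thus ?thesis by (simp only: power_Suc mult.assoc)
   qed
   ultimately have "{a2..b2} \<subseteq> It (j + k) ` {a..b}" "(a2 \<le> 1/2 \<and> b2 = p 1) \<or> q ^ Suc m * (b - a) \<le> b2 - a2"
    using 2(1,4) by (blast, linarith)
   thus ?thesis using 2(2,3) by blast
  qed
 qed
 moreover obtain m where "1 / (b - a) < q ^ m" using real_arch_pow[OF q] by blast
 hence m: "1 < q ^ m * (b - a)" using ab(1) by (simp add: field_simps)
 ultimately obtain k a' b' where 1: "{a'..b'} \<subseteq> It k ` {a..b}" "{a'..b'} \<subseteq> {p 2..p 1}" "a' < b'"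
   "(a' \<le> 1/2 \<and> b' = p 1) \<or> q ^ m * (b - a) \<le> b' - a'" by blast
 have "p 1 \<le> 1" "0 \<le> p 2" using p_unit[of 1] p_unit[of 2] by auto
 moreover have "p 2 \<le> a'" "b' \<le> p 1" using 1(2,3) by auto
 ultimately have "a' \<le> 1/2 \<and> b' = p 1" using 1(4) m by linarith
 hence half: "{1/2..p 1} \<subseteq> It k ` {a..b}" using 1(1) by auto
 have onto: "{p 2..p 1} \<subseteq> It 1 ` {1/2..p 1}"
 proof
  fix y assume y: "y \<in> {p 2..p 1}"
  have "It 1 (1/2) = p 1" "It 1 (p 1) = p 2" by (simp_all add: It_p p_def[symmetric] It_p1 numeral_2_eq_2 One_nat_def)
  then obtain x where "x \<in> {1/2..p 1}" "It 1 x = y" using It_between[of "1/2" "p 1" 1 y] y p1_gt by auto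
  thus "y \<in> It 1 ` {1/2..p 1}" by blast
 qed
 have "{p 2..p 1} \<subseteq> It (Suc k + i) ` {a..b}" for i
 proof (induction i)
  case 0
  show ?case
  proof
   fix y assume "y \<in> {p 2..p 1}"
   then obtain x where x: "x \<in> {a..b}" "y = It 1 (It k x)" using onto half by blast
   have "It (Suc k + 0) x = It 1 (It k x)" using It_add[of 1 k x] by (simp add: One_nat_def)
   thus "y \<in> It (Suc k + 0) ` {a..b}" unfolding image_iff using x by metis
  qed
 next
  case (Suc i)
  have "{1/2..p 1} \<subseteq> {p 2..p 1}" using p2_lt by auto
  show ?case
  proof
   fix y assume "y \<in> {p 2..p 1}"
   then obtain x where x: "x \<in> {a..b}" "y = It 1 (It (Suc k + i) x)" using onto Suc `{1/2..p 1} \<subseteq> {p 2..p 1}` by blast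
   have "It (Suc k + Suc i) x = It 1 (It (Suc k + i) x)" using It_add[of 1 "Suc k + i" x] by (simp add: One_nat_def)
   thus "y \<in> It (Suc k + Suc i) ` {a..b}" unfolding image_iff using x by metis
  qed
 qed
 hence "{p 2..p 1} \<subseteq> It i ` {a..b}" if "Suc k \<le> i" for i using that by (metis le_add_diff_inverse)
 thus thesis by (rule that)
qed

text \<open>The points with the prescribed initial word contain an interval whose high iterates
  cover the core interval. So it contains preimages of the turning point of every large order, and
  the order determines the class of the tail.\<close>

lemma dense_tails:
 assumes l: "Adm l" and c: "c < n"
 obtains l' where "Adm l'" "\<And>i. i < M \<Longrightarrow> l' i = l i" "tl c l'"
proof -
 have "admissible_word \<nu> (map l [0..<M])" using l by (simp add: Adm_def)
 then obtain y where y: "generic y" "y \<in> {p 2..p 1}" "\<And>i. i < M \<Longrightarrow> it y i = l i" using word_realized by metis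
 have yo: "p 2 < y" "y < p 1" using y(2) generic_not_p[OF y(1), of 0 2] generic_not_p[OF y(1), of 0 1] by auto
 define S where "S = {x. \<forall>i\<in>{..<M}. ssid (l i) (It i x)} \<inter> {p 2<..<p 1}"
 have "open {x. ssid (l i) (It i x)}" for i
 proof (cases "l i")
  case True
  hence "{x. ssid (l i) (It i x)} = {x. 1/2 < It i x}" by (simp add: ssid_def)
  thus ?thesis using open_Collect_less[OF continuous_on_const It_continuous[of i], of "1/2"] by metis
 next
  case False
  hence "{x. ssid (l i) (It i x)} = {x. It i x < 1/2}" by (simp add: ssid_def)
  thus ?thesis using open_Collect_less[OF It_continuous[of i] continuous_on_const, of "1/2"] by metis
 qed
 hence "open (\<Inter>i\<in>{..<M}. {x. ssid (l i) (It i x)})" by (intro open_INT) auto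
 moreover have "(\<Inter>i\<in>{..<M}. {x. ssid (l i) (It i x)}) = {x. \<forall>i\<in>{..<M}. ssid (l i) (It i x)}" by auto
 ultimately have "open S" unfolding S_def by (intro open_Int) auto
 moreover have "ssid (l i) (It i y)" if "i < M" for i using it_ssid[OF y(1), of i] unfolding y(3)[OF that] .
 hence "y \<in> S" using yo by (auto simp: S_def)
 ultimately obtain d where d: "0 < d" "cball y d \<subseteq> S" using open_contains_cball by blast
 hence ds: "{y - d..y + d} \<subseteq> S" by (simp only: cball_eq_atLeastAtMost)
 have "S \<subseteq> {p 2..p 1}" by (auto simp: S_def)
 hence "{y - d..y + d} \<subseteq> {p 2..p 1}" using ds by blast
 then obtain k where k: "\<And>i. k \<le> i \<Longrightarrow> {p 2..p 1} \<subseteq> It i ` {y - d..y + d}" using eventually_onto[of "y - d" "y + d"] d(1) by auto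
 \<comment> \<open>\<open>N + c\<close> is divisible by \<open>n\<close>, so a sequence that equals
   \<open>\<nu>\<close> from index \<open>N\<close> on belongs to class \<open>c\<close>.\<close>
 define N where "N = n * (k + 2 + c) - c"
 have N: "N + c = n * (k + 2 + c)" "k < N" using le_n_mult[of "k + 2 + c"] unfolding N_def by linarith+
 define i where "i = N - 1"
 have i: "Suc i = N" "k \<le> i" using N(2) by (auto simp: i_def)
 have "1/2 \<in> {p 2..p 1}" using p2_lt p1_gt by auto
 then obtain z where z: "z \<in> {y - d..y + d}" "It i z = 1/2" using k[OF i(2)] by (metis imageE subsetD)
 have zS: "z \<in> S" using ds z(1) by blast
 define l' where "l' = oit z 1"
 have sd: "side (l' j) (It j z)" for j unfolding l'_def by (rule oit_ssid1(2)) simp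
 have A: "Adm l'" unfolding l'_def
 proof (rule oit_Adm)
  show "0 < p 1 - z" using zS by (simp add: S_def)
  fix e assume "0 < e" "e < p 1 - z"
  thus "z + 1 * e \<in> {p 2..p 1}" using zS by (simp add: S_def)
 qed simp
 have "l' j = l j" if "j < M" for j
 using that zS ssid_iff sd by (fastforce simp: S_def)
 moreover have "tl c l'"
 proof -
  have "l' (N + j) = \<nu> j" for j using Adm_after_turn[OF A sd z(2), of j] i(1) by simp
  hence t: "tl ((n - N mod n) mod n) l'" by (rule ntail_tl)
  have "(N + c) mod n = 0" unfolding N(1) by simp
  hence nc: "(N mod n + c) mod n = 0" by (simp add: mod_add_left_eq)
  have lt: "N mod n < n" using n_pos by simp
  have "(n - N mod n) mod n = c"
  proof (cases "c = 0")
   case True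
   thus ?thesis using nc by simp
  next
   case False
   have "n dvd N mod n + c" using nc by (rule mod_0_imp_dvd)
   then obtain u where u: "N mod n + c = n * u" by (rule dvdE)
   have "u \<noteq> 0" using u False by (metis add_is_0 mult_0_right)
   moreover have "n * u < n * 2" using u lt c by linarith
   ultimately have "u = 1" using n_pos by simp
   thus ?thesis using u c False by simp
  qed
  thus ?thesis using t by simp
 qed
 ultimately show thesis using that A by blast
qed

text \<open>A sequence of class \<open>c\<close> sharing enough letters with \<open>l\<close> has
  the same projection, so its arc contains a point with the same coordinate \<open>t\<close>, drawn
  nearby.\<close>

lemma UU_dense: assumes "c < n" shows "KK \<subseteq> closure (drw ` UU c)"
proof
 fix z assume "z \<in> KK"
 then obtain l t where l: "Hc l" "t \<in> B l" "z = Phi l t" by (auto simp: KK_def DD_def)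
 have H: "H l" using l(1) by (simp add: Hc_def)
 show "z \<in> closure (drw ` UU c)" unfolding closure_approachable
 proof (intro allI impI)
  fix e :: real assume "0 < e"
  then obtain M d where Md: "0 < d" "\<And>l' t'. H l' \<Longrightarrow> (\<forall>i<M. l' i = l i) \<Longrightarrow> \<bar>t' - t\<bar> < d \<Longrightarrow> dist (Phi l' t') (Phi l t) < e"
   using Phi_near[OF H] by metis
  obtain l' where l': "Adm l'" "\<And>i. i < max M n \<Longrightarrow> l' i = l i" "tl c l'"
   using dense_tails[OF _ assms, of l "max M n"] l(1) Hc_iff_Adm by blast
  have H': "H l'" using l'(1) Hc_iff_Adm[of l'] by (simp add: Hc_def)
  have "B l' = B l" by (rule B_markov(3)[OF H H']) (simp add: l'(2))
  hence r: "isrep l' (pt l' t)" using isrep_pt[OF H'] l(2) by simp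
  hence "pt l' t \<in> UU c" using UU_rep l'(3) by blast
  moreover have "drw (pt l' t) = Phi l' t" using drw_rep[OF r] by simp
  moreover have "dist (Phi l' t) (Phi l t) < e" by (rule Md(2)[OF H']) (use l'(2) Md(1) in auto)
  ultimately show "\<exists>y\<in>drw ` UU c. dist y z < e" using l(3) by (metis image_eqI)
 qed
qed

lemma core_inv_lim: "core s \<subseteq> inv_lim s" by (auto simp: core_set)

lemma drw_core: "continuous_on (core s) drw" "inj_on drw (core s)"
 using continuous_on_subset[OF drw_continuous core_inv_lim] inj_on_subset[OF drw_inj core_inv_lim] by auto

lemma compact_KK: "compact KK"
 using compact_continuous_image[OF drw_core(1) compact_core] KK_eq(2) by simp

definition Rc :: "nat \<Rightarrow> (real \<times> real) set" where "Rc c = drw ` UU c"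

definition gR :: "nat \<Rightarrow> real \<Rightarrow> real \<times> real" where "gR c \<tau> = drw (gr c \<tau>)"

lemma Rc_ray: "Rc c = gR c ` {0..}" "continuous_on {0..} (gR c)" "inj_on (gR c) {0..}"
proof -
 show "Rc c = gR c ` {0..}" by (simp add: Rc_def gR_def UU_ray image_image)
 have sub: "gr c ` {0..} \<subseteq> core s" using gr_core by auto
 show "continuous_on {0..} (gR c)" unfolding gR_def
  by (rule continuous_on_compose2[OF drw_core(1) gr_continuous sub])
 show "inj_on (gR c) {0..}" unfolding gR_def
  using comp_inj_on[OF gr_inj inj_on_subset[OF drw_core(2) sub]] by (simp add: comp_def)
qed

lemma Rc_KK: "Rc c \<subseteq> KK" unfolding Rc_def using UU_core KK_eq(2) by blast

lemma connected_KK: "connected KK"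
proof -
 have "connected (Rc 0)" unfolding Rc_ray(1) by (rule connected_continuous_image[OF Rc_ray(2)]) auto
 thus ?thesis
  by (rule connected_intermediate_closure[OF _ Rc_KK]) (use UU_dense[OF n_pos(1)] in "simp add: Rc_def")
qed

lemma Rc_disjoint: "c < n \<Longrightarrow> c' < n \<Longrightarrow> c \<noteq> c' \<Longrightarrow> Rc c \<inter> Rc c' = {}"
proof -
 assume "c < n" "c' < n" "c \<noteq> c'"
 hence "UU c \<inter> UU c' = {}" by (rule UU_disjoint)
 thus ?thesis unfolding Rc_def using inj_on_image_Int[OF drw_core(2) UU_core[of c] UU_core[of c']] by simp
qed

section \<open>The drawing of the core does not separate the plane\<close>

lemma agree_upto_close:
 fixes e :: real assumes "0 < e"
 obtains N where "\<And>x y :: nat \<Rightarrow> real. (\<And>i. i \<le> N \<Longrightarrow> x i = y i) \<Longrightarrow> dist x y < e"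
proof -
 obtain k where k: "(1/2::real) ^ k < e" using real_arch_pow_inv[OF assms, of "1/2"] by auto
 define N where "N = Max (from_nat ` {..k} :: nat set)"
 have N: "from_nat i \<le> N" if "i \<le> k" for i unfolding N_def using that by (intro Max_ge) auto
 have "dist x y < e" if a: "\<And>i. i \<le> N \<Longrightarrow> x i = y i" for x y :: "nat \<Rightarrow> real"
 proof -
  have "dist x y \<le> 2 * Max {dist (x (from_nat i)) (y (from_nat i)) | i. i \<le> k} + (1/2) ^ k"
   by (rule dist_fun_le_dist_first_terms)
  also have "{dist (x (from_nat i)) (y (from_nat i)) | i. i \<le> k} = {0}"
  proof -
   have "dist (x (from_nat i)) (y (from_nat i)) = 0" if "i \<le> k" for i using a[OF N[OF that]] by simp
   thus ?thesis by (auto intro!: exI[of _ 0])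
  qed
  finally show ?thesis using k by simp
 qed
 thus thesis by (rule that)
qed

text \<open>Up to a small error, \<open>F\<close> factors through one coordinate, that is, through an interval.\<close>

lemma core_logarithm:
 assumes F: "continuous_on (core s) F" "\<And>x. x \<in> core s \<Longrightarrow> F x \<noteq> (0::complex)"
 obtains G where "continuous_on (core s) G" "\<And>x. x \<in> core s \<Longrightarrow> F x = exp (G x)"
proof -
 \<comment> \<open>\<open>f N t\<close> is a point of the core with coordinate \<open>t\<close> at
   index \<open>N\<close>: iterates of \<open>t\<close> at smaller indices, preimages on the right
   branch at larger ones. This branch maps the core interval into itself.\<close>
 define f where "f N t j = (if j \<le> N then It (N - j) t else ((\<lambda>u. 1 - u / s) ^^ (j - N)) t)" for N j :: nat and t
 have rstep: "1 - u / s \<in> {p 2..p 1}" "tent s (1 - u / s) = u" if "u \<in> {p 2..p 1}" for u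
 proof -
  have h: "1/2 \<le> 1 - u / s" using that p_1 s1 by (auto simp: field_simps)
  have "p 2 / s \<le> u / s" using that s1 by (intro divide_right_mono) auto
  moreover have "p 2 / s = 1 - s / 2" using p_2 s1 by simp
  ultimately have "1 - u / s \<le> s / 2" by linarith
  thus "1 - u / s \<in> {p 2..p 1}" by (rule right_core[OF h])
  show "tent s (1 - u / s) = u" using tent_right[OF h] s1 by simp
 qed
 have rit: "((\<lambda>u. 1 - u / s) ^^ k) t \<in> {p 2..p 1}" if "t \<in> {p 2..p 1}" for k t
  using that by (induction k) (use rstep in auto)
 have fcore: "f N t \<in> core s" if t: "t \<in> {p 2..p 1}" for N t
 proof -
  have c: "f N t j \<in> {p 2..p 1}" for j unfolding f_def using It_core[OF t] rit[OF t] by simp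
  moreover have "tent s (f N t (Suc j)) = f N t j" for j
  proof (cases "Suc j \<le> N")
   case True
   hence "N - j = Suc (N - Suc j)" by simp
   thus ?thesis using True by (simp add: f_def It_Suc)
  next
   case False
   hence e: "f N t j = ((\<lambda>u. 1 - u / s) ^^ (j - N)) t" by (auto simp: f_def)
   have "Suc j - N = Suc (j - N)" using False by simp
   hence "f N t (Suc j) = 1 - f N t j / s" using False unfolding e by (simp add: f_def)
   thus ?thesis using rstep(2)[OF c[of j]] by simp
  qed
  ultimately show ?thesis unfolding core_set inv_lim_def using core_unit by blast
 qed
 have fcont: "continuous_on {p 2..p 1} (f N)" for N
 proof (rule continuous_on_coordinatewise_then_product)
  fix j
  have "continuous_on A ((\<lambda>u. 1 - u / s) ^^ k)" for A k
  proof (induction k)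
   case (Suc k)
   thus ?case using s1 by (auto intro!: continuous_intros)
  qed (simp add: id_def)
  moreover have "continuous_on A (It k)" for A k by (rule continuous_on_subset[OF It_continuous]) simp
  ultimately show "continuous_on {p 2..p 1} (\<lambda>t. f N t j)" by (cases "j \<le> N") (simp_all add: f_def)
 qed
 have "compact (F ` core s)" using compact_continuous_image[OF F(1) compact_core] .
 hence cl: "closed (F ` core s)" by (rule compact_imp_closed)
 have "0 \<in> - F ` core s" using F(2) by force
 then obtain m where m: "0 < m" "ball 0 m \<subseteq> - F ` core s" using open_contains_ball[of "- F ` core s"] open_Compl[OF cl] by blast
 have big: "m \<le> norm (F x)" if "x \<in> core s" for x
 using that m(2) by force
 have "uniformly_continuous_on (core s) F" by (rule compact_uniformly_continuous[OF F(1) compact_core])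
 then obtain d where d: "0 < d" "\<And>x y. x \<in> core s \<Longrightarrow> y \<in> core s \<Longrightarrow> dist y x < d \<Longrightarrow> dist (F y) (F x) < m"
  using m(1) unfolding uniformly_continuous_on_def by metis
 obtain N where N: "\<And>x y :: nat \<Rightarrow> real. (\<And>i. i \<le> N \<Longrightarrow> x i = y i) \<Longrightarrow> dist x y < d" by (rule agree_upto_close[OF d(1)]) blast
 have xN: "x N \<in> {p 2..p 1}" if "x \<in> core s" for x using that by (simp add: core_set)
 have near: "dist (F x) (F (f N (x N))) < m" if x: "x \<in> core s" for x
 proof (rule d(2)[OF fcore[OF xN[OF x]] x], rule N)
  fix i assume "i \<le> N"
  thus "x i = f N (x N) i" using inv_lim_It[of x "N - i" i] x core_inv_lim by (auto simp: f_def)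
 qed
 \<comment> \<open>The quotient is close to 1 and has a principal logarithm. The denominator depends
   only on a coordinate in an interval, where a logarithm exists as well.\<close>
 define Q where "Q x = F x / F (f N (x N))" for x
 have coordc: "continuous_on (core s) (\<lambda>x. x N)" by (rule continuous_on_subset[of UNIV]) simp_all
 have fc: "continuous_on (core s) (\<lambda>x. f N (x N))"
  by (rule continuous_on_compose2[OF fcont coordc]) (use xN in auto)
 have Ffc: "continuous_on (core s) (\<lambda>x. F (f N (x N)))"
  by (rule continuous_on_compose2[OF F(1) fc]) (use xN fcore in auto)
 have Ff0: "F (f N (x N)) \<noteq> 0" if "x \<in> core s" for x using F(2) fcore xN that by blast
 have Qc: "continuous_on (core s) Q" unfolding Q_def using Ff0 by (intro continuous_intros F(1) Ffc) auto
 have Qpos: "Q x \<notin> \<real>\<^sub>\<le>\<^sub>0" "Q x \<noteq> 0" if x: "x \<in> core s" for x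
 proof -
  define w where "w = F (f N (x N))"
  have w: "w \<noteq> 0" "m \<le> norm w" using Ff0[OF x] big[OF fcore[OF xN[OF x]]] by (simp_all add: w_def)
  have "norm (Q x - 1) = norm (F x - w) / norm w" using w(1) by (simp add: Q_def w_def[symmetric] diff_divide_distrib norm_divide[symmetric])
  also have "\<dots> < 1" using near[OF x] w by (simp add: w_def[symmetric] dist_norm)
  finally have "norm (Q x - 1) < 1" .
  hence "\<bar>Re (Q x - 1)\<bar> < 1" using abs_Re_le_cmod[of "Q x - 1"] by linarith
  hence "0 < Re (Q x)" by simp
  thus "Q x \<notin> \<real>\<^sub>\<le>\<^sub>0" "Q x \<noteq> 0" by (auto simp: complex_nonpos_Reals_iff)
 qed
 have "continuous_on {p 2..p 1} (\<lambda>t. F (f N t))"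
  by (rule continuous_on_compose2[OF F(1) fcont]) (use fcore in auto)
 moreover have "contractible {p 2..p 1}" by (intro convex_imp_contractible) simp
 moreover have "F (f N t) \<noteq> 0" if "t \<in> {p 2..p 1}" for t using F(2) fcore that by blast
 ultimately obtain h where h: "continuous_on {p 2..p 1} h" "\<And>t. t \<in> {p 2..p 1} \<Longrightarrow> F (f N t) = exp (h t)"
  using continuous_logarithm_on_contractible[of "{p 2..p 1}" "\<lambda>t. F (f N t)"] by blast
 define G where "G x = Ln (Q x) + h (x N)" for x
 have "continuous_on (core s) (\<lambda>x. h (x N))"
  by (rule continuous_on_compose2[OF h(1) coordc]) (use xN in auto)
 hence "continuous_on (core s) G" unfolding G_def using Qpos(1) by (intro continuous_intros Qc) auto
 moreover have "F x = exp (G x)" if x: "x \<in> core s" for x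
 proof -
  have "exp (G x) = Q x * F (f N (x N))" unfolding G_def exp_add using Qpos(2)[OF x] h(2)[OF xN[OF x]] by simp
  thus ?thesis using Ff0[OF x] by (simp add: Q_def)
 qed
 ultimately show thesis by (rule that)
qed

text \<open>Borsuk's criterion: a compact plane set does not separate the plane if all its
  continuous maps to the punctured plane have continuous logarithms. This property is transferred
  from the core along the homeomorphism.\<close>

lemma connected_Compl_KK: "connected (- KK)"
proof -
 define f where "f = (\<lambda>x. cx (drw x))"
 have fc: "continuous_on (core s) f" unfolding f_def by (rule continuous_on_compose2[OF continuous_on_cx drw_core(1)]) auto
 have finj: "inj_on f (core s)" unfolding f_def
  using comp_inj_on[OF drw_core(2) cx_inj] by (simp add: comp_def)
 have im: "f ` core s = cx ` KK" unfolding f_def KK_eq(2)[symmetric] image_image ..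
 define k where "k = the_inv_into (core s) f"
 have kf: "k (f x) = x" if "x \<in> core s" for x unfolding k_def by (rule the_inv_into_f_f[OF finj that])
 have kc: "continuous_on (f ` core s) k" by (rule continuous_on_inv[OF fc compact_core]) (use kf in auto)
 have "Borsukian (cx ` KK)" unfolding im[symmetric] Borsukian_continuous_logarithm
 proof (intro allI impI)
  fix F :: "complex \<Rightarrow> complex" assume F: "continuous_on (f ` core s) F \<and> F \<in> f ` core s \<rightarrow> - {0}"
  have "continuous_on (core s) (\<lambda>x. F (f x))" by (rule continuous_on_compose2[OF _ fc]) (use F in auto)
  moreover have "F (f x) \<noteq> 0" if "x \<in> core s" for x using F that by blast
  ultimately obtain G where G: "continuous_on (core s) G" "\<And>x. x \<in> core s \<Longrightarrow> F (f x) = exp (G x)"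
   using core_logarithm by blast
  have "continuous_on (f ` core s) (\<lambda>z. G (k z))" by (rule continuous_on_compose2[OF G(1) kc]) (use kf in auto)
  moreover have "F z = exp (G (k z))" if "z \<in> f ` core s" for z using that G(2) kf by auto
  ultimately show "\<exists>g. continuous_on (f ` core s) g \<and> (\<forall>z\<in>f ` core s. F z = exp (g z))" by blast
 qed
 hence "connected (- (cx ` KK))" using Borsukian_separation_compact[OF cx_compact[OF compact_KK]] by simp
 thus ?thesis by (simp only: cx_Compl[symmetric] cx_connected)
qed

text \<open>The core points outside a neighbourhood of \<open>x\<close> have a compact image not
  containing \<open>drw x\<close>. So points of \<open>KK\<close> near \<open>drw x\<close> come
  from points near \<open>x\<close>.\<close>

lemma KK_near:
 assumes x: "x \<in> core s"
 obtains d where "0 < d"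
  "\<And>z. z \<in> KK \<Longrightarrow> dist z (drw x) < d \<Longrightarrow> \<exists>l'' l. isrep l x \<and> Hc l'' \<and> (\<forall>i<M. l'' i = l i) \<and> z \<in> DD l''"
proof -
 have xi: "x \<in> inv_lim s" using x core_inv_lim by blast
 obtain S where S: "open S" "x \<in> S"
  "\<And>y. y \<in> S \<Longrightarrow> y \<noteq> x \<Longrightarrow> y \<in> inv_lim s \<Longrightarrow> \<forall>l'. isrep l' y \<longrightarrow> (\<exists>l. isrep l x \<and> (\<forall>i<M. l' i = l i))"
  using nearby_rep[OF xi, of M] unfolding eventually_at_topological by blast
 have co: "compact (core s - S)" using compact_diff[OF compact_core S(1)] .
 have "compact (drw ` (core s - S))" by (rule compact_continuous_image[OF continuous_on_subset[OF drw_core(1)] co]) auto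
 hence cl: "closed (drw ` (core s - S))" by (rule compact_imp_closed)
 have "drw x \<notin> drw ` (core s - S)" using inj_onD[OF drw_core(2)] x S(2) by blast
 then obtain d where d: "0 < d" "ball (drw x) d \<subseteq> - drw ` (core s - S)"
  using open_contains_ball[of "- drw ` (core s - S)"] open_Compl[OF cl] by blast
 have "\<exists>l'' l. isrep l x \<and> Hc l'' \<and> (\<forall>i<M. l'' i = l i) \<and> z \<in> DD l''" if z: "z \<in> KK" "dist z (drw x) < d" for z
 proof -
  obtain y where y: "y \<in> core s" "z = drw y" using z(1) KK_eq(2) by blast
  have "z \<in> ball (drw x) d" using z(2) by (simp add: dist_commute)
  hence yS: "y \<in> S" using d(2) y by blast
  have yi: "y \<in> inv_lim s" using y core_inv_lim by blast
  obtain l' where l': "isrep l' y" using isrep_ex[OF yi] by blast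
  have rr: "H l'" "y 0 \<in> B l'" "y = pt l' (y 0)" using l' unfolding isrep_def by blast+
  have "Hc l'" using Hc_iff[OF rr(1,2)] rr(3) y(1) by simp
  moreover have "z \<in> DD l'" using drw_rep[OF l'] rr(2) y(2) by (simp add: DD_def)
  moreover have "\<exists>l. isrep l x \<and> (\<forall>i<M. l' i = l i)"
   using S(3)[OF yS _ yi] l' by (cases "y = x") blast+
  ultimately show ?thesis by blast
 qed
 thus thesis using that d(1) by blast
qed

end

section \<open>Flow boxes\<close>

lemma connected_closure_between:
 fixes I :: "real set"
 assumes "connected I" "v \<in> closure I" "w \<in> closure I" "v < x" "x < w" shows "x \<in> I"
proof -
 have "\<exists>a\<in>I. dist a v < x - v" "\<exists>b\<in>I. dist b w < w - x"
  using assms(2-5) unfolding closure_approachable by simp_all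
 then obtain a b where "a \<in> I" "a < x" "b \<in> I" "x < b" by (auto simp: dist_real_def abs_less_iff)
 thus ?thesis using connectedD_interval[OF assms(1), of a b x] by simp
qed

context tent_lhe
begin

lemma Hc_H: "Hc l \<Longrightarrow> H l" by (simp add: Hc_def)

lemma ht_agree: assumes "\<bar>ht x - ht l\<bar> < 1 / 3 ^ M" "i < M" shows "x i = l i"
proof (rule ccontr)
 assume "x i \<noteq> l i"
 hence "\<exists>i<M. l i \<noteq> x i" using assms(2) by metis
 hence "1 / 3 ^ M + 1 / (2 * 3 ^ M) \<le> \<bar>ht x - yc l M\<bar>" by (rule ht_far)
 thus False using assms(1) ht_yc[of l M] by linarith
qed

text \<open>Mates are included because a level of a flow box at a semicircle runs through both arcs
  that are joined there.\<close>

definition DM :: "bits \<Rightarrow> real \<times> real \<Rightarrow> bool" where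
 "DM l z \<longleftrightarrow> z \<in> DD l \<or> (\<exists>r. fin l r \<and> z \<in> DD (mt l r))"

lemma DM_KK: "Hc l \<Longrightarrow> DM l z \<Longrightarrow> z \<in> KK"
 unfolding DM_def KK_def using Hc_mt by blast

lemma DD_Rc: assumes "H l" "tl c l" "z \<in> DD l" shows "z \<in> Rc c"
proof -
 obtain t where t: "t \<in> B l" "z = Phi l t" using assms(3) by (auto simp: DD_def)
 have r: "isrep l (pt l t)" by (rule isrep_pt[OF assms(1) t(1)])
 hence "pt l t \<in> UU c" using UU_rep assms(2) by blast
 moreover have "z = drw (pt l t)" using drw_rep[OF r] t(2) by simp
 ultimately show ?thesis unfolding Rc_def by blast
qed

lemma DM_Rc: "Hc l \<Longrightarrow> tl c l \<Longrightarrow> DM l z \<Longrightarrow> z \<in> Rc c"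
 unfolding DM_def using DD_Rc[of l c z] DD_Rc[of "mt l _" c z] Hc_H Hc_mt tl_flip unfolding mt_def by blast

text \<open>\<open>h\<close> is a transversal coordinate: inside \<open>N\<close> the set
  \<open>KK\<close> consists of the levels of \<open>h\<close> at the heights of core sequences.
  Openness of \<open>N\<close> is not part of it, as \<open>endp_bridge\<close> uses a box bounded
  by a half stadium.\<close>

definition flow :: "(real \<times> real) set \<Rightarrow> (real \<times> real \<Rightarrow> real) \<Rightarrow> bool" where
 "flow N h \<longleftrightarrow> continuous_on N h \<and> (\<forall>z\<in>N. z \<in> KK \<longrightarrow> (\<exists>l. Hc l \<and> ht l = h z)) \<and>
   (\<forall>z\<in>N. \<forall>l. Hc l \<and> ht l = h z \<longrightarrow> DM l z)"

lemma nontail_near: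
 assumes "Hc l" "\<not> ntail l" "0 < e"
 obtains x y where "Hc x" "ht l < ht x" "ht x < ht l + e" "Hc y" "ht y < ht l" "ht l - e < ht y"
proof -
 obtain M where "(1/3::real) ^ M < e" using real_arch_pow_inv[OF assms(3), of "1/3"] by auto
 hence M: "1 / 3 ^ M < e" by (simp add: power_one_over)
 have A: "Adm l" using assms(1) Hc_iff_Adm by simp
 obtain x where x: "Adm x" "\<forall>i<M. x i = l i" "ht l < ht x" using nontail_accumulated(1)[OF A assms(2)] by blast
 obtain y where y: "Adm y" "\<forall>i<M. y i = l i" "ht y < ht l" using nontail_accumulated(2)[OF A assms(2)] by blast
 have "\<bar>ht x - ht l\<bar> \<le> 1 / 3 ^ M" "\<bar>ht y - ht l\<bar> \<le> 1 / 3 ^ M" using ht_close[of M x l] ht_close[of M y l] x y by auto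
 thus thesis using that[of x y] x y M Hc_iff_Adm by force
qed

text \<open>\<open>h\<close> maps the crosscut without its ends to an interval free of heights. If
  the heights at the ends differ, they bound a gap and have a common tail. If they agree, heights do
  not accumulate there from one side, so the sequence has a tail by \<open>nontail_near\<close>, and
  both ends lie on its ray.\<close>

lemma flow_same_ray:
 assumes f: "flow N h" and Q: "crosscut KK Q" "Q \<subseteq> N"
 shows "\<exists>c<n. Q \<inter> KK \<subseteq> Rc c"
proof -
 obtain a b where q: "Q \<inter> KK = {a, b}" "connected (Q - KK)" "Q \<subseteq> closure (Q - KK)" "Q - KK \<noteq> {}" by (rule crosscutE[OF Q(1)])
 have hc: "continuous_on Q h" using f Q(2) continuous_on_subset by (auto simp: flow_def)
 define I where "I = h ` (Q - KK)"
 have I: "connected I" unfolding I_def by (rule connected_continuous_image[OF continuous_on_subset[OF hc] q(2)]) auto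
 have noht: "ht l \<notin> I" if "Hc l" for l
 proof
  assume "ht l \<in> I"
  then obtain z where "z \<in> Q - KK" "ht l = h z" by (auto simp: I_def)
  thus False using f Q(2) that DM_KK unfolding flow_def by blast
 qed
 have cl: "h z \<in> closure I" if zQ: "z \<in> Q" for z
 proof -
  have "\<exists>y\<in>I. dist y (h z) < e" if e: "0 < e" for e
  proof -
   obtain d where d: "0 < d" "\<forall>y\<in>Q. dist y z < d \<longrightarrow> dist (h y) (h z) < e"
    using hc[unfolded continuous_on_iff, rule_format, OF zQ e] by blast
   have "z \<in> closure (Q - KK)" using q(3) `z \<in> Q` by blast
   then obtain y where "y \<in> Q - KK" "dist y z < d" using d(1) unfolding closure_approachable by blast
   thus ?thesis unfolding I_def using d(2) by blast
  qed
  thus ?thesis unfolding closure_approachable by blast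
 qed
 have ab: "a \<in> Q" "b \<in> Q" "a \<in> KK" "b \<in> KK" using q(1) by auto
 obtain la lb where l: "Hc la" "ht la = h a" "Hc lb" "ht lb = h b"
  using f ab Q(2) unfolding flow_def by blast
 have D: "DM la a" "DM lb b" using f l ab Q(2) unfolding flow_def by blast+
 have tails: "\<exists>c<n. tl c la \<and> tl c lb"
 proof (cases "h a = h b")
  case True
  hence e: "la = lb" using l ht_inj by metis
  have "ntail la"
  proof (rule ccontr)
   assume nt: "\<not> ntail la"
   obtain z where z: "z \<in> Q - KK" using q(4) by blast
   have u: "h z \<in> I" unfolding I_def by (rule imageI[OF z])
   have u2: "h z \<in> closure I" using cl z by blast
   hence "0 < \<bar>h z - ht la\<bar>" using noht[OF l(1)] u by auto
   then obtain x y where xy: "Hc x" "ht la < ht x" "ht x < ht la + \<bar>h z - ht la\<bar>" "Hc y" "ht y < ht la" "ht la - \<bar>h z - ht la\<bar> < ht y"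
    using nontail_near[OF l(1) nt] by metis
   have cla: "ht la \<in> closure I" using cl[OF ab(1)] l(2) by simp
   show False
   proof (cases "ht la < h z")
    case True
    hence "ht x \<in> I" using connected_closure_between[OF I cla u2, of "ht x"] xy by simp
    thus False using noht xy by blast
   next
    case False
    hence "ht y \<in> I" using connected_closure_between[OF I u2 cla, of "ht y"] xy by simp
    thus False using noht xy by blast
   qed
  qed
  thus ?thesis using ntail_iff e by blast
 next
  case False
  have adj: "\<exists>c<n. tl c l1 \<and> tl c l2" if l12: "Hc l1" "Hc l2" "ht l1 < ht l2" "ht l1 \<in> closure I" "ht l2 \<in> closure I" for l1 l2
  proof -
   have "\<not> (ht l1 < ht x \<and> ht x < ht l2)" if "Adm x" for x
    using connected_closure_between[OF I l12(4,5), of "ht x"] noht[of x] that Hc_iff_Adm by blast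
   then obtain i where "\<And>k. l1 (i + k) = \<nu> k" "\<And>k. l2 (i + k) = \<nu> k"
    using adjacent_tail[of l1 l2] l12(1-3) Hc_iff_Adm by metis
   hence "tl ((n - i mod n) mod n) l1" "tl ((n - i mod n) mod n) l2" using ntail_tl by blast+
   moreover have "(n - i mod n) mod n < n" using n_pos by simp
   ultimately show ?thesis by blast
  qed
  have c: "ht la \<in> closure I" "ht lb \<in> closure I" using cl[OF ab(1)] cl[OF ab(2)] l by simp_all
  have "ht la < ht lb \<or> ht lb < ht la" using False l by auto
  thus ?thesis using adj[OF l(1,3) _ c] adj[OF l(3,1) _ c(2,1)] by blast
 qed
 then obtain c where "c < n" "tl c la" "tl c lb" by blast
 hence "a \<in> Rc c" "b \<in> Rc c" using DM_Rc l D by blast+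
 thus ?thesis using q(1) `c < n` by auto
qed

text \<open>Along an arc that leaves \<open>KK\<close> at once, \<open>h\<close> would run through
  an interval ending at \<open>ht l\<close> and meet no other height, but heights accumulate at
  \<open>ht l\<close> from both sides.\<close>

lemma flow_not_accessible:
 assumes f: "flow N h" "open N" and z: "z0 \<in> N" "z0 \<in> KK" and l: "Hc l" "h z0 = ht l" "\<not> ntail l"
 shows "\<not> accessible KK z0"
proof
 assume "accessible KK z0"
 then obtain g where g: "arc g" "path_image g \<inter> KK = {z0}" by (auto simp: accessible_def)
 have gc: "continuous_on {0..1} g" "inj_on g {0..1}" using g(1) by (auto simp: arc_def path_def)
 have "z0 \<in> g ` {0..1}" using g(2) unfolding path_image_def by blast
 then obtain t0 where t0: "t0 \<in> {0..1}" "g t0 = z0" by (metis imageE)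
 obtain e where e: "0 < e" "ball z0 e \<subseteq> N" using f(2) z(1) open_contains_ball by blast
 obtain d where d: "0 < d" "\<And>t. t \<in> {0..1} \<Longrightarrow> dist t t0 < d \<Longrightarrow> dist (g t) (g t0) < e"
  using gc(1) t0(1) e(1) unfolding continuous_on_iff by metis
 define t1 where "t1 = (if t0 < 1 then min 1 (t0 + d / 2) else t0 - min 1 (d / 2))"
 have t1: "t1 \<in> {0..1}" "t1 \<noteq> t0" "\<bar>t1 - t0\<bar> < d" using t0 d(1) by (auto simp: t1_def min_def)
 define S where "S = closed_segment t0 t1"
 have S: "t \<in> {0..1} \<and> g t \<in> N" if "t \<in> S" for t
 proof -
  have "t \<in> {0..1}" using that t0 t1 closed_segment_subset[OF _ _ convex_real_interval(5), of t0 0 1 t1] by (auto simp: S_def)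
  moreover have "dist t t0 < d" using that t1(3) dist_in_closed_segment[of t t0 t1] unfolding S_def by (simp add: dist_real_def abs_minus_commute)
  ultimately have "dist (g t) (g t0) < e" using d(2) by blast
  hence "g t \<in> ball z0 e" unfolding t0(2) by (simp add: dist_commute)
  thus ?thesis using e(2) `t \<in> {0..1}` by blast
 qed
 have cS: "connected ((\<lambda>t. h (g t)) ` S)"
 proof (rule connected_continuous_image)
  show "continuous_on S (\<lambda>t. h (g t))"
   by (rule continuous_on_compose2[of N h S g]) (use f S in "auto simp: flow_def intro!: continuous_on_subset[OF gc(1)]")
 qed (simp add: S_def)
 have gt: "g t \<in> KK \<longleftrightarrow> t = t0" if "t \<in> S" for t
 proof
  assume k: "g t \<in> KK"
  have "g t \<in> path_image g" using S[OF that] unfolding path_image_def by blast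
  hence "g t = g t0" using k g(2) t0(2) by blast
  thus "t = t0" using inj_onD[OF gc(2), of t t0] S[OF that] t0(1) by blast
 qed (use t0(2) z(2) in simp)
 have nh: "Hc x \<Longrightarrow> t \<in> S \<Longrightarrow> h (g t) = ht x \<Longrightarrow> t = t0" for x t
  using f(1) S[of t] DM_KK[of x "g t"] gt[of t] unfolding flow_def by metis
 have ts: "t0 \<in> S" "t1 \<in> S" by (simp_all add: S_def)
 have "h (g t1) \<noteq> ht l" using nh[OF l(1) ts(2)] t1(2) by blast
 hence "0 < \<bar>h (g t1) - ht l\<bar>" by simp
 then obtain x y where xy: "Hc x" "ht l < ht x" "ht x < ht l + \<bar>h (g t1) - ht l\<bar>" "Hc y" "ht y < ht l" "ht l - \<bar>h (g t1) - ht l\<bar> < ht y"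
  using nontail_near[OF l(1,3)] by metis
 have im: "ht l \<in> (\<lambda>t. h (g t)) ` S" "h (g t1) \<in> (\<lambda>t. h (g t)) ` S" using ts t0(2) l(2) by force+
 obtain w where w: "Hc w" "ht w \<noteq> ht l" "ht w \<in> (\<lambda>t. h (g t)) ` S"
 proof (cases "ht l < h (g t1)")
  case True
  hence "ht x \<in> (\<lambda>t. h (g t)) ` S" using connectedD_interval[OF cS im, of "ht x"] xy by simp
  thus ?thesis using that[of x] xy by simp
 next
  case False
  hence "ht y \<in> (\<lambda>t. h (g t)) ` S" using connectedD_interval[OF cS im(2,1), of "ht y"] xy by simp
  thus ?thesis using that[of y] xy by simp
 qed
 then obtain t where "t \<in> S" "h (g t) = ht w" by auto
 hence "t = t0" "h (g t) = ht w" using nh[OF w(1)] by auto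
 thus False using t0(2) l(2) w(2) by simp
qed

lemma isolated_side:
 assumes "Hc l" "ntail l"
 obtains M and b :: real where "b = 1 \<or> b = -1" "\<And>x. Hc x \<Longrightarrow> (\<And>i. i < M \<Longrightarrow> x i = l i) \<Longrightarrow> b * (ht x - ht l) \<le> 0"
proof -
 obtain M where M: "(\<forall>x. Adm x \<and> (\<forall>i<M. x i = l i) \<longrightarrow> ht x \<le> ht l) \<or> (\<forall>x. Adm x \<and> (\<forall>i<M. x i = l i) \<longrightarrow> ht l \<le> ht x)"
  using tail_isolated[OF _ assms(2)] assms(1) Hc_iff_Adm by blast
 thus thesis
 proof
  assume "\<forall>x. Adm x \<and> (\<forall>i<M. x i = l i) \<longrightarrow> ht x \<le> ht l"
  thus thesis using that[of 1 M] Hc_iff_Adm by auto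
 next
  assume "\<forall>x. Adm x \<and> (\<forall>i<M. x i = l i) \<longrightarrow> ht l \<le> ht x"
  thus thesis using that[of "-1" M] Hc_iff_Adm by auto
 qed
qed

text \<open>The accessing arc follows the transversal to the side \<open>b\<close> on which the
  height of \<open>l\<close> is isolated.\<close>

lemma flow_accessible:
 assumes f: "flow N h" and z: "z0 \<in> KK" and l: "Hc l" "ntail l"
  and eta: "0 < d" "continuous_on {ht l - d..ht l + d} \<eta>" "\<And>v. v \<in> {ht l - d..ht l + d} \<Longrightarrow> \<eta> v \<in> N \<and> h (\<eta> v) = v" "\<eta> (ht l) = z0"
 shows "accessible KK z0"
proof -
 obtain M and b :: real where b: "b = 1 \<or> b = -1" "\<And>x. Hc x \<Longrightarrow> (\<And>i. i < M \<Longrightarrow> x i = l i) \<Longrightarrow> b * (ht x - ht l) \<le> 0"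
  using isolated_side[OF l] by metis
 define e where "e = min d (1 / (2 * 3 ^ M))"
 have e: "0 < e" "e \<le> d" "e < 1 / 3 ^ M" using eta(1) by (auto simp: e_def min_def field_simps)
 define g where "g t = \<eta> (ht l + b * (e * t))" for t
 have rng: "ht l + b * (e * t) \<in> {ht l - d..ht l + d}" "0 \<le> e * t" "e * t < 1 / 3 ^ M" if "t \<in> {0..1}" for t
 proof -
  have "0 \<le> e * t" "e * t \<le> e" using that e(1) mult_left_mono[of t 1 e] by auto
  thus "ht l + b * (e * t) \<in> {ht l - d..ht l + d}" "0 \<le> e * t" "e * t < 1 / 3 ^ M" using b(1) e(2,3) by auto
 qed
 have "path g" unfolding path_def g_def
  by (rule continuous_on_compose2[OF eta(2)]) (use rng in "auto intro!: continuous_intros")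
 moreover have "inj_on g {0..1}"
 proof (rule inj_onI)
  fix t u :: real assume tu: "t \<in> {0..1}" "u \<in> {0..1}" "g t = g u"
  have "h (g t) = ht l + b * (e * t)" "h (g u) = ht l + b * (e * u)"
   unfolding g_def using eta(3)[OF rng(1)[OF tu(1)]] eta(3)[OF rng(1)[OF tu(2)]] by blast+
  hence "ht l + b * (e * t) = ht l + b * (e * u)" unfolding tu(3) by (rule trans[OF sym])
  hence "b * (e * t) = b * (e * u)" by (rule add_left_imp_eq)
  moreover have "b \<noteq> 0" "e \<noteq> 0" using b(1) e(1) by auto
  ultimately show "t = u" by simp
 qed
 ultimately have "arc g" by (simp add: arc_def)
 moreover have "path_image g \<inter> KK = {z0}"
 proof
  have "g 0 = z0" using eta(4) by (simp add: g_def)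
  thus "{z0} \<subseteq> path_image g \<inter> KK" using z by (force simp: path_image_def)
  show "path_image g \<inter> KK \<subseteq> {z0}"
  proof
   fix w assume "w \<in> path_image g \<inter> KK"
   then obtain t where t: "t \<in> {0..1}" "w = g t" "g t \<in> KK" by (auto simp: path_image_def)
   define v where "v = ht l + b * (e * t)"
   have w: "w = \<eta> v" using t(2) by (simp add: g_def v_def)
   have v: "\<eta> v \<in> N" "h (\<eta> v) = v" using eta(3)[OF rng(1)[OF t(1)]] by (simp_all add: v_def)
   then obtain x where x: "Hc x" "ht x = v" using f t(2,3) w unfolding flow_def by metis
   have "\<bar>ht x - ht l\<bar> < 1 / 3 ^ M" using rng(2,3)[OF t(1)] b(1) by (auto simp: x(2) v_def)
   hence "b * (ht x - ht l) \<le> 0" using b(2)[OF x(1)] ht_agree by blast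
   hence "e * t \<le> 0" using b(1) by (auto simp: x(2) v_def)
   hence "v = ht l" using rng(2)[OF t(1)] by (simp add: v_def)
   thus "w \<in> {z0}" using w eta(4) by simp
  qed
 qed
 ultimately show ?thesis using z unfolding accessible_def by blast
qed

text \<open>A common lower bound for the lengths of all \<open>B l\<close>, which exists because
  their ends lie in a finite set. Within this distance of one end the other end of the arc is out of
  sight.\<close>

definition w0 :: real where "w0 = (SOME w. 0 < w \<and> (\<forall>l. H l \<longrightarrow> w \<le> hi l - lo l))"

lemma w0: "0 < w0" "H l \<Longrightarrow> w0 \<le> hi l - lo l"
proof -
 obtain d where d: "0 < d" "\<And>x y. x \<in> P \<Longrightarrow> y \<in> P \<Longrightarrow> x \<noteq> y \<Longrightarrow> d \<le> \<bar>x - y\<bar>" by (rule finite_separated[OF finite_P]) blast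
 have "d \<le> hi l - lo l" if "H l" for l using d(2)[of "hi l" "lo l"] B_ends[OF that] by auto
 hence "\<exists>d. 0 < d \<and> (\<forall>l. H l \<longrightarrow> d \<le> hi l - lo l)" using d(1) by blast
 from someI_ex[OF this] show "0 < w0" "H l \<Longrightarrow> w0 \<le> hi l - lo l" by (auto simp: w0_def)
qed

lemma en_diff: "H l \<Longrightarrow> sg r * (en l (\<not> r) - en l r) \<le> - w0"
 using w0(2)[of l] by (cases r) (auto simp: en_def)

text \<open>The level sets of \<open>th r u y\<close> are stadium-shaped: semicircles about \<open>(u, y)\<close> continued by horizontal lines.\<close>

definition th :: "bool \<Rightarrow> real \<Rightarrow> real \<Rightarrow> real \<times> real \<Rightarrow> real" where
 "th r u y z = sqrt ((max 0 (sg r * (fst z - u)))\<^sup>2 + (snd z - y)\<^sup>2)"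

lemma th_continuous: "continuous_on A (th r u y)" unfolding th_def by (intro continuous_intros)

lemma th_ge: "\<bar>snd z - y\<bar> \<le> th r u y z"
using real_sqrt_le_mono by (auto simp: th_def)

lemma th_nonneg: "0 \<le> th r u y z" using th_ge[of z y r u] by linarith

lemma th_eq_iff: "th r u y z = \<bar>d\<bar> \<longleftrightarrow> (max 0 (sg r * (fst z - u)))\<^sup>2 + (snd z - y)\<^sup>2 = d\<^sup>2"
using real_sqrt_eq_iff by (fastforce simp: th_def)

text \<open>A segment and the quarter circle at its end lie on one level of \<open>th\<close>, as
  long as the other end is out of reach. \<open>th_DM\<close> is the converse, for an arc together
  with its mate.\<close>

lemma DD_th:
 assumes l: "H l" "fin l r" and z: "z \<in> DD l" "- w0 < sg r * (fst z - en l r)"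
 shows "th r (en l r) (yc l (Jl l r)) z = \<bar>dl l r\<bar>"
proof -
 note m = mt_facts[OF l]
 consider "seg l z" | r' where "cap l r' z" using z(1) DD_iff[OF l(1)] by blast
 thus ?thesis
 proof cases
  case 1
  hence "sg r * (fst z - en l r) \<le> 0" "snd z = ht l" by (cases r; simp add: seg_def en_def)+
  thus ?thesis unfolding th_eq_iff using m(11) by (simp add: max_absorb1)
 next
  case (2 r')
  show ?thesis
  proof (cases "r' = r")
   case True
   hence "0 \<le> sg r * (fst z - en l r)" "(fst z - en l r)\<^sup>2 + (snd z - yc l (Jl l r))\<^sup>2 = (dl l r)\<^sup>2" using 2 by (auto simp: cap_def)
   thus ?thesis unfolding th_eq_iff by (cases r) (simp_all add: max_absorb2 power2_commute)
  next
   case False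
   hence r': "r' = (\<not> r)" by auto
   have "0 \<le> sg r' * (fst z - en l r')" using 2 by (auto simp: cap_def)
   hence "sg r * (fst z - en l r) \<le> sg r * (en l (\<not> r) - en l r)" unfolding r' by (cases r) auto
   thus ?thesis using en_diff[OF l(1), of r] z(2) by linarith
  qed
 qed
qed

lemma th_DM:
 assumes l: "H l" "fin l r" and z: "- w0 < sg r * (fst z - en l r)" "th r (en l r) (yc l (Jl l r)) z = \<bar>dl l r\<bar>"
 shows "z \<in> DD l \<or> z \<in> DD (mt l r)"
proof -
 note m = mt_facts[OF l]
 have e: "(max 0 (sg r * (fst z - en l r)))\<^sup>2 + (snd z - yc l (Jl l r))\<^sup>2 = (dl l r)\<^sup>2" using z(2) unfolding th_eq_iff .
 show ?thesis
 proof (cases "0 \<le> sg r * (fst z - en l r)")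
  case True
  hence e': "(fst z - en l r)\<^sup>2 + (snd z - yc l (Jl l r))\<^sup>2 = (dl l r)\<^sup>2"
   using e by (cases r) (simp_all add: max_absorb2 power2_commute)
  have "0 \<le> (snd z - yc l (Jl l r)) * dl l r \<or> 0 \<le> (snd z - yc l (Jl l r)) * (- dl l r)" by auto
  hence "cap l r z \<or> cap (mt l r) r z"
   unfolding cap_def m(2,4,5,8) using l(2) m(3) e' True by auto
  thus ?thesis using DD_iff[OF l(1)] DD_iff[OF m(1)] by blast
 next
  case False
  hence "(snd z - yc l (Jl l r))\<^sup>2 = (dl l r)\<^sup>2" using e by (simp add: max_absorb1)
  hence "snd z - yc l (Jl l r) = dl l r \<or> snd z - yc l (Jl l r) = - dl l r" by (rule power2_eq_iff[THEN iffD1])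
  hence Y: "snd z = ht l \<or> snd z = ht (mt l r)" using m(10,11) by auto
  have sgz: "seg x z" if "H x" "en x r = en l r" "snd z = ht x" for x
   using False z(1) w0(2)[OF that(1)] that(2,3) by (cases r) (auto simp: seg_def en_def)
  thus ?thesis using Y sgz[OF l(1)] sgz[OF m(1,2)] DD_iff[OF l(1)] DD_iff[OF m(1)] by blast
 qed
qed

lemma fin_agree:
 assumes "H l" "H l'" "fin l r" "\<And>i. i < M \<Longrightarrow> l i = l' i" "Jl l r + n \<le> M"
 shows "fin l' r" "Jl l' r = Jl l r" "en l' r = en l r" "yc l' (Jl l r) = yc l (Jl l r)"
proof -
 have "lastt l' (en l' r) (Jl l r)" by (rule lastt_agree[OF assms(1,2,4,5) fin_Jl[OF assms(3)]])
 thus "fin l' r" "Jl l' r = Jl l r" using Jl_eq by (auto simp: fin_def)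
 show "en l' r = en l r" by (rule en_agree[OF assms(1,2)]) (use assms(4,5) in auto)
 show "yc l' (Jl l r) = yc l (Jl l r)" by (rule yc_cong) (use assms(4,5) in auto)
qed

lemma ball_coord: fixes z p :: "real \<times> real" assumes "dist z p < d" shows "\<bar>fst z - fst p\<bar> < d" "\<bar>snd z - snd p\<bar> < d"
 using assms dist_fst_le[of z p] dist_snd_le[of z p] by (auto simp: dist_real_def)

lemma rep_pt: assumes "isrep l x" shows "H l" "x 0 \<in> B l" "x = pt l (x 0)"
 using assms unfolding isrep_def by blast+

lemma rep_mates:
 assumes "isrep l x" "isrep l' x" "l \<noteq> l'" obtains r where "fin l r" "x 0 = en l r" "l' = mt l r"
using that rep_pt(3) assms(1) assms(2) reps_mate rep_pt(1) rep_pt(2) assms(3) by metis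

lemma rep_Hc: "x \<in> core s \<Longrightarrow> isrep l x \<Longrightarrow> Hc l"
 using Hc_iff[of l "x 0"] rep_pt[of l x] by metis

text \<open>A flow box at \<open>z\<close> together with a curve \<open>\<eta>\<close> crossing its
  levels through \<open>z\<close>, parametrized by the values of \<open>h\<close>;
  \<open>flow_accessible\<close> moves along this curve.\<close>

definition flow_pt :: "bits \<Rightarrow> real \<times> real \<Rightarrow> bool" where
 "flow_pt l z \<longleftrightarrow> (\<exists>N h \<eta> d. open N \<and> z \<in> N \<and> flow N h \<and> h z = ht l \<and> 0 < d \<and> continuous_on {ht l - d..ht l + d} \<eta> \<and>
   (\<forall>v\<in>{ht l - d..ht l + d}. \<eta> v \<in> N \<and> h (\<eta> v) = v) \<and> \<eta> (ht l) = z)"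

lemma transversal_in_open:
 fixes \<eta> :: "real \<Rightarrow> real \<times> real"
 assumes "continuous_on UNIV \<eta>" "open N" "\<eta> v \<in> N" "0 < e"
 obtains d where "0 < d" "d \<le> e" "\<And>u. u \<in> {v - d..v + d} \<Longrightarrow> \<eta> u \<in> N"
proof -
 have "open (\<eta> -` N)" using assms(1,2) by (simp add: open_vimage)
 moreover have "v \<in> \<eta> -` N" using assms(3) by simp
 ultimately obtain d where d: "0 < d" "cball v d \<subseteq> \<eta> -` N" using open_contains_cball by blast
 hence "\<eta> u \<in> N" if "u \<in> {v - min d e..v + min d e}" for u
 proof -
  have "u \<in> cball v d" using that by (auto simp: dist_real_def)
  thus ?thesis using d(2) by blast
 qed
 thus thesis using that[of "min d e"] d(1) assms(4) by auto
qed

text \<open>Over the interior of \<open>B l\<close> the nearby arcs are horizontal segments with the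
  same ends, so the second coordinate itself is transversal.\<close>

lemma flow_segment:
 assumes x: "x \<in> core s" "isrep l x" and X: "lo l < fst (drw x)" "fst (drw x) < hi l"
 shows "flow_pt l (drw x)"
proof -
 define p where "p = drw x"
 have lH: "H l" "x 0 \<in> B l" using rep_pt[OF x(2)] by auto
 have lc: "Hc l" by (rule rep_Hc[OF x])
 have pP: "p = Phi l (x 0)" using drw_rep[OF x(2)] by (simp add: p_def)
 have uniq: "l' = l" if r0: "isrep l' x" for l'
 proof (rule ccontr)
  assume "l' \<noteq> l"
  then obtain r where r: "fin l r" "x 0 = en l r" using rep_mates[OF x(2) r0] by metis
  have "fst p = en l r + sg r * \<bar>dl l r\<bar>" using Phi_tip[OF lH(1) r(1)] pP r(2) by simp
  thus False using X unfolding p_def[symmetric] by (cases r) (auto simp: en_def)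
 qed
 have strict: "seg l' z" if "z \<in> DD l'" "H l'" "lo l' < fst z" "fst z < hi l'" for l' z
 proof -
  have "\<not> cap l' r z" for r using that(3,4) by (cases r) (auto simp: cap_def en_def)
  thus ?thesis using that DD_iff by blast
 qed
 have "p \<in> DD l" using pP lH(2) by (simp add: DD_def)
 hence py: "snd p = ht l" using strict[OF _ lH(1) X[folded p_def]] by (simp add: seg_def)
 obtain d where d: "0 < d" "\<And>z. z \<in> KK \<Longrightarrow> dist z p < d \<Longrightarrow> \<exists>l'' l. isrep l x \<and> Hc l'' \<and> (\<forall>i<n. l'' i = l i) \<and> z \<in> DD l''"
  using KK_near[OF x(1), of n] unfolding p_def by metis
 define N where "N = ball p d \<inter> {z. lo l < fst z} \<inter> {z. fst z < hi l} \<inter> {z. \<bar>snd z - ht l\<bar> < 1 / 3 ^ n}"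
 have op: "open N" unfolding N_def by (intro open_Int open_ball open_Collect_less continuous_intros)
 have pN: "p \<in> N" using X d(1) py by (simp add: N_def p_def)
 have ends: "lo l'' = lo l" "hi l'' = hi l" if "H l''" "\<And>i. i < n \<Longrightarrow> l'' i = l i" for l''
  using B_markov[OF lH(1) that(1)] that(2) by auto
 have fl: "flow N snd" unfolding flow_def
 proof (intro conjI ballI allI impI)
  show "continuous_on N snd" by (intro continuous_intros)
  fix z assume z: "z \<in> N"
  { assume "z \<in> KK"
   then obtain l'' l' where l'': "isrep l' x" "Hc l''" "\<forall>i<n. l'' i = l' i" "z \<in> DD l''"
    using d(2)[of z] z by (auto simp: N_def dist_commute)
   hence "\<forall>i<n. l'' i = l i" using uniq by simp
   hence "seg l'' z" using strict[OF l''(4) Hc_H[OF l''(2)]] ends[OF Hc_H[OF l''(2)]] z by (auto simp: N_def)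
   thus "\<exists>l. Hc l \<and> ht l = snd z" using l''(2) by (auto simp: seg_def) }
  fix l'' assume l'': "Hc l'' \<and> ht l'' = snd z"
  hence "\<bar>ht l'' - ht l\<bar> < 1 / 3 ^ n" using z by (simp add: N_def)
  hence "seg l'' z" using ends[OF Hc_H, of l''] ht_agree l'' z by (auto simp: N_def seg_def)
  thus "DM l'' z" using DD_iff[OF Hc_H] l'' by (simp add: DM_def)
 qed
 define \<eta> where "\<eta> v = (fst p, v)" for v :: real
 have ec: "continuous_on A \<eta>" for A unfolding \<eta>_def by (intro continuous_intros)
 have ep: "\<eta> (ht l) = p" using py by (simp add: \<eta>_def prod_eq_iff)
 obtain d' where d': "0 < d'" "\<And>u. u \<in> {ht l - d'..ht l + d'} \<Longrightarrow> \<eta> u \<in> N"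
  using transversal_in_open[OF ec op, of "ht l" 1] ep pN by auto
 have "\<forall>v\<in>{ht l - d'..ht l + d'}. \<eta> v \<in> N \<and> snd (\<eta> v) = v" using d'(2) by (simp add: \<eta>_def)
 thus ?thesis unfolding flow_pt_def p_def[symmetric] using op pN fl py d'(1) ec ep by blast
qed

text \<open>The arcs sharing enough letters with \<open>l\<close> or its mate are half stadiums
  about the same centre, so \<open>th\<close>, taken with the sign of \<open>dl l r\<close> and
  measured from the height \<open>y\<close> of the centre, recovers the height.\<close>

lemma flow_cap:
 assumes x: "x \<in> core s" "isrep l x" and f: "fin l r" and X: "0 \<le> sg r * (fst (drw x) - en l r)"
 shows "flow_pt l (drw x)"
proof -
 define p u y J M where defs: "p = drw x" "u = en l r" "y = yc l (Jl l r)" "J = Jl l r" "M = Jl l r + n"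
 define b where "b = (if 0 < dl l r then 1 else -1 :: real)"
 have lH: "H l" "x 0 \<in> B l" using rep_pt[OF x(2)] by auto
 have lc: "Hc l" by (rule rep_Hc[OF x])
 note m = mt_facts[OF lH(1) f]
 have d0: "dl l r \<noteq> 0" by (rule dl_ne[OF f])
 have b: "b * \<bar>dl l r\<bar> = dl l r" "b = 1 \<or> b = -1" using d0 by (auto simp: b_def)
 have pP: "p = Phi l (x 0)" using drw_rep[OF x(2)] by (simp add: defs)
 have pD: "p \<in> DD l" using pP lH(2) by (simp add: DD_def)
 define h where "h z = y + b * th r u y z" for z
 have hc: "continuous_on A h" for A unfolding h_def by (intro continuous_intros th_continuous)
 have pb: "0 \<le> sg r * (fst p - u)" using X by (simp add: defs)
 have thp: "th r u y p = \<bar>dl l r\<bar>" using DD_th[OF lH(1) f pD] pb w0(1) by (simp add: defs)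
 have hp: "h p = ht l" unfolding h_def thp b(1) using m(11) by (simp add: defs)
 have reps: "l' = l \<or> l' = mt l r" if r0: "isrep l' x" for l'
 proof (rule ccontr)
  assume a: "\<not> ?thesis"
  then obtain r' where r': "fin l r'" "x 0 = en l r'" "l' = mt l r'" using rep_mates[OF x(2) r0] by metis
  hence "r' = (\<not> r)" using a by auto
  moreover have "fst p = en l r' + sg r' * \<bar>dl l r'\<bar>" using Phi_tip[OF lH(1) r'(1)] pP r'(2) by simp
  ultimately show False using pb en_diff[OF lH(1), of r] w0(1) unfolding defs by (cases r) auto
 qed
 obtain d where d: "0 < d" "\<And>z. z \<in> KK \<Longrightarrow> dist z p < d \<Longrightarrow> \<exists>l'' l. isrep l x \<and> Hc l'' \<and> (\<forall>i<M. l'' i = l i) \<and> z \<in> DD l''"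
  using KK_near[OF x(1), of M] unfolding defs(1) by metis
 define N where "N = ball p (min d w0) \<inter> {z. \<bar>h z - ht l\<bar> < 1 / 3 ^ M}"
 have op: "open N" unfolding N_def by (intro open_Int open_ball open_Collect_less continuous_intros hc)
 have pN: "p \<in> N" using d(1) w0(1) hp by (simp add: N_def)
 have Nb: "- w0 < sg r * (fst z - u)" "dist z p < d" if "z \<in> N" for z
 proof -
  have z: "dist z p < w0" "dist z p < d" using that by (auto simp: N_def dist_commute)
  thus "dist z p < d" by simp
  have "sg r * (fst z - u) = sg r * (fst p - u) + sg r * (fst z - fst p)" by (simp add: algebra_simps)
  moreover have "- w0 < sg r * (fst z - fst p)" using ball_coord(1)[OF z(1)] by (cases r) auto
  ultimately show "- w0 < sg r * (fst z - u)" using pb by linarith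
 qed
 have st: "fin l'' r" "Jl l'' r = J" "en l'' r = u" "yc l'' J = y" if "H l''" "l' = l \<or> l' = mt l r" "\<And>i. i < M \<Longrightarrow> l'' i = l' i" for l'' l'
 proof -
  have l': "H l'" "fin l' r" "Jl l' r = J" "en l' r = u" "yc l' J = y" using that(2) lH(1) f m by (auto simp: defs)
  have "fin l'' r \<and> Jl l'' r = Jl l' r \<and> en l'' r = en l' r \<and> yc l'' (Jl l' r) = yc l' (Jl l' r)"
   using fin_agree[OF l'(1) that(1) l'(2), of M] that(3) l'(3) by (simp add: defs)
  thus "fin l'' r" "Jl l'' r = J" "en l'' r = u" "yc l'' J = y" using l' by auto
 qed
 have fl: "flow N h" unfolding flow_def
 proof (intro conjI ballI allI impI)
  show "continuous_on N h" by (rule hc)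
  fix z assume z: "z \<in> N"
  { assume "z \<in> KK"
   then obtain l'' l' where l'': "isrep l' x" "Hc l''" "\<forall>i<M. l'' i = l' i" "z \<in> DD l''"
    using d(2)[of z] Nb(2)[OF z] by blast
   have q: "fin l'' r" "Jl l'' r = J" "en l'' r = u" "yc l'' J = y"
    using st[OF Hc_H[OF l''(2)] reps[OF l''(1)]] l''(3) by auto
   have t: "th r u y z = \<bar>dl l'' r\<bar>" using DD_th[OF Hc_H[OF l''(2)] q(1) l''(4)] Nb(1)[OF z] q by simp
   note m'' = mt_facts[OF Hc_H[OF l''(2)] q(1)]
   have "h z = y + dl l'' r \<or> h z = y - dl l'' r" unfolding h_def t using b(2) by (auto simp: abs_if)
   hence "h z = ht l'' \<or> h z = ht (mt l'' r)" using m''(10,11) q by auto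
   thus "\<exists>l. Hc l \<and> ht l = h z" using l''(2) Hc_mt[OF l''(2) q(1)] by metis }
  fix l'' assume l'': "Hc l'' \<and> ht l'' = h z"
  hence "\<bar>ht l'' - ht l\<bar> < 1 / 3 ^ M" using z by (simp add: N_def)
  hence "l'' i = l i" if "i < M" for i using ht_agree that by blast
  hence q: "fin l'' r" "Jl l'' r = J" "en l'' r = u" "yc l'' J = y"
   using st[OF Hc_H, of l'' l] l'' by auto
  have "y + dl l'' r = y + b * th r u y z" using mt_facts(11)[OF Hc_H q(1)] l'' q by (simp add: h_def)
  hence "\<bar>dl l'' r\<bar> = th r u y z" using b(2) th_nonneg[of r u y z] by auto
  hence "z \<in> DD l'' \<or> z \<in> DD (mt l'' r)" using th_DM[OF Hc_H q(1)] l'' Nb(1)[OF z] q by simp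
  thus "DM l'' z" using q(1) by (auto simp: DM_def)
 qed
 \<comment> \<open>The straight line from the centre \<open>(u, y)\<close> through \<open>p\<close>,
   scaled so that \<open>th\<close> has the value \<open>\<bar>v - y\<bar>\<close> at parameter
   \<open>v\<close>.\<close>
 define \<eta> where "\<eta> v = (u + (\<bar>v - y\<bar> / \<bar>dl l r\<bar>) * (fst p - u), y + (\<bar>v - y\<bar> / \<bar>dl l r\<bar>) * (snd p - y))" for v :: real
 have ec: "continuous_on A \<eta>" for A unfolding \<eta>_def using d0 by (intro continuous_intros) auto
 have ly: "ht l - y = dl l r" using m(11) by (simp add: defs)
 have ep: "\<eta> (ht l) = p" unfolding \<eta>_def ly using d0 by (simp add: prod_eq_iff)
 have heta: "h (\<eta> v) = v" if v: "\<bar>v - ht l\<bar> < \<bar>dl l r\<bar>" for v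
 proof -
  define k where "k = \<bar>v - y\<bar> / \<bar>dl l r\<bar>"
  have k: "0 \<le> k" "k * \<bar>dl l r\<bar> = \<bar>v - y\<bar>" using d0 by (simp_all add: k_def)
  have "sg r * (fst (\<eta> v) - u) = k * (sg r * (fst p - u))" by (simp add: \<eta>_def k_def[symmetric])
  moreover have "0 \<le> k * (sg r * (fst p - u))" using pb k(1) by (rule_tac mult_nonneg_nonneg)
  ultimately have m1: "max 0 (sg r * (fst (\<eta> v) - u)) = k * max 0 (sg r * (fst p - u))" using pb by (simp only: max_absorb2)
  have m2: "snd (\<eta> v) - y = k * (snd p - y)" by (simp add: \<eta>_def k_def[symmetric])
  have "th r u y (\<eta> v) = sqrt (k\<^sup>2 * ((max 0 (sg r * (fst p - u)))\<^sup>2 + (snd p - y)\<^sup>2))"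
   unfolding th_def m1 m2 by (simp only: power_mult_distrib distrib_left)
  also have "\<dots> = k * th r u y p" using k(1) by (simp add: th_def real_sqrt_mult)
  also have "\<dots> = \<bar>v - y\<bar>" unfolding thp by (rule k(2))
  finally have "h (\<eta> v) = y + b * \<bar>v - y\<bar>" by (simp add: h_def)
  moreover have "b * \<bar>v - y\<bar> = v - y"
  using v ly d0 by (auto simp: b_def)
  ultimately show ?thesis by simp
 qed
 obtain d' where d': "0 < d'" "d' \<le> \<bar>dl l r\<bar> / 2" "\<And>u. u \<in> {ht l - d'..ht l + d'} \<Longrightarrow> \<eta> u \<in> N"
  using transversal_in_open[OF ec op, of "ht l" "\<bar>dl l r\<bar> / 2"] ep pN d0 by auto
 have "\<forall>v\<in>{ht l - d'..ht l + d'}. \<eta> v \<in> N \<and> h (\<eta> v) = v"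
 using d'(1,2) heta d'(3) by auto
 thus ?thesis unfolding flow_pt_def defs(1)[symmetric] using op pN fl hp d'(1) ec ep by blast
qed

text \<open>The two kinds of boxes cover everything except ends that carry no semicircle, that is,
  ends without a last tight index.\<close>

lemma flow_or_endpoint:
 assumes x: "x \<in> core s" "isrep l x"
 shows "flow_pt l (drw x) \<or>
  (\<exists>r. \<not> fin l r \<and> x 0 = en l r \<and> drw x = (en l r, ht l))"
proof -
 have lH: "H l" "x 0 \<in> B l" using rep_pt[OF x(2)] by auto
 have pP: "drw x = Phi l (x 0)" by (rule drw_rep[OF x(2)])
 have "drw x \<in> DD l" using pP lH(2) by (simp add: DD_def)
 then consider r where "cap l r (drw x)" | "seg l (drw x)" using DD_iff[OF lH(1)] by blast
 thus ?thesis
 proof cases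
  case (1 r)
  hence "fin l r" "0 \<le> sg r * (fst (drw x) - en l r)" by (auto simp: cap_def)
  from flow_cap[OF x this] show ?thesis ..
 next
  case 2
  show ?thesis
  proof (cases "lo l < fst (drw x) \<and> fst (drw x) < hi l")
   case True
   thus ?thesis using flow_segment[OF x] by simp
  next
   case False
   hence "fst (drw x) = en l True \<or> fst (drw x) = en l False" using 2 by (auto simp: seg_def en_def)
   then obtain r where r: "fst (drw x) = en l r" by blast
   show ?thesis
   proof (cases "fin l r")
    case True
    thus ?thesis using flow_cap[OF x True] r by simp
   next
    case nf: False
    have "sx l (en l r) = en l r + sg r * \<bar>dl l r\<bar>" using sx_ends[OF lH(1)] by (cases r) (simp_all add: en_def)
    also have "\<dots> = en l r" using nf by (simp add: dl_def)
    finally have "sx l (x 0) = sx l (en l r)" using r pP by (simp add: Phi_def)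
    hence "x 0 = en l r" using sx_inj[OF lH(1)] by simp
    moreover have "drw x = (en l r, ht l)" using r 2 by (simp add: seg_def prod_eq_iff)
    ultimately show ?thesis using nf by blast
   qed
  qed
 qed
qed

end

section \<open>Endpoints\<close>

context tent_lhe
begin

text \<open>\<open>endp l r\<close>: the end \<open>r\<close> of the basic arc of \<open>l\<close> is an endpoint of its arc-component.\<close>

definition endp :: "bits \<Rightarrow> bool \<Rightarrow> bool" where
 "endp l r \<longleftrightarrow> Hc l \<and> \<not> fin l r"

lemma step_Suc: "j + n * Suc i = j + n * i + n" by simp

text \<open>Without a last tight index each tight one is followed by another, \<open>n\<close>
  further on. A first one exists because the lower end of a core arc is not 0.\<close>

lemma endp_tight:
 assumes "endp l r" obtains j0 where "j0 < n" "\<And>i. lb l (j0 + n * i) (en l r) = s/2"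
proof -
 have l: "Hc l" "H l" "\<not> fin l r" using assms Hc_H by (auto simp: endp_def)
 obtain j0 where j0: "j0 < n" "lb l j0 (en l r) = s/2"
 proof (cases r)
  case True
  thus ?thesis using hi_tight[OF l(2)] that by (auto simp: en_def)
 next
  case False
  have "lo l \<noteq> 0"
  using lo_zero l(2) l(1) by (metis Hc_def)
  thus ?thesis using lo_tight[OF l(2)] that False by (auto simp: en_def)
 qed
 have "lb l (j0 + n * i) (en l r) = s/2" for i
 proof (induction i)
  case (Suc i)
  have "\<not> lastt l (en l r) (j0 + n * i)" using l(3) by (auto simp: fin_def)
  hence "lb l (j0 + n * i + n) (en l r) = s/2" using lastt_iff[OF en_in[OF l(2)]] Suc by blast
  thus ?case unfolding step_Suc .
 qed (use j0 in simp)
 thus thesis using that j0(1) by blast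
qed

lemma endp_letters:
 assumes "H l" "t \<in> B l" "lb l (j0 + n * Suc i) t = s/2" "q < n"
 shows "l (j0 + n * i + n - 1 - q) = \<nu> q"
 using forced_letters[OF assms(1,2) assms(3)[unfolded step_Suc] assms(4)] .

lemma tight_index: assumes "(j0::nat) \<le> j" obtains i q where "q < n" "j = j0 + n * i + n - 1 - q"
proof -
 define k where "k = j - j0"
 have "k mod n < n" using n_pos by simp
 moreover have "k = n * (k div n) + k mod n" by simp
 ultimately have "j = j0 + n * (k div n) + n - 1 - (n - 1 - k mod n)" "n - 1 - k mod n < n" using assms by (auto simp: k_def)
 thus thesis using that by blast
qed

text \<open>Tightness forces the letters to be \<open>\<nu>\<close> read backwards, and the
  reflection symmetry makes this the tail of class \<open>c\<close>, where \<open>c\<close> is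
  solved from \<open>kk c 0 = j0\<close>.\<close>

lemma endp_tail: assumes "endp l r" obtains c where "c < n" "tl c l"
proof -
 have l: "H l" using assms Hc_H by (auto simp: endp_def)
 obtain j0 where j0: "j0 < n" "\<And>i. lb l (j0 + n * i) (en l r) = s/2" using endp_tight[OF assms] by blast
 define c where "c = nat ((1 - int j0 - int dd) mod int n)"
 have ic: "int c = (1 - int j0 - int dd) mod int n" using n_pos by (simp add: c_def)
 have cn: "c < n" using n_pos ic by (simp add: c_def nat_less_iff)
 have "(1 - int c - int dd) mod int n = (int j0) mod int n"
 proof -
  have "(1 - int c - int dd) mod int n = ((1 - int dd) - (1 - int j0 - int dd) mod int n) mod int n"
   unfolding ic by (rule arg_cong[where f = "\<lambda>k. k mod int n"]) simp
  also have "\<dots> = ((1 - int dd) - (1 - int j0 - int dd)) mod int n" by (rule mod_diff_right_eq)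
  finally show ?thesis by simp
 qed
 also have "\<dots> = int j0" using j0(1) by simp
 finally have k: "kk c N = j0 + n * N" for N by (simp add: kk_def)
 have "l j = \<nu> (j + c)" if jj: "j0 \<le> j" for j
 proof -
  obtain i q where q: "q < n" "j = j0 + n * i + n - 1 - q" by (rule tight_index[OF jj])
  have "l j = \<nu> q" using endp_letters[OF l en_in[OF l] j0(2) q(1), of i] q(2) by simp
  moreover have "q + Suc j = kk c (Suc i)" using q n_pos by (simp add: k)
  ultimately show ?thesis using kk_letter by metis
 qed
 hence "tl c l" unfolding tl_def by blast
 thus thesis using that cn by blast
qed

text \<open>Tight constraints force the letters before them, so \<open>x\<close> follows
  \<open>l\<close> as long as it is tight at the same indices. Since \<open>x\<close> differs from
  \<open>l\<close>, tightness must end at some last index, late because of the common prefix, and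
  \<open>x\<close> departs from \<open>l\<close> within the next \<open>n\<close> letters.\<close>

lemma endp_near:
 assumes e: "endp l r" and x: "Hc x" "x \<noteq> l" "\<forall>i<M. x i = l i" and M: "n \<le> M"
 shows "en x r = en l r" "fin x r" "M < Jl x r + n" "\<And>i. i < Jl x r \<Longrightarrow> x i = l i" "\<exists>i<Jl x r + n. x i \<noteq> l i"
  "\<And>j0. j0 < n \<Longrightarrow> lb l j0 (en l r) = s/2 \<Longrightarrow> Jl x r mod n = j0"
proof -
 have H: "H l" "H x" using e x(1) Hc_H by (auto simp: endp_def)
 obtain j0 where j0: "j0 < n" "\<And>i. lb l (j0 + n * i) (en l r) = s/2" using endp_tight[OF e] by blast
 show en: "en x r = en l r" by (rule en_agree[OF H]) (use x(3) M in simp)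
 have xB: "en l r \<in> B x" using en_in[OF H(2), of r] by (simp add: en)
 have xl: "lb x j t = lb l j t" if "j \<le> M" for j t by (rule lb_cong) (use x(3) that in auto)
 have x0: "lb x j0 (en l r) = s/2" using xl[of j0] j0(1) j0(2)[of 0] M by simp
 have letters: "x j = l j" if "j < j0 + n * i" "lb x (j0 + n * i) (en l r) = s/2" for i j
 proof (cases "j < j0")
  case True
  thus ?thesis using x(3) M j0(1) by simp
 next
  case False
  hence "j0 \<le> j" by simp
  then obtain k q where q: "q < n" "j = j0 + n * k + n - 1 - q" by (rule tight_index) blast
  have "n * k < n * i" using that(1) q by linarith
  hence ki: "k < i" by simp
  have "j0 + n * i = j0 + n * Suc k + (i - Suc k) * n" using ki by (metis add.assoc le_add_diff_inverse less_eq_Suc_le mult.commute add_mult_distrib2)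
  hence "lb x (j0 + n * Suc k) (en l r) = s/2" using tight_reduce_mult[OF xB, of "j0 + n * Suc k" "i - Suc k"] that(2) by metis
  thus ?thesis using endp_letters[OF H(2) xB _ q(1)] endp_letters[OF H(1) en_in[OF H(1)] j0(2) q(1)] q(2) by metis
 qed
 show fx: "fin x r"
 proof (rule ccontr)
  assume nf: "\<not> fin x r"
  have "lb x (j0 + n * i) (en l r) = s/2" for i
  proof (induction i)
   case (Suc i)
   have "\<not> lastt x (en l r) (j0 + n * i)" using nf en by (auto simp: fin_def)
   hence "lb x (j0 + n * i + n) (en l r) = s/2" using lastt_iff[OF xB] Suc by blast
   thus ?case unfolding step_Suc .
  qed (use x0 in simp)
  moreover have "j < j0 + n * Suc j" for j using le_n_mult[of "Suc j"] by linarith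
  ultimately have "x = l" using letters by blast
  thus False using x(2) by simp
 qed
 define J where "J = Jl x r"
 have J: "lb x J (en l r) = s/2" "lb x (J + n) (en l r) \<noteq> s/2"
  using fin_Jl[OF fx] lastt_iff[OF xB, of J] by (auto simp: J_def en)
 have Jmod: "J mod n = j0"
 proof (cases "j0 \<le> J")
  case True
  have "(J - j0) mod n = 0" by (rule tight_cong[OF xB J(1) x0 True])
  thus ?thesis using True j0(1) by (metis mod_eq_dvd_iff_nat mod_0_imp_dvd mod_less)
 next
  case False
  hence "(j0 - J) mod n = 0" by (intro tight_cong[OF xB x0 J(1)]) simp
  hence "j0 - J = 0" using j0(1) by simp
  thus ?thesis using False by simp
 qed
 hence Je: "J = j0 + n * (J div n)" by (metis add.commute mult_div_mod_eq)
 show "M < Jl x r + n"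
 proof (rule ccontr)
  assume "\<not> M < Jl x r + n"
  hence "lb x (J + n) (en l r) = lb l (J + n) (en l r)" using xl by (simp add: J_def)
  moreover have "J + n = j0 + n * Suc (J div n)" unfolding step_Suc using Je by simp
  ultimately show False using J(2) j0(2)[of "Suc (J div n)"] by metis
 qed
 show "x i = l i" if "i < Jl x r" for i using letters[of i "J div n"] J(1) Je that by (simp add: J_def)
 show "\<exists>i<Jl x r + n. x i \<noteq> l i"
 using lb_cong Je J(2) j0(2) by (smt (verit) J_def step_Suc)
 show "Jl x r mod n = j1" if j1: "j1 < n" "lb l j1 (en l r) = s/2" for j1
 proof -
  have "j1 = j0"
  proof (cases "j0 \<le> j1")
   case True
   hence "(j1 - j0) mod n = 0" using tight_cong[OF en_in[OF H(1)] j1(2), of j0] j0(2)[of 0] by simp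
   thus ?thesis using True j1(1) by simp
  next
   case False
   hence "(j0 - j1) mod n = 0" using tight_cong[OF en_in[OF H(1)] _ j1(2), of j0] j0(2)[of 0] by simp
   thus ?thesis using False j0(1) by simp
  qed
  thus ?thesis using Jmod by (simp add: J_def)
 qed
qed

text \<open>\<open>l\<close> is isolated on one side, so \<open>x\<close> and its mate, both sharing
  a long prefix with \<open>l\<close>, have heights on the same side of \<open>ht l\<close>. Their
  stadium does not reach around the endpoint.\<close>

lemma endp_stadium:
 assumes e: "endp l r"
 obtains M where "n \<le> M" "\<And>x. Hc x \<Longrightarrow> x \<noteq> l \<Longrightarrow> \<forall>i<M. x i = l i \<Longrightarrow> \<bar>dl x r\<bar> < \<bar>ht l - yc l (Jl x r)\<bar>"
proof -
 have lc: "Hc l" using e by (simp add: endp_def)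
 have "ntail l" using endp_tail[OF e] ntail_iff by metis
 then obtain M0 and b :: real where b: "b = 1 \<or> b = -1" "\<And>x. Hc x \<Longrightarrow> (\<And>i. i < M0 \<Longrightarrow> x i = l i) \<Longrightarrow> b * (ht x - ht l) \<le> 0"
  using isolated_side[OF lc] by metis
 have "\<bar>dl x r\<bar> < \<bar>ht l - yc l (Jl x r)\<bar>" if x: "Hc x" "x \<noteq> l" "\<forall>i<M0 + n. x i = l i" for x
 proof -
  have nM: "n \<le> M0 + n" by simp
  note N = endp_near[OF e x nM]
  note m = mt_facts[OF Hc_H[OF x(1)] N(2)]
  have J: "M0 < Jl x r" using N(3) by simp
  have y: "yc x (Jl x r) = yc l (Jl x r)" by (rule yc_cong) (rule N(4))
  have mc: "Hc (mt x r)" by (rule Hc_mt[OF x(1) N(2)])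
  have am: "mt x r i = l i" if ii: "i < Jl x r" for i using N(4)[OF ii] ii by (simp add: mt_def flip_def)
  have 1: "b * (ht x - ht l) \<le> 0" "b * (ht (mt x r) - ht l) \<le> 0"
   using b(2)[OF x(1)] b(2)[OF mc] x(3) am J by auto
  have "mt x r \<noteq> l"
  proof
   assume "mt x r = l"
   thus False using m(3) e by (simp add: endp_def)
  qed
  hence ne: "ht x \<noteq> ht l" "ht (mt x r) \<noteq> ht l" using x(2) by (simp_all add: ht_inj)
  hence "ht x = yc l (Jl x r) + dl x r" "ht (mt x r) = yc l (Jl x r) - dl x r" using m(10,11) y by simp_all
  thus ?thesis using 1 ne b(1) by (auto simp: abs_if split: if_splits)
 qed
 thus thesis using that[of "M0 + n"] by auto
qed

text \<open>The two indices are congruent modulo \<open>n\<close>, so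
  \<open>Jl a r + n \<le> Jl b r\<close>, and \<open>a\<close> and its mate leave the common prefix
  of \<open>b\<close> and \<open>l\<close> before \<open>Jl b r\<close>. As cylinders are convex,
  their heights are not between that of \<open>l\<close> and those of \<open>b\<close> and its mate;
  so the height \<open>Y\<close> lies outside the range of the stadium of \<open>a\<close>.\<close>

lemma endp_nested:
 assumes e: "endp l r" and M: "n \<le> M"
  and st: "\<forall>x. Hc x \<and> x \<noteq> l \<and> (\<forall>i<M. x i = l i) \<longrightarrow> \<bar>dl x r\<bar> < \<bar>ht l - yc l (Jl x r)\<bar>"
  and a: "Hc a" "a \<noteq> l" "\<forall>i<M. a i = l i" and b: "Hc b" "b \<noteq> l" "\<forall>i<M. b i = l i"
  and J: "Jl a r < Jl b r" and Y: "\<bar>Y - yc l (Jl b r)\<bar> \<le> \<bar>dl b r\<bar>"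
 shows "\<bar>dl a r\<bar> < \<bar>Y - yc l (Jl a r)\<bar>"
proof -
 note Na = endp_near[OF e a M] note Nb = endp_near[OF e b M]
 note ma = mt_facts[OF Hc_H[OF a(1)] Na(2)] note mb = mt_facts[OF Hc_H[OF b(1)] Nb(2)]
 define ya yb where "ya = yc l (Jl a r)" and "yb = yc l (Jl b r)"
 have ya: "yc a (Jl a r) = ya" unfolding ya_def by (rule yc_cong) (rule Na(4))
 have yb: "yc b (Jl b r) = yb" unfolding yb_def by (rule yc_cong) (rule Nb(4))
 obtain j0 where j0: "j0 < n" "\<And>i. lb l (j0 + n * i) (en l r) = s/2" using endp_tight[OF e] by blast
 have "Jl a r mod n = Jl b r mod n" using Na(6)[OF j0(1)] Nb(6)[OF j0(1)] j0(2)[of 0] by simp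
 hence "n dvd Jl b r - Jl a r" using J by (metis mod_eq_dvd_iff_nat less_imp_le)
 hence Jab: "Jl a r + n \<le> Jl b r" using J by (auto dest!: dvd_imp_le)
 have sidea: "\<bar>dl a r\<bar> < \<bar>ht l - ya\<bar>" using st a by (simp add: ya_def)
 have agb: "w i = l i" if "w = b \<or> w = mt b r" "i < Jl b r" for w i using that Nb(4)[of i] by (auto simp: mt_def)
 have dif: "\<exists>i<Jl b r. v i \<noteq> l i" if "v = a \<or> v = mt a r" for v
 proof (cases "v = a")
  case True
  thus ?thesis using Na(5) Jab by (meson less_le_trans)
 next
  case False
  have mc: "Hc (mt a r)" by (rule Hc_mt[OF a(1) Na(2)])
  have ml: "mt a r \<noteq> l" using ma(3) e by (auto simp: endp_def)
  show ?thesis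
  proof (cases "\<forall>i<M. mt a r i = l i")
   case True
   hence "\<exists>i<Jl (mt a r) r + n. mt a r i \<noteq> l i" using endp_near(5)[OF e mc ml _ M] by blast
   thus ?thesis using False that ma(4) Jab by (metis less_le_trans)
  next
   case F: False
   then obtain i where i: "i < M" "mt a r i \<noteq> l i" by blast
   have "i = Jl a r"
   using i a(3) by (fastforce simp: mt_def)
   thus ?thesis using i(2) False that J by metis
  qed
 qed
 have no: "\<not> (ht l \<le> ht v \<and> ht v \<le> ht w)" "\<not> (ht w \<le> ht v \<and> ht v \<le> ht l)"
  if vw: "v = a \<or> v = mt a r" "w = b \<or> w = mt b r" for v w
 proof -
  obtain i where i: "i < Jl b r" "v i \<noteq> l i" using dif[OF vw(1)] by blast
  show "\<not> (ht l \<le> ht v \<and> ht v \<le> ht w)"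
   using ht_convex[of "Jl b r" l w v i] agb[OF vw(2)] i by auto
  show "\<not> (ht w \<le> ht v \<and> ht v \<le> ht l)"
   using ht_convex[of "Jl b r" w l v i] agb[OF vw(2)] i by auto
 qed
 have ha: "ht a = ya + dl a r" "ht (mt a r) = ya - dl a r" using ma(10,11) ya by simp_all
 have hb: "ht b = yb + dl b r" "ht (mt b r) = yb - dl b r" using mb(10,11) yb by simp_all
 have Yb: "min (ht b) (ht (mt b r)) \<le> Y" "Y \<le> max (ht b) (ht (mt b r))" using Y unfolding hb yb_def[symmetric] by (auto simp: abs_if split: if_splits)
 have nab: "\<not> (ht l \<le> ht a \<and> ht a \<le> ht b)" "\<not> (ht b \<le> ht a \<and> ht a \<le> ht l)"
  "\<not> (ht l \<le> ht a \<and> ht a \<le> ht (mt b r))" "\<not> (ht (mt b r) \<le> ht a \<and> ht a \<le> ht l)"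
  "\<not> (ht l \<le> ht (mt a r) \<and> ht (mt a r) \<le> ht b)" "\<not> (ht b \<le> ht (mt a r) \<and> ht (mt a r) \<le> ht l)"
  "\<not> (ht l \<le> ht (mt a r) \<and> ht (mt a r) \<le> ht (mt b r))" "\<not> (ht (mt b r) \<le> ht (mt a r) \<and> ht (mt a r) \<le> ht l)"
  using no[of a b] no[of a "mt b r"] no[of "mt a r" b] no[of "mt a r" "mt b r"] by auto
 show ?thesis
 proof (cases "ya < ht l")
  case True
  hence "ht a < ht l" "ht (mt a r) < ht l" using sidea unfolding ha by auto
  hence "ht a < ht b" "ht a < ht (mt b r)" "ht (mt a r) < ht b" "ht (mt a r) < ht (mt b r)" using nab by linarith+
  hence "ht a < Y" "ht (mt a r) < Y" using Yb by auto
  thus ?thesis unfolding ha ya_def[symmetric] by auto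
 next
  case False
  hence "ht l < ht a" "ht l < ht (mt a r)" using sidea unfolding ha by auto
  hence "ht b < ht a" "ht (mt b r) < ht a" "ht b < ht (mt a r)" "ht (mt b r) < ht (mt a r)" using nab by linarith+
  hence "Y < ht a" "Y < ht (mt a r)" using Yb by auto
  thus ?thesis unfolding ha ya_def[symmetric] by auto
 qed
qed

text \<open>Near an endpoint, \<open>KK\<close> consists of the arc ending there and of parts of stadiums lying on one side of it.\<close>

definition endp_box :: "bits \<Rightarrow> bool \<Rightarrow> nat \<Rightarrow> real \<Rightarrow> bool" where
 "endp_box l r M d \<longleftrightarrow> n \<le> M \<and> 0 < d \<and> d \<le> w0 \<and>
  (\<forall>y. Hc y \<and> y \<noteq> l \<and> (\<forall>i<M. y i = l i) \<longrightarrow> \<bar>dl y r\<bar> < \<bar>ht l - yc l (Jl y r)\<bar>) \<and>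
  (\<forall>z. z \<in> KK \<and> dist z (en l r, ht l) < d \<longrightarrow>
    (snd z = ht l \<and> sg r * (fst z - en l r) \<le> 0) \<or> (\<exists>y. Hc y \<and> y \<noteq> l \<and> (\<forall>i<M + n. y i = l i) \<and> z \<in> DD y)) \<and>
  (\<forall>z. snd z = ht l \<and> dist z (en l r, ht l) < d \<and> sg r * (fst z - en l r) \<le> 0 \<longrightarrow> z \<in> KK)"

lemma endp_boxD:
 assumes "endp_box l r M d"
 shows "n \<le> M" "0 < d" "d \<le> w0"
  "\<forall>y. Hc y \<and> y \<noteq> l \<and> (\<forall>i<M. y i = l i) \<longrightarrow> \<bar>dl y r\<bar> < \<bar>ht l - yc l (Jl y r)\<bar>"
  "\<And>z. z \<in> KK \<Longrightarrow> dist z (en l r, ht l) < d \<Longrightarrow>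
    (snd z = ht l \<and> sg r * (fst z - en l r) \<le> 0) \<or> (\<exists>y. Hc y \<and> y \<noteq> l \<and> (\<forall>i<M + n. y i = l i) \<and> z \<in> DD y)"
  "\<And>z. snd z = ht l \<Longrightarrow> dist z (en l r, ht l) < d \<Longrightarrow> sg r * (fst z - en l r) \<le> 0 \<Longrightarrow> z \<in> KK"
proof -
 note a = assms[unfolded endp_box_def]
 note b = conjunct2[OF a] note c = conjunct2[OF b] note d = conjunct2[OF c] note e = conjunct2[OF d]
 show "n \<le> M" "0 < d" "d \<le> w0" using a b c by blast+
 show "\<forall>y. Hc y \<and> y \<noteq> l \<and> (\<forall>i<M. y i = l i) \<longrightarrow> \<bar>dl y r\<bar> < \<bar>ht l - yc l (Jl y r)\<bar>" by (rule conjunct1[OF d])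
 show "(snd z = ht l \<and> sg r * (fst z - en l r) \<le> 0) \<or> (\<exists>y. Hc y \<and> y \<noteq> l \<and> (\<forall>i<M + n. y i = l i) \<and> z \<in> DD y)"
  if "z \<in> KK" "dist z (en l r, ht l) < d" for z
  by (rule mp[OF spec[OF conjunct1[OF e]]]) (intro conjI that)
 show "z \<in> KK" if "snd z = ht l" "dist z (en l r, ht l) < d" "sg r * (fst z - en l r) \<le> 0" for z
  by (rule mp[OF spec[OF conjunct2[OF e]]]) (intro conjI that)
qed

lemma endp_local:
 assumes x: "x \<in> core s" "isrep l x" and e: "endp l r" and p: "drw x = (en l r, ht l)" "x 0 = en l r"
 obtains M d where "endp_box l r M d"
proof -
 have lc: "Hc l" "H l" "\<not> fin l r" using e Hc_H by (auto simp: endp_def)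
 obtain M where M: "n \<le> M" "\<And>y. Hc y \<Longrightarrow> y \<noteq> l \<Longrightarrow> \<forall>i<M. y i = l i \<Longrightarrow> \<bar>dl y r\<bar> < \<bar>ht l - yc l (Jl y r)\<bar>"
  using endp_stadium[OF e] by metis
 obtain d0 where d0: "0 < d0" "\<And>z. z \<in> KK \<Longrightarrow> dist z (drw x) < d0 \<Longrightarrow> \<exists>l'' l. isrep l x \<and> Hc l'' \<and> (\<forall>i<M + n. l'' i = l i) \<and> z \<in> DD l''"
  using KK_near[OF x(1), of "M + n"] by metis
 have uniq: "l' = l" if r0: "isrep l' x" for l'
 proof (rule ccontr)
  assume "l' \<noteq> l"
  then obtain r' where r': "fin l r'" "x 0 = en l r'" using rep_mates[OF x(2) r0] by metis
  hence "r' = r" using p(2) B_ends(2)[OF lc(2)] by (cases r; cases r') (auto simp: en_def)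
  thus False using r'(1) lc(3) by simp
 qed
 define d where "d = min d0 w0"
 have dist: "- w0 < sg r * (fst z - en l r)" if "dist z (en l r, ht l) < d" for z
 proof -
  have "\<bar>fst z - en l r\<bar> < w0" using ball_coord(1)[of z "(en l r, ht l)" w0] that by (simp add: d_def)
  thus ?thesis by (cases r) auto
 qed
 show thesis
 proof (rule that[of M d], unfold endp_box_def, intro conjI allI impI; (elim conjE)?)
  show "n \<le> M" by (rule M(1))
  show "0 < d" "d \<le> w0" using d0(1) w0(1) by (simp_all add: d_def)
  show "\<bar>dl y r\<bar> < \<bar>ht l - yc l (Jl y r)\<bar>" if "Hc y" "y \<noteq> l" "\<forall>i<M. y i = l i" for y by (rule M(2)[OF that])
  show "(snd z = ht l \<and> sg r * (fst z - en l r) \<le> 0) \<or> (\<exists>y. Hc y \<and> y \<noteq> l \<and> (\<forall>i<M + n. y i = l i) \<and> z \<in> DD y)"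
   if z: "z \<in> KK" "dist z (en l r, ht l) < d" for z
  proof -
   obtain y l' where y: "isrep l' x" "Hc y" "\<forall>i<M + n. y i = l' i" "z \<in> DD y"
    using d0(2)[OF z(1)] z(2) p(1) by (auto simp: d_def)
   have ag: "\<forall>i<M + n. y i = l i" using y(3) uniq[OF y(1)] by simp
   show ?thesis
   proof (cases "y = l")
    case True
    have "\<not> cap l r' z" for r'
    proof
     assume c: "cap l r' z"
     hence "fin l r'" by (simp add: cap_def)
     have "r' \<noteq> r"
     proof
      assume "r' = r"
      thus False using `fin l r'` lc(3) by simp
     qed
     hence r': "r' = (\<not> r)" by auto
     have "0 \<le> sg r' * (fst z - en l r')" using c by (auto simp: cap_def)
     hence "sg r * (fst z - en l r) \<le> sg r * (en l (\<not> r) - en l r)" unfolding r' by (cases r) auto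
     thus False using en_diff[OF lc(2), of r] dist[OF z(2)] by linarith
    qed
    hence "seg l z" using y(4) True DD_iff[OF lc(2)] by blast
    thus ?thesis by (cases r) (auto simp: seg_def en_def)
   next
    case False
    thus ?thesis using y(2,4) ag by blast
   qed
  qed
  show "z \<in> KK" if z: "snd z = ht l" "dist z (en l r, ht l) < d" "sg r * (fst z - en l r) \<le> 0" for z
  proof -
   have "seg l z" using z(1,3) dist[OF z(2)] w0(2)[OF lc(2)] by (cases r) (auto simp: seg_def en_def)
   thus ?thesis using DD_iff[OF lc(2)] lc(1) unfolding KK_def by blast
  qed
 qed
qed

text \<open>The radius of a stadium is smaller than the distance of its centre from the height of
  \<open>l\<close>, so no stadium meets this height.\<close>

lemma endp_outward:
 assumes M: "n \<le> M" and e: "endp l r"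
  and st: "\<forall>y. Hc y \<and> y \<noteq> l \<and> (\<forall>i<M. y i = l i) \<longrightarrow> \<bar>dl y r\<bar> < \<bar>ht l - yc l (Jl y r)\<bar>"
  and y: "Hc y" "y \<noteq> l" "\<forall>i<M. y i = l i" and z: "z \<in> DD y" "- w0 < sg r * (fst z - en l r)"
 shows "snd z \<noteq> ht l" "th r (en l r) (yc l (Jl y r)) z = \<bar>dl y r\<bar>"
proof -
 note N = endp_near[OF e y M]
 have yy: "yc y (Jl y r) = yc l (Jl y r)" by (rule yc_cong) (rule N(4))
 show t: "th r (en l r) (yc l (Jl y r)) z = \<bar>dl y r\<bar>" using DD_th[OF Hc_H[OF y(1)] N(2) z(1)] z(2) unfolding N(1) yy by simp
 show "snd z \<noteq> ht l"
 proof
  assume "snd z = ht l"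
  hence "\<bar>ht l - yc l (Jl y r)\<bar> \<le> \<bar>dl y r\<bar>" using th_ge[of z "yc l (Jl y r)" r "en l r"] t by simp
  moreover have "\<bar>dl y r\<bar> < \<bar>ht l - yc l (Jl y r)\<bar>" using st y by blast
  ultimately show False by linarith
 qed
qed

text \<open>The horizontal segment prolonging the arc beyond its endpoint avoids all
  stadiums.\<close>

lemma endp_accessible:
 assumes x: "x \<in> core s" "isrep l x" and e: "endp l r" and p: "drw x = (en l r, ht l)" "x 0 = en l r"
 shows "accessible KK (drw x)"
proof -
 obtain M d where Bx: "endp_box l r M d" by (rule endp_local[OF x e p])
 note L = endp_boxD[OF Bx]
 define w where "w = (en l r + sg r * (d / 2), ht l)"
 have w: "w \<noteq> drw x" using p(1) L(2) by (simp add: w_def)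
 have "path_image (linepath (drw x) w) \<inter> KK \<subseteq> {drw x}"
 proof
  fix z assume z: "z \<in> path_image (linepath (drw x) w) \<inter> KK"
  then obtain t where t: "0 \<le> t" "t \<le> 1" "z = (1 - t) *\<^sub>R drw x + t *\<^sub>R w" by (auto simp: closed_segment_def)
  hence zz: "fst z = en l r + t * (sg r * (d / 2))" "snd z = ht l" by (simp_all add: p(1) w_def algebra_simps)
  have sz: "sg r * (fst z - en l r) = t * (d / 2)" unfolding zz by (cases r) simp_all
  have "t * (d / 2) \<le> 1 * (d / 2)" using t L(2) by (intro mult_right_mono) auto
  hence td: "0 \<le> t * (d / 2)" "t * (d / 2) < d" using t L(2) by (auto simp: mult_nonneg_nonneg)
  have "z = (fst z, ht l)" using zz(2) by (simp add: prod_eq_iff)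
  moreover have "dist (a, b) (c, b) = dist a c" for a b c :: real by (simp add: dist_Pair_Pair)
  ultimately have "dist z (en l r, ht l) = dist (fst z) (en l r)" by metis
  also have "\<dots> = \<bar>t * (d / 2)\<bar>" unfolding zz(1) by (cases r) (simp_all add: dist_real_def)
  also have "\<dots> < d" using td by simp
  finally have dz: "dist z (en l r, ht l) < d" .
  have "t = 0"
  proof (rule ccontr)
   assume "t \<noteq> 0"
   hence pos: "0 < sg r * (fst z - en l r)" using t(1) L(2) unfolding sz by simp
   then obtain y where y: "Hc y" "y \<noteq> l" "\<forall>i<M + n. y i = l i" "z \<in> DD y" using L(5)[of z] z dz by auto
   have "\<forall>i<M. y i = l i" using y(3) by simp
   moreover have "- w0 < sg r * (fst z - en l r)" using pos w0(1) by linarith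
   ultimately have "snd z \<noteq> ht l" by (intro endp_outward(1)[OF L(1) e L(4) y(1,2) _ y(4)])
   thus False using zz(2) by blast
  qed
  thus "z \<in> {drw x}" using t(3) by simp
 qed
 moreover have "drw x \<in> KK" using x(1) KK_eq(2) by blast
 moreover have "drw x \<in> path_image (linepath (drw x) w)" by simp
 moreover have "arc (linepath (drw x) w)" using w by simp
 ultimately show ?thesis unfolding accessible_def by blast
qed

lemma dist_le_coords: fixes z w :: "real \<times> real" shows "dist z w \<le> \<bar>fst z - fst w\<bar> + \<bar>snd z - snd w\<bar>"
 using sqrt_sum_squares_le_sum_abs[of "fst z - fst w" "snd z - snd w"] by (simp add: dist_prod_def dist_real_def)

text \<open>A small crosscut near an endpoint can either be joined horizontally to a point outside all stadiums,
 or it lies in one stadium and hence in a gap of it.\<close>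

lemma endp_bridge:
 assumes x: "x \<in> core s" "isrep l x" and e: "endp l r" and p: "drw x = (en l r, ht l)" "x 0 = en l r" and ep: "0 < \<epsilon>"
 shows "\<exists>d>0. \<exists>G. connected G \<and> G \<subseteq> - KK \<inter> ball (drw x) \<epsilon> \<and>
   (\<forall>Q. crosscut KK Q \<and> Q \<subseteq> ball (drw x) d \<longrightarrow> (\<exists>c<n. Q \<inter> KK \<subseteq> Rc c) \<or> Q \<inter> G \<noteq> {})"
proof -
 obtain M d0 where Bx: "endp_box l r M d0" by (rule endp_local[OF x e p])
 note L = endp_boxD[OF Bx]
 define q u k m where "q = en l r" and "u = ht l" and "k = min d0 \<epsilon>" and "m = k / 2"
 have k: "0 < k" "k \<le> d0" "k \<le> \<epsilon>" "k \<le> w0" "0 < m" "m < k" using L(2,3) ep by (auto simp: k_def m_def)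
 have drx: "drw x = (q, u)" using p(1) by (simp add: q_def u_def)
 have bd: "- w0 < sg r * (fst z - q)" if "dist z (q, u) < k" for z
  using ball_coord(1)[OF that] k(4) by (cases r) auto
 have cls: "(snd z = u \<and> sg r * (fst z - q) \<le> 0) \<or> (\<exists>y. Hc y \<and> y \<noteq> l \<and> (\<forall>i<M + n. y i = l i) \<and> z \<in> DD y \<and>
   snd z \<noteq> u \<and> th r q (yc l (Jl y r)) z = \<bar>dl y r\<bar>)" if z: "z \<in> KK" "dist z (q, u) < k" for z
 proof -
  have "dist z (en l r, ht l) < d0" using z(2) k(2) by (simp add: q_def u_def)
  from L(5)[OF z(1) this] show ?thesis
  proof
   assume "\<exists>y. Hc y \<and> y \<noteq> l \<and> (\<forall>i<M + n. y i = l i) \<and> z \<in> DD y"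
   then obtain y where y: "Hc y" "y \<noteq> l" "\<forall>i<M + n. y i = l i" "z \<in> DD y" by blast
   have yM: "\<forall>i<M. y i = l i" using y(3) by simp
   have b: "- w0 < sg r * (fst z - en l r)" using bd[OF z(2)] by (simp add: q_def)
   have "snd z \<noteq> u" "th r q (yc l (Jl y r)) z = \<bar>dl y r\<bar>"
    using endp_outward[OF L(1) e L(4) y(1,2) yM y(4) b] by (simp_all add: q_def u_def)
   thus ?thesis using y by blast
  qed (simp add: q_def u_def)
 qed
 \<comment> \<open>The point \<open>(Xc, u)\<close> lies on the prolongation of the arc beyond its
   endpoint, hence off \<open>KK\<close>; all of \<open>G\<close> will be joined to it.\<close>
 define Xc where "Xc = q + sg r * m"
 have Xc: "sg r * (Xc - q) = m" by (cases r) (simp_all add: Xc_def)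
 have CK: "(Xc, u) \<notin> KK"
 proof
  assume C: "(Xc, u) \<in> KK"
  have "dist (Xc, u) (q, u) \<le> \<bar>Xc - q\<bar>" using dist_le_coords[of "(Xc, u)" "(q, u)"] by simp
  also have "\<dots> = m" using k(5) by (cases r) (simp_all add: Xc_def)
  finally have "dist (Xc, u) (q, u) < k" using k(6) by simp
  from cls[OF C this] show False using Xc k(5) by auto
 qed
 obtain g0 where g0: "0 < g0" "ball (Xc, u) g0 \<subseteq> - KK"
  using CK open_Compl[OF compact_imp_closed[OF compact_KK]] open_contains_ball[of "- KK"] by blast
 define g where "g = min g0 m"
 have g: "0 < g" "g \<le> g0" "g \<le> m" using g0(1) k(5) by (auto simp: g_def)
 have near: "dist z (q, u) < k" if "\<bar>snd z - u\<bar> < g" "\<bar>fst z - q\<bar> \<le> m" for z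
 proof -
  have "dist z (q, u) \<le> \<bar>fst z - q\<bar> + \<bar>snd z - u\<bar>" using dist_le_coords[of z "(q, u)"] by simp
  also have "\<dots> < m + m" using that g(3) by linarith
  finally show ?thesis by (simp add: m_def)
 qed
 have rho: "\<bar>a - q\<bar> \<le> m \<longleftrightarrow> - m \<le> sg r * (a - q) \<and> sg r * (a - q) \<le> m" for a by (cases r) auto
 have segm: "snd w = snd z \<and> sg r * (fst z - q) \<le> sg r * (fst w - q) \<and> sg r * (fst w - q) \<le> m"
  if w: "w \<in> closed_segment z (Xc, snd z)" and z: "sg r * (fst z - q) \<le> m" for w z
 proof -
  obtain t where t: "0 \<le> t" "t \<le> 1" "w = (1 - t) *\<^sub>R z + t *\<^sub>R (Xc, snd z)" using w by (auto simp: closed_segment_def)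
  have f: "fst w = (1 - t) * fst z + t * Xc" and sn: "snd w = snd z" unfolding t(3) by (simp_all add: algebra_simps)
  define A where "A = sg r * (fst z - q)"
  have "sg r * (fst w - q) = (1 - t) * A + t * (sg r * (Xc - q))" unfolding f A_def by (simp add: algebra_simps)
  hence 1: "sg r * (fst w - q) = A + t * (m - A)" "sg r * (fst w - q) = m - (1 - t) * (m - A)" unfolding Xc by (simp_all add: algebra_simps)
  have "0 \<le> t * (m - A)" "0 \<le> (1 - t) * (m - A)" using t(1,2) z by (simp_all add: A_def)
  thus ?thesis using sn 1 unfolding A_def by linarith
 qed
 \<comment> \<open>The points that can be joined horizontally to the vertical line at
   \<open>Xc\<close>. Their heights are so close to \<open>u\<close> that this part of the line is
   off \<open>KK\<close>.\<close>
 define G where "G = {z. \<bar>snd z - u\<bar> < g \<and> \<bar>fst z - q\<bar> \<le> m \<and> closed_segment z (Xc, snd z) \<inter> KK = {}}"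
 define T where "T z = closed_segment z (Xc, snd z) \<union> closed_segment (Xc, snd z) (Xc, u)" for z
 have TG: "T z \<subseteq> G" if z: "z \<in> G" for z
 proof
  fix w assume "w \<in> T z"
  then consider "w \<in> closed_segment z (Xc, snd z)" | "w \<in> closed_segment (Xc, snd z) (Xc, u)" by (auto simp: T_def)
  thus "w \<in> G"
  proof cases
   case 1
   have zz: "\<bar>snd z - u\<bar> < g" "\<bar>fst z - q\<bar> \<le> m" "closed_segment z (Xc, snd z) \<inter> KK = {}" using z by (auto simp: G_def)
   have s: "snd w = snd z" "sg r * (fst z - q) \<le> sg r * (fst w - q)" "sg r * (fst w - q) \<le> m"
    using segm[OF 1] zz(2) rho[of "fst z"] by auto
   hence "\<bar>fst w - q\<bar> \<le> m" using zz(2) rho[of "fst z"] rho[of "fst w"] by linarith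
   moreover have "closed_segment w (Xc, snd w) \<subseteq> closed_segment z (Xc, snd z)"
    unfolding s(1) by (rule closed_segment_subset[OF 1 _ convex_closed_segment]) simp
   ultimately show ?thesis using zz s(1) by (auto simp: G_def)
  next
   case 2
   then obtain t where t: "0 \<le> t" "t \<le> 1" "w = (1 - t) *\<^sub>R (Xc, snd z) + t *\<^sub>R (Xc, u)" by (auto simp: closed_segment_def)
   have f: "fst w = Xc" "snd w - u = (1 - t) * (snd z - u)" unfolding t(3) by (simp_all add: algebra_simps)
   have "(1 - t) * \<bar>snd z - u\<bar> \<le> 1 * \<bar>snd z - u\<bar>" using t by (intro mult_right_mono) auto
   hence sw: "\<bar>snd w - u\<bar> < g" using z t unfolding f(2) by (auto simp: G_def abs_mult)
   have "dist w (Xc, u) \<le> \<bar>snd w - u\<bar>" using dist_le_coords[of w "(Xc, u)"] f(1) by simp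
   hence "w \<in> ball (Xc, u) g0" using sw g(2) by (simp add: dist_commute)
   hence "w \<notin> KK" using g0(2) by blast
   moreover have "(Xc, snd w) = w" using f(1) by (simp add: prod_eq_iff)
   moreover have "\<bar>fst w - q\<bar> \<le> m" unfolding f(1) rho Xc using k(5) by simp
   ultimately show ?thesis using sw by (simp add: G_def)
  qed
 qed
 have Tz: "connected (T z)" "z \<in> T z" "(Xc, u) \<in> T z" for z
  unfolding T_def by (auto intro!: connected_Un)
 have "connected (\<Union>z\<in>G. T z)"
 proof (cases "G = {}")
  case False
  hence "(Xc, u) \<in> (\<Inter>z\<in>G. T z)" using Tz(3) by blast
  thus ?thesis using Tz(1) by (intro connected_Union) blast+
 qed simp
 moreover have "(\<Union>z\<in>G. T z) = G" using TG Tz(2) by blast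
 ultimately have Gcon: "connected G" by simp
 have GK: "G \<subseteq> - KK \<inter> ball (drw x) \<epsilon>"
 proof
  fix z assume z: "z \<in> G"
  hence "dist z (q, u) < k" by (intro near) (auto simp: G_def)
  hence "z \<in> ball (drw x) \<epsilon>" using k(3) drx by (simp add: dist_commute)
  moreover have "z \<notin> KK" using z by (auto simp: G_def)
  ultimately show "z \<in> - KK \<inter> ball (drw x) \<epsilon>" by blast
 qed
 have main: "\<exists>c<n. Q \<inter> KK \<subseteq> Rc c" if Q: "crosscut KK Q" "Q \<subseteq> ball (drw x) g" and QG: "Q \<inter> G = {}" for Q
 proof -
  have Qn: "\<bar>snd z - u\<bar> < g" "\<bar>fst z - q\<bar> \<le> m" "dist z (q, u) < k" if "z \<in> Q" for z
  proof -
   have "dist z (q, u) < g" using Q(2) that drx by (auto simp: dist_commute)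
   from ball_coord[OF this] show "\<bar>snd z - u\<bar> < g" "\<bar>fst z - q\<bar> \<le> m" using g(3) by auto
   thus "dist z (q, u) < k" by (rule near)
  qed
  obtain a b where ab: "connected (Q - KK)" "Q \<subseteq> closure (Q - KK)" "Q - KK \<noteq> {}" by (rule crosscutE[OF Q(1)])
  obtain z0 where z0: "z0 \<in> Q" "z0 \<notin> KK" using ab(3) by blast
  \<comment> \<open>As \<open>Q\<close> misses \<open>G\<close>, the way outwards from
    \<open>z0\<close> is blocked. The obstacle is not the arc of \<open>l\<close> itself, for then
    \<open>z0\<close> would lie on that arc too; so it is a stadium.\<close>
  have "closed_segment z0 (Xc, snd z0) \<inter> KK \<noteq> {}" using QG z0(1) Qn[OF z0(1)] by (auto simp: G_def)
  then obtain w where w: "w \<in> closed_segment z0 (Xc, snd z0)" "w \<in> KK" by blast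
  have sw: "snd w = snd z0" "sg r * (fst z0 - q) \<le> sg r * (fst w - q)" "sg r * (fst w - q) \<le> m"
   using segm[OF w(1)] Qn(2)[OF z0(1)] rho[of "fst z0"] by auto
  hence "\<bar>fst w - q\<bar> \<le> m" using Qn(2)[OF z0(1)] rho[of "fst z0"] rho[of "fst w"] by linarith
  hence dw: "dist w (q, u) < k" using Qn(1)[OF z0(1)] sw(1) by (intro near) auto
  have "\<not> (snd w = u \<and> sg r * (fst w - q) \<le> 0)"
  proof
   assume "snd w = u \<and> sg r * (fst w - q) \<le> 0"
   hence "snd z0 = ht l" "dist z0 (en l r, ht l) < d0" "sg r * (fst z0 - en l r) \<le> 0"
    using sw Qn(3)[OF z0(1)] k(2) by (auto simp: q_def u_def)
   thus False using L(6) z0(2) by blast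
  qed
  then obtain y where y: "Hc y" "y \<noteq> l" "\<forall>i<M + n. y i = l i" "th r q (yc l (Jl y r)) w = \<bar>dl y r\<bar>"
   using cls[OF w(2) dw] by blast
  have yM: "\<forall>i<M. y i = l i" using y(3) by simp
  define Y D where "Y = yc l (Jl y r)" and "D = \<bar>dl y r\<bar>"
  have yMn: "n \<le> M + n" by simp
  note Ny = endp_near[OF e y(1-3) yMn]
  have JM: "M < Jl y r" using Ny(3) by simp
  have yY: "yc y (Jl y r) = Y" unfolding Y_def by (rule yc_cong) (rule Ny(4))
  have eq: "en y r = q" using Ny(1) by (simp add: q_def)
  have far: "D < \<bar>u - Y\<bar>" using L(4) y(1,2) yM by (simp add: D_def Y_def u_def)
  note my = mt_facts[OF Hc_H[OF y(1)] Ny(2)]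
  have Dcase: "D = dl y r \<or> D = - dl y r" "0 < D" using dl_ne[OF Ny(2)] by (auto simp: D_def)
  define h where "h z = Y + th r q Y z" for z
  \<comment> \<open>By \<open>endp_nested\<close> stadiums of different index occupy disjoint ranges
    of height, so the arcs within the range of the stadium of \<open>y\<close> have its index and
    its centre.\<close>
  have JJ: "Jl v r = Jl y r" if v: "Hc v" "v \<noteq> l" "\<forall>i<M. v i = l i"
   and Z: "\<bar>Z - yc l (Jl v r)\<bar> \<le> \<bar>dl v r\<bar>" "\<bar>Z - Y\<bar> \<le> D" for v Z
  proof (rule linorder_cases[of "Jl v r" "Jl y r"])
   assume "Jl v r < Jl y r"
   hence "\<bar>dl v r\<bar> < \<bar>Z - yc l (Jl v r)\<bar>"
    using endp_nested[OF e L(1) L(4) v y(1,2) yM _, of Z] Z(2) by (simp add: Y_def D_def)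
   thus ?thesis using Z(1) by simp
  next
   assume "Jl y r < Jl v r"
   hence "\<bar>dl y r\<bar> < \<bar>Z - yc l (Jl y r)\<bar>"
    using endp_nested[OF e L(1) L(4) y(1,2) yM v _, of Z] Z(1) by simp
   thus ?thesis using Z(2) by (simp add: Y_def D_def)
  qed
  \<comment> \<open>The half stadium of \<open>y\<close> with its inside. Here \<open>h\<close>
    always takes the height of the upper sequence of a pair of mates.\<close>
  define N where "N = {z. dist z (q, u) < k \<and> th r q Y z \<le> D}"
  have fl: "flow N h" unfolding flow_def
  proof (intro conjI ballI allI impI)
   show "continuous_on N h" unfolding h_def by (intro continuous_intros th_continuous)
   fix z assume "z \<in> N"
   hence z: "dist z (q, u) < k" "th r q Y z \<le> D" by (auto simp: N_def)
   have zY: "\<bar>snd z - Y\<bar> \<le> D" using th_ge[of z Y r q] z(2) by linarith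
   { assume "z \<in> KK"
    from cls[OF this z(1)] obtain v where v: "Hc v" "v \<noteq> l" "\<forall>i<M + n. v i = l i" "th r q (yc l (Jl v r)) z = \<bar>dl v r\<bar>"
     using zY far by auto
    have vM: "\<forall>i<M. v i = l i" using v(3) by simp
    have "\<bar>snd z - yc l (Jl v r)\<bar> \<le> \<bar>dl v r\<bar>" using th_ge[of z "yc l (Jl v r)" r q] v(4) by simp
    hence J: "Jl v r = Jl y r" by (rule JJ[OF v(1,2) vM _ zY])
    hence t: "th r q Y z = \<bar>dl v r\<bar>" using v(4) by (simp add: Y_def)
    note Nv = endp_near[OF e v(1,2) vM L(1)]
    note mv = mt_facts[OF Hc_H[OF v(1)] Nv(2)]
    have "yc v (Jl v r) = Y" unfolding Y_def J[symmetric] by (rule yc_cong) (rule Nv(4))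
    hence "ht v = Y + dl v r" "ht (mt v r) = Y - dl v r" using mv(10,11) by simp_all
    hence "ht v = h z \<or> ht (mt v r) = h z" unfolding h_def t by (auto simp: abs_if)
    thus "\<exists>l. Hc l \<and> ht l = h z" using v(1) Hc_mt[OF v(1) Nv(2)] by blast }
   fix v assume v: "Hc v \<and> ht v = h z"
   hence hv: "\<bar>ht v - Y\<bar> \<le> D" "ht v - Y = th r q Y z" using z(2) th_nonneg[of r q Y z] by (auto simp: h_def)
   have "v i = y i" if "i < Jl y r" for i
    using between_cap(1)[OF Hc_H[OF y(1)] Ny(2), of v i] hv(1) Hc_H v that by (simp add: yY D_def)
   hence vM: "\<forall>i<M. v i = l i" using yM JM by simp
   have vl: "v \<noteq> l" using hv(1) far by (auto simp: u_def)
   have vH: "Hc v" using v by simp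
   note Nv = endp_near[OF e vH vl vM L(1)]
   note mv = mt_facts[OF Hc_H[OF vH] Nv(2)]
   have yv: "yc v (Jl v r) = yc l (Jl v r)" by (rule yc_cong) (rule Nv(4))
   have "ht v = yc l (Jl v r) + dl v r" using mv(11) yv by simp
   hence J: "Jl v r = Jl y r" by (intro JJ[OF vH vl vM _ hv(1)]) simp
   have yY': "yc v (Jl v r) = Y" using yv J by (simp add: Y_def)
   hence "dl v r = th r q Y z" using mv(11) hv(2) by simp
   hence "th r (en v r) (yc v (Jl v r)) z = \<bar>dl v r\<bar>" unfolding yY' Nv(1) q_def[symmetric] using th_nonneg[of r q Y z] by simp
   moreover have "- w0 < sg r * (fst z - en v r)" using bd[OF z(1)] by (simp add: Nv(1) q_def)
   ultimately have "z \<in> DD v \<or> z \<in> DD (mt v r)" using th_DM[OF Hc_H[OF vH] Nv(2)] by blast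
   thus "DM v z" using Nv(2) by (auto simp: DM_def)
  qed
  have onD: "th r q Y z \<noteq> D" if "z \<in> Q - KK" for z
  proof
   assume t: "th r q Y z = D"
   have "- w0 < sg r * (fst z - en y r)" using bd[OF Qn(3)] that by (simp add: eq)
   hence "z \<in> DD y \<or> z \<in> DD (mt y r)" using th_DM[OF Hc_H[OF y(1)] Ny(2)] t by (simp add: eq yY D_def)
   hence "DM y z" using Ny(2) by (auto simp: DM_def)
   thus False using DM_KK[OF y(1)] that by blast
  qed
  \<comment> \<open>\<open>w\<close> lies further outwards at the same height, so \<open>z0\<close>
    is inside the stadium of \<open>y\<close>. The rest of \<open>Q - KK\<close> cannot cross it,
    hence all of \<open>Q\<close> lies in \<open>N\<close>.\<close>
  have "th r q Y z0 \<le> th r q Y w"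
  using sw(2) power_mono real_sqrt_le_mono by (auto simp: th_def sw(1))
  hence t0: "th r q Y z0 < D" using y(4) onD[of z0] z0 by (simp add: Y_def D_def)
  have inN: "th r q Y z < D" if z: "z \<in> Q - KK" for z
  proof (rule ccontr)
   assume "\<not> th r q Y z < D"
   hence "D \<in> th r q Y ` (Q - KK)"
    using connectedD_interval[of "th r q Y ` (Q - KK)" "th r q Y z0" "th r q Y z" D]
     connected_continuous_image[OF th_continuous ab(1)] z z0 t0 by auto
   thus False using onD by auto
  qed
  have "Q \<subseteq> {z. th r q Y z \<le> D}"
  proof -
   have "closed {z. th r q Y z \<le> D}" by (intro closed_Collect_le th_continuous continuous_on_const)
   moreover have "Q - KK \<subseteq> {z. th r q Y z \<le> D}" using inN by (auto intro: less_imp_le)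
   ultimately have "closure (Q - KK) \<subseteq> {z. th r q Y z \<le> D}" by (rule closure_minimal[rotated])
   thus ?thesis using ab(2) by blast
  qed
  hence "Q \<subseteq> N" using Qn(3) by (auto simp: N_def)
  thus ?thesis by (rule flow_same_ray[OF fl Q(1)])
 qed
 show ?thesis
  by (rule exI[of _ g], rule conjI[OF g(1)], rule exI[of _ G]) (use Gcon GK main in blast)
qed

section \<open>Accessible points and prime ends of the core\<close>

lemma KK_point:
 assumes "a \<in> KK" obtains x l where "x \<in> core s" "isrep l x" "a = drw x" "Hc l"
using that assms KK_eq(2) isrep_ex core_inv_lim rep_Hc by blast

lemma accessible_if_tail:
 assumes x: "x \<in> core s" "isrep l x" "ntail l" shows "accessible KK (drw x)"
proof -
 have lc: "Hc l" by (rule rep_Hc[OF x(1,2)])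
 have k: "drw x \<in> KK" using x(1) KK_eq(2) by blast
 from flow_or_endpoint[OF x(1,2)] show ?thesis
 proof
  assume "flow_pt l (drw x)"
  then obtain N h \<eta> d where F: "flow N h" "0 < d" "continuous_on {ht l - d..ht l + d} \<eta>"
   "\<forall>v\<in>{ht l - d..ht l + d}. \<eta> v \<in> N \<and> h (\<eta> v) = v" "\<eta> (ht l) = drw x" unfolding flow_pt_def by blast
  show ?thesis by (rule flow_accessible[OF F(1) k lc x(3) F(2,3) _ F(5)]) (use F(4) in blast)
 next
  assume "\<exists>r. \<not> fin l r \<and> x 0 = en l r \<and> drw x = (en l r, ht l)"
  then obtain r where r: "\<not> fin l r" "x 0 = en l r" "drw x = (en l r, ht l)" by blast
  thus ?thesis using endp_accessible[OF x(1,2) _ r(3,2)] lc by (simp add: endp_def)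
 qed
qed

lemma Rc_accessible: assumes "a \<in> Rc c" shows "accessible KK a"
using assms accessible_if_tail tl_ntail UU_core by (fastforce simp: Rc_def UU_def)

lemma accessible_Rc: assumes "accessible KK a" shows "\<exists>c<n. a \<in> Rc c"
proof -
 have "a \<in> KK" using assms by (simp add: accessible_def)
 then obtain x l where x: "x \<in> core s" "isrep l x" "a = drw x" "Hc l" by (rule KK_point)
 have "ntail l"
 proof (rule ccontr)
  assume nt: "\<not> ntail l"
  from flow_or_endpoint[OF x(1,2)] show False
  proof
   assume "flow_pt l (drw x)"
   then obtain N h where F: "open N" "drw x \<in> N" "flow N h" "h (drw x) = ht l" unfolding flow_pt_def by blast
   thus False using flow_not_accessible[OF F(3,1,2) _ x(4) F(4) nt] assms `a \<in> KK` x(3) by blast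
  next
   assume "\<exists>r. \<not> fin l r \<and> x 0 = en l r \<and> drw x = (en l r, ht l)"
   then obtain r where "endp l r" using x(4) by (auto simp: endp_def)
   thus False using endp_tail ntail_iff nt by metis
  qed
 qed
 then obtain c where c: "c < n" "tl c l" using ntail_iff by blast
 hence "x \<in> UU c" using UU_rep x(2) by blast
 thus ?thesis using c(1) x(3) unfolding Rc_def by blast
qed

lemma no_canal: "\<not> infinite_canal KK E"
proof -
 interpret ray_continuum KK n Rc gR
 proof
  show "compact KK" "connected KK" "connected (- KK)" by (rule compact_KK connected_KK connected_Compl_KK)+
  show "3 \<le> n" using n_pos(3) by simp
  fix c assume c: "c < n"
  show "Rc c = gR c ` {0..}" "continuous_on {0..} (gR c)" "inj_on (gR c) {0..}" by (rule Rc_ray)+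
  show "Rc c \<subseteq> KK \<and> KK \<subseteq> closure (Rc c)" using Rc_KK UU_dense[OF c] by (simp add: Rc_def)
  have "gR c 0 \<in> Rc c" unfolding Rc_ray(1) by simp
  thus "\<exists>a\<in>Rc c. accessible KK a" using Rc_accessible by blast
 next
  fix c c' assume "c < n" "c' < n" "c \<noteq> c'" thus "Rc c \<inter> Rc c' = {}" by (rule Rc_disjoint)
 qed
 show ?thesis
 proof (rule no_infinite_canal)
  fix a and e :: real assume a: "a \<in> KK" and e: "0 < e"
  obtain x l where x: "x \<in> core s" "isrep l x" "a = drw x" "Hc l" by (rule KK_point[OF a])
  from flow_or_endpoint[OF x(1,2)]
  show "\<exists>d>0. \<exists>G. connected G \<and> G \<subseteq> - KK \<inter> ball a e \<and>
   (\<forall>Q. crosscut KK Q \<and> Q \<subseteq> ball a d \<longrightarrow> (\<exists>c<n. Q \<inter> KK \<subseteq> Rc c) \<or> Q \<inter> G \<noteq> {})"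
  proof
   assume "flow_pt l (drw x)"
   then obtain N h where F: "open N" "a \<in> N" "flow N h" unfolding flow_pt_def x(3) by blast
   then obtain d where d: "0 < d" "ball a d \<subseteq> N" using open_contains_ball by blast
   have "\<exists>c<n. Q \<inter> KK \<subseteq> Rc c" if "crosscut KK Q" "Q \<subseteq> ball a d" for Q
    by (rule flow_same_ray[OF F(3) that(1)]) (use that(2) d(2) in blast)
   thus ?thesis using d(1) by (intro exI[of _ d] conjI exI[of _ "{}"]) auto
  next
   assume "\<exists>r. \<not> fin l r \<and> x 0 = en l r \<and> drw x = (en l r, ht l)"
   then obtain r where r: "\<not> fin l r" "x 0 = en l r" "drw x = (en l r, ht l)" by blast
   have "endp l r" using r(1) x(4) by (simp add: endp_def)
   thus ?thesis unfolding x(3) by (rule endp_bridge[OF x(1,2) _ r(3,2) e])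
  qed
 qed
qed

lemma phi_UU: "phi_C s ` UU c = Rc c"
proof -
 have a: "H l" if "l \<in> {l. H l \<and> tl c l}" for l using that by simp
 have b: "mt l r \<in> {l. H l \<and> tl c l}" if "l \<in> {l. H l \<and> tl c l}" "fin l r" for l r
  using mt_facts(1)[of l r] that by (simp add: mt_def tl_flip)
 show ?thesis unfolding Rc_def UU_arcs by (rule phi_image(1)[OF a b])
qed

end

theorem theorem13p21:
  fixes s :: real and m n :: nat and K :: "(real \<times> real) set"
  assumes "sqrt 2 < s" and "s \<le> 2"
    and "0 < real m / real n" and "real m / real n < 1/2" and "coprime m n"
    and "kneading s = lhe m n"
    and "K = phi_C s ` core s"
  shows "(\<exists>\<R>. finite \<R> \<and> card \<R> = n \<and>
            (\<forall>R \<in> \<R>. is_ray R \<and> fully_accessible K R \<and>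
               (\<exists>U. R = phi_C s ` U \<and> (\<exists>x \<in> core s. U = arc_component (core s) x) \<and>
                    described_by_kneading_tail s U)) \<and>
            (\<forall>a \<in> K. accessible K a \<longrightarrow> a \<in> \<Union>\<R>)) \<and>
         \<not> (\<exists>P. infinite_canal K P)"
proof -
 have mn: "0 < m" "0 < n" using assms(3) by (auto simp: zero_less_divide_iff)
 hence "real m < real n / 2" using assms(4) by (simp add: field_simps)
 hence "2 * m < n" by linarith
 then interpret tent_lhe s n "lhe m n" by (intro tent_lhe_if_kneading[OF assms(1,2) mn(1) _ assms(5,6)])
 have K': "K = KK" using assms(7) KK_eq(1) by simp
 have inj: "inj_on Rc {..<n}"
 proof (rule inj_onI)
  fix c c' assume c: "c \<in> {..<n}" "c' \<in> {..<n}" "Rc c = Rc c'"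
  have "gR c 0 \<in> Rc c" unfolding Rc_ray(1) by simp
  thus "c = c'" using Rc_disjoint[of c c'] c by auto
 qed
 have ray: "is_ray (Rc c)" for c unfolding is_ray_def using Rc_ray[of c] by blast
 have full: "fully_accessible KK (Rc c)" for c unfolding fully_accessible_def using Rc_accessible by blast
 have arc: "\<exists>U. Rc c = phi_C s ` U \<and> (\<exists>x \<in> core s. U = arc_component (core s) x) \<and> described_by_kneading_tail s U" for c
  using phi_UU[of c] UU_arc_component[of c] gr_core[of 0 c] UU_described[of c] by (metis order_refl)
 show ?thesis
 proof (intro conjI exI[of _ "Rc ` {..<n}"] ballI impI)
  show "finite (Rc ` {..<n})" by simp
  show "card (Rc ` {..<n}) = n" using card_image[OF inj] by simp
 next
  fix R assume "R \<in> Rc ` {..<n}"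
  then obtain c where R: "R = Rc c" by blast
  show "is_ray R" "fully_accessible K R" unfolding R K' by (rule ray full)+
  show "\<exists>U. R = phi_C s ` U \<and> (\<exists>x \<in> core s. U = arc_component (core s) x) \<and> described_by_kneading_tail s U"
   unfolding R by (rule arc)
 next
  fix a assume "accessible K a"
  then obtain c where "c < n" "a \<in> Rc c" using accessible_Rc unfolding K' by blast
  thus "a \<in> \<Union> (Rc ` {..<n})" by blast
 next
  show "\<not> (\<exists>P. infinite_canal K P)" unfolding K' by (simp add: no_canal)
 qed
qed

end
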